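(* (i) The following decision problem is $\mathbf{NP}$-complete: given a planar $3$-colorable graph $G$, decide whether $G$ has a vertex-labeling by product from $\mathbb{N}_2=\{1,2\}$. (ii) For every fixed integer $k\geq 3$, the following decision problem is $\mathbf{NP}$-complete: given a graph $G$, decide whether $G$ has a vertex-labeling by product from $\mathbb{N}_k$.
   Context: All graphs are finite and simple. For a positive integer $k$, $\mathbb{N}_k=\{1,\ldots,k\}$. A vertex-labeling by product from $\mathbb{N}_k$ of a graph $G$ is a map $f:V(G)\to\mathbb{N}_k$ such that the vertex coloring $c(v)=\prod_{u\sim v} f(u)$ (product over the neighbors $u$ of $v$) is a proper vertex coloring, i.e. $c(u)\neq c(v)$ for every edge $uv$. *)

theory Defs
  imports "HOL-Analysis.Analysis" "HOL-Computational_Algebra.Polynomial"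
begin

section \<open>Finite simple graphs\<close>

text \<open>A graph is a vertex set together with a set of two-element sets of vertices.\<close>

definition simple_graph :: "'a set \<Rightarrow> 'a set set \<Rightarrow> bool" where
  "simple_graph V E \<longleftrightarrow> finite V \<and> (\<forall>e\<in>E. e \<subseteq> V \<and> card e = 2)"

definition neighbors :: "'a set set \<Rightarrow> 'a \<Rightarrow> 'a set" where
  "neighbors E v = {u. {u, v} \<in> E}"

definition proper_coloring :: "'a set set \<Rightarrow> ('a \<Rightarrow> 'c) \<Rightarrow> bool" where
  "proper_coloring E c \<longleftrightarrow> (\<forall>u v. {u, v} \<in> E \<longrightarrow> c u \<noteq> c v)"

definition three_colorable :: "'a set \<Rightarrow> 'a set set \<Rightarrow> bool" where
  "three_colorable V E \<longleftrightarrow> (\<exists>c :: 'a \<Rightarrow> nat. c ` V \<subseteq> {1..3} \<and> proper_coloring E c)"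

definition product_labeling :: "nat \<Rightarrow> 'a set \<Rightarrow> 'a set set \<Rightarrow> ('a \<Rightarrow> nat) \<Rightarrow> bool" where
  "product_labeling k V E f \<longleftrightarrow>
     f ` V \<subseteq> {1..k} \<and> proper_coloring E (\<lambda>v. \<Prod>u\<in>neighbors E v. f u)"

definition has_product_labeling :: "nat \<Rightarrow> 'a set \<Rightarrow> 'a set set \<Rightarrow> bool" where
  "has_product_labeling k V E \<longleftrightarrow> (\<exists>f. product_labeling k V E f)"

text \<open>Planarity: the graph can be drawn in the plane, with vertices as distinct points and edges as
  simple arcs that meet vertices and each other only in common end points.\<close>

definition plane_drawing ::
    "'a set \<Rightarrow> 'a set set \<Rightarrow> ('a \<Rightarrow> complex) \<Rightarrow> ('a set \<Rightarrow> real \<Rightarrow> complex) \<Rightarrow> bool" where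
  "plane_drawing V E p g \<longleftrightarrow>
     inj_on p V \<and>
     (\<forall>e\<in>E. arc (g e) \<and> {pathstart (g e), pathfinish (g e)} = p ` e \<and>
             path_image (g e) \<inter> p ` V = p ` e) \<and>
     (\<forall>e\<in>E. \<forall>e'\<in>E. e \<noteq> e' \<longrightarrow> path_image (g e) \<inter> path_image (g e') = p ` (e \<inter> e'))"

definition planar :: "'a set \<Rightarrow> 'a set set \<Rightarrow> bool" where
  "planar V E \<longleftrightarrow> (\<exists>p g. plane_drawing V E p g)"

section \<open>Deterministic multi-tape Turing machines\<close>

text \<open>States and tape symbols are initial segments of the natural numbers; symbol 0 is the blank,
  and the symbols 1 and 2 are the input letters. Tapes are infinite in both directions and are
  stored with the head position. The transition function maps a state and the scanned symbols to
  the next state and, for every tape, the symbol to be written and the head move.\<close>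

datatype move = Left | Stay | Right

record tm =
  num_tapes :: nat
  num_symbols :: nat
  num_states :: nat
  start_state :: nat
  accept_state :: nat
  reject_state :: nat
  trans :: "nat \<Rightarrow> nat list \<Rightarrow> nat \<times> (nat \<times> move) list"

type_synonym tape = "int \<times> (int \<Rightarrow> nat)"
type_synonym config = "nat \<times> tape list"

definition wf_tm :: "tm \<Rightarrow> bool" where
  "wf_tm M \<longleftrightarrow>
     1 \<le> num_tapes M \<and> 3 \<le> num_symbols M \<and>
     start_state M < num_states M \<and> accept_state M < num_states M \<and>
     reject_state M < num_states M \<and> accept_state M \<noteq> reject_state M \<and>
     (\<forall>q < num_states M. \<forall>ss. length ss = num_tapes M \<and> set ss \<subseteq> {..<num_symbols M} \<longrightarrow>
        fst (trans M q ss) < num_states M \<and>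
        length (snd (trans M q ss)) = num_tapes M \<and>
        fst ` set (snd (trans M q ss)) \<subseteq> {..<num_symbols M})"

fun offset :: "move \<Rightarrow> int" where
  "offset Left = -1"
| "offset Stay = 0"
| "offset Right = 1"

fun read_tape :: "tape \<Rightarrow> nat" where
  "read_tape (h, t) = t h"

fun act_tape :: "nat \<times> move \<Rightarrow> tape \<Rightarrow> tape" where
  "act_tape (a, m) (h, t) = (h + offset m, t(h := a))"

definition halting :: "tm \<Rightarrow> nat \<Rightarrow> bool" where
  "halting M q \<longleftrightarrow> q = accept_state M \<or> q = reject_state M"

fun step_tm :: "tm \<Rightarrow> config \<Rightarrow> config" where
  "step_tm M (q, ts) =
     (if halting M q then (q, ts)
      else let (q', acts) = trans M q (map read_tape ts) in (q', map2 act_tape acts ts))"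

definition word_contents :: "bool list \<Rightarrow> int \<Rightarrow> nat" where
  "word_contents w i =
     (if 0 \<le> i \<and> i < int (length w) then (if w ! nat i then 2 else 1) else 0)"

text \<open>The words in the list are written on the first tapes; all other tapes are blank.\<close>

definition init_config :: "tm \<Rightarrow> bool list list \<Rightarrow> config" where
  "init_config M ws =
     (start_state M,
      map (\<lambda>i. (0, word_contents (if i < length ws then ws ! i else []))) [0..<num_tapes M])"

definition run_tm :: "tm \<Rightarrow> bool list list \<Rightarrow> nat \<Rightarrow> config" where
  "run_tm M ws t = (step_tm M ^^ t) (init_config M ws)"

definition halts_within :: "tm \<Rightarrow> bool list list \<Rightarrow> nat \<Rightarrow> bool" where
  "halts_within M ws t \<longleftrightarrow> halting M (fst (run_tm M ws t))"

definition accepts :: "tm \<Rightarrow> bool list list \<Rightarrow> bool" where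
  "accepts M ws \<longleftrightarrow> (\<exists>t. fst (run_tm M ws t) = accept_state M)"

section \<open>Polynomial time and NP-completeness\<close>

text \<open>A function is computed by replacing the input on the first tape by the output.\<close>

definition poly_time_computable :: "(bool list \<Rightarrow> bool list) \<Rightarrow> bool" where
  "poly_time_computable f \<longleftrightarrow>
     (\<exists>M (p :: nat poly). wf_tm M \<and>
        (\<forall>x. halts_within M [x] (poly p (length x)) \<and>
             snd (hd (snd (run_tm M [x] (poly p (length x))))) = word_contents (f x)))"

text \<open>NP is the class of languages with polynomial-time verifiers for certificates of polynomial
  length; the verifier receives the input on its first and the certificate on its second tape.\<close>

definition NP :: "bool list set set" where
  "NP = {L. \<exists>M (p :: nat poly) (q :: nat poly). wf_tm M \<and> 2 \<le> num_tapes M \<and>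
     (\<forall>x w. length w \<le> poly p (length x) \<longrightarrow> halts_within M [x, w] (poly q (length x))) \<and>
     (\<forall>x. x \<in> L \<longleftrightarrow> (\<exists>w. length w \<le> poly p (length x) \<and> accepts M [x, w]))}"

definition NP_complete :: "bool list set \<Rightarrow> bool" where
  "NP_complete L \<longleftrightarrow>
     L \<in> NP \<and>
     (\<forall>A\<in>NP. \<exists>f. poly_time_computable f \<and> (\<forall>x. x \<in> A \<longleftrightarrow> f x \<in> L))"

text \<open>NP-completeness of a decision problem whose inputs are restricted to a set \<open>I\<close> of instances,
  with yes-instances \<open>Y \<subseteq> I\<close>. Algorithms need only be correct on \<open>I\<close> (deciding membership in
  \<open>I\<close> is not part of the problem), and reductions must always produce elements of \<open>I\<close>.\<close>

definition NP_complete_on :: "bool list set \<Rightarrow> bool list set \<Rightarrow> bool" where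
  "NP_complete_on I Y \<longleftrightarrow>
     (\<exists>L\<in>NP. \<forall>x\<in>I. x \<in> Y \<longleftrightarrow> x \<in> L) \<and>
     (\<forall>A\<in>NP. \<exists>f. poly_time_computable f \<and> (\<forall>x. f x \<in> I \<and> (x \<in> A \<longleftrightarrow> f x \<in> Y)))"

lemma NP_complete_on_UNIV: "NP_complete_on UNIV L \<longleftrightarrow> NP_complete L"
proof -
  have "(\<exists>L'\<in>NP. \<forall>x\<in>UNIV. x \<in> L \<longleftrightarrow> x \<in> L') \<longleftrightarrow> L \<in> NP"
    by (metis UNIV_I subsetI subset_antisym)
  then show ?thesis
    unfolding NP_complete_on_def NP_complete_def by simp
qed

section \<open>Graphs as inputs\<close>

text \<open>A graph with vertices \<open>0, \<dots>, n - 1\<close> is presented as the number \<open>n\<close> in unary followed by the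
  rows of its adjacency matrix.\<close>

definition graph_code :: "nat \<Rightarrow> nat set set \<Rightarrow> bool list" where
  "graph_code n E =
     replicate n True @ [False] @ concat (map (\<lambda>i. map (\<lambda>j. {i, j} \<in> E) [0..<n]) [0..<n])"

lemma graph_code_inject:
  assumes "simple_graph {..<n} E" "simple_graph {..<n'} E'" "graph_code n E = graph_code n' E'"
  shows "n = n' \<and> E = E'"
proof -
  have *: "length (takeWhile id (graph_code m F)) = m" for m F
    by (simp add: graph_code_def takeWhile_append)
  have n: "n' = n"
    using *[of n E] *[of n' E'] assms(3) by simp
  have "concat (map (\<lambda>i. map (\<lambda>j. {i, j} \<in> E) [0..<n]) [0..<n]) =
        concat (map (\<lambda>i. map (\<lambda>j. {i, j} \<in> E') [0..<n]) [0..<n])"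
    using assms(3) unfolding graph_code_def n by simp
  then have "map (\<lambda>i. map (\<lambda>j. {i, j} \<in> E) [0..<n]) [0..<n] =
        map (\<lambda>i. map (\<lambda>j. {i, j} \<in> E') [0..<n]) [0..<n]"
    by (subst (asm) concat_eq_concat_iff) (auto simp: set_zip)
  then have eq: "{i, j} \<in> E \<longleftrightarrow> {i, j} \<in> E'" if "i < n" "j < n" for i j
    using that by (auto simp: map_eq_conv)
  have "e \<in> E \<longleftrightarrow> e \<in> E'" for e
  proof (cases "e \<subseteq> {..<n} \<and> card e = 2")
    case True
    then obtain i j where "e = {i, j}" by (auto simp: card_2_iff)
    with True eq show ?thesis by auto
  next
    case False
    with assms(1,2) n show ?thesis by (auto simp: simple_graph_def)
  qed
  with n show ?thesis by auto
qed

end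

theory Submission
  imports Defs
begin

text \<open>Polynomial time is handled by a small language of arithmetic expressions with bounded sums, which
  is compiled to multi-tape Turing machines that use head positions as counters. Everything that is
  expressible in the language has polynomially bounded values and running time, so membership in NP
  and the computability of the reductions become statements about expressibility.

  Hardness starts from a version of the Cook-Levin theorem whose output is a 0/1-matrix of positive and
  negative literals. For \<open>k \<ge> 3\<close>, a row of the matrix becomes a gadget in which the product of the
  literals of the row must exceed \<open>k\<close>. For two labels, only the number of neighbors labeled 2 matters. The
  matrix itself becomes the graph, one planar cell per entry: the value of a variable travels
  downwards and the partial disjunction of a clause travels to the right, and a cell lets the two
  signals cross. One drawing of a cell, repeated periodically, shows planarity.\<close>

section \<open>Structured programs for Turing machines\<close>

text \<open>Three obstacles shape the development. Values of the expression language are held in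
  unary, so a number that is exponential in the input, such as a product of up to n labels, cannot
  be computed at all; the verifier therefore compares two products through the exponents of the
  finitely many primes up to k. The rows of the clause matrix have unbounded length and are never
  split into short clauses: for k >= 3 one product of arbitrarily many labels handles a whole row,
  and for two labels a chain of disjunctions running through the row does. An arbitrary matrix is
  not a planar incidence structure, so signals have to cross. A cell with left input P and upper
  input R introduces S and imposes that each of the triples (P, R, S), (S, R, Q), (S, P, R below)
  contains an odd number of true values; eliminating S leaves Q = P and R below = R, the classical
  crossing by three exclusive-or gates.\<close>

datatype prog =
    Act nat "nat \<Rightarrow> nat \<times> move"
  | Seq prog prog
  | Ite "nat list \<Rightarrow> bool" prog prog
  | Loop "nat list \<Rightarrow> bool" prog

text \<open>Time is the exact number of machine steps: a control construct costs one step of its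
  own, because unfolding it changes only the state of the machine. The loop rules charge one step
  per evaluation of the guard.\<close>

inductive exec :: "prog \<Rightarrow> tape list \<Rightarrow> nat \<Rightarrow> tape list \<Rightarrow> bool" where
  exec_Act: "exec (Act i f) ts 1 (ts[i := act_tape (f (read_tape (ts ! i))) (ts ! i)])"
| exec_Seq: "exec p ts a ts' \<Longrightarrow> exec q ts' b ts'' \<Longrightarrow> exec (Seq p q) ts (a + b + 1) ts''"
| exec_IteT: "c (map read_tape ts) \<Longrightarrow> exec p ts a ts' \<Longrightarrow> exec (Ite c p q) ts (a + 1) ts'"
| exec_IteF: "\<not> c (map read_tape ts) \<Longrightarrow> exec q ts a ts' \<Longrightarrow> exec (Ite c p q) ts (a + 1) ts'"
| exec_LoopF: "\<not> c (map read_tape ts) \<Longrightarrow> exec (Loop c p) ts 1 ts"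
| exec_LoopT: "c (map read_tape ts) \<Longrightarrow> exec p ts a ts' \<Longrightarrow> exec (Loop c p) ts' b ts'' \<Longrightarrow>
    exec (Loop c p) ts (a + b + 1) ts''"

text \<open>The states of the machine for a program are its continuations, i.e. stacks of programs that
  are still to be executed; only finitely many of them are reachable.\<close>

fun next_cont :: "prog list \<Rightarrow> nat list \<Rightarrow> prog list" where
  "next_cont [] ss = []"
| "next_cont (Act i f # K) ss = K"
| "next_cont (Seq p q # K) ss = p # q # K"
| "next_cont (Ite c p q # K) ss = (if c ss then p else q) # K"
| "next_cont (Loop c p # K) ss = (if c ss then p # Loop c p # K else K)"

definition keep :: "nat list \<Rightarrow> (nat \<times> move) list" where
  "keep ss = map (\<lambda>s. (s, Stay)) ss"

fun cont_acts :: "prog list \<Rightarrow> nat list \<Rightarrow> (nat \<times> move) list" where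
  "cont_acts (Act i f # K) ss = (keep ss)[i := f (ss ! i)]"
| "cont_acts K ss = keep ss"

text \<open>\<open>conts p K\<close> collects the stacks met while \<open>p\<close> runs on top of
  \<open>K\<close>, without \<open>K\<close> itself. The body of a loop runs on top of the stack
  with which the loop started, so another round creates no new stack; this is why recursion on the
  program suffices and the set is finite.\<close>

fun conts :: "prog \<Rightarrow> prog list \<Rightarrow> prog list set" where
  "conts (Act i f) K = {Act i f # K}"
| "conts (Seq p q) K = insert (Seq p q # K) (conts p (q # K) \<union> conts q K)"
| "conts (Ite c p q) K = insert (Ite c p q # K) (conts p K \<union> conts q K)"
| "conts (Loop c p) K = insert (Loop c p # K) (conts p (Loop c p # K))"

lemma finite_conts: "finite (conts p K)"
  by (induction p arbitrary: K) auto

lemma conts_start: "p # K \<in> conts p K"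
  by (cases p) auto

lemma next_cont_closed: "c \<in> conts p K \<Longrightarrow> next_cont c ss \<in> insert K (conts p K)"
proof (induction p arbitrary: K)
  case (Seq p q)
  then show ?case using conts_start[of p "q # K"] conts_start[of q K] by fastforce
next
  case (Ite b p q)
  from Ite.prems consider "c = Ite b p q # K" | "c \<in> conts p K" | "c \<in> conts q K" by auto
  then show ?case
  proof cases
    case 1
    then show ?thesis using conts_start[of p K] conts_start[of q K] by auto
  next
    case 2
    from Ite.IH(1)[OF this] show ?thesis by auto
  next
    case 3
    from Ite.IH(2)[OF this] show ?thesis by auto
  qed
next
  case (Loop b p)
  then show ?case using conts_start[of p "Loop b p # K"] by fastforce
qed auto

text \<open>The six tape symbols are 0, 1, 2 and their marked copies 3, 4, 5, which are used for
  cell 0 of a counter tape.\<close>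

fun wf_prog :: "prog \<Rightarrow> bool" where
  "wf_prog (Act i f) = (\<forall>s<6. fst (f s) < 6)"
| "wf_prog (Seq p q) = (wf_prog p \<and> wf_prog q)"
| "wf_prog (Ite c p q) = (wf_prog p \<and> wf_prog q)"
| "wf_prog (Loop c p) = wf_prog p"

lemma conts_Act: "wf_prog p \<Longrightarrow> Act i f # K' \<in> conts p K \<Longrightarrow> \<forall>s<6. fst (f s) < 6"
  by (induction p arbitrary: K) auto

definition all_conts :: "prog \<Rightarrow> prog list set" where
  "all_conts p = insert [] (conts p [])"

text \<open>The stacks are numbered below \<open>card S\<close>, and the next two numbers serve as
  accepting and rejecting state. The empty stack is not yet a halting state: it spends one further
  step on the test \<open>acc\<close> of the scanned symbols.\<close>

definition prog_tm :: "nat \<Rightarrow> prog \<Rightarrow> (nat list \<Rightarrow> bool) \<Rightarrow> tm" where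
  "prog_tm n p acc =
     (let S = all_conts p in
      \<lparr> num_tapes = n, num_symbols = 6, num_states = card S + 2,
        start_state = to_nat_on S [p], accept_state = card S, reject_state = card S + 1,
        trans = (\<lambda>q ss. if q < card S then
            (let c = from_nat_into S q in
             if c = [] then (if acc ss then card S else card S + 1, keep ss)
             else (to_nat_on S (next_cont c ss), cont_acts c ss))
          else (q, keep ss)) \<rparr>)"

lemma finite_all_conts: "finite (all_conts p)"
  by (simp add: all_conts_def finite_conts)

lemma to_nat_on_all_conts: "c \<in> all_conts p \<Longrightarrow> to_nat_on (all_conts p) c < card (all_conts p)"
  using to_nat_on_finite[OF finite_all_conts, of p] by (auto simp: bij_betw_def)

lemma next_cont_all_conts: "c \<in> all_conts p \<Longrightarrow> next_cont c ss \<in> all_conts p"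
  using next_cont_closed[of c p "[]" ss] by (auto simp: all_conts_def)

lemma length_keep [simp]: "length (keep ss) = length ss"
  by (simp add: keep_def)

lemma length_cont_acts [simp]: "length (cont_acts c ss) = length ss"
  by (cases "(c, ss)" rule: cont_acts.cases) auto

lemma cont_acts_symbols:
  assumes "wf_prog p" "c \<in> all_conts p" "set ss \<subseteq> {..<6}"
  shows "fst ` set (cont_acts c ss) \<subseteq> {..<6}"
proof -
  have k: "fst ` set (keep ss) \<subseteq> {..<6}"
    using assms(3) by (auto simp: keep_def)
  show ?thesis
  proof (cases "\<exists>i f K. c = Act i f # K")
    case True
    then obtain i f K where c: "c = Act i f # K" by blast
    have f: "\<forall>s<6. fst (f s) < 6"
      using conts_Act[of p i f K "[]"] assms c by (auto simp: all_conts_def)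
    show ?thesis
    proof (cases "i < length ss")
      case True
      then have "ss ! i < 6" using assms(3) nth_mem by blast
      then have "fst (f (ss ! i)) < 6" using f by blast
      moreover have "set ((keep ss)[i := f (ss ! i)]) \<subseteq> insert (f (ss ! i)) (set (keep ss))"
        by (rule set_update_subset_insert)
      ultimately show ?thesis using k c by fastforce
    next
      case False
      then have "(keep ss)[i := f (ss ! i)] = keep ss" by (simp add: list_update_beyond)
      then show ?thesis using c k by simp
    qed
  next
    case False
    then have "cont_acts c ss = keep ss"
      by (cases "(c, ss)" rule: cont_acts.cases) auto
    with k show ?thesis by simp
  qed
qed

lemma wf_prog_tm:
  assumes "wf_prog p" "1 \<le> n"
  shows "wf_tm (prog_tm n p acc)"
proof -
  let ?S = "all_conts p"
  have s: "[p] \<in> ?S" by (simp add: all_conts_def conts_start)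
  have keep6: "fst ` set (keep ss) \<subseteq> {..<6}" if "set ss \<subseteq> {..<6}" for ss
    using that by (auto simp: keep_def)
  have fr: "from_nat_into ?S q \<in> ?S" for q
    by (rule from_nat_into) (auto simp: all_conts_def)
  have "to_nat_on ?S (next_cont (from_nat_into ?S q) ss) < card ?S + 2" for q ss
    using to_nat_on_all_conts[OF next_cont_all_conts[OF fr[of q]], of ss] by simp
  moreover have "to_nat_on ?S [p] < card ?S + 2"
    using to_nat_on_all_conts[OF s] by simp
  ultimately show ?thesis
    using assms cont_acts_symbols[OF assms(1) fr] keep6
    unfolding wf_tm_def prog_tm_def Let_def by auto
qed

lemma act_tape_keep: "act_tape (read_tape tp, Stay) tp = tp"
  by (cases tp) simp

lemma map2_keep: "map2 act_tape (keep (map read_tape ts)) ts = ts"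
  by (rule nth_equalityI) (auto simp: keep_def act_tape_keep)

lemma prog_tm_step:
  assumes "c \<in> all_conts p" "c \<noteq> []"
  shows "step_tm (prog_tm n p acc) (to_nat_on (all_conts p) c, ts) =
    (to_nat_on (all_conts p) (next_cont c (map read_tape ts)),
     map2 act_tape (cont_acts c (map read_tape ts)) ts)"
  using assms to_nat_on_all_conts[OF assms(1)]
    from_nat_into_to_nat_on[OF countable_finite[OF finite_all_conts] assms(1)]
  by (simp add: prog_tm_def Let_def halting_def)

lemma prog_tm_last_step:
  "step_tm (prog_tm n p acc) (to_nat_on (all_conts p) [], ts) =
    (if acc (map read_tape ts) then card (all_conts p) else card (all_conts p) + 1, ts)"
proof -
  have "[] \<in> all_conts p" by (simp add: all_conts_def)
  then show ?thesis
    using to_nat_on_all_conts[of "[]" p]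
      from_nat_into_to_nat_on[OF countable_finite[OF finite_all_conts], of "[]" p]
    by (simp add: prog_tm_def Let_def halting_def map2_keep)
qed

lemma map2_update:
  assumes "i < length ts"
  shows "map2 act_tape ((keep (map read_tape ts))[i := a]) ts = ts[i := act_tape a (ts ! i)]"
proof (rule nth_equalityI)
  fix j assume j: "j < length (map2 act_tape ((keep (map read_tape ts))[i := a]) ts)"
  from j show "map2 act_tape ((keep (map read_tape ts))[i := a]) ts ! j =
      ts[i := act_tape a (ts ! i)] ! j"
    by (cases "i = j") (auto simp: keep_def act_tape_keep)
qed (use assms in simp)

declare step_tm.simps [simp del]

text \<open>The stack \<open>K\<close> below the running program is arbitrary, because a subprogram
  is simulated on top of the work that remains after it.\<close>

lemma exec_tm:
  "exec q ts t ts' \<Longrightarrow> q # K \<in> all_conts p \<Longrightarrow>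
   (step_tm (prog_tm n p acc) ^^ t) (to_nat_on (all_conts p) (q # K), ts) =
     (to_nat_on (all_conts p) K, ts')"
proof (induction arbitrary: K rule: exec.induct)
  case (exec_Act i f ts)
  have "map2 act_tape (cont_acts (Act i f # K) (map read_tape ts)) ts =
    ts[i := act_tape (f (read_tape (ts ! i))) (ts ! i)]"
  proof (cases "i < length ts")
    case True
    then show ?thesis by (simp add: map2_update)
  next
    case False
    then have "(keep (map read_tape ts))[i := f (map read_tape ts ! i)] = keep (map read_tape ts)"
      "ts[i := act_tape (f (read_tape (ts ! i))) (ts ! i)] = ts"
      by (simp_all add: list_update_beyond)
    then show ?thesis by (simp add: map2_keep)
  qed
  then show ?case using exec_Act by (simp add: prog_tm_step)
next
  case (exec_Seq p1 ts a ts' p2 b ts'')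
  note m = next_cont_all_conts[OF exec_Seq.prems, of "[]"]
  then have m1: "p1 # p2 # K \<in> all_conts p" by simp
  \<comment> \<open>\<open>p2 # K\<close> is not the successor of the present stack but the one
    reached once \<open>p1\<close> is finished; its membership is therefore shown by induction over
    the whole program instead of by closure under \<open>next_cont\<close>.\<close>
  have m2: "p2 # K \<in> all_conts p"
  proof -
    have "Seq p1 p2 # K \<in> conts p L \<Longrightarrow> p2 # K \<in> conts p L" for L
      by (induction p arbitrary: L) (auto simp: conts_start)
    then show ?thesis using exec_Seq.prems by (auto simp: all_conts_def)
  qed
  have "a + b + 1 = Suc (b + a)" by simp
  then show ?case
    using exec_Seq.IH(1)[OF m1] exec_Seq.IH(2)[OF m2] exec_Seq.prems
    by (simp only: funpow_Suc_right funpow_add o_apply) (simp add: prog_tm_step map2_keep)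
next
  case (exec_IteT c ts p1 a ts' p2)
  have "p1 # K \<in> all_conts p"
    using next_cont_all_conts[OF exec_IteT.prems, of "map read_tape ts"] exec_IteT.hyps by simp
  from exec_IteT.IH[OF this] show ?case
    using exec_IteT.prems exec_IteT.hyps
    by (simp only: Suc_eq_plus1[symmetric] funpow_Suc_right o_apply)
       (simp add: prog_tm_step map2_keep)
next
  case (exec_IteF c ts p2 a ts' p1)
  have "p2 # K \<in> all_conts p"
    using next_cont_all_conts[OF exec_IteF.prems, of "map read_tape ts"] exec_IteF.hyps by simp
  from exec_IteF.IH[OF this] show ?case
    using exec_IteF.prems exec_IteF.hyps
    by (simp only: Suc_eq_plus1[symmetric] funpow_Suc_right o_apply)
       (simp add: prog_tm_step map2_keep)
next
  case (exec_LoopF c ts p1)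
  then show ?case by (simp add: prog_tm_step map2_keep)
next
  case (exec_LoopT c ts p1 a ts' b ts'')
  have m: "p1 # Loop c p1 # K \<in> all_conts p"
    using next_cont_all_conts[OF exec_LoopT.prems, of "map read_tape ts"] exec_LoopT.hyps by simp
  have "a + b + 1 = Suc (b + a)" by simp
  then show ?case
    using exec_LoopT.IH(1)[OF m] exec_LoopT.IH(2)[OF exec_LoopT.prems] exec_LoopT.prems exec_LoopT.hyps
    by (simp only: funpow_Suc_right funpow_add o_apply) (simp add: prog_tm_step map2_keep)
qed

lemma halting_stable: "halting M q \<Longrightarrow> (step_tm M ^^ t) (q, ts) = (q, ts)"
  by (induction t) (auto simp: step_tm.simps)

text \<open>The inequality \<open>t < b\<close> is strict because the final test takes one step;
  afterwards the halting configuration no longer changes.\<close>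

lemma prog_tm_run:
  assumes e: "exec p (snd (init_config (prog_tm n p acc) ws)) t ts" and b: "t < b"
  shows "run_tm (prog_tm n p acc) ws b =
    (if acc (map read_tape ts) then card (all_conts p) else card (all_conts p) + 1, ts)"
proof -
  let ?M = "prog_tm n p acc"
  have "[p] \<in> all_conts p" by (simp add: all_conts_def conts_start)
  from exec_tm[OF e this]
  have r: "(step_tm ?M ^^ t) (init_config ?M ws) = (to_nat_on (all_conts p) [], ts)"
    by (simp add: init_config_def prog_tm_def Let_def)
  obtain d where d: "b = d + Suc t" using b less_iff_Suc_add by (metis add.commute add_Suc_right)
  have "(step_tm ?M ^^ Suc t) (init_config ?M ws) =
     (if acc (map read_tape ts) then card (all_conts p) else card (all_conts p) + 1, ts)" (is "_ = ?r")
    using r prog_tm_last_step by simp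
  moreover have "halting ?M (fst ?r)"
    by (simp add: halting_def prog_tm_def Let_def)
  ultimately show ?thesis
    unfolding run_tm_def d funpow_add o_apply by (metis halting_stable fst_conv)
qed

section \<open>Counters as head positions\<close>

text \<open>A tape serves as a counter whose value is the head position. The symbol in cell 0 is marked
  by adding 3, so that zero can be recognised. The tapes 0 and 1 hold the two input words, and the
  last tape is the output tape, on which nothing is marked.\<close>

definition marked :: "bool list \<Rightarrow> int \<Rightarrow> nat" where
  "marked w z = word_contents w z + (if z = 0 then 3 else 0)"

definition input_word :: "bool list \<Rightarrow> bool list \<Rightarrow> nat \<Rightarrow> bool list" where
  "input_word x w i = (if i = 0 then x else if i = 1 then w else [])"

definition reg_tapes :: "bool list \<Rightarrow> bool list \<Rightarrow> nat \<Rightarrow> bool list \<Rightarrow> (nat \<Rightarrow> nat) \<Rightarrow> tape list" where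
  "reg_tapes x w n out \<sigma> =
     map (\<lambda>i. (int (\<sigma> i), marked (input_word x w i))) [0..<n] @ [(int (length out), word_contents out)]"

definition reaches :: "prog \<Rightarrow> tape list \<Rightarrow> nat \<Rightarrow> tape list \<Rightarrow> bool" where
  "reaches p ts b ts' \<longleftrightarrow> (\<exists>t\<le>b. exec p ts t ts')"

lemma reaches_mono: "reaches p ts a ts' \<Longrightarrow> a \<le> b \<Longrightarrow> reaches p ts b ts'"
  unfolding reaches_def by (meson order_trans)

lemma reaches_Act: "reaches (Act i f) ts 1 (ts[i := act_tape (f (read_tape (ts ! i))) (ts ! i)])"
  unfolding reaches_def using exec_Act by blast

lemma reaches_Seq: "reaches p ts a ts' \<Longrightarrow> reaches q ts' b ts'' \<Longrightarrow> reaches (Seq p q) ts (a + b + 1) ts''"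
  unfolding reaches_def by (meson add_le_mono exec_Seq order_refl)

lemma reaches_Ite:
  assumes "c (map read_tape ts) \<Longrightarrow> reaches p ts a ts'" and "\<not> c (map read_tape ts) \<Longrightarrow> reaches q ts a ts'"
  shows "reaches (Ite c p q) ts (a + 1) ts'"
proof (cases "c (map read_tape ts)")
  case True
  then obtain t where "t \<le> a" "exec p ts t ts'"
    using assms(1) unfolding reaches_def by blast
  then show ?thesis
    unfolding reaches_def using exec_IteT[of c, OF True] by (intro exI[of _ "t + 1"]) simp
next
  case False
  then obtain t where "t \<le> a" "exec q ts t ts'"
    using assms(2) unfolding reaches_def by blast
  then show ?thesis
    unfolding reaches_def using exec_IteF[of c, OF False] by (intro exI[of _ "t + 1"]) simp
qed

text \<open>The invariant is given explicitly as the sequence \<open>s\<close> of tape contents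
  after each round, with one time bound \<open>b\<close> for all rounds; the last summand 1 is the
  failing evaluation of the guard.\<close>

lemma reaches_Loop:
  assumes "\<And>j. j < m \<Longrightarrow> c (map read_tape (s j))"
    and "\<And>j. j < m \<Longrightarrow> reaches p (s j) b (s (Suc j))"
    and "\<not> c (map read_tape (s m))"
  shows "reaches (Loop c p) (s 0) (m * (b + 1) + 1) (s m)"
  using assms
proof (induction m arbitrary: s)
  case 0
  then show ?case unfolding reaches_def using exec_LoopF[of c "s 0" p] by (intro exI[of _ 1]) simp
next
  case (Suc m)
  have "reaches (Loop c p) (s (Suc 0)) (m * (b + 1) + 1) (s (Suc m))"
    using Suc.IH[of "\<lambda>j. s (Suc j)"] Suc.prems by auto
  then obtain t where t: "t \<le> m * (b + 1) + 1" "exec (Loop c p) (s (Suc 0)) t (s (Suc m))"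
    unfolding reaches_def by blast
  obtain t' where t': "t' \<le> b" "exec p (s 0) t' (s (Suc 0))"
    using Suc.prems(2)[of 0] unfolding reaches_def by blast
  have "exec (Loop c p) (s 0) (t' + t + 1) (s (Suc m))"
    using exec_LoopT[OF _ t'(2) t(2)] Suc.prems(1)[of 0] by simp
  then show ?case
    unfolding reaches_def using t(1) t'(1) by (intro exI[of _ "t' + t + 1"]) simp
qed

definition runs ::
    "bool list \<Rightarrow> bool list \<Rightarrow> nat \<Rightarrow> bool list \<Rightarrow> prog \<Rightarrow> (nat \<Rightarrow> nat) \<Rightarrow> nat \<Rightarrow> (nat \<Rightarrow> nat) \<Rightarrow> bool" where
  "runs x w n out p \<sigma> b \<tau> \<longleftrightarrow> reaches p (reg_tapes x w n out \<sigma>) b (reg_tapes x w n out \<tau>)"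

lemma word_contents_le: "word_contents w z \<le> 2"
  by (simp add: word_contents_def)

lemma length_reg_tapes [simp]: "length (reg_tapes x w n out \<sigma>) = Suc n"
  by (simp add: reg_tapes_def)

lemma nth_reg_tapes:
  "i < n \<Longrightarrow> reg_tapes x w n out \<sigma> ! i = (int (\<sigma> i), marked (input_word x w i))"
  by (simp add: reg_tapes_def nth_append)

lemma update_reg_tapes:
  "i < n \<Longrightarrow> (reg_tapes x w n out \<sigma>)[i := (int v, marked (input_word x w i))] =
    reg_tapes x w n out (\<sigma>(i := v))"
  by (rule nth_equalityI) (auto simp: reg_tapes_def nth_append nth_list_update)

lemma read_reg_tapes:
  "i < n \<Longrightarrow> map read_tape (reg_tapes x w n out \<sigma>) ! i = marked (input_word x w i) (int (\<sigma> i))"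
  by (simp add: nth_reg_tapes)

lemma marked_less_3: "marked w (int v) < 3 \<longleftrightarrow> v \<noteq> 0"
  using word_contents_le[of w "int v"] by (auto simp: marked_def)

lemma marked_mod_3: "marked w z mod 3 = word_contents w z"
  using word_contents_le[of w z] by (auto simp: marked_def)

section \<open>Counter operations on head positions\<close>

definition Skip :: prog where "Skip = Act 0 (\<lambda>s. (s, Stay))"
definition Inc :: "nat \<Rightarrow> prog" where "Inc i = Act i (\<lambda>s. (s, Right))"
text \<open>The head refuses to leave the marked cell 0 to the left, so this is truncated
  subtraction; \<open>Monus\<close> inherits the truncation.\<close>

definition Dec :: "nat \<Rightarrow> prog" where "Dec i = Act i (\<lambda>s. (s, if 3 \<le> s then Stay else Left))"
definition nonzero :: "nat \<Rightarrow> nat list \<Rightarrow> bool" where "nonzero i ss \<longleftrightarrow> ss ! i < 3"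

lemma nonzero_reg_tapes:
  "i < n \<Longrightarrow> nonzero i (map read_tape (reg_tapes x w n out \<sigma>)) \<longleftrightarrow> \<sigma> i \<noteq> 0"
  unfolding nonzero_def by (simp only: read_reg_tapes marked_less_3)

lemma runs_mono: "runs x w n out p \<sigma> a \<tau> \<Longrightarrow> a \<le> b \<Longrightarrow> runs x w n out p \<sigma> b \<tau>"
  unfolding runs_def by (rule reaches_mono)

lemma runs_Skip: "0 < n \<Longrightarrow> runs x w n out Skip \<sigma> 1 \<sigma>"
  using reaches_Act[of 0 "\<lambda>s. (s, Stay)" "reg_tapes x w n out \<sigma>"]
  unfolding runs_def Skip_def
  by (simp add: nth_reg_tapes update_reg_tapes)

lemma runs_Inc: "i < n \<Longrightarrow> runs x w n out (Inc i) \<sigma> 1 (\<sigma>(i := Suc (\<sigma> i)))"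
  using reaches_Act[of i "\<lambda>s. (s, Right)" "reg_tapes x w n out \<sigma>"]
    update_reg_tapes[of i n x w out \<sigma> "Suc (\<sigma> i)"]
  unfolding runs_def Inc_def
  by (simp add: nth_reg_tapes add.commute)

lemma runs_Dec: "i < n \<Longrightarrow> runs x w n out (Dec i) \<sigma> 1 (\<sigma>(i := \<sigma> i - 1))"
proof -
  assume i: "i < n"
  have "3 \<le> marked (input_word x w i) (int (\<sigma> i)) \<longleftrightarrow> \<sigma> i = 0"
    using marked_less_3[of "input_word x w i" "\<sigma> i"] by linarith
  moreover have "int (\<sigma> i - 1) = int (\<sigma> i) - 1" if "\<sigma> i \<noteq> 0"
    using that by simp
  ultimately show ?thesis
    using reaches_Act[of i "\<lambda>s. (s, if 3 \<le> s then Stay else Left)" "reg_tapes x w n out \<sigma>"]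
      update_reg_tapes[of i n x w out \<sigma> "\<sigma> i - 1"] i
    unfolding runs_def Dec_def
    by (auto simp: nth_reg_tapes)
qed

lemma runs_Seq:
  "runs x w n out p \<sigma> a \<tau> \<Longrightarrow> runs x w n out q \<tau> b \<upsilon> \<Longrightarrow> runs x w n out (Seq p q) \<sigma> (a + b + 1) \<upsilon>"
  unfolding runs_def by (rule reaches_Seq)

lemma runs_Ite:
  assumes "c (map read_tape (reg_tapes x w n out \<sigma>)) \<Longrightarrow> runs x w n out p \<sigma> a \<tau>"
    and "\<not> c (map read_tape (reg_tapes x w n out \<sigma>)) \<Longrightarrow> runs x w n out q \<sigma> a \<tau>"
  shows "runs x w n out (Ite c p q) \<sigma> (a + 1) \<tau>"
  using assms unfolding runs_def by (rule reaches_Ite)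

lemma runs_Loop:
  assumes "\<And>j. j < m \<Longrightarrow> c (map read_tape (reg_tapes x w n out (s j)))"
    and "\<And>j. j < m \<Longrightarrow> runs x w n out p (s j) b (s (Suc j))"
    and "\<not> c (map read_tape (reg_tapes x w n out (s m)))"
  shows "runs x w n out (Loop c p) (s 0) (m * (b + 1) + 1) (s m)"
  using assms unfolding runs_def by (rule reaches_Loop)

definition Clear :: "nat \<Rightarrow> prog" where "Clear i = Loop (nonzero i) (Dec i)"
definition Move :: "nat \<Rightarrow> nat \<Rightarrow> prog" where "Move i j = Loop (nonzero i) (Seq (Dec i) (Inc j))"
text \<open>Reading a counter means emptying it. The value is therefore sent both to the target and
  to a helper \<open>h\<close>, from which \<open>i\<close> is restored.\<close>

definition Copy :: "nat \<Rightarrow> nat \<Rightarrow> nat \<Rightarrow> prog" where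
  "Copy i r h = Seq (Loop (nonzero i) (Seq (Dec i) (Seq (Inc r) (Inc h)))) (Move h i)"
definition Monus :: "nat \<Rightarrow> nat \<Rightarrow> prog" where "Monus i j = Loop (nonzero j) (Seq (Dec j) (Dec i))"

lemma runs_Clear: "i < n \<Longrightarrow> runs x w n out (Clear i) \<sigma> (2 * \<sigma> i + 1) (\<sigma>(i := 0))"
proof -
  assume i: "i < n"
  have "runs x w n out (Dec i) (\<sigma>(i := \<sigma> i - j)) 1 (\<sigma>(i := \<sigma> i - Suc j))" for j
    using runs_Dec[OF i, of x w out "\<sigma>(i := \<sigma> i - j)"] by simp
  then show ?thesis
    using runs_Loop[of "\<sigma> i" "nonzero i" x w n out "\<lambda>j. \<sigma>(i := \<sigma> i - j)" "Dec i" 1] i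
    by (auto simp: nonzero_reg_tapes Clear_def elim!: runs_mono)
qed

lemma runs_Move:
  assumes i: "i < n" "j < n" "i \<noteq> j"
  shows "runs x w n out (Move i j) \<sigma> (4 * \<sigma> i + 1) (\<sigma>(i := 0, j := \<sigma> j + \<sigma> i))"
proof -
  have "runs x w n out (Seq (Dec i) (Inc j)) (\<sigma>(i := \<sigma> i - a, j := \<sigma> j + a)) 3
      (\<sigma>(i := \<sigma> i - Suc a, j := \<sigma> j + Suc a))" for a
    using runs_Seq[OF runs_Dec[OF i(1), of x w out "\<sigma>(i := \<sigma> i - a, j := \<sigma> j + a)"] runs_Inc[OF i(2)]] i
    by (simp add: fun_upd_twist numeral_eq_Suc)
  then show ?thesis
    using runs_Loop[of "\<sigma> i" "nonzero i" x w n out "\<lambda>a. \<sigma>(i := \<sigma> i - a, j := \<sigma> j + a)"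
        "Seq (Dec i) (Inc j)" 3] i
    by (simp add: nonzero_reg_tapes Move_def mult.commute)
qed

lemma runs_Copy:
  assumes i: "i < n" "r < n" "h < n" "i \<noteq> r" "i \<noteq> h" "r \<noteq> h" and h: "\<sigma> h = 0"
  shows "runs x w n out (Copy i r h) \<sigma> (10 * \<sigma> i + 3) (\<sigma>(r := \<sigma> r + \<sigma> i))"
proof -
  let ?s = "\<lambda>a. \<sigma>(i := \<sigma> i - a, r := \<sigma> r + a, h := a)"
  have "runs x w n out (Seq (Dec i) (Seq (Inc r) (Inc h))) (?s a) 5 (?s (Suc a))" for a
    using runs_Seq[OF runs_Dec[OF i(1), of x w out "?s a"] runs_Seq[OF runs_Inc[OF i(2)] runs_Inc[OF i(3)]]] i
    by (simp add: fun_upd_twist numeral_eq_Suc)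
  then have "runs x w n out (Loop (nonzero i) (Seq (Dec i) (Seq (Inc r) (Inc h)))) (?s 0) (\<sigma> i * 6 + 1) (?s (\<sigma> i))"
    using runs_Loop[of "\<sigma> i" "nonzero i" x w n out ?s "Seq (Dec i) (Seq (Inc r) (Inc h))" 5] i
    by (simp add: nonzero_reg_tapes)
  moreover have "?s 0 = \<sigma>" using h by auto
  ultimately have l: "runs x w n out (Loop (nonzero i) (Seq (Dec i) (Seq (Inc r) (Inc h)))) \<sigma> (\<sigma> i * 6 + 1) (?s (\<sigma> i))"
    by simp
  have "(?s (\<sigma> i))(h := 0, i := \<sigma> i) = \<sigma>(r := \<sigma> r + \<sigma> i)"
    using i h by (auto simp: fun_eq_iff)
  then have "runs x w n out (Move h i) (?s (\<sigma> i)) (4 * \<sigma> i + 1) (\<sigma>(r := \<sigma> r + \<sigma> i))"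
    using runs_Move[of h n i x w out "?s (\<sigma> i)"] i by simp
  from runs_Seq[OF l this] show ?thesis
    unfolding Copy_def by (rule runs_mono) simp
qed

lemma runs_Monus:
  assumes i: "i < n" "j < n" "i \<noteq> j"
  shows "runs x w n out (Monus i j) \<sigma> (4 * \<sigma> j + 1) (\<sigma>(i := \<sigma> i - \<sigma> j, j := 0))"
proof -
  let ?s = "\<lambda>a. \<sigma>(i := \<sigma> i - a, j := \<sigma> j - a)"
  have "runs x w n out (Seq (Dec j) (Dec i)) (?s a) 3 (?s (Suc a))" for a
    using runs_Seq[OF runs_Dec[OF i(2), of x w out "?s a"] runs_Dec[OF i(1)]] i
    by (simp add: fun_upd_twist numeral_eq_Suc)
  then show ?thesis
    using runs_Loop[of "\<sigma> j" "nonzero j" x w n out ?s "Seq (Dec j) (Dec i)" 3] i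
    by (simp add: nonzero_reg_tapes Monus_def mult.commute)
qed

fun Incs :: "nat \<Rightarrow> nat \<Rightarrow> prog" where
  "Incs r 0 = Skip"
| "Incs r (Suc k) = Seq (Inc r) (Incs r k)"

lemma runs_Incs: "r < n \<Longrightarrow> runs x w n out (Incs r k) \<sigma> (2 * k + 1) (\<sigma>(r := \<sigma> r + k))"
proof (induction k arbitrary: \<sigma>)
  case 0
  then show ?case using runs_Skip[of n x w out \<sigma>] by simp
next
  case (Suc k)
  have "(\<sigma>(r := Suc (\<sigma> r)))(r := (\<sigma>(r := Suc (\<sigma> r))) r + k) = \<sigma>(r := \<sigma> r + Suc k)"
    by simp
  then show ?case
    using runs_Seq[OF runs_Inc[OF Suc.prems, of x w out \<sigma>] Suc.IH[OF Suc.prems, of "\<sigma>(r := Suc (\<sigma> r))"]]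
    by (simp only: Incs.simps) (erule runs_mono, simp)
qed

section \<open>Arithmetic expressions with bounded sums\<close>

text \<open>Variables are de Bruijn indices; \<open>Sum a b\<close> binds one variable in \<open>b\<close>. The flag of \<open>Bit\<close> and
  \<open>Len\<close> selects the first (\<open>False\<close>) or the second (\<open>True\<close>) input word.\<close>

datatype expr =
    Var nat
  | Num nat
  | Add expr expr
  | Sub expr expr
  | Sum expr expr
  | Bit bool expr
  | Len bool

primrec ev :: "bool list \<Rightarrow> bool list \<Rightarrow> expr \<Rightarrow> (nat \<Rightarrow> nat) \<Rightarrow> nat" where
  "ev x w (Var i) = (\<lambda>e. e i)"
| "ev x w (Num k) = (\<lambda>e. k)"
| "ev x w (Add a b) = (\<lambda>e. ev x w a e + ev x w b e)"
| "ev x w (Sub a b) = (\<lambda>e. ev x w a e - ev x w b e)"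
| "ev x w (Sum a b) = (\<lambda>e. \<Sum>i<ev x w a e. ev x w b (case_nat i e))"
| "ev x w (Bit c a) = (\<lambda>e. let v = (if c then w else x); i = ev x w a e in
     of_bool (i < length v \<and> v ! i))"
| "ev x w (Len c) = (\<lambda>e. length (if c then w else x))"

definition word_reg :: "bool \<Rightarrow> nat" where "word_reg c = (if c then 1 else 0)"

text \<open>\<open>comp \<rho> h r a\<close> adds the value of \<open>a\<close> to register \<open>r\<close>; variable \<open>i\<close> is held in register \<open>\<rho> i\<close>,
  and all registers from \<open>h\<close> on are scratch space, zero before and after.\<close>

primrec comp :: "expr \<Rightarrow> (nat \<Rightarrow> nat) \<Rightarrow> nat \<Rightarrow> nat \<Rightarrow> prog" where
  "comp (Var i) = (\<lambda>\<rho> h r. Copy (\<rho> i) r h)"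
| "comp (Num k) = (\<lambda>\<rho> h r. Incs r k)"
| "comp (Add a b) = (\<lambda>\<rho> h r. Seq (comp a \<rho> h r) (comp b \<rho> h r))"
| "comp (Sub a b) = (\<lambda>\<rho> h r. Seq (comp a \<rho> (h + 2) h) (Seq (comp b \<rho> (h + 2) (h + 1))
     (Seq (Monus h (h + 1)) (Move h r))))"
| "comp (Sum a b) = (\<lambda>\<rho> h r. Seq (comp a \<rho> (h + 2) h)
     (Seq (Loop (nonzero h) (Seq (comp b (case_nat (h + 1) \<rho>) (h + 2) r) (Seq (Inc (h + 1)) (Dec h))))
       (Clear (h + 1))))"
| "comp (Bit c a) = (\<lambda>\<rho> h r. Seq (comp a \<rho> (h + 1) h) (Seq (Move h (word_reg c))
     (Seq (Ite (\<lambda>ss. ss ! word_reg c mod 3 = 2) (Inc r) Skip) (Clear (word_reg c)))))"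
| "comp (Len c) = (\<lambda>\<rho> h r. Seq (Loop (\<lambda>ss. ss ! word_reg c mod 3 \<noteq> 0) (Seq (Inc (word_reg c)) (Inc r)))
     (Clear (word_reg c)))"

text \<open>An upper bound on the number of registers from \<open>h\<close> on that the compiled
  code touches; sums are taken instead of maxima, since any fixed number of tapes is
  allowed.\<close>

primrec scratch :: "expr \<Rightarrow> nat" where
  "scratch (Var i) = 1"
| "scratch (Num k) = 0"
| "scratch (Add a b) = scratch a + scratch b"
| "scratch (Sub a b) = 2 + scratch a + scratch b"
| "scratch (Sum a b) = 2 + scratch a + scratch b"
| "scratch (Bit c a) = 1 + scratch a"
| "scratch (Len c) = 0"

section \<open>Polynomially bounded functions\<close>

definition poly_bounded :: "(nat \<Rightarrow> nat) \<Rightarrow> bool" where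
  "poly_bounded g \<longleftrightarrow> mono g \<and> (\<exists>p :: nat poly. \<forall>n. g n \<le> poly p n)"

lemma mono_poly_nat: "mono (poly (p :: nat poly))"
proof (rule monoI)
  fix a b :: nat assume "a \<le> b"
  then show "poly p a \<le> poly p b"
    by (induction p) (auto intro!: add_mono mult_mono)
qed

lemma poly_bounded_const: "poly_bounded (\<lambda>_. c)"
  unfolding poly_bounded_def by (auto intro!: exI[of _ "[:c:]"] simp: mono_def)

lemma poly_bounded_id: "poly_bounded (\<lambda>n. n)"
  unfolding poly_bounded_def by (auto intro!: exI[of _ "[:0, 1:]"] simp: mono_def)

lemma poly_bounded_add: "poly_bounded f \<Longrightarrow> poly_bounded g \<Longrightarrow> poly_bounded (\<lambda>n. f n + g n)"
  unfolding poly_bounded_def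
proof (elim conjE exE, intro conjI)
  fix p q :: "nat poly"
  assume "\<forall>n. f n \<le> poly p n" "\<forall>n. g n \<le> poly q n"
  then show "\<exists>r :: nat poly. \<forall>n. f n + g n \<le> poly r n"
    by (intro exI[of _ "p + q"]) (auto intro: add_mono)
qed (auto simp: mono_def intro: add_mono)

lemma poly_bounded_mult: "poly_bounded f \<Longrightarrow> poly_bounded g \<Longrightarrow> poly_bounded (\<lambda>n. f n * g n)"
  unfolding poly_bounded_def
proof (elim conjE exE, intro conjI)
  fix p q :: "nat poly"
  assume "\<forall>n. f n \<le> poly p n" "\<forall>n. g n \<le> poly q n"
  then show "\<exists>r :: nat poly. \<forall>n. f n * g n \<le> poly r n"
    by (intro exI[of _ "p * q"]) (auto intro: mult_mono)
qed (auto simp: mono_def intro: mult_mono)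

lemma poly_bounded_comp: "poly_bounded f \<Longrightarrow> poly_bounded g \<Longrightarrow> poly_bounded (\<lambda>n. f (g n))"
  unfolding poly_bounded_def
proof (elim conjE exE, intro conjI)
  fix p q :: "nat poly"
  assume pq: "\<forall>n. f n \<le> poly p n" "\<forall>n. g n \<le> poly q n"
  have "f (g n) \<le> poly p (poly q n)" for n
    using pq monoD[OF mono_poly_nat, of "g n" "poly q n" p] order_trans by blast
  then show "\<exists>r :: nat poly. \<forall>n. f (g n) \<le> poly r n"
    by (intro exI[of _ "pcompose p q"]) (simp add: poly_pcompose)
qed (auto simp: mono_def)

lemma poly_bounded_poly: "poly_bounded (poly p)"
  unfolding poly_bounded_def using mono_poly_nat by auto

lemmas poly_bounded_intros =
  poly_bounded_const poly_bounded_id poly_bounded_add poly_bounded_mult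

text \<open>One function \<open>g\<close> bounds both the value and the running time, since a value
  may become a number of iterations. The parameter \<open>N\<close> bounds the words and all
  variables at once. Heads 0 and 1 must rest at position 0, since compiled code moves them to look
  up the input and brings them back.\<close>

definition comp_within :: "expr \<Rightarrow> (nat \<Rightarrow> nat) \<Rightarrow> bool" where
  "comp_within a g \<longleftrightarrow> (\<forall>x w n out \<rho> h r \<sigma> N.
     h + scratch a \<le> n \<longrightarrow> 2 \<le> r \<longrightarrow> r < h \<longrightarrow> (\<forall>i. 2 \<le> \<rho> i \<and> \<rho> i < h \<and> \<rho> i \<noteq> r) \<longrightarrow>
     \<sigma> 0 = 0 \<longrightarrow> \<sigma> 1 = 0 \<longrightarrow> (\<forall>j\<ge>h. \<sigma> j = 0) \<longrightarrow>
     length x \<le> N \<longrightarrow> length w \<le> N \<longrightarrow> (\<forall>i. \<sigma> (\<rho> i) \<le> N) \<longrightarrow>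
     ev x w a (\<sigma> \<circ> \<rho>) \<le> g N \<and>
     runs x w n out (comp a \<rho> h r) \<sigma> (g N) (\<sigma>(r := \<sigma> r + ev x w a (\<sigma> \<circ> \<rho>))))"

lemma comp_withinD:
  assumes "comp_within a g" "h + scratch a \<le> n" "2 \<le> r" "r < h" "\<And>i. 2 \<le> \<rho> i \<and> \<rho> i < h \<and> \<rho> i \<noteq> r"
    "\<sigma> 0 = 0" "\<sigma> 1 = 0" "\<And>j. j \<ge> h \<Longrightarrow> \<sigma> j = 0" "length x \<le> N" "length w \<le> N" "\<And>i. \<sigma> (\<rho> i) \<le> N"
  shows "ev x w a (\<sigma> \<circ> \<rho>) \<le> g N \<and>
    runs x w n out (comp a \<rho> h r) \<sigma> (g N) (\<sigma>(r := \<sigma> r + ev x w a (\<sigma> \<circ> \<rho>)))"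
  using assms unfolding comp_within_def by blast

section \<open>Correctness and cost of the compiler, construct by construct\<close>

lemma comp_within_Var: "comp_within (Var i) (\<lambda>N. 10 * N + 3)"
  unfolding comp_within_def
proof (intro allI impI)
  fix x w out :: "bool list" and n h r N :: nat and \<rho> \<sigma> :: "nat \<Rightarrow> nat"
  assume a: "h + scratch (Var i) \<le> n" "2 \<le> r" "r < h" "\<forall>i. 2 \<le> \<rho> i \<and> \<rho> i < h \<and> \<rho> i \<noteq> r"
    "\<forall>j\<ge>h. \<sigma> j = 0" "\<forall>i. \<sigma> (\<rho> i) \<le> N"
  then have i: "\<rho> i < h" "\<rho> i \<noteq> r" "\<sigma> (\<rho> i) \<le> N" by auto
  have "runs x w n out (Copy (\<rho> i) r h) \<sigma> (10 * \<sigma> (\<rho> i) + 3) (\<sigma>(r := \<sigma> r + \<sigma> (\<rho> i)))"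
    using a(1,3,5) i by (intro runs_Copy) auto
  then show "ev x w (Var i) (\<sigma> \<circ> \<rho>) \<le> 10 * N + 3 \<and> runs x w n out (comp (Var i) \<rho> h r) \<sigma> (10 * N + 3)
      (\<sigma>(r := \<sigma> r + ev x w (Var i) (\<sigma> \<circ> \<rho>)))"
    using i(3) by (auto elim!: runs_mono)
qed

lemma comp_within_Num: "comp_within (Num k) (\<lambda>N. 2 * k + 1)"
  unfolding comp_within_def using runs_Incs by (auto simp del: One_nat_def add_Suc_right)

lemma comp_within_Add:
  assumes "comp_within a f" "comp_within b g"
  shows "comp_within (Add a b) (\<lambda>N. f N + g N + 1)"
  unfolding comp_within_def
proof (intro allI impI)
  fix x w out :: "bool list" and n h r N :: nat and \<rho> \<sigma> :: "nat \<Rightarrow> nat"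
  assume 0: "h + scratch (Add a b) \<le> n" "2 \<le> r" "r < h" "\<forall>i. 2 \<le> \<rho> i \<and> \<rho> i < h \<and> \<rho> i \<noteq> r"
    "\<sigma> 0 = 0" "\<sigma> 1 = 0" "\<forall>j\<ge>h. \<sigma> j = 0" "length x \<le> N" "length w \<le> N" "\<forall>i. \<sigma> (\<rho> i) \<le> N"
  note A = comp_withinD[OF assms(1), of h n r \<rho> \<sigma> x N w out]
  let ?\<tau> = "\<sigma>(r := \<sigma> r + ev x w a (\<sigma> \<circ> \<rho>))"
  note B = comp_withinD[OF assms(2), of h n r \<rho> ?\<tau> x N w out]
  have c: "?\<tau> \<circ> \<rho> = \<sigma> \<circ> \<rho>" using 0(4) by (auto simp: fun_eq_iff)
  have "ev x w a (\<sigma> \<circ> \<rho>) \<le> f N" "runs x w n out (comp a \<rho> h r) \<sigma> (f N) ?\<tau>"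
    using 0 A by auto
  moreover have "ev x w b (\<sigma> \<circ> \<rho>) \<le> g N"
    "runs x w n out (comp b \<rho> h r) ?\<tau> (g N) (?\<tau>(r := ?\<tau> r + ev x w b (\<sigma> \<circ> \<rho>)))"
    using 0 B unfolding c by auto
  ultimately show "ev x w (Add a b) (\<sigma> \<circ> \<rho>) \<le> f N + g N + 1 \<and>
      runs x w n out (comp (Add a b) \<rho> h r) \<sigma> (f N + g N + 1)
      (\<sigma>(r := \<sigma> r + ev x w (Add a b) (\<sigma> \<circ> \<rho>)))"
    using runs_Seq[of x w n out "comp a \<rho> h r" \<sigma> "f N" ?\<tau>] by (auto simp: add.assoc)
qed

lemma comp_within_Sub:
  assumes "comp_within a f" "comp_within b g"
  shows "comp_within (Sub a b) (\<lambda>N. 5 * f N + 5 * g N + 10)"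
  unfolding comp_within_def
proof (intro allI impI)
  fix x w out :: "bool list" and n h r N :: nat and \<rho> \<sigma> :: "nat \<Rightarrow> nat"
  assume 0: "h + scratch (Sub a b) \<le> n" "2 \<le> r" "r < h" "\<forall>i. 2 \<le> \<rho> i \<and> \<rho> i < h \<and> \<rho> i \<noteq> r"
    "\<sigma> 0 = 0" "\<sigma> 1 = 0" "\<forall>j\<ge>h. \<sigma> j = 0" "length x \<le> N" "length w \<le> N" "\<forall>i. \<sigma> (\<rho> i) \<le> N"
  have \<rho>: "2 \<le> \<rho> i" "\<rho> i < h" "\<rho> i < h + 2" "\<rho> i \<noteq> h" "\<rho> i \<noteq> h + 1" "\<sigma> (\<rho> i) \<le> N" for i
    using 0(4)[rule_format, of i] 0(10) by auto
  let ?A = "ev x w a (\<sigma> \<circ> \<rho>)" and ?B = "ev x w b (\<sigma> \<circ> \<rho>)"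
  let ?s1 = "\<sigma>(h := ?A)"
  let ?s2 = "?s1(h + 1 := ?B)"
  let ?s3 = "\<sigma>(h := ?A - ?B)"
  let ?s4 = "\<sigma>(r := \<sigma> r + (?A - ?B))"
  have c: "?s1 \<circ> \<rho> = \<sigma> \<circ> \<rho>" using \<rho>(4) by (auto simp: fun_eq_iff)
  have z: "\<sigma> h = 0" "\<sigma> (h + 1) = 0" using 0(7) by auto
  note A = comp_withinD[OF assms(1), of "h + 2" n h \<rho> \<sigma> x N w out]
  note B = comp_withinD[OF assms(2), of "h + 2" n "h + 1" \<rho> ?s1 x N w out]
  have a: "?A \<le> f N" "runs x w n out (comp a \<rho> (h + 2) h) \<sigma> (f N) ?s1"
    using 0 \<rho> z A by auto
  have b: "?B \<le> g N" "runs x w n out (comp b \<rho> (h + 2) (h + 1)) ?s1 (g N) ?s2"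
    using 0 \<rho> z B unfolding c by auto
  have mo: "runs x w n out (Monus h (h + 1)) ?s2 (4 * ?B + 1) ?s3"
  proof -
    have "?s2(h := ?s2 h - ?s2 (h + 1), h + 1 := 0) = ?s3" using z by (auto simp: fun_eq_iff)
    then show ?thesis using runs_Monus[of h n "h + 1" x w out ?s2] 0(1) by simp
  qed
  have mv: "runs x w n out (Move h r) ?s3 (4 * (?A - ?B) + 1) ?s4"
  proof -
    have "?s3(h := 0, r := ?s3 r + ?s3 h) = ?s4" using z 0(3) by (auto simp: fun_eq_iff)
    then show ?thesis using runs_Move[of h n r x w out ?s3] 0(1,3) by simp
  qed
  have "runs x w n out (comp (Sub a b) \<rho> h r) \<sigma>
      (f N + (g N + ((4 * ?B + 1) + (4 * (?A - ?B) + 1) + 1) + 1) + 1) ?s4"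
    unfolding comp.simps by (rule runs_Seq[OF a(2) runs_Seq[OF b(2) runs_Seq[OF mo mv]]])
  then show "ev x w (Sub a b) (\<sigma> \<circ> \<rho>) \<le> 5 * f N + 5 * g N + 10 \<and>
      runs x w n out (comp (Sub a b) \<rho> h r) \<sigma> (5 * f N + 5 * g N + 10)
      (\<sigma>(r := \<sigma> r + ev x w (Sub a b) (\<sigma> \<circ> \<rho>)))"
    using a(1) b(1) by (auto elim!: runs_mono)
qed

text \<open>The index lives in register \<open>h + 1\<close> and never exceeds the value of
  \<open>a\<close>, so the body is run with \<open>N + f N\<close> in place of \<open>N\<close>.
  Bounds stay polynomial because this only composes polynomials, once per nested sum.\<close>

lemma comp_within_Sum:
  assumes "comp_within a f" "comp_within b g" "mono g"
  shows "comp_within (Sum a b) (\<lambda>N. f N + f N * (g (N + f N) + 5) + 2 * f N + 10)"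
  unfolding comp_within_def
proof (intro allI impI)
  fix x w out :: "bool list" and n h r N :: nat and \<rho> \<sigma> :: "nat \<Rightarrow> nat"
  assume 0: "h + scratch (Sum a b) \<le> n" "2 \<le> r" "r < h" "\<forall>i. 2 \<le> \<rho> i \<and> \<rho> i < h \<and> \<rho> i \<noteq> r"
    "\<sigma> 0 = 0" "\<sigma> 1 = 0" "\<forall>j\<ge>h. \<sigma> j = 0" "length x \<le> N" "length w \<le> N" "\<forall>i. \<sigma> (\<rho> i) \<le> N"
  have \<rho>: "2 \<le> \<rho> i" "\<rho> i < h" "\<rho> i < h + 2" "\<rho> i \<noteq> h" "\<rho> i \<noteq> h + 1" "\<sigma> (\<rho> i) \<le> N" "\<rho> i \<noteq> r" for i
    using 0(4)[rule_format, of i] 0(10) by auto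
  let ?A = "ev x w a (\<sigma> \<circ> \<rho>)"
  let ?B = "\<lambda>i. ev x w b (case_nat i (\<sigma> \<circ> \<rho>))"
  let ?M = "N + f N"
  let ?body = "Seq (comp b (case_nat (h + 1) \<rho>) (h + 2) r) (Seq (Inc (h + 1)) (Dec h))"
  \<comment> \<open>After \<open>i\<close> rounds, \<open>h\<close> counts the remaining rounds,
    \<open>h + 1\<close> is the index and \<open>r\<close> has received the partial sum.\<close>
  let ?s = "\<lambda>i. \<sigma>(h := ?A - i, h + 1 := i, r := \<sigma> r + (\<Sum>j<i. ?B j))"
  have z: "\<sigma> h = 0" "\<sigma> (h + 1) = 0" using 0(7) by auto
  have a: "?A \<le> f N" "runs x w n out (comp a \<rho> (h + 2) h) \<sigma> (f N) (\<sigma>(h := ?A))"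
    using comp_withinD[OF assms(1), of "h + 2" n h \<rho> \<sigma> x N w out] 0 \<rho> z by auto
  have s0: "?s 0 = \<sigma>(h := ?A)" using z 0(3) by (auto simp: fun_eq_iff)
  have step: "?B i \<le> g ?M \<and> runs x w n out ?body (?s i) (g ?M + 4) (?s (Suc i))" if i: "i < ?A" for i
  proof -
    let ?\<rho> = "case_nat (h + 1) \<rho>"
    let ?t = "(?s i)(r := \<sigma> r + (\<Sum>j<Suc i. ?B j))"
    have e: "?s i \<circ> ?\<rho> = case_nat i (\<sigma> \<circ> \<rho>)"
      using \<rho>(4,5,7) 0(3) by (auto simp: fun_eq_iff split: nat.splits)
    have \<rho>': "2 \<le> ?\<rho> j \<and> ?\<rho> j < h + 2 \<and> ?\<rho> j \<noteq> r" for j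
      using \<rho>(1,3,7) 0(2,3) by (cases j) auto
    have bd: "?s i (?\<rho> j) \<le> ?M" for j
      using \<rho>(4-7) 0(3) i a(1) by (cases j) (auto intro: trans_le_add1)
    note B = comp_withinD[OF assms(2), of "h + 2" n r ?\<rho> "?s i" x ?M w out]
    have b: "?B i \<le> g ?M" "runs x w n out (comp b ?\<rho> (h + 2) r) (?s i) (g ?M)
        ((?s i)(r := (?s i) r + ?B i))"
      using B 0 \<rho>' bd unfolding e by auto
    have t: "(?s i)(r := (?s i) r + ?B i) = ?t" by (simp add: add.assoc)
    have id: "runs x w n out (Seq (Inc (h + 1)) (Dec h)) ?t 3 (?s (Suc i))"
    proof -
      have "(?t(h + 1 := Suc (?t (h + 1))))(h := (?t(h + 1 := Suc (?t (h + 1)))) h - 1) = ?s (Suc i)"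
        using 0(3) by (auto simp: fun_eq_iff)
      then show ?thesis
        using runs_Seq[OF runs_Inc[of "h + 1" n x w out ?t] runs_Dec[of h n]] 0(1)
        by (simp add: numeral_eq_Suc)
    qed
    have "runs x w n out ?body (?s i) (g ?M + 3 + 1) (?s (Suc i))"
      by (rule runs_Seq[OF b(2)[unfolded t] id])
    then have "runs x w n out ?body (?s i) (g ?M + 4) (?s (Suc i))" by (rule runs_mono) simp
    with b(1) show ?thesis by blast
  qed
  have nz: "nonzero h (map read_tape (reg_tapes x w n out (?s i))) \<longleftrightarrow> i < ?A" for i
    using 0(1,3) by (auto simp: nonzero_reg_tapes)
  have lo: "runs x w n out (Loop (nonzero h) ?body) (?s 0) (?A * ((g ?M + 4) + 1) + 1) (?s ?A)"
  proof (rule runs_Loop[where s = ?s])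
    show "nonzero h (map read_tape (reg_tapes x w n out (?s i)))" if "i < ?A" for i
      unfolding nz using that .
    show "runs x w n out ?body (?s i) (g ?M + 4) (?s (Suc i))" if "i < ?A" for i
      using step[OF that] by (rule conjunct2)
    show "\<not> nonzero h (map read_tape (reg_tapes x w n out (?s ?A)))"
      unfolding nz by simp
  qed
  have cl: "runs x w n out (Clear (h + 1)) (?s ?A) (2 * ?A + 1)
      (\<sigma>(r := \<sigma> r + (\<Sum>j<?A. ?B j)))"
  proof -
    have "(?s ?A)(h + 1 := 0) = \<sigma>(r := \<sigma> r + (\<Sum>j<?A. ?B j))"
      using z 0(3) by (auto simp: fun_eq_iff)
    then show ?thesis using runs_Clear[of "h + 1" n x w out "?s ?A"] 0(1,3) by simp
  qed
  have r: "runs x w n out (comp (Sum a b) \<rho> h r) \<sigma>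
      (f N + ((?A * ((g ?M + 4) + 1) + 1) + (2 * ?A + 1) + 1) + 1) (\<sigma>(r := \<sigma> r + (\<Sum>j<?A. ?B j)))"
    unfolding comp.simps by (rule runs_Seq[OF a(2) runs_Seq[OF lo[unfolded s0] cl]])
  have m: "?A * (g ?M + 5) \<le> f N * (g ?M + 5)" using a(1) by (rule mult_right_mono) simp
  have "(\<Sum>j<?A. ?B j) \<le> (\<Sum>j<?A. g ?M)" using step by (intro sum_mono) auto
  also have "\<dots> \<le> f N * (g ?M + 5)" using m by (simp add: algebra_simps)
  finally show "ev x w (Sum a b) (\<sigma> \<circ> \<rho>) \<le> f N + f N * (g (N + f N) + 5) + 2 * f N + 10 \<and>
      runs x w n out (comp (Sum a b) \<rho> h r) \<sigma> (f N + f N * (g (N + f N) + 5) + 2 * f N + 10)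
      (\<sigma>(r := \<sigma> r + ev x w (Sum a b) (\<sigma> \<circ> \<rho>)))"
    using r m a(1) by (auto elim!: runs_mono simp: algebra_simps)
qed

lemma word_contents_nat: "word_contents v (int i) = (if i < length v then if v ! i then 2 else 1 else 0)"
  by (simp add: word_contents_def)

lemma read_word_reg:
  "word_reg c < n \<Longrightarrow> map read_tape (reg_tapes x w n out \<sigma>) ! word_reg c mod 3 =
    word_contents (if c then w else x) (int (\<sigma> (word_reg c)))"
  by (simp only: read_reg_tapes marked_mod_3) (simp add: word_reg_def input_word_def)

text \<open>The lookup moves the head of the input tape itself: the index is poured into the word
  register, the scanned symbol is tested, and the head returns to 0. Reduction modulo 3 removes the
  mark in cell 0; beyond the word the blank yields 0.\<close>

lemma comp_within_Bit:
  assumes "comp_within a f"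
  shows "comp_within (Bit c a) (\<lambda>N. 10 * f N + 10)"
  unfolding comp_within_def
proof (intro allI impI)
  fix x w out :: "bool list" and n h r N :: nat and \<rho> \<sigma> :: "nat \<Rightarrow> nat"
  assume 0: "h + scratch (Bit c a) \<le> n" "2 \<le> r" "r < h" "\<forall>i. 2 \<le> \<rho> i \<and> \<rho> i < h \<and> \<rho> i \<noteq> r"
    "\<sigma> 0 = 0" "\<sigma> 1 = 0" "\<forall>j\<ge>h. \<sigma> j = 0" "length x \<le> N" "length w \<le> N" "\<forall>i. \<sigma> (\<rho> i) \<le> N"
  have \<rho>: "2 \<le> \<rho> i" "\<rho> i < h + 1" "\<rho> i \<noteq> h" "\<sigma> (\<rho> i) \<le> N" for i
    using 0(4)[rule_format, of i] 0(10) by auto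
  let ?A = "ev x w a (\<sigma> \<circ> \<rho>)" and ?k = "word_reg c" and ?v = "if c then w else x"
  let ?b = "of_bool (?A < length ?v \<and> ?v ! ?A) :: nat"
  let ?s1 = "\<sigma>(h := ?A)"
  let ?s2 = "\<sigma>(?k := ?A)"
  let ?s3 = "?s2(r := \<sigma> r + ?b)"
  have k: "?k < n" "?k < 2" "\<sigma> ?k = 0" "?k \<noteq> r" "?k \<noteq> h" using 0 by (auto simp: word_reg_def)
  have z: "\<sigma> h = 0" using 0(7) by auto
  have a: "?A \<le> f N" "runs x w n out (comp a \<rho> (h + 1) h) \<sigma> (f N) ?s1"
    using comp_withinD[OF assms(1), of "h + 1" n h \<rho> \<sigma> x N w out] 0 \<rho> z by auto
  have m: "runs x w n out (Move h ?k) ?s1 (4 * ?A + 1) ?s2"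
  proof -
    have "?s1(h := 0, ?k := ?s1 ?k + ?s1 h) = ?s2" using z k by (auto simp: fun_eq_iff)
    then show ?thesis using runs_Move[of h n ?k x w out ?s1] 0(1) k by simp
  qed
  have sy: "map read_tape (reg_tapes x w n out ?s2) ! ?k mod 3 = word_contents ?v (int ?A)"
    using read_word_reg[OF k(1), of x w out ?s2] by simp
  have i: "runs x w n out (Ite (\<lambda>ss. ss ! ?k mod 3 = 2) (Inc r) Skip) ?s2 (1 + 1) ?s3"
  proof (rule runs_Ite)
    assume "map read_tape (reg_tapes x w n out ?s2) ! ?k mod 3 = 2"
    then have "?b = 1" unfolding sy word_contents_nat by (auto split: if_splits)
    then show "runs x w n out (Inc r) ?s2 1 ?s3"
      using runs_Inc[of r n x w out ?s2] 0(1,3) k by simp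
  next
    assume "map read_tape (reg_tapes x w n out ?s2) ! ?k mod 3 \<noteq> 2"
    then have "?b = 0" unfolding sy word_contents_nat by (auto split: if_splits)
    then have "?s3 = ?s2" using k by auto
    then show "runs x w n out Skip ?s2 1 ?s3"
      using runs_Skip[of n x w out ?s2] k(1) by simp
  qed
  have cl: "runs x w n out (Clear ?k) ?s3 (2 * ?A + 1) (\<sigma>(r := \<sigma> r + ?b))"
  proof -
    have "?s3(?k := 0) = \<sigma>(r := \<sigma> r + ?b)" using k by (auto simp: fun_eq_iff)
    then show ?thesis using runs_Clear[of ?k n x w out ?s3] k by simp
  qed
  have "runs x w n out (comp (Bit c a) \<rho> h r) \<sigma>
      (f N + ((4 * ?A + 1) + ((1 + 1) + (2 * ?A + 1) + 1) + 1) + 1) (\<sigma>(r := \<sigma> r + ?b))"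
    unfolding comp.simps by (rule runs_Seq[OF a(2) runs_Seq[OF m runs_Seq[OF i cl]]])
  then show "ev x w (Bit c a) (\<sigma> \<circ> \<rho>) \<le> 10 * f N + 10 \<and>
      runs x w n out (comp (Bit c a) \<rho> h r) \<sigma> (10 * f N + 10)
      (\<sigma>(r := \<sigma> r + ev x w (Bit c a) (\<sigma> \<circ> \<rho>)))"
    using a(1) by (auto elim!: runs_mono simp: Let_def)
qed

lemma comp_within_Len: "comp_within (Len c) (\<lambda>N. 6 * N + 3)"
  unfolding comp_within_def
proof (intro allI impI)
  fix x w out :: "bool list" and n h r N :: nat and \<rho> \<sigma> :: "nat \<Rightarrow> nat"
  assume 0: "h + scratch (Len c) \<le> n" "2 \<le> r" "r < h" "\<sigma> 0 = 0" "\<sigma> 1 = 0" "length x \<le> N" "length w \<le> N"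
  let ?k = "word_reg c" and ?v = "if c then w else x"
  let ?L = "length ?v"
  let ?s = "\<lambda>i. \<sigma>(?k := i, r := \<sigma> r + i)"
  have k: "?k < n" "?k < 2" "\<sigma> ?k = 0" "?k \<noteq> r" using 0 by (auto simp: word_reg_def)
  have sy: "map read_tape (reg_tapes x w n out (?s i)) ! ?k mod 3 = word_contents ?v (int i)" for i
    using read_word_reg[OF k(1), of x w out "?s i"] k by simp
  have "runs x w n out (Loop (\<lambda>ss. ss ! ?k mod 3 \<noteq> 0) (Seq (Inc ?k) (Inc r))) (?s 0) (?L * (3 + 1) + 1) (?s ?L)"
  proof (rule runs_Loop[where s = ?s])
    fix i
    have "(?s i)(?k := Suc (?s i ?k), r := Suc (?s i r)) = ?s (Suc i)" using k by (auto simp: fun_eq_iff)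
    then show "runs x w n out (Seq (Inc ?k) (Inc r)) (?s i) 3 (?s (Suc i))"
      using runs_Seq[OF runs_Inc[OF k(1), of x w out "?s i"] runs_Inc[of r n]] 0(1,3) k
      by (simp add: numeral_eq_Suc)
  qed (unfold sy word_contents_nat, auto)
  moreover have "?s 0 = \<sigma>" using k by (auto simp: fun_eq_iff)
  ultimately have l: "runs x w n out (Loop (\<lambda>ss. ss ! ?k mod 3 \<noteq> 0) (Seq (Inc ?k) (Inc r))) \<sigma> (?L * (3 + 1) + 1) (?s ?L)"
    by simp
  have "runs x w n out (Clear ?k) (?s ?L) (2 * ?L + 1) (\<sigma>(r := \<sigma> r + ?L))"
  proof -
    have "(?s ?L)(?k := 0) = \<sigma>(r := \<sigma> r + ?L)" using k by (auto simp: fun_eq_iff)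
    then show ?thesis using runs_Clear[of ?k n x w out "?s ?L"] k by simp
  qed
  from runs_Seq[OF l this] have "runs x w n out (comp (Len c) \<rho> h r) \<sigma> (6 * N + 3) (\<sigma>(r := \<sigma> r + ?L))"
    unfolding comp.simps by (rule runs_mono) (use 0 in auto)
  then show "ev x w (Len c) (\<sigma> \<circ> \<rho>) \<le> 6 * N + 3 \<and>
      runs x w n out (comp (Len c) \<rho> h r) \<sigma> (6 * N + 3) (\<sigma>(r := \<sigma> r + ev x w (Len c) (\<sigma> \<circ> \<rho>)))"
    using 0 by auto
qed

lemma comp_poly: "\<exists>g. poly_bounded g \<and> comp_within a g"
proof (induction a)
  case (Var i)
  then show ?case by (intro exI conjI, rule_tac [2] comp_within_Var) (intro poly_bounded_intros)
next
  case (Num k)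
  then show ?case by (intro exI conjI, rule_tac [2] comp_within_Num) (intro poly_bounded_intros)
next
  case (Add a b)
  then obtain f g where *: "poly_bounded f" "comp_within a f" "poly_bounded g" "comp_within b g" by blast
  show ?case
    by (intro exI conjI, rule_tac [2] comp_within_Add[OF *(2,4)]) (intro poly_bounded_intros *)
next
  case (Sub a b)
  then obtain f g where *: "poly_bounded f" "comp_within a f" "poly_bounded g" "comp_within b g" by blast
  show ?case
    by (intro exI conjI, rule_tac [2] comp_within_Sub[OF *(2,4)]) (intro poly_bounded_intros *)
next
  case (Sum a b)
  then obtain f g where *: "poly_bounded f" "comp_within a f" "poly_bounded g" "comp_within b g" by blast
  then have "mono g" by (simp add: poly_bounded_def)
  show ?case
    by (intro exI conjI, rule_tac [2] comp_within_Sum[OF *(2,4) \<open>mono g\<close>])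
       (intro poly_bounded_intros * poly_bounded_comp[OF *(3)])
next
  case (Bit c a)
  then obtain f where *: "poly_bounded f" "comp_within a f" by blast
  show ?case
    by (intro exI conjI, rule_tac [2] comp_within_Bit[OF *(2)]) (intro poly_bounded_intros *)
next
  case (Len c)
  then show ?case by (intro exI conjI, rule_tac [2] comp_within_Len) (intro poly_bounded_intros)
qed

lemma wf_prog_basic [simp]:
  "wf_prog Skip" "wf_prog (Inc i)" "wf_prog (Dec i)" "wf_prog (Clear i)" "wf_prog (Move i j)"
  "wf_prog (Copy i j k)" "wf_prog (Monus i j)"
  by (simp_all add: Skip_def Inc_def Dec_def Clear_def Move_def Copy_def Monus_def)

lemma wf_prog_Incs [simp]: "wf_prog (Incs r k)"
  by (induction k) auto

lemma wf_prog_comp [simp]: "wf_prog (comp a \<rho> h r)"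
  by (induction a arbitrary: \<rho> h r) auto

section \<open>Machines for expressions\<close>

fun Marks :: "nat \<Rightarrow> prog" where
  "Marks 0 = Skip"
| "Marks (Suc k) = Seq (Act k (\<lambda>s. (s mod 3 + 3, Stay))) (Marks k)"

lemma wf_prog_Marks [simp]: "wf_prog (Marks k)"
  by (induction k) auto

lemma reaches_Marks:
  assumes "k \<le> n" "2 \<le> n"
  shows "reaches (Marks k)
    (map (\<lambda>i. (0, if k \<le> i then marked (input_word x w i) else word_contents (input_word x w i))) [0..<n]
      @ [(0, word_contents [])]) (2 * k + 1) (reg_tapes x w n [] (\<lambda>_. 0))"
  using assms(1)
proof (induction k)
  case 0
  have "reaches Skip (reg_tapes x w n [] (\<lambda>_. 0)) 1 (reg_tapes x w n [] (\<lambda>_. 0))"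
    using runs_Skip[of n x w "[]" "\<lambda>_. 0"] assms by (simp add: runs_def)
  then show ?case by (simp add: reg_tapes_def)
next
  case (Suc k)
  let ?ts = "\<lambda>k. map (\<lambda>i. (0 :: int, if k \<le> i then marked (input_word x w i) else word_contents (input_word x w i))) [0..<n]
      @ [(0, word_contents [])]"
  let ?f = "\<lambda>s. (s mod 3 + 3, Stay)"
  have k: "?ts (Suc k) ! k = (0, word_contents (input_word x w k))"
    using Suc.prems by (simp add: nth_append)
  have "(word_contents v)(0 := word_contents v 0 mod 3 + 3) = marked v" for v
    using word_contents_le[of v 0] by (auto simp: marked_def fun_eq_iff)
  then have a: "act_tape (?f (read_tape (?ts (Suc k) ! k))) (?ts (Suc k) ! k) = (0, marked (input_word x w k))"
    unfolding k by simp
  have "(?ts (Suc k))[k := (0, marked (input_word x w k))] = ?ts k"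
    using Suc.prems by (intro nth_equalityI) (auto simp: nth_append nth_list_update)
  then have "reaches (Act k ?f) (?ts (Suc k)) 1 (?ts k)"
    using reaches_Act[of k ?f "?ts (Suc k)"] unfolding a by simp
  from reaches_Seq[OF this Suc.IH] Suc.prems show ?case by simp
qed

text \<open>A machine started on one word sees a blank second tape, which is the same as an empty
  second word; deciders and transducers thus share the initial marking.\<close>

lemma init_reaches:
  assumes "2 \<le> n" "ws = [x, w] \<or> ws = [x] \<and> w = []"
  shows "reaches (Marks n) (snd (init_config (prog_tm (Suc n) p acc) ws)) (2 * n + 1) (reg_tapes x w n [] (\<lambda>_. 0))"
proof -
  have "snd (init_config (prog_tm (Suc n) p acc) ws) =
    map (\<lambda>i. (0, if n \<le> i then marked (input_word x w i) else word_contents (input_word x w i))) [0..<n]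
      @ [(0, word_contents [])]"
    using assms
    by (intro nth_equalityI)
       (auto simp: init_config_def prog_tm_def Let_def nth_append input_word_def less_Suc_eq nth_Cons split: nat.splits)
  then show ?thesis using reaches_Marks[of n n x w] assms by simp
qed

lemma run_tm_stable:
  assumes "halting M (fst (run_tm M ws t))" "t \<le> t'"
  shows "run_tm M ws t' = run_tm M ws t"
proof -
  obtain d where "t' = d + t" using assms(2) by (metis le_add_diff_inverse2)
  then show ?thesis
    using halting_stable[of M "fst (run_tm M ws t)" d "snd (run_tm M ws t)"] assms(1)
    by (simp add: run_tm_def funpow_add)
qed

theorem NP_expr: "{x. \<exists>w. length w \<le> poly p (length x) \<and> ev x w a (\<lambda>_. 0) \<noteq> 0} \<in> NP"
proof -
  obtain g where g: "poly_bounded g" "comp_within a g" using comp_poly by blast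
  define n where "n = 4 + scratch a"
  \<comment> \<open>The result goes to register 2, all free variables share register 3, which stays
    0, and scratch space begins at 4; registers 0 and 1 belong to the input words.\<close>
  define P where "P = Seq (Marks n) (comp a (\<lambda>_. 3) 4 2)"
  define M where "M = prog_tm (Suc n) P (nonzero 2)"
  define h where "h = (\<lambda>N. 2 * n + 1 + g (N + poly p N) + 2)"
  have "poly_bounded h"
    unfolding h_def by (intro poly_bounded_intros poly_bounded_comp[OF g(1)] poly_bounded_poly)
  then obtain q :: "nat poly" where q: "h m \<le> poly q m" for m
    unfolding poly_bounded_def by blast
  have wf: "wf_tm M" unfolding M_def P_def by (rule wf_prog_tm) auto
  have key: "run_tm M [x, w] (poly q (length x)) =
      (if ev x w a (\<lambda>_. 0) \<noteq> 0 then accept_state M else reject_state M,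
       snd (run_tm M [x, w] (poly q (length x))))"
    if w: "length w \<le> poly p (length x)" for x w
  proof -
    let ?N = "length x + poly p (length x)"
    let ?\<sigma> = "(\<lambda>_ :: nat. 0 :: nat)(2 := 0 + ev x w a ((\<lambda>_ :: nat. 0) \<circ> (\<lambda>_. 3)))"
    have "runs x w n [] (comp a (\<lambda>_. 3) 4 2) (\<lambda>_. 0) (g ?N) ?\<sigma>"
      using comp_withinD[OF g(2), of 4 n 2 "\<lambda>_. 3" "\<lambda>_. 0" x ?N w "[]"] w n_def by auto
    moreover have "reaches (Marks n) (snd (init_config M [x, w])) (2 * n + 1) (reg_tapes x w n [] (\<lambda>_. 0))"
      unfolding M_def by (rule init_reaches) (auto simp: n_def)
    ultimately have "reaches P (snd (init_config M [x, w])) (2 * n + 1 + g ?N + 1) (reg_tapes x w n [] ?\<sigma>)"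
      unfolding P_def runs_def by (rule reaches_Seq[rotated])
    then obtain t where t: "t \<le> 2 * n + 1 + g ?N + 1" "exec P (snd (init_config M [x, w])) t (reg_tapes x w n [] ?\<sigma>)"
      unfolding reaches_def by blast
    have "t < h (length x)" using t(1) unfolding h_def by simp
    then have "t < poly q (length x)" using q[of "length x"] by simp
    from prog_tm_run[OF t(2)[unfolded M_def] this]
    show ?thesis
      unfolding M_def using nonzero_reg_tapes[of 2 n x w "[]" ?\<sigma>] n_def
      by (auto simp: prog_tm_def Let_def comp_def)
  qed
  have ne: "accept_state M \<noteq> reject_state M" by (simp add: M_def prog_tm_def Let_def)
  have halts: "halts_within M [x, w] (poly q (length x))" if "length w \<le> poly p (length x)" for x w
    unfolding halts_within_def by (subst key[OF that]) (simp add: halting_def)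
  \<comment> \<open>Acceptance at some time is the same as acceptance at the polynomial bound,
    because a halted configuration is final: both are compared at the maximum of the two
    times.\<close>
  have acc: "accepts M [x, w] \<longleftrightarrow> ev x w a (\<lambda>_. 0) \<noteq> 0" if w: "length w \<le> poly p (length x)" for x w
  proof
    assume "accepts M [x, w]"
    then obtain t where t: "fst (run_tm M [x, w] t) = accept_state M" unfolding accepts_def by blast
    let ?b = "poly q (length x)"
    have "run_tm M [x, w] (max t ?b) = run_tm M [x, w] t"
      by (rule run_tm_stable) (auto simp: t halting_def)
    moreover have "run_tm M [x, w] (max t ?b) = run_tm M [x, w] ?b"
      by (rule run_tm_stable) (use halts[OF w] in \<open>auto simp: halts_within_def\<close>)
    ultimately have "fst (run_tm M [x, w] ?b) = accept_state M" using t by simp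
    then show "ev x w a (\<lambda>_. 0) \<noteq> 0" using ne by (subst (asm) key[OF w]) (auto split: if_splits)
  next
    assume "ev x w a (\<lambda>_. 0) \<noteq> 0"
    then have "fst (run_tm M [x, w] (poly q (length x))) = accept_state M"
      by (subst key[OF w]) simp
    then show "accepts M [x, w]" unfolding accepts_def by blast
  qed
  have "2 \<le> num_tapes M" by (simp add: M_def prog_tm_def Let_def n_def)
  then show ?thesis
    unfolding NP_def mem_Collect_eq using wf halts acc
    by (metis (no_types, lifting))
qed

section \<open>Machines with output\<close>

definition Out :: "nat \<Rightarrow> bool \<Rightarrow> prog" where
  "Out n b = Act n (\<lambda>s. (if b then 2 else 1, Right))"

lemma word_contents_snoc:
  "(word_contents out)(int (length out) := (if b then 2 else 1)) = word_contents (out @ [b])"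
  by (auto simp: word_contents_def fun_eq_iff nth_append nat_less_iff)

lemma reaches_Out: "reaches (Out n b) (reg_tapes x w n out \<sigma>) 1 (reg_tapes x w n (out @ [b]) \<sigma>)"
proof -
  have "reg_tapes x w n out \<sigma> ! n = (int (length out), word_contents out)"
    by (simp add: reg_tapes_def nth_append)
  moreover have "(reg_tapes x w n out \<sigma>)[n := (int (length (out @ [b])), word_contents (out @ [b]))] =
      reg_tapes x w n (out @ [b]) \<sigma>"
    by (simp add: reg_tapes_def list_update_append)
  ultimately show ?thesis
    using reaches_Act[of n "\<lambda>s. (if b then 2 else 1, Right)" "reg_tapes x w n out \<sigma>"]
    by (simp add: Out_def word_contents_snoc add.commute)
qed

text \<open>The output is moved to tape 0; the marked cell 0 is overwritten on the way.\<close>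

definition Deliver :: "nat \<Rightarrow> prog" where
  "Deliver n = Seq (Act n (\<lambda>s. (s, Left))) (Seq (Loop (\<lambda>ss. ss ! n \<noteq> 0) (Act n (\<lambda>s. (s, Left))))
     (Seq (Act n (\<lambda>s. (s, Right)))
       (Loop (\<lambda>ss. ss ! 0 \<noteq> 0 \<or> ss ! n \<noteq> 0)
         (Seq (Ite (\<lambda>ss. ss ! n = 1) (Act 0 (\<lambda>s. (1, Right)))
               (Ite (\<lambda>ss. ss ! n = 2) (Act 0 (\<lambda>s. (2, Right))) (Act 0 (\<lambda>s. (0, Right)))))
              (Act n (\<lambda>s. (s, Right)))))))"

lemma reaches_Deliver:
  assumes n: "2 \<le> n" and \<sigma>: "\<sigma> 0 = 0"
  shows "\<exists>ts. reaches (Deliver n) (reg_tapes x w n out \<sigma>) (2 * length out + 8 * (length x + length out + 1) + 10) ts \<and>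
     snd (hd ts) = word_contents out"
proof -
  define T where "T = (\<lambda>(tp :: tape) h. (reg_tapes x w n out \<sigma>)[0 := tp, n := (h, word_contents out)])"
  have len: "length (reg_tapes x w n out \<sigma>) = Suc n" by simp
  have T0: "T tp h ! 0 = tp" and Tn: "T tp h ! n = (h, word_contents out)" and lT: "length (T tp h) = Suc n" for tp h
    using n by (auto simp: T_def)
  have upn: "(T tp h)[n := (h', word_contents out)] = T tp h'" for tp h h'
    by (simp add: T_def)
  have up0: "(T tp h)[0 := tp'] = T tp' h" for tp tp' h
    using n by (simp add: T_def list_update_swap[of 0 n])
  let ?L = "length out" and ?tp = "(0 :: int, marked x)"
  have start: "reg_tapes x w n out \<sigma> = T ?tp (int ?L)"
  proof -
    have "reg_tapes x w n out \<sigma> ! 0 = ?tp" using n \<sigma> by (simp add: nth_reg_tapes input_word_def)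
    moreover have "reg_tapes x w n out \<sigma> ! n = (int ?L, word_contents out)"
      by (simp add: reg_tapes_def nth_append)
    ultimately show ?thesis unfolding T_def by (metis list_update_id)
  qed
  have mv: "reaches (Act n (\<lambda>s. (s, m))) (T tp h) 1 (T tp (h + offset m))" for tp h m
    using reaches_Act[of n "\<lambda>s. (s, m)" "T tp h"] by (simp add: Tn upn)
  have rn: "map read_tape (T tp h) ! n = word_contents out h" for tp h
    using lT[of tp h] by (simp add: Tn)
  have r0: "map read_tape (T tp h) ! 0 = read_tape tp" for tp h
    using lT[of tp h] by (simp add: T0)
  have 1: "reaches (Act n (\<lambda>s. (s, Left))) (T ?tp (int ?L)) 1 (T ?tp (int ?L - 1))"
    using mv[of Left ?tp "int ?L"] by simp
  \<comment> \<open>Going left from the end of the output, the first blank is cell -1, since the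
    output tape is unmarked.\<close>
  let ?s = "\<lambda>j. T ?tp (int ?L - 1 - int j)"
  have 2: "reaches (Loop (\<lambda>ss. ss ! n \<noteq> 0) (Act n (\<lambda>s. (s, Left)))) (?s 0) (?L * (1 + 1) + 1) (?s ?L)"
  proof (rule reaches_Loop[where s = ?s])
    fix j
    show "reaches (Act n (\<lambda>s. (s, Left))) (?s j) 1 (?s (Suc j))"
      using mv[of Left ?tp "int ?L - 1 - int j"] by (simp add: algebra_simps)
  qed (auto simp: rn word_contents_def)
  have 3: "reaches (Act n (\<lambda>s. (s, Right))) (?s ?L) 1 (T ?tp 0)"
    using mv[of Right ?tp "-1"] by simp
  \<comment> \<open>Copying runs until both tapes are blank, so that a longer input is erased. It
    lasts at least one round: even for an empty input, cell 0 carries a mark that has to be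
    overwritten.\<close>
  let ?m = "max 1 (max (length x) ?L)"
  define u where "u = (\<lambda>j z. if 0 \<le> z \<and> z < int j then word_contents out z else marked x z)"
  define v where "v = (\<lambda>j. T (int j, u j) (int j))"
  have "u 0 = marked x" by (auto simp: u_def)
  then have v0: "v 0 = T ?tp 0" by (simp add: v_def)
  have u_step: "(u j)(int j := word_contents out (int j)) = u (Suc j)" for j
    by (auto simp: u_def fun_eq_iff)
  have wr: "reaches (Act 0 (\<lambda>s. (word_contents out (int j), Right))) (v j) 1 (T (int (Suc j), u (Suc j)) (int j))" for j
    using reaches_Act[of 0 "\<lambda>s. (word_contents out (int j), Right)" "v j"]
    by (simp add: v_def T0 up0 u_step add.commute)
  let ?body = "Seq (Ite (\<lambda>ss. ss ! n = 1) (Act 0 (\<lambda>s. (1, Right)))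
               (Ite (\<lambda>ss. ss ! n = 2) (Act 0 (\<lambda>s. (2, Right))) (Act 0 (\<lambda>s. (0, Right)))))
              (Act n (\<lambda>s. (s, Right)))"
  have ite: "reaches (Ite (\<lambda>ss. ss ! n = 1) (Act 0 (\<lambda>s. (1, Right)))
               (Ite (\<lambda>ss. ss ! n = 2) (Act 0 (\<lambda>s. (2, Right))) (Act 0 (\<lambda>s. (0, Right)))))
      (v j) (1 + 1 + 1) (T (int (Suc j), u (Suc j)) (int j))" for j
  proof (rule reaches_Ite)
    assume "map read_tape (v j) ! n = 1"
    then show "reaches (Act 0 (\<lambda>s. (1, Right))) (v j) (1 + 1) (T (int (Suc j), u (Suc j)) (int j))"
      using wr[of j] by (auto simp: v_def rn elim!: reaches_mono)
  next
    assume a: "map read_tape (v j) ! n \<noteq> 1"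
    show "reaches (Ite (\<lambda>ss. ss ! n = 2) (Act 0 (\<lambda>s. (2, Right))) (Act 0 (\<lambda>s. (0, Right)))) (v j) (1 + 1)
        (T (int (Suc j), u (Suc j)) (int j))"
    proof (rule reaches_Ite)
      assume "map read_tape (v j) ! n = 2"
      then show "reaches (Act 0 (\<lambda>s. (2, Right))) (v j) 1 (T (int (Suc j), u (Suc j)) (int j))"
        using wr[of j] by (auto simp: v_def rn)
    next
      assume b: "map read_tape (v j) ! n \<noteq> 2"
      have "word_contents out (int j) = 0"
        using a b word_contents_le[of out "int j"] unfolding v_def rn by linarith
      then show "reaches (Act 0 (\<lambda>s. (0, Right))) (v j) 1 (T (int (Suc j), u (Suc j)) (int j))"
        using wr[of j] by simp
    qed
  qed
  have body: "reaches ?body (v j) 5 (v (Suc j))" for j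
    using reaches_Seq[OF ite[of j] mv[of Right "(int (Suc j), u (Suc j))" "int j"]]
    by (simp add: v_def add.commute numeral_eq_Suc)
  have rd: "map read_tape (v j) ! 0 = marked x (int j)" "map read_tape (v j) ! n = word_contents out (int j)" for j
    by (auto simp only: v_def r0 rn) (simp add: u_def)
  have 4: "reaches (Loop (\<lambda>ss. ss ! 0 \<noteq> 0 \<or> ss ! n \<noteq> 0) ?body) (v 0) (?m * (5 + 1) + 1) (v ?m)"
  proof (rule reaches_Loop[where s = v])
    fix j assume "j < ?m"
    then show "map read_tape (v j) ! 0 \<noteq> 0 \<or> map read_tape (v j) ! n \<noteq> 0"
      unfolding rd marked_def word_contents_nat by auto
  next
    show "\<not> (map read_tape (v ?m) ! 0 \<noteq> 0 \<or> map read_tape (v ?m) ! n \<noteq> 0)"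
      unfolding rd marked_def word_contents_nat by auto
  qed (rule body)
  have s0: "?s 0 = T ?tp (int ?L - 1)" by simp
  have "reaches (Deliver n) (T ?tp (int ?L)) (1 + ((?L * (1 + 1) + 1) + (1 + (?m * (5 + 1) + 1) + 1) + 1) + 1) (v ?m)"
    unfolding Deliver_def
    by (rule reaches_Seq[OF 1 reaches_Seq[OF 2[unfolded s0] reaches_Seq[OF 3 4[unfolded v0]]]])
  then have "reaches (Deliver n) (reg_tapes x w n out \<sigma>) (2 * length out + 8 * (length x + length out + 1) + 10) (v ?m)"
    unfolding start by (rule reaches_mono) auto
  moreover have "snd (hd (v ?m)) = word_contents out"
  proof -
    have "v ?m \<noteq> []" using lT[of "(int ?m, u ?m)" "int ?m"] unfolding v_def by auto
    then have "hd (v ?m) = (int ?m, u ?m)" unfolding v_def by (simp add: hd_conv_nth T0)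
    moreover have "u ?m z = word_contents out z" for z
      unfolding u_def by (auto simp: marked_def word_contents_def)
    ultimately show ?thesis by (simp add: fun_eq_iff)
  qed
  ultimately show ?thesis by blast
qed

theorem poly_time_expr:
  "poly_time_computable (\<lambda>x. map (\<lambda>i. ev x [] b (case_nat i (\<lambda>_. 0)) \<noteq> 0) [0..<ev x [] l (\<lambda>_. 0)])"
proof -
  obtain f where f: "poly_bounded f" "comp_within l f" using comp_poly by blast
  obtain g where g: "poly_bounded g" "comp_within b g" using comp_poly by blast
  define n where "n = 6 + scratch l + scratch b"
  \<comment> \<open>Register 2 holds the number of bits still to be written, 3 the position of the
    next bit (variable 0 of \<open>b\<close>) and 4 its value; every other variable is mapped to 5,
    which stays 0.\<close>
  define \<rho> where "\<rho> = case_nat 3 (\<lambda>_. 5 :: nat)"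
  define body where "body = Seq (comp b \<rho> 6 4) (Seq (Ite (nonzero 4) (Out n True) (Out n False))
    (Seq (Clear 4) (Seq (Inc 3) (Dec 2))))"
  define P where "P = Seq (Marks n) (Seq (comp l (\<lambda>_. 5) 6 2) (Seq (Loop (nonzero 2) body) (Deliver n)))"
  define M where "M = prog_tm (Suc n) P (\<lambda>_. True)"
  define G where "G = (\<lambda>N. g (N + f N))"
  define h where "h = (\<lambda>N. 2 * n + f N + f N * (3 * G N + 20) + 2 * f N + 8 * (N + f N + 1) + 20)"
  have "poly_bounded h"
    unfolding h_def G_def by (intro poly_bounded_intros poly_bounded_comp[OF g(1)] f)
  then obtain q :: "nat poly" where q: "h m \<le> poly q m" for m
    unfolding poly_bounded_def by blast
  have wf: "wf_tm M"
    unfolding M_def P_def body_def Deliver_def Out_def by (rule wf_prog_tm) auto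
  have "halts_within M [x] (poly q (length x)) \<and>
      snd (hd (snd (run_tm M [x] (poly q (length x))))) =
        word_contents (map (\<lambda>i. ev x [] b (case_nat i (\<lambda>_. 0)) \<noteq> 0) [0..<ev x [] l (\<lambda>_. 0)])" for x
  proof -
    let ?N = "length x"
    define L where "L = ev x [] l (\<lambda>_. 0)"
    define B where "B = (\<lambda>i. ev x [] b (case_nat i (\<lambda>_. 0)))"
    define s where "s = (\<lambda>i :: nat. (\<lambda>_ :: nat. 0 :: nat)(2 := L - i, 3 := i))"
    define out where "out = (\<lambda>i. map (\<lambda>i. B i \<noteq> 0) [0..<i])"
    have n6: "6 \<le> n" by (simp add: n_def)
    have l: "L \<le> f ?N" "runs x [] n [] (comp l (\<lambda>_. 5) 6 2) (\<lambda>_. 0) (f ?N) (s 0)"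
    proof -
      have "s 0 = (\<lambda>_. 0)(2 := 0 + ev x [] l ((\<lambda>_ :: nat. 0) \<circ> (\<lambda>_. 5)))"
        by (auto simp: s_def L_def comp_def fun_eq_iff)
      then show "L \<le> f ?N" "runs x [] n [] (comp l (\<lambda>_. 5) 6 2) (\<lambda>_. 0) (f ?N) (s 0)"
        using comp_withinD[OF f(2), of 6 n 2 "\<lambda>_. 5" "\<lambda>_. 0" x ?N "[]" "[]"] n_def
        by (auto simp: L_def comp_def)
    qed
    have bd: "reaches body (reg_tapes x [] n (out i) (s i)) (3 * G ?N + 19) (reg_tapes x [] n (out (Suc i)) (s (Suc i)))"
      if i: "i < L" for i
    proof -
      let ?t = "(s i)(4 := B i)"
      have e: "s i \<circ> \<rho> = case_nat i (\<lambda>_. 0)"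
        by (auto simp: s_def \<rho>_def fun_eq_iff split: nat.splits)
      have s4: "s i 4 = 0" by (simp add: s_def)
      have "B i \<le> G ?N \<and> runs x [] n (out i) (comp b \<rho> 6 4) (s i) (G ?N) ((s i)(4 := s i 4 + ev x [] b (s i \<circ> \<rho>)))"
        unfolding G_def B_def e[symmetric]
      proof (rule comp_withinD[OF g(2)])
        fix j
        show "2 \<le> \<rho> j \<and> \<rho> j < 6 \<and> \<rho> j \<noteq> 4" by (cases j) (auto simp: \<rho>_def)
        show "s i (\<rho> j) \<le> length x + f (length x)"
          using l(1) i by (cases j) (auto simp: \<rho>_def s_def)
      qed (auto simp: s_def n_def)
      then have 1: "B i \<le> G ?N" "runs x [] n (out i) (comp b \<rho> 6 4) (s i) (G ?N) ?t"
        unfolding e s4 add_0 B_def by simp_all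
      have out: "out (Suc i) = out i @ [B i \<noteq> 0]" by (simp add: out_def)
      have nz: "nonzero 4 (map read_tape (reg_tapes x [] n (out i) ?t)) \<longleftrightarrow> B i \<noteq> 0"
        using nonzero_reg_tapes[of 4 n x "[]" "out i" ?t] n6 by simp
      have 2: "reaches (Ite (nonzero 4) (Out n True) (Out n False)) (reg_tapes x [] n (out i) ?t) (1 + 1)
          (reg_tapes x [] n (out (Suc i)) ?t)"
        unfolding out by (rule reaches_Ite) (use nz reaches_Out[of n _ x "[]" "out i" ?t] in auto)
      have 3: "runs x [] n (out (Suc i)) (Clear 4) ?t (2 * B i + 1) (s i)"
      proof -
        have "?t(4 := 0) = s i" by (auto simp: s_def fun_eq_iff)
        then show ?thesis using runs_Clear[of 4 n x "[]" "out (Suc i)" ?t] n6 by simp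
      qed
      have 4: "runs x [] n (out (Suc i)) (Seq (Inc 3) (Dec 2)) (s i) (1 + 1 + 1) (s (Suc i))"
      proof -
        let ?u = "(s i)(3 := Suc (s i 3))"
        have "?u(2 := ?u 2 - 1) = s (Suc i)" by (auto simp: s_def fun_eq_iff)
        then show ?thesis
          using runs_Seq[OF runs_Inc[of 3 n x "[]" "out (Suc i)" "s i"] runs_Dec[of 2 n x "[]" "out (Suc i)" ?u]] n6
          by simp
      qed
      have "reaches body (reg_tapes x [] n (out i) (s i)) (G ?N + ((1 + 1) + ((2 * B i + 1) + (1 + 1 + 1) + 1) + 1) + 1)
          (reg_tapes x [] n (out (Suc i)) (s (Suc i)))"
        unfolding body_def
        by (rule reaches_Seq[OF 1(2)[unfolded runs_def] reaches_Seq[OF 2 reaches_Seq[OF 3[unfolded runs_def] 4[unfolded runs_def]]]])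
      then show ?thesis by (rule reaches_mono) (use 1(1) in auto)
    qed
    have "reaches (Loop (nonzero 2) body) (reg_tapes x [] n (out 0) (s 0)) (L * (3 * G ?N + 19 + 1) + 1)
        (reg_tapes x [] n (out L) (s L))"
      by (rule reaches_Loop[where s = "\<lambda>i. reg_tapes x [] n (out i) (s i)"])
         (use bd n6 in \<open>auto simp: nonzero_reg_tapes s_def\<close>)
    then have lo: "reaches (Loop (nonzero 2) body) (reg_tapes x [] n [] (s 0)) (L * (3 * G ?N + 19 + 1) + 1)
        (reg_tapes x [] n (out L) (s L))" by (simp add: out_def)
    have "length (out L) = L" by (simp add: out_def)
    then obtain ts where ts: "reaches (Deliver n) (reg_tapes x [] n (out L) (s L)) (2 * L + 8 * (length x + L + 1) + 10) ts"
      "snd (hd ts) = word_contents (out L)"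
      using reaches_Deliver[of n "s L" x "[]" "out L"] n6 by (auto simp: s_def)
    have init: "reaches (Marks n) (snd (init_config M [x])) (2 * n + 1) (reg_tapes x [] n [] (\<lambda>_. 0))"
      unfolding M_def by (rule init_reaches) (use n6 in auto)
    have "reaches P (snd (init_config M [x]))
        ((2 * n + 1) + (f ?N + ((L * (3 * G ?N + 19 + 1) + 1) + (2 * L + 8 * (length x + L + 1) + 10) + 1) + 1) + 1) ts"
      unfolding P_def by (rule reaches_Seq[OF init reaches_Seq[OF l(2)[unfolded runs_def] reaches_Seq[OF lo ts(1)]]])
    then obtain t where t: "t \<le> (2 * n + 1) + (f ?N + ((L * (3 * G ?N + 19 + 1) + 1) + (2 * L + 8 * (length x + L + 1) + 10) + 1) + 1) + 1"
      "exec P (snd (init_config M [x])) t ts"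
      unfolding reaches_def by blast
    have "L * (3 * G ?N + 20) \<le> f ?N * (3 * G ?N + 20)" using l(1) by (rule mult_right_mono) simp
    then have "t < h ?N" using t(1) l(1) unfolding h_def by (simp add: algebra_simps)
    then have "t < poly q ?N" using q[of ?N] by simp
    from prog_tm_run[OF t(2)[unfolded M_def] this] ts(2) show ?thesis
      unfolding M_def halts_within_def
      by (simp add: prog_tm_def Let_def halting_def out_def B_def L_def)
  qed
  with wf show ?thesis unfolding poly_time_computable_def by blast
qed

section \<open>Definable functions\<close>

text \<open>Expressibility is stated for HOL functions instead of expressions, so that a formula can
  be written as usual and shown expressible by introduction rules that follow its structure.\<close>

definition definable :: "(bool list \<Rightarrow> bool list \<Rightarrow> (nat \<Rightarrow> nat) \<Rightarrow> nat) \<Rightarrow> bool" where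
  "definable F \<longleftrightarrow> (\<exists>a. \<forall>x w e. ev x w a e = F x w e)"

definition definable_pred :: "(bool list \<Rightarrow> bool list \<Rightarrow> (nat \<Rightarrow> nat) \<Rightarrow> bool) \<Rightarrow> bool" where
  "definable_pred P \<longleftrightarrow> definable (\<lambda>x w e. of_bool (P x w e))"

primrec rename :: "expr \<Rightarrow> (nat \<Rightarrow> nat) \<Rightarrow> expr" where
  "rename (Var i) = (\<lambda>\<rho>. Var (\<rho> i))"
| "rename (Num k) = (\<lambda>\<rho>. Num k)"
| "rename (Add a b) = (\<lambda>\<rho>. Add (rename a \<rho>) (rename b \<rho>))"
| "rename (Sub a b) = (\<lambda>\<rho>. Sub (rename a \<rho>) (rename b \<rho>))"
| "rename (Sum a b) = (\<lambda>\<rho>. Sum (rename a \<rho>) (rename b (case_nat 0 (Suc \<circ> \<rho>))))"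
| "rename (Bit c a) = (\<lambda>\<rho>. Bit c (rename a \<rho>))"
| "rename (Len c) = (\<lambda>\<rho>. Len c)"

lemma ev_rename: "ev x w (rename a \<rho>) e = ev x w a (\<lambda>i. e (\<rho> i))"
proof (induction a arbitrary: \<rho> e)
  case (Sum a b)
  have "(\<lambda>i. case_nat k e (case_nat 0 (Suc \<circ> \<rho>) i)) = case_nat k (\<lambda>i. e (\<rho> i))" for k
    by (auto simp: fun_eq_iff split: nat.splits)
  then show ?case using Sum by simp
qed simp_all

text \<open>Weakening: the term is to be used below one more binder, where its variables have moved
  up by one.\<close>

lemma definable_shift: "definable F \<Longrightarrow> definable (\<lambda>x w e. F x w (\<lambda>n. e (Suc n)))"
  unfolding definable_def by (metis ev_rename)

lemma definable_var: "definable (\<lambda>x w e. e i)"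
  unfolding definable_def by (intro exI[of _ "Var i"]) simp

lemma definable_const: "definable (\<lambda>x w e. k)"
  unfolding definable_def by (intro exI[of _ "Num k"]) simp

lemma definable_add: "definable F \<Longrightarrow> definable G \<Longrightarrow> definable (\<lambda>x w e. F x w e + G x w e)"
  unfolding definable_def by (metis ev.simps(3))

lemma definable_diff: "definable F \<Longrightarrow> definable G \<Longrightarrow> definable (\<lambda>x w e. F x w e - G x w e)"
  unfolding definable_def by (metis ev.simps(4))

lemma definable_Suc: "definable F \<Longrightarrow> definable (\<lambda>x w e. Suc (F x w e))"
  using definable_add[OF _ definable_const[of 1]] by simp

lemma definable_length_input: "definable (\<lambda>x w e. length x)"
  unfolding definable_def by (intro exI[of _ "Len False"]) simp

text \<open>The summation index becomes variable 0 of the body and the outer variables move up by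
  one; the second premise is the body read in this extended environment.\<close>

lemma definable_sum:
  assumes "definable F" "definable (\<lambda>x w e. G x w (e 0) (\<lambda>n. e (Suc n)))"
  shows "definable (\<lambda>x w e. \<Sum>i<F x w e. G x w i e)"
proof -
  obtain a where a: "\<And>x w e. ev x w a e = F x w e" using assms(1) unfolding definable_def by blast
  obtain b where b: "\<And>x w e. ev x w b e = G x w (e 0) (\<lambda>n. e (Suc n))"
    using assms(2) unfolding definable_def by blast
  have "ev x w (Sum a b) e = (\<Sum>i<F x w e. G x w i e)" for x w e
    by (simp add: a b)
  then show ?thesis unfolding definable_def by blast
qed

lemma definable_mult:
  assumes "definable F" "definable G"
  shows "definable (\<lambda>x w e. F x w e * G x w e)"
  using definable_sum[OF assms(1), of "\<lambda>x w i. G x w"] definable_shift[OF assms(2)] by simp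

lemma definable_power: "definable F \<Longrightarrow> definable (\<lambda>x w e. F x w e ^ k)"
  by (induction k) (simp_all add: definable_const definable_mult)

lemma definable_poly: "definable F \<Longrightarrow> definable (\<lambda>x w e. poly p (F x w e))"
  by (induction p) (simp_all add: definable_const definable_add definable_mult)

lemma definable_of_bool: "definable_pred P \<Longrightarrow> definable (\<lambda>x w e. of_bool (P x w e))"
  by (simp add: definable_pred_def)

lemma definable_pred_const: "definable_pred (\<lambda>x w e. c)"
  unfolding definable_pred_def by (rule definable_const)

lemma definable_pred_not:
  assumes "definable_pred P"
  shows "definable_pred (\<lambda>x w e. \<not> P x w e)"
proof -
  have "definable (\<lambda>x w e. 1 - of_bool (P x w e))"
    using assms by (intro definable_diff definable_const definable_of_bool)
  moreover have "1 - of_bool b = (of_bool (\<not> b) :: nat)" for b by simp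
  ultimately show ?thesis unfolding definable_pred_def by simp
qed

lemma definable_pred_conj:
  "definable_pred P \<Longrightarrow> definable_pred Q \<Longrightarrow> definable_pred (\<lambda>x w e. P x w e \<and> Q x w e)"
  unfolding definable_pred_def of_bool_conj by (rule definable_mult)

lemma definable_pred_disj:
  assumes "definable_pred P" "definable_pred Q"
  shows "definable_pred (\<lambda>x w e. P x w e \<or> Q x w e)"
  using definable_pred_not[OF definable_pred_conj[OF definable_pred_not[OF assms(1)] definable_pred_not[OF assms(2)]]]
  by simp

lemma definable_pred_imp:
  assumes "definable_pred P" "definable_pred Q"
  shows "definable_pred (\<lambda>x w e. P x w e \<longrightarrow> Q x w e)"
  using definable_pred_disj[OF definable_pred_not[OF assms(1)] assms(2)] by simp

lemma definable_pred_le: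
  assumes "definable F" "definable G"
  shows "definable_pred (\<lambda>x w e. F x w e \<le> G x w e)"
proof -
  have "definable (\<lambda>x w e. 1 - (F x w e - G x w e))"
    using assms by (intro definable_diff definable_const)
  moreover have "1 - (a - b) = (of_bool (a \<le> b) :: nat)" for a b :: nat by auto
  ultimately show ?thesis unfolding definable_pred_def by simp
qed

lemma definable_pred_less:
  assumes "definable F" "definable G"
  shows "definable_pred (\<lambda>x w e. F x w e < G x w e)"
  using definable_pred_le[OF definable_Suc[OF assms(1)] assms(2)] by (simp add: Suc_le_eq)

lemma definable_pred_eq:
  assumes "definable F" "definable G"
  shows "definable_pred (\<lambda>x w e. F x w e = G x w e)"
  using definable_pred_conj[OF definable_pred_le[OF assms] definable_pred_le[OF assms(2,1)]]
  by (simp add: eq_iff)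

lemma definable_pred_ex:
  assumes "definable F" "definable_pred (\<lambda>x w e. P x w (e 0) (\<lambda>n. e (Suc n)))"
  shows "definable_pred (\<lambda>x w e. \<exists>i<F x w e. P x w i e)"
proof -
  have "definable (\<lambda>x w e. \<Sum>i<F x w e. of_bool (P x w i e))"
    using assms by (intro definable_sum) (auto simp: definable_pred_def)
  from definable_pred_less[OF definable_const[of 0] this] show ?thesis
    by (simp only: neq0_conv[symmetric]) (auto elim!: back_subst[of definable_pred] simp: fun_eq_iff)
qed

lemma definable_pred_all:
  assumes "definable F" "definable_pred (\<lambda>x w e. P x w (e 0) (\<lambda>n. e (Suc n)))"
  shows "definable_pred (\<lambda>x w e. \<forall>i<F x w e. P x w i e)"
  using definable_pred_not[OF definable_pred_ex[OF assms(1) definable_pred_not[OF assms(2)]]]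
  by simp

lemma definable_if:
  assumes "definable_pred P" "definable F" "definable G"
  shows "definable (\<lambda>x w e. if P x w e then F x w e else G x w e)"
proof -
  have "definable (\<lambda>x w e. of_bool (P x w e) * F x w e + of_bool (\<not> P x w e) * G x w e)"
    using assms by (intro definable_add definable_mult definable_of_bool definable_pred_not)
  then show ?thesis by (rule back_subst[of definable]) (auto simp: fun_eq_iff)
qed

text \<open>The quotient is the number of \<open>i\<close> with \<open>Suc i * b \<le> a\<close>.
  The conjunct \<open>0 < b\<close> gives 0 for division by zero, as in HOL.\<close>

lemma definable_div:
  assumes "definable F" "definable G"
  shows "definable (\<lambda>x w e. F x w e div G x w e)"
proof -
  have "definable (\<lambda>x w e. \<Sum>i<F x w e. of_bool (0 < G x w e \<and> Suc i * G x w e \<le> F x w e))"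
    using assms definable_shift[OF assms(1)] definable_shift[OF assms(2)]
    by (intro definable_sum definable_of_bool definable_pred_conj definable_pred_less definable_pred_le
        definable_mult definable_Suc definable_var definable_const)
  moreover have "(\<Sum>i<a. of_bool (0 < b \<and> Suc i * b \<le> a)) = a div b" for a b :: nat
  proof (cases "b = 0")
    case False
    have "Suc i * b \<le> a \<longleftrightarrow> i < a div b" for i
      using False by (simp add: less_eq_div_iff_mult_less_eq Suc_le_eq[symmetric])
    then have "{..<a} \<inter> {i. 0 < b \<and> Suc i * b \<le> a} = {..<a div b}"
      using False div_le_dividend[of a b] by (auto intro: less_le_trans)
    then show ?thesis by (simp add: sum_of_bool_eq)
  qed simp
  ultimately show ?thesis by simp
qed

lemma definable_mod:
  assumes "definable F" "definable G"
  shows "definable (\<lambda>x w e. F x w e mod G x w e)"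
  using definable_diff[OF assms(1) definable_mult[OF definable_div[OF assms] assms(2)]]
  by (simp add: minus_div_mult_eq_mod)

lemma definable_pred_bit:
  assumes "definable F"
  shows "definable_pred (\<lambda>x w e. F x w e < length x \<and> x ! F x w e)"
proof -
  obtain a where "\<And>x w e. ev x w a e = F x w e" using assms unfolding definable_def by blast
  then have "ev x w (Bit False a) e = of_bool (F x w e < length x \<and> x ! F x w e)" for x w e
    by (simp add: Let_def)
  then show ?thesis unfolding definable_pred_def definable_def by blast
qed

lemma definable_pred_cert_bit:
  assumes "definable F"
  shows "definable_pred (\<lambda>x w e. F x w e < length w \<and> w ! F x w e)"
proof -
  obtain a where "\<And>x w e. ev x w a e = F x w e" using assms unfolding definable_def by blast
  then have "ev x w (Bit True a) e = of_bool (F x w e < length w \<and> w ! F x w e)" for x w e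
    by (simp add: Let_def)
  then show ?thesis unfolding definable_pred_def definable_def by blast
qed

text \<open>A table of constant size is a finite case distinction, with default 0 outside the table.
  The transition function of a fixed machine enters in this way.\<close>

lemma definable_table:
  assumes "definable F" "\<And>k. k < m \<Longrightarrow> definable (\<lambda>x w e. g x w e k)"
  shows "definable (\<lambda>x w e. if F x w e < m then g x w e (F x w e) else 0)"
  using assms(2)
proof (induction m)
  case 0
  then show ?case by (simp add: definable_const)
next
  case (Suc m)
  have "definable (\<lambda>x w e. if F x w e = m then g x w e m else if F x w e < m then g x w e (F x w e) else 0)"
    by (rule definable_if[OF definable_pred_eq[OF assms(1) definable_const]]) (use Suc in auto)
  then show ?case by (rule back_subst[of definable]) (auto simp: fun_eq_iff less_Suc_eq)
qed

lemma definable_pred_ex_const: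
  fixes m :: nat
  assumes "\<And>k. k < m \<Longrightarrow> definable_pred (\<lambda>x w e. P x w e k)"
  shows "definable_pred (\<lambda>x w e. \<exists>k<m. P x w e k)"
  using assms
proof (induction m)
  case 0
  then show ?case by (simp add: definable_pred_const)
next
  case (Suc m)
  have "definable_pred (\<lambda>x w e. (\<exists>k<m. P x w e k) \<or> P x w e m)"
    by (rule definable_pred_disj) (use Suc in auto)
  then show ?case by (rule back_subst[of definable_pred]) (auto simp: fun_eq_iff less_Suc_eq)
qed

lemmas definable_intros =
  definable_var definable_const definable_add definable_diff definable_Suc definable_length_input
  definable_sum definable_mult definable_power definable_poly definable_of_bool definable_if
  definable_div definable_mod
  definable_pred_const definable_pred_not definable_pred_conj definable_pred_disj definable_pred_imp
  definable_pred_le definable_pred_less definable_pred_eq definable_pred_ex definable_pred_all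
  definable_pred_bit definable_pred_cert_bit

theorem NP_definable:
  assumes "definable_pred P"
  shows "{x. \<exists>w. length w \<le> poly p (length x) \<and> P x w (\<lambda>_. 0)} \<in> NP"
proof -
  obtain a where "\<And>x w e. ev x w a e = of_bool (P x w e)"
    using assms unfolding definable_pred_def definable_def by blast
  then show ?thesis using NP_expr[of p a] by simp
qed

theorem poly_time_definable:
  assumes "definable (\<lambda>x w e. l x)" "definable_pred (\<lambda>x w e. b x (e 0))"
  shows "poly_time_computable (\<lambda>x. map (b x) [0..<l x])"
proof -
  obtain la where "\<And>x w e. ev x w la e = l x" using assms(1) unfolding definable_def by blast
  moreover obtain ba where "\<And>x w e. ev x w ba e = of_bool (b x (e 0))"
    using assms(2) unfolding definable_pred_def definable_def by blast
  ultimately show ?thesis using poly_time_expr[of ba la] by simp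
qed

text \<open>The language has no local definitions. A sum over \<open>i \<le> F\<close>, weighted by
  the indicator of \<open>i = F\<close>, has the same effect.\<close>

lemma definable_subst:
  assumes "definable (\<lambda>x w e. G x w (e 0) (\<lambda>n. e (Suc n)))" "definable F"
  shows "definable (\<lambda>x w e. G x w (F x w e) e)"
proof -
  have "definable (\<lambda>x w e. \<Sum>i<Suc (F x w e). of_bool (i = F x w e) * G x w i e)"
    using assms definable_shift[OF assms(2)]
    by (intro definable_sum definable_mult definable_of_bool definable_pred_eq definable_Suc definable_var)
  then show ?thesis
    by (rule back_subst[of definable]) (auto simp: fun_eq_iff of_bool_def if_distrib if_distribR sum.If_cases cong: if_cong)
qed

lemma definable_pred_subst:
  assumes "definable_pred (\<lambda>x w e. P x w (e 0) (\<lambda>n. e (Suc n)))" "definable F"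
  shows "definable_pred (\<lambda>x w e. P x w (F x w e) e)"
  using definable_subst[of "\<lambda>x w i e. of_bool (P x w i e)" F] assms unfolding definable_pred_def by blast

lemma definable_pred_subst2:
  assumes "definable_pred (\<lambda>x w e. P x (e 0) (e 1))" "definable F" "definable G"
  shows "definable_pred (\<lambda>x w e. P x (F x w e) (G x w e))"
proof -
  have "definable_pred (\<lambda>x w e. P x (F x w (\<lambda>n. e (Suc n))) (e 0))"
  proof (rule definable_pred_subst[where P = "\<lambda>x w i e. P x i (e 0)"])
    show "definable_pred (\<lambda>x w e. P x (e 0) (e (Suc 0)))" using assms(1) by simp
  qed (rule definable_shift[OF assms(2)])
  from definable_pred_subst[where P = "\<lambda>x w i e. P x (F x w e) i", OF this assms(3)] show ?thesis .
qed

section \<open>Product labelings are in NP\<close>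

lemma concat_map_upt:
  "concat (map (\<lambda>i. map (f i) [0..<n]) [0..<m]) = map (\<lambda>i. f (i div n) (i mod n)) [0..<m * n]"
proof (induction m)
  case (Suc m)
  have "[0..<Suc m * n] = [0..<m * n] @ map (\<lambda>j. j + m * n) [0..<n]"
    using upt_add_eq_append[of 0 "m * n" n] by (simp add: map_add_upt add.commute)
  moreover have "map (\<lambda>i. f (i div n) (i mod n)) (map (\<lambda>j. j + m * n) [0..<n]) = map (f m) [0..<n]"
    by (auto simp: div_mult_self3)
  ultimately show ?case using Suc by (simp del: mult_Suc)
qed simp

definition code_bit :: "nat \<Rightarrow> nat set set \<Rightarrow> nat \<Rightarrow> bool" where
  "code_bit n E i \<longleftrightarrow> i < n \<or> n < i \<and> {(i - Suc n) div n, (i - Suc n) mod n} \<in> E"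

lemma graph_code_eq: "graph_code n E = map (code_bit n E) [0..<n + 1 + n * n]"
proof (rule nth_equalityI)
  have l: "length (graph_code n E) = n + 1 + n * n"
    by (simp add: graph_code_def concat_map_upt)
  then show "length (graph_code n E) = length (map (code_bit n E) [0..<n + 1 + n * n])" by simp
  fix i assume "i < length (graph_code n E)"
  then have i: "i < n + 1 + n * n" using l by simp
  show "graph_code n E ! i = map (code_bit n E) [0..<n + 1 + n * n] ! i"
    using i unfolding graph_code_def concat_map_upt
    by (auto simp: nth_append code_bit_def nth_Cons simp del: upt_Suc split: nat.splits)
       (auto simp: diff_Suc split: nat.splits)
qed

text \<open>The certificate gives vertex \<open>u\<close> a block of \<open>k\<close> bits, and the
  label is the number of true bits in it; it can therefore never exceed \<open>k\<close>.\<close>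

definition cert_label :: "nat \<Rightarrow> bool list \<Rightarrow> nat \<Rightarrow> nat" where
  "cert_label k w u = (\<Sum>a<k. of_bool (u * k + a < length w \<and> w ! (u * k + a)))"

definition code_adj :: "bool list \<Rightarrow> nat \<Rightarrow> nat \<Rightarrow> nat \<Rightarrow> bool" where
  "code_adj x n u v \<longleftrightarrow> n + 1 + u * n + v < length x \<and> x ! (n + 1 + u * n + v)"

text \<open>As labels are at most \<open>k\<close>, the multiplicity is a finite table and requires
  no arithmetic on primes.\<close>

definition label_mult :: "nat \<Rightarrow> nat \<Rightarrow> nat \<Rightarrow> nat" where
  "label_mult k p y = (if y < Suc k then multiplicity p y else 0)"

text \<open>Two products of labels differ exactly when some prime up to \<open>k\<close> has
  different total exponents in them. Unlike the products, the exponent sums are polynomially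
  bounded.\<close>

definition sums_differ :: "nat \<Rightarrow> bool list \<Rightarrow> bool list \<Rightarrow> nat \<Rightarrow> nat \<Rightarrow> nat \<Rightarrow> bool" where
  "sums_differ k x w n u v \<longleftrightarrow> (\<exists>p<Suc k. prime p \<and>
     (\<Sum>z<n. of_bool (code_adj x n z u) * label_mult k p (cert_label k w z)) \<noteq>
     (\<Sum>z<n. of_bool (code_adj x n z v) * label_mult k p (cert_label k w z)))"

text \<open>The number of vertices is searched below the length of the input, which determines it.
  Conditions such as \<open>i < length x \<and> x ! i\<close> have the form in which expressions can
  access bits.\<close>

definition verifies :: "nat \<Rightarrow> bool list \<Rightarrow> bool list \<Rightarrow> bool" where
  "verifies k x w \<longleftrightarrow> (\<exists>n<length x. length x = n + 1 + n * n \<and>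
     (\<forall>i<n. i < length x \<and> x ! i) \<and> \<not> (n < length x \<and> x ! n) \<and>
     (\<forall>u<n. \<not> code_adj x n u u \<and> 1 \<le> cert_label k w u \<and>
       (\<forall>v<n. code_adj x n u v \<longrightarrow> code_adj x n v u \<and> sums_differ k x w n u v)))"

lemma definable_verifies: "definable_pred (\<lambda>x w e. verifies k x w)"
proof -
  have adj: "definable_pred (\<lambda>x w e. code_adj x (N x w e) (U x w e) (V x w e))"
    if "definable N" "definable U" "definable V" for N U V
    unfolding code_adj_def using that by (intro definable_pred_bit definable_intros)
  have lab: "definable (\<lambda>x w e. cert_label k w (U x w e))" if "definable U" for U
    unfolding cert_label_def using definable_shift[OF that]
    by (intro definable_sum definable_of_bool definable_pred_cert_bit definable_add definable_mult definable_const definable_var)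
  have mult: "definable (\<lambda>x w e. label_mult k p (cert_label k w (U x w e)))" if "definable U" for U p
    unfolding label_mult_def by (rule definable_table[OF lab[OF that] definable_const])
  have differ: "definable_pred (\<lambda>x w e. sums_differ k x w (N x w e) (U x w e) (V x w e))"
    if "definable N" "definable U" "definable V" for N U V
    unfolding sums_differ_def
    using that that[THEN definable_shift]
    by (intro definable_pred_ex_const definable_pred_conj definable_pred_const definable_pred_not
        definable_pred_eq definable_sum definable_mult definable_of_bool adj mult definable_var)
  show ?thesis
    unfolding verifies_def
    by (intro definable_pred_bit definable_intros adj lab differ)
qed

text \<open>Positive integers with equal prime exponents are equal, and a prime above
  \<open>k\<close> divides none of the factors.\<close>

lemma prod_eq_iff_multiplicity:
  fixes f :: "nat \<Rightarrow> nat"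
  assumes "finite A" "finite B" "\<And>a. a \<in> A \<union> B \<Longrightarrow> 1 \<le> f a \<and> f a \<le> k"
  shows "prod f A = prod f B \<longleftrightarrow>
    (\<forall>p<Suc k. prime p \<longrightarrow> (\<Sum>a\<in>A. multiplicity p (f a)) = (\<Sum>a\<in>B. multiplicity p (f a)))"
proof -
  have m: "multiplicity p (prod f C) = (\<Sum>a\<in>C. multiplicity p (f a))"
    if "prime p" "C \<subseteq> A \<union> B" for p C
  proof (rule prime_elem_multiplicity_prod_distrib)
    have "f a \<noteq> 0" if "a \<in> C" for a using assms(3)[of a] \<open>C \<subseteq> A \<union> B\<close> that by fastforce
    then show "0 \<notin> f ` C" by (metis imageE)
    show "finite C" using that(2) assms(1,2) by (auto intro: finite_subset)
  qed (use that in simp)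
  have z: "(\<Sum>a\<in>C. multiplicity p (f a)) = 0" if "\<not> p < Suc k" "C \<subseteq> A \<union> B" for p C
  proof (intro sum.neutral ballI not_dvd_imp_multiplicity_0 notI)
    fix a assume "a \<in> C" "p dvd f a"
    moreover then have "1 \<le> f a \<and> f a \<le> k" using that(2) assms(3)[of a] by blast
    ultimately have "p \<le> f a" "f a \<le> k" using dvd_imp_le[of p "f a"] by auto
    with that(1) show False by simp
  qed
  have pos: "prod f A > 0" "prod f B > 0" using assms(3) by (auto intro!: prod_pos simp: Suc_le_eq)
  show ?thesis
  proof
    assume "prod f A = prod f B"
    then show "\<forall>p<Suc k. prime p \<longrightarrow> (\<Sum>a\<in>A. multiplicity p (f a)) = (\<Sum>a\<in>B. multiplicity p (f a))"
      using m[of _ A] m[of _ B] by auto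
  next
    assume r: "\<forall>p<Suc k. prime p \<longrightarrow> (\<Sum>a\<in>A. multiplicity p (f a)) = (\<Sum>a\<in>B. multiplicity p (f a))"
    show "prod f A = prod f B"
    proof (rule multiplicity_eq_nat[OF pos])
      fix p :: nat assume "prime p"
      then show "multiplicity p (prod f A) = multiplicity p (prod f B)"
        using m[of p A] m[of p B] r z[of p A] z[of p B] by (cases "p < Suc k") auto
    qed
  qed
qed

lemma code_adj_graph_code:
  assumes "u < n" "v < n"
  shows "code_adj (graph_code n E) n u v \<longleftrightarrow> {u, v} \<in> E"
proof -
  have "u * n + v < n * n"
  proof -
    have "u * n + v < Suc u * n" using assms by simp
    also have "\<dots> \<le> n * n" using assms(1) by (intro mult_right_mono) auto
    finally show ?thesis .
  qed
  then show ?thesis using assms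
    by (simp add: code_adj_def graph_code_eq code_bit_def del: upt_Suc)
qed

lemma sum_of_bool_mult:
  fixes n :: nat
  shows "(\<Sum>z<n. of_bool (P z) * g z) = (\<Sum>z\<in>{z. z < n \<and> P z}. (g z :: nat))"
proof -
  have "(\<Sum>z<n. of_bool (P z) * g z) = (\<Sum>z\<in>{..<n}. if P z then g z else 0)"
    by (intro sum.cong) auto
  also have "\<dots> = (\<Sum>z\<in>{z. z < n \<and> P z}. g z)"
    using sum.inter_filter[of "{..<n}" g P] by simp
  finally show ?thesis .
qed

lemma verifies_graph_code:
  assumes s: "simple_graph {..<n} E" and lab: "\<And>u. u < n \<Longrightarrow> 1 \<le> cert_label k w u"
  shows "verifies k (graph_code n E) w \<longleftrightarrow> product_labeling k {..<n} E (cert_label k w)"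
proof -
  let ?x = "graph_code n E" and ?f = "cert_label k w"
  have len: "length ?x = n + 1 + n * n" by (simp add: graph_code_eq del: upt_Suc)
  \<comment> \<open>\<open>n + 1 + n * n\<close> is strictly increasing, hence the length of the
    code determines \<open>n\<close>.\<close>
  have uniq: "m = n" if "length ?x = m + 1 + m * m" for m
  proof (rule ccontr)
    assume "m \<noteq> n"
    moreover have "m + 1 + m * m < n + 1 + n * n" if "m < n" for m n :: nat
      using that mult_strict_mono[of m n m n] by simp
    ultimately show False using len that by (metis less_irrefl linorder_neqE_nat)
  qed
  have first: "\<forall>i<n. i < length ?x \<and> ?x ! i" and sep: "\<not> (n < length ?x \<and> ?x ! n)"
    unfolding len by (auto simp: graph_code_eq code_bit_def simp del: upt_Suc)
  have le: "?f u \<le> k" for u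
  proof -
    have "?f u \<le> (\<Sum>a<k. 1)" unfolding cert_label_def by (intro sum_mono) auto
    then show ?thesis by simp
  qed
  have E: "e \<in> E \<Longrightarrow> e \<subseteq> {..<n} \<and> card e = 2" for e using s by (auto simp: simple_graph_def)
  have irr: "{u, u} \<notin> E" for u using E[of "{u, u}"] by auto
  have lt: "u < n" "v < n" if "{u, v} \<in> E" for u v using E[OF that] by auto
  have nb: "neighbors E v = {z. z < n \<and> {z, v} \<in> E}" for v
    by (auto simp: neighbors_def dest: lt)
  have lm: "label_mult k p (?f z) = multiplicity p (?f z)" for p z
    using le[of z] by (simp add: label_mult_def)
  have sums: "(\<Sum>z<n. of_bool (code_adj ?x n z u) * label_mult k p (?f z)) =
      (\<Sum>z\<in>neighbors E u. multiplicity p (?f z))" if "u < n" for u p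
  proof -
    have "(\<Sum>z<n. of_bool (code_adj ?x n z u) * label_mult k p (?f z)) =
        (\<Sum>z<n. of_bool ({z, u} \<in> E) * multiplicity p (?f z))"
      using that by (intro sum.cong) (auto simp: code_adj_graph_code lm)
    then show ?thesis unfolding nb sum_of_bool_mult .
  qed
  have prods: "(\<Prod>z\<in>neighbors E u. ?f z) = (\<Prod>z\<in>neighbors E v. ?f z) \<longleftrightarrow>
      (\<forall>p<Suc k. prime p \<longrightarrow> (\<Sum>z\<in>neighbors E u. multiplicity p (?f z)) =
        (\<Sum>z\<in>neighbors E v. multiplicity p (?f z)))" for u v
    by (rule prod_eq_iff_multiplicity) (use lab le in \<open>auto simp: nb\<close>)
  have "verifies k ?x w \<longleftrightarrow> (\<forall>u<n. \<forall>v<n. {u, v} \<in> E \<longrightarrow>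
     (\<Prod>z\<in>neighbors E u. ?f z) \<noteq> (\<Prod>z\<in>neighbors E v. ?f z))" (is "?l \<longleftrightarrow> ?r")
  proof
    assume ?l
    then obtain m where "length ?x = m + 1 + m * m" and m: "\<forall>u<m. \<forall>v<m. code_adj ?x m u v \<longrightarrow>
         (\<exists>p<Suc k. prime p \<and>
           (\<Sum>z<m. of_bool (code_adj ?x m z u) * label_mult k p (?f z)) \<noteq>
           (\<Sum>z<m. of_bool (code_adj ?x m z v) * label_mult k p (?f z)))"
      unfolding verifies_def sums_differ_def by blast
    then have "m = n" using uniq by blast
    show ?r
    proof (intro allI impI)
      fix u v assume uv: "u < n" "v < n" "{u, v} \<in> E"
      then have "code_adj ?x n u v" by (simp add: code_adj_graph_code)
      then obtain p where "p < Suc k" "prime p"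
         "(\<Sum>z<n. of_bool (code_adj ?x n z u) * label_mult k p (?f z)) \<noteq>
          (\<Sum>z<n. of_bool (code_adj ?x n z v) * label_mult k p (?f z))"
        using m uv \<open>m = n\<close> by blast
      then show "(\<Prod>z\<in>neighbors E u. ?f z) \<noteq> (\<Prod>z\<in>neighbors E v. ?f z)"
        unfolding prods sums[OF uv(1)] sums[OF uv(2)] by blast
    qed
  next
    assume r: ?r
    show ?l
      unfolding verifies_def
    proof (rule exI[of _ n], intro conjI allI impI)
      fix u v assume u: "u < n" "v < n" "code_adj ?x n u v"
      then have e: "{u, v} \<in> E" by (simp add: code_adj_graph_code)
      then show "code_adj ?x n v u" using u by (simp add: code_adj_graph_code insert_commute)
      show "sums_differ k ?x w n u v"
        unfolding sums_differ_def sums[OF u(1)] sums[OF u(2)] using r[rule_format, OF u(1,2) e]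
        unfolding prods by blast
    qed (use len first sep lab irr in \<open>auto simp: code_adj_graph_code\<close>)
  qed
  also have "\<dots> \<longleftrightarrow> product_labeling k {..<n} E ?f"
    unfolding product_labeling_def proper_coloring_def using lt lab le by (auto; blast)
  finally show ?thesis .
qed

text \<open>The format checks pin down the length, the unary prefix with its end mark, symmetry and
  irreflexivity, which is all that a word needs to be the code of a simple graph.\<close>

lemma verifies_imp_graph_code:
  assumes "verifies k x w"
  shows "\<exists>n E. simple_graph {..<n} E \<and> x = graph_code n E \<and> (\<forall>u<n. 1 \<le> cert_label k w u)"
proof -
  obtain n where n: "length x = n + 1 + n * n" "\<forall>i<n. i < length x \<and> x ! i" "\<not> (n < length x \<and> x ! n)"
    "\<forall>u<n. \<not> code_adj x n u u \<and> 1 \<le> cert_label k w u \<and> (\<forall>v<n. code_adj x n u v \<longrightarrow> code_adj x n v u)"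
    using assms unfolding verifies_def by blast
  define E where "E = {{u, v} | u v. u < n \<and> v < n \<and> code_adj x n u v}"
  have s: "simple_graph {..<n} E"
    using n(4) by (auto simp: simple_graph_def E_def card_insert_if)
  have mem: "{u, v} \<in> E \<longleftrightarrow> code_adj x n u v" if "u < n" "v < n" for u v
    using that n(4) by (auto simp: E_def doubleton_eq_iff)
  have "x = map (code_bit n E) [0..<n + 1 + n * n]"
  proof (rule nth_equalityI)
    fix i assume i: "i < length x"
    consider "i < n" | "i = n" | "n < i" by linarith
    then have "x ! i = code_bit n E i"
    proof cases
      case 3
      let ?j = "i - Suc n"
      have j: "?j < n * n" using i 3 n(1) by simp
      then have "n > 0" by (cases n) auto
      then have d: "?j div n < n" "?j mod n < n" using j by (auto simp: less_mult_imp_div_less)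
      have "n + 1 + ?j div n * n + ?j mod n = i" using 3 by (simp add: add.assoc)
      then have "code_adj x n (?j div n) (?j mod n) \<longleftrightarrow> x ! i"
        unfolding code_adj_def using i by simp
      then show ?thesis using mem[OF d] 3 by (simp add: code_bit_def)
    qed (use n in \<open>auto simp: code_bit_def\<close>)
    then show "x ! i = map (code_bit n E) [0..<n + 1 + n * n] ! i"
      using i n(1) by (simp del: upt_Suc)
  qed (use n(1) in simp)
  with s n(4) show ?thesis unfolding graph_code_eq[symmetric] by blast
qed

lemma cert_label_exists:
  assumes "\<And>u. u < n \<Longrightarrow> f u \<le> k"
  shows "\<exists>w. length w = n * k \<and> (\<forall>u<n. cert_label k w u = f u)"
proof (intro exI[of _ "map (\<lambda>i. i mod k < f (i div k)) [0..<n * k]"] conjI allI impI)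
  fix u assume u: "u < n"
  have lt: "u * k + a < n * k" if "a < k" for a
  proof -
    have "u * k + a < Suc u * k" using that by simp
    also have "\<dots> \<le> n * k" using u by (intro mult_right_mono) auto
    finally show ?thesis .
  qed
  have "cert_label k (map (\<lambda>i. i mod k < f (i div k)) [0..<n * k]) u = (\<Sum>a<k. of_bool (a < f u))"
    unfolding cert_label_def using lt by (intro sum.cong) auto
  also have "\<dots> = card ({..<k} \<inter> {a. a < f u})" by simp
  also have "{..<k} \<inter> {a. a < f u} = {..<f u}" using assms[OF u] by auto
  finally show "cert_label k (map (\<lambda>i. i mod k < f (i div k)) [0..<n * k]) u = f u" by simp
qed simp

lemma product_labeling_cong:
  assumes "simple_graph V E" "\<And>u. u \<in> V \<Longrightarrow> f u = g u"
  shows "product_labeling k V E f \<longleftrightarrow> product_labeling k V E g"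
proof -
  have "neighbors E v \<subseteq> V" for v
    using assms(1) by (auto simp: neighbors_def simple_graph_def)
  then have "(\<Prod>u\<in>neighbors E v. f u) = (\<Prod>u\<in>neighbors E v. g u)" for v
    using assms(2) by (intro prod.cong) auto
  moreover have "f ` V = g ` V" using assms(2) by (auto simp: image_def)
  ultimately show ?thesis by (simp add: product_labeling_def)
qed

theorem product_labeling_in_NP:
  "{graph_code n E | n E. simple_graph {..<n} E \<and> has_product_labeling k {..<n} E} \<in> NP"
proof -
  \<comment> \<open>A certificate consists of \<open>n\<close> blocks of \<open>k\<close> bits, and
    \<open>n * k\<close> is at most \<open>k\<close> times the length of the code.\<close>
  have "{x. \<exists>w. length w \<le> poly [:0, k:] (length x) \<and> verifies k x w} \<in> NP"
    by (rule NP_definable[OF definable_verifies])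
  also have "{x. \<exists>w. length w \<le> poly [:0, k:] (length x) \<and> verifies k x w} =
    {graph_code n E | n E. simple_graph {..<n} E \<and> has_product_labeling k {..<n} E}" (is "?A = ?B")
  proof (intro equalityI subsetI)
    fix x assume "x \<in> ?A"
    then obtain w where w: "verifies k x w" by blast
    then obtain n E where "simple_graph {..<n} E" "x = graph_code n E" "\<forall>u<n. 1 \<le> cert_label k w u"
      using verifies_imp_graph_code by blast
    then show "x \<in> ?B"
      using verifies_graph_code[of n E k w] w unfolding has_product_labeling_def by blast
  next
    fix x assume "x \<in> ?B"
    then obtain n E f where x: "x = graph_code n E" "simple_graph {..<n} E" "product_labeling k {..<n} E f"
      unfolding has_product_labeling_def by blast
    have f: "1 \<le> f u \<and> f u \<le> k" if "u < n" for u
      using x(3) that by (force simp: product_labeling_def)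
    then obtain w where w: "length w = n * k" "\<forall>u<n. cert_label k w u = f u"
      using cert_label_exists[of n f k] by blast
    have "product_labeling k {..<n} E (cert_label k w)"
      using x(3) product_labeling_cong[OF x(2), of f "cert_label k w" k] w(2) by simp
    then have "verifies k x w"
      using verifies_graph_code[OF x(2), of k w] w(2) f x(1) by simp
    moreover have "length w \<le> poly [:0, k:] (length x)"
      unfolding w x(1) by (simp add: graph_code_eq algebra_simps)
    ultimately show "x \<in> ?A" by blast
  qed
  finally show ?thesis .
qed

section \<open>Satisfiability of clause matrices is NP-hard\<close>

definition satisfiable :: "nat \<Rightarrow> nat \<Rightarrow> (nat \<Rightarrow> nat \<Rightarrow> bool) \<Rightarrow> (nat \<Rightarrow> nat \<Rightarrow> bool) \<Rightarrow> bool" where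
  "satisfiable m n pos neg \<longleftrightarrow> (\<exists>a. \<forall>r<m. \<exists>c<n. pos r c \<and> a c \<or> neg r c \<and> \<not> a c)"

definition digit :: "nat \<Rightarrow> nat \<Rightarrow> nat \<Rightarrow> nat" where
  "digit B j r = (r div B ^ j) mod B"

lemma digit_0 [simp]: "a < B \<Longrightarrow> digit B 0 (a + B * b) = a"
  by (simp add: digit_def)

lemma digit_Suc [simp]: "a < B \<Longrightarrow> digit B (Suc j) (a + B * b) = digit B j b"
  by (simp add: digit_def div_mult2_eq)

lemma digit_0_single [simp]: "a < B \<Longrightarrow> digit B 0 a = a"
  by (simp add: digit_def)

lemma digit_less: "0 < B \<Longrightarrow> digit B j r < B"
  by (simp add: digit_def)

lemma mixed_radix_less: "a < B \<Longrightarrow> b < C \<Longrightarrow> a + B * b < B * (C :: nat)"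
proof -
  assume "a < B" "b < C"
  then have "a + B * b < B * Suc b" by simp
  also have "\<dots> \<le> B * C" using \<open>b < C\<close> by (intro mult_left_mono) auto
  finally show ?thesis .
qed

lemma definable_digit: "definable F \<Longrightarrow> definable G \<Longrightarrow> definable (\<lambda>x w e. digit (F x w e) j (G x w e))"
  unfolding digit_def by (intro definable_intros)

lemma definable_pred_if:
  assumes "definable_pred P" "definable_pred F" "definable_pred G"
  shows "definable_pred (\<lambda>x w e. if P x w e then F x w e else G x w e)"
proof -
  have "definable_pred (\<lambda>x w e. P x w e \<and> F x w e \<or> \<not> P x w e \<and> G x w e)"
    using assms by (intro definable_intros)
  then show ?thesis by (rule back_subst[of definable_pred]) (auto simp: fun_eq_iff)
qed

definition table2 :: "nat \<Rightarrow> nat \<Rightarrow> (nat \<Rightarrow> nat \<Rightarrow> nat) \<Rightarrow> nat \<Rightarrow> nat \<Rightarrow> nat" where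
  "table2 m n g a b = (if a < m then if b < n then g a b else 0 else 0)"

lemma definable_table2:
  assumes "definable F" "definable G"
  shows "definable (\<lambda>x w e. table2 m n g (F x w e) (G x w e))"
  unfolding table2_def by (rule definable_table[OF assms(1)], rule definable_table[OF assms(2)], rule definable_const)

definition table3 :: "nat \<Rightarrow> nat \<Rightarrow> nat \<Rightarrow> (nat \<Rightarrow> nat \<Rightarrow> nat \<Rightarrow> nat) \<Rightarrow> nat \<Rightarrow> nat \<Rightarrow> nat \<Rightarrow> nat" where
  "table3 m n l g a b c = (if a < m then table2 n l (g a) b c else 0)"

lemma definable_table3:
  assumes "definable F" "definable G" "definable H"
  shows "definable (\<lambda>x w e. table3 m n l g (F x w e) (G x w e) (H x w e))"
  unfolding table3_def by (rule definable_table[OF assms(1)], rule definable_table2[OF assms(2,3)])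

subsection \<open>The transition table\<close>

text \<open>Halting states become self-loops that write back the scanned symbols, so that one
  transition rule also covers the time after halting and acceptance can be asked at the fixed time
  \<open>T\<close>.\<close>

definition delta :: "tm \<Rightarrow> nat \<Rightarrow> nat list \<Rightarrow> nat \<times> (nat \<times> move) list" where
  "delta M q ss = (if halting M q then (q, keep ss) else trans M q ss)"

definition tuples :: "tm \<Rightarrow> nat list set" where
  "tuples M = {ss. set ss \<subseteq> {..<num_symbols M} \<and> length ss = num_tapes M}"

text \<open>The symbols scanned on all tapes together are coded by one number, so that a transition
  has a single parameter for them.\<close>

definition tuple :: "tm \<Rightarrow> nat \<Rightarrow> nat list" where
  "tuple M = from_nat_into (tuples M)"

definition tuple_sym :: "tm \<Rightarrow> nat \<Rightarrow> nat \<Rightarrow> nat" where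
  "tuple_sym M = table2 (card (tuples M)) (num_tapes M) (\<lambda>\<sigma> i. tuple M \<sigma> ! i)"

definition next_state :: "tm \<Rightarrow> nat \<Rightarrow> nat \<Rightarrow> nat" where
  "next_state M = table2 (num_states M) (card (tuples M)) (\<lambda>q \<sigma>. fst (delta M q (tuple M \<sigma>)))"

definition written :: "tm \<Rightarrow> nat \<Rightarrow> nat \<Rightarrow> nat \<Rightarrow> nat" where
  "written M = table3 (num_states M) (card (tuples M)) (num_tapes M)
     (\<lambda>q \<sigma> i. fst (snd (delta M q (tuple M \<sigma>)) ! i))"

text \<open>Head moves are shifted by one to be natural numbers.\<close>

definition moved :: "tm \<Rightarrow> nat \<Rightarrow> nat \<Rightarrow> nat \<Rightarrow> nat" where
  "moved M = table3 (num_states M) (card (tuples M)) (num_tapes M)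
     (\<lambda>q \<sigma> i. nat (offset (snd (snd (delta M q (tuple M \<sigma>)) ! i)) + 1))"

lemma finite_tuples: "finite (tuples M)"
  unfolding tuples_def by (rule finite_lists_length_eq) simp

lemma tuple_exists:
  assumes "ss \<in> tuples M"
  shows "\<exists>\<sigma><card (tuples M). tuple M \<sigma> = ss"
  using bij_betw_from_nat_into_finite[OF finite_tuples, of M] assms
  unfolding tuple_def bij_betw_def by (metis imageE lessThan_iff)

lemma tuple_mem: "wf_tm M \<Longrightarrow> tuple M \<sigma> \<in> tuples M"
proof -
  assume "wf_tm M"
  then have "replicate (num_tapes M) 0 \<in> tuples M" by (auto simp: tuples_def wf_tm_def)
  then show ?thesis unfolding tuple_def by (intro from_nat_into) auto
qed

lemma delta_wf:
  assumes "wf_tm M" "q < num_states M" "ss \<in> tuples M"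
  shows "fst (delta M q ss) < num_states M" "length (snd (delta M q ss)) = num_tapes M"
    "i < num_tapes M \<Longrightarrow> fst (snd (delta M q ss) ! i) < num_symbols M"
proof -
  have t: "fst (trans M q ss) < num_states M \<and> length (snd (trans M q ss)) = num_tapes M \<and>
      fst ` set (snd (trans M q ss)) \<subseteq> {..<num_symbols M}"
    using assms unfolding wf_tm_def tuples_def by blast
  then show "fst (delta M q ss) < num_states M" "length (snd (delta M q ss)) = num_tapes M"
    using assms by (auto simp: delta_def tuples_def)
  show "fst (snd (delta M q ss) ! i) < num_symbols M" if i: "i < num_tapes M"
  proof (cases "halting M q")
    case True
    have "ss ! i \<in> set ss" using assms(3) i by (auto simp: tuples_def)
    then have "ss ! i < num_symbols M" using assms(3) by (auto simp: tuples_def)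
    then show ?thesis using True i assms(3) by (simp add: delta_def keep_def tuples_def)
  next
    case False
    have "fst (snd (trans M q ss) ! i) \<in> fst ` set (snd (trans M q ss))" using t i by simp
    with t have "fst (snd (trans M q ss) ! i) < num_symbols M" by blast
    with False show ?thesis by (simp add: delta_def)
  qed
qed

lemma step_delta:
  "step_tm M (q, ts) = (fst (delta M q (map read_tape ts)), map2 act_tape (snd (delta M q (map read_tape ts))) ts)"
  by (auto simp: step_tm.simps delta_def map2_keep split: prod.splits)

definition state_at :: "tm \<Rightarrow> bool list list \<Rightarrow> nat \<Rightarrow> nat" where
  "state_at M ws t = fst (run_tm M ws t)"
definition head_at :: "tm \<Rightarrow> bool list list \<Rightarrow> nat \<Rightarrow> nat \<Rightarrow> int" where
  "head_at M ws t i = fst (snd (run_tm M ws t) ! i)"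
definition cell_at :: "tm \<Rightarrow> bool list list \<Rightarrow> nat \<Rightarrow> nat \<Rightarrow> int \<Rightarrow> nat" where
  "cell_at M ws t i = snd (snd (run_tm M ws t) ! i)"
definition scan_at :: "tm \<Rightarrow> bool list list \<Rightarrow> nat \<Rightarrow> nat \<Rightarrow> nat" where
  "scan_at M ws t i = cell_at M ws t i (head_at M ws t i)"

lemma read_tape_eq: "read_tape tp = snd tp (fst tp)"
  by (cases tp) simp

lemma act_tape_eq: "act_tape a tp = (fst tp + offset (snd a), (snd tp)(fst tp := fst a))"
  by (cases a; cases tp) simp

lemma run_tm_Suc: "run_tm M ws (Suc t) = step_tm M (run_tm M ws t)"
  by (simp add: run_tm_def)

text \<open>The bound on head positions is the reason for shifting tape positions by
  \<open>T + 1\<close>: up to time \<open>T\<close> the shifted positions are positive. The other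
  parts are the invariants that keep all parameters below the base.\<close>

lemma run_wf:
  assumes "wf_tm M"
  shows "state_at M ws t < num_states M \<and> length (snd (run_tm M ws t)) = num_tapes M \<and>
    map read_tape (snd (run_tm M ws t)) \<in> tuples M \<and>
    (\<forall>i<num_tapes M. \<bar>head_at M ws t i\<bar> \<le> int t \<and> (\<forall>z. cell_at M ws t i z < num_symbols M))"
proof (induction t)
  case 0
  have "word_contents v z < num_symbols M" for v z
    using word_contents_le[of v z] assms by (simp add: wf_tm_def)
  then show ?case using assms
    by (auto simp: run_tm_def init_config_def state_at_def head_at_def cell_at_def wf_tm_def tuples_def)
next
  case (Suc t)
  let ?q = "fst (run_tm M ws t)" and ?ts = "snd (run_tm M ws t)"
  let ?d = "delta M ?q (map read_tape ?ts)"
  have d: "fst ?d < num_states M" "length (snd ?d) = num_tapes M"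
    "i < num_tapes M \<Longrightarrow> fst (snd ?d ! i) < num_symbols M" for i
    using delta_wf[OF assms, of ?q "map read_tape ?ts"] Suc by (auto simp: state_at_def)
  have s: "run_tm M ws (Suc t) = (fst ?d, map2 act_tape (snd ?d) ?ts)"
    using step_delta[of M ?q ?ts] by (simp add: run_tm_Suc)
  have i: "\<bar>head_at M ws (Suc t) i\<bar> \<le> int (Suc t) \<and> (\<forall>z. cell_at M ws (Suc t) i z < num_symbols M)"
    if "i < num_tapes M" for i
  proof -
    have "snd (run_tm M ws (Suc t)) ! i = act_tape (snd ?d ! i) (?ts ! i)"
      using that d(2) Suc by (simp add: s)
    then have hc: "head_at M ws (Suc t) i = head_at M ws t i + offset (snd (snd ?d ! i))"
      "cell_at M ws (Suc t) i = (cell_at M ws t i)(head_at M ws t i := fst (snd ?d ! i))"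
      by (simp_all add: head_at_def cell_at_def act_tape_eq)
    have "\<bar>offset m\<bar> \<le> 1" for m by (cases m) auto
    from this[of "snd (snd ?d ! i)"] have "\<bar>head_at M ws (Suc t) i\<bar> \<le> int (Suc t)"
      using Suc that unfolding hc(1) by fastforce
    moreover have "cell_at M ws (Suc t) i z < num_symbols M" for z
      using Suc that d(3)[OF that] unfolding hc(2) by simp
    ultimately show ?thesis by blast
  qed
  have len: "length (snd (run_tm M ws (Suc t))) = num_tapes M" using d(2) Suc by (simp add: s)
  have "map read_tape (snd (run_tm M ws (Suc t))) \<in> tuples M"
  proof -
    have "read_tape tp < num_symbols M" if tp: "tp \<in> set (snd (run_tm M ws (Suc t)))" for tp
    proof -
      obtain j where "j < num_tapes M" "tp = snd (run_tm M ws (Suc t)) ! j"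
        using tp len by (metis in_set_conv_nth)
      with i[of j] show ?thesis by (simp add: read_tape_eq cell_at_def)
    qed
    then show ?thesis using len by (auto simp: tuples_def)
  qed
  then show ?case using len i d(1) by (simp add: state_at_def s)
qed

lemma run_step:
  assumes "wf_tm M"
  obtains \<sigma> where "\<sigma> < card (tuples M)" "\<And>i. i < num_tapes M \<Longrightarrow> tuple_sym M \<sigma> i = scan_at M ws t i"
    "state_at M ws (Suc t) = next_state M (state_at M ws t) \<sigma>"
    "\<And>i. i < num_tapes M \<Longrightarrow> head_at M ws (Suc t) i = head_at M ws t i + int (moved M (state_at M ws t) \<sigma> i) - 1"
    "\<And>i. i < num_tapes M \<Longrightarrow> cell_at M ws (Suc t) i = (cell_at M ws t i)(head_at M ws t i := written M (state_at M ws t) \<sigma> i)"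
proof -
  let ?q = "fst (run_tm M ws t)" and ?ts = "snd (run_tm M ws t)"
  note wf = run_wf[OF assms, of ws t]
  obtain \<sigma> where \<sigma>: "\<sigma> < card (tuples M)" "tuple M \<sigma> = map read_tape ?ts"
    using tuple_exists wf by blast
  let ?d = "delta M ?q (tuple M \<sigma>)"
  have q: "?q < num_states M" using wf by (simp add: state_at_def)
  have s: "run_tm M ws (Suc t) = (fst ?d, map2 act_tape (snd ?d) ?ts)"
    using step_delta[of M ?q ?ts] by (simp add: run_tm_Suc \<sigma>)
  have i: "snd (run_tm M ws (Suc t)) ! i = act_tape (snd ?d ! i) (?ts ! i)" if "i < num_tapes M" for i
    using that wf delta_wf(2)[OF assms q, of "tuple M \<sigma>"] \<sigma>(2) by (simp add: s)
  have "0 \<le> offset m + 1" for m by (cases m) auto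
  then have mv: "int (moved M (state_at M ws t) \<sigma> i) = offset (snd (snd ?d ! i)) + 1" if "i < num_tapes M" for i
    using that q \<sigma>(1) by (simp add: moved_def table3_def table2_def state_at_def)
  show ?thesis
  proof (rule that[of \<sigma>])
    show "tuple_sym M \<sigma> i = scan_at M ws t i" if "i < num_tapes M" for i
      using that \<sigma> wf
      by (simp add: tuple_sym_def table2_def scan_at_def cell_at_def head_at_def read_tape_eq)
    show "state_at M ws (Suc t) = next_state M (state_at M ws t) \<sigma>"
      using q \<sigma>(1) by (simp add: next_state_def table2_def state_at_def s)
    show "head_at M ws (Suc t) i = head_at M ws t i + int (moved M (state_at M ws t) \<sigma> i) - 1"
      if "i < num_tapes M" for i
      using mv[OF that] i[OF that] by (simp add: head_at_def act_tape_eq)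
    show "cell_at M ws (Suc t) i = (cell_at M ws t i)(head_at M ws t i := written M (state_at M ws t) \<sigma> i)"
      if "i < num_tapes M" for i
      using i[OF that] that q \<sigma>(1)
      by (simp add: cell_at_def head_at_def act_tape_eq written_def table3_def table2_def state_at_def)
  qed (rule \<sigma>)
qed


subsection \<open>The tableau\<close>

text \<open>The digits of a clause index in base \<open>B\<close> are the number of a clause family and its parameters;
  the digits of a variable index say which of the facts ``the state at time \<open>t\<close> is \<open>q\<close>'', ``head \<open>i\<close>
  is at \<open>z\<close>'', ``cell \<open>z\<close> of tape \<open>i\<close> contains \<open>a\<close>'', ``head \<open>i\<close> scans \<open>a\<close>'' it stands for. The number 0
  is a dummy variable that makes clauses without a meaning true. Tape positions are shifted by
  \<open>T + 1\<close>. The clauses only force the facts of the actual computation to be true.\<close>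

definition base :: "tm \<Rightarrow> nat \<Rightarrow> nat \<Rightarrow> nat" where
  "base M T P = 2 * T + P + (20 + num_tapes M + num_symbols M + num_states M + card (tuples M))"

definition tableau_var :: "nat \<Rightarrow> nat \<Rightarrow> nat \<Rightarrow> nat \<Rightarrow> nat \<Rightarrow> nat \<Rightarrow> nat" where
  "tableau_var B k t i z a = k + B * (t + B * (i + B * (z + B * a)))"

abbreviation "state_fact B t q \<equiv> tableau_var B 1 t 0 0 q"
abbreviation "head_fact B t i z \<equiv> tableau_var B 2 t i z 0"
abbreviation "cell_fact B t i z a \<equiv> tableau_var B 3 t i z a"
abbreviation "scan_fact B t i a \<equiv> tableau_var B 4 t i 0 a"

definition input_sym :: "bool list \<Rightarrow> nat \<Rightarrow> nat \<Rightarrow> nat \<Rightarrow> nat" where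
  "input_sym x T i z =
     (if i = 0 \<and> T + 1 \<le> z \<and> z - (T + 1) < length x
      then if z - (T + 1) < length x \<and> x ! (z - (T + 1)) then 2 else 1 else 0)"

text \<open>With the literals of \<open>clause_neg\<close> read as premises, the families are: 1 to
  3, start state, heads and tapes other than the certificate tape; 4, a cell of the certificate tape
  is blank or, inside a window of \<open>P\<close> cells, a letter; 5, blanks in the window continue
  to the right; 6, a head has one position (\<open>z\<close> and \<open>a\<close> are two positions
  here); 7, a head scans the symbol below it; 8 to 10, next state, written symbol, new position; 11,
  an unscanned cell keeps its symbol; 12, no state but the accepting one at time \<open>T\<close>.
  Family 7 relieves 8 to 10 of mentioning the positions of all heads, so the same few parameters
  suffice for every machine.\<close>

definition clause_pos ::
    "tm \<Rightarrow> bool list \<Rightarrow> nat \<Rightarrow> nat \<Rightarrow> nat \<Rightarrow> nat \<Rightarrow> nat \<Rightarrow> nat \<Rightarrow> nat \<Rightarrow> nat \<Rightarrow> nat \<Rightarrow> nat \<Rightarrow> nat \<Rightarrow> bool" where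
  "clause_pos M x T P B f t q \<sigma> i z a c \<longleftrightarrow>
    (if f = 1 then c = state_fact B 0 (start_state M)
     else if f = 2 \<and> i < num_tapes M then c = head_fact B 0 i (T + 1)
     else if f = 3 \<and> i < num_tapes M \<and> i \<noteq> 1 then c = cell_fact B 0 i z (input_sym x T i z)
     else if f = 4 then c = cell_fact B 0 1 z 0 \<or>
       (T + 1 \<le> z \<and> z < T + 1 + P \<and> (c = cell_fact B 0 1 z 1 \<or> c = cell_fact B 0 1 z 2))
     else if f = 5 \<and> T + 1 \<le> z \<and> z + 1 < T + 1 + P then c = cell_fact B 0 1 (z + 1) 0
     else if f = 6 \<and> t \<le> T \<and> i < num_tapes M \<and> z \<noteq> a then False
     else if f = 7 \<and> t \<le> T \<and> i < num_tapes M then c = scan_fact B t i a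
     else if f = 8 \<and> t < T \<and> q < num_states M \<and> \<sigma> < card (tuples M) then
       c = state_fact B (t + 1) (next_state M q \<sigma>)
     else if f = 9 \<and> t < T \<and> q < num_states M \<and> \<sigma> < card (tuples M) \<and> i < num_tapes M then
       c = cell_fact B (t + 1) i z (written M q \<sigma> i)
     else if f = 10 \<and> t < T \<and> q < num_states M \<and> \<sigma> < card (tuples M) \<and> i < num_tapes M \<and> 1 \<le> z \<and> z \<le> 2 * T + 1 then
       c = head_fact B (t + 1) i (z + moved M q \<sigma> i - 1)
     else if f = 11 \<and> t < T \<and> i < num_tapes M then c = head_fact B t i z \<or> c = cell_fact B (t + 1) i z a
     else if f = 12 \<and> q < num_states M \<and> q \<noteq> accept_state M then False
     else c = 0)"

definition step_premise :: "tm \<Rightarrow> nat \<Rightarrow> nat \<Rightarrow> nat \<Rightarrow> nat \<Rightarrow> nat \<Rightarrow> bool" where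
  "step_premise M B t q \<sigma> c \<longleftrightarrow>
     c = state_fact B t q \<or> (\<exists>j<num_tapes M. c = scan_fact B t j (tuple_sym M \<sigma> j))"

definition clause_neg ::
    "tm \<Rightarrow> nat \<Rightarrow> nat \<Rightarrow> nat \<Rightarrow> nat \<Rightarrow> nat \<Rightarrow> nat \<Rightarrow> nat \<Rightarrow> nat \<Rightarrow> nat \<Rightarrow> nat \<Rightarrow> nat \<Rightarrow> bool" where
  "clause_neg M T P B f t q \<sigma> i z a c \<longleftrightarrow>
    (if f = 5 then c = cell_fact B 0 1 z 0
     else if f = 6 then c = head_fact B t i z \<or> c = head_fact B t i a
     else if f = 7 then c = head_fact B t i z \<or> c = cell_fact B t i z a
     else if f = 8 then step_premise M B t q \<sigma> c
     else if f = 9 \<or> f = 10 then step_premise M B t q \<sigma> c \<or> c = head_fact B t i z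
     else if f = 11 then c = cell_fact B t i z a
     else if f = 12 then c = state_fact B T q
     else False)"

lemma tableau_var_less:
  assumes "k < B" "t < B" "i < B" "z < B" "a < B"
  shows "tableau_var B k t i z a < B ^ 5"
  using assms by (simp add: tableau_var_def numeral_eq_Suc mixed_radix_less)

lemma tableau_var_digits:
  assumes "k < B" "t < B" "i < B" "z < B" "a < B"
  shows "digit B 0 (tableau_var B k t i z a) = k" "digit B 1 (tableau_var B k t i z a) = t"
    "digit B 2 (tableau_var B k t i z a) = i" "digit B 3 (tableau_var B k t i z a) = z"
    "digit B 4 (tableau_var B k t i z a) = a"
  using assms by (simp_all add: tableau_var_def numeral_eq_Suc)

lemma definable_tableau_var:
  assumes "definable B" "definable k" "definable t" "definable i" "definable z" "definable a"
  shows "definable (\<lambda>x w e. tableau_var (B x w e) (k x w e) (t x w e) (i x w e) (z x w e) (a x w e))"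
  unfolding tableau_var_def using assms by (intro definable_intros)

lemma definable_clause_pos:
  assumes "definable T" "definable P" "definable B" "definable f" "definable t" "definable q"
    "definable \<sigma>" "definable i" "definable z" "definable a" "definable c"
  shows "definable_pred (\<lambda>x w e. clause_pos M x (T x w e) (P x w e) (B x w e) (f x w e) (t x w e) (q x w e)
    (\<sigma> x w e) (i x w e) (z x w e) (a x w e) (c x w e))"
  unfolding clause_pos_def input_sym_def next_state_def written_def moved_def using assms
  by (intro definable_pred_if definable_if definable_pred_bit definable_table2 definable_table3 definable_tableau_var
      definable_pred_conj definable_pred_disj definable_pred_eq definable_pred_le definable_pred_less
      definable_pred_not definable_pred_const definable_add definable_diff definable_mult
      definable_length_input definable_const)

lemma definable_clause_neg:
  assumes "definable T" "definable P" "definable B" "definable f" "definable t" "definable q"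
    "definable \<sigma>" "definable i" "definable z" "definable a" "definable c"
  shows "definable_pred (\<lambda>x w e. clause_neg M (T x w e) (P x w e) (B x w e) (f x w e) (t x w e) (q x w e)
    (\<sigma> x w e) (i x w e) (z x w e) (a x w e) (c x w e))"
proof -
  have "definable_pred (\<lambda>x w e. step_premise M (B x w e) (t x w e) (q x w e) (\<sigma> x w e) (c x w e))"
    unfolding step_premise_def tuple_sym_def using assms assms[THEN definable_shift]
    by (intro definable_pred_disj definable_pred_eq definable_pred_ex definable_tableau_var definable_table2
        definable_var definable_const)
  with assms show ?thesis
    unfolding clause_neg_def
    by (intro definable_pred_if definable_tableau_var
        definable_pred_disj definable_pred_eq definable_pred_const definable_const)
qed

definition holds :: "(nat \<Rightarrow> bool) \<Rightarrow> nat \<Rightarrow> (nat \<Rightarrow> bool) \<Rightarrow> (nat \<Rightarrow> bool) \<Rightarrow> bool" where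
  "holds v n pos neg \<longleftrightarrow> (\<exists>c<n. pos c \<and> v c \<or> neg c \<and> \<not> v c)"

definition tableau :: "tm \<Rightarrow> bool list \<Rightarrow> nat \<Rightarrow> nat \<Rightarrow> (nat \<Rightarrow> bool) \<Rightarrow> bool" where
  "tableau M x T P v \<longleftrightarrow> (let B = base M T P in
     \<forall>f<B. \<forall>t<B. \<forall>q<B. \<forall>\<sigma><B. \<forall>i<B. \<forall>z<B. \<forall>a<B.
       holds v (B ^ 5) (clause_pos M x T P B f t q \<sigma> i z a) (clause_neg M T P B f t q \<sigma> i z a))"

lemma holdsD: "holds v n pos neg \<Longrightarrow> \<forall>c. neg c \<longrightarrow> v c \<Longrightarrow> \<exists>c. pos c \<and> v c"
  unfolding holds_def by blast

lemma tableauD: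
  assumes "tableau M x T P v" "f < base M T P" "t < base M T P" "q < base M T P" "\<sigma> < base M T P"
    "i < base M T P" "z < base M T P" "a < base M T P"
    "\<And>c. clause_neg M T P (base M T P) f t q \<sigma> i z a c \<Longrightarrow> v c"
  shows "\<exists>c. clause_pos M x T P (base M T P) f t q \<sigma> i z a c \<and> v c"
  using holdsD[OF assms(1)[unfolded tableau_def Let_def, rule_format, OF assms(2-8)]] assms(9) by blast

text \<open>Each fact of the actual computation is the conclusion of clauses whose premises are
  earlier facts, so it must hold in \<open>v\<close>, by induction on the time. The certificate is
  whatever \<open>v\<close> writes on tape 1. Further facts may hold in \<open>v\<close> as well;
  only a second head position has to be ruled out.\<close>

lemma tableau_imp_accepts:
  assumes wf: "wf_tm M" "2 \<le> num_tapes M" and tab: "tableau M x T P v"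
  shows "\<exists>w. length w \<le> P \<and> state_at M [x, w] T = accept_state M"
proof -
  define B where "B = base M T P"
  note D = tableauD[OF tab, folded B_def]
  have Bl: "num_tapes M < B" "num_symbols M < B" "num_states M < B" "card (tuples M) < B" "2 * T + P + 20 \<le> B"
    unfolding B_def base_def by auto
  have B12: "k < B" if "k \<le> 12" for k using that Bl by simp
  define blank where "blank = (\<lambda>j. v (cell_fact B 0 1 (T + 1 + j) 0))"
  \<comment> \<open>The certificate ends at its first blank cell or fills the window; by family 5
    all later cells of the window are blank.\<close>
  define L where "L = (LEAST j. j = P \<or> blank j)"
  \<comment> \<open>If \<open>v\<close> allows both letters in a cell, the letter 2 is taken; the
    chosen letter is a true fact in any case.\<close>
  define w where "w = map (\<lambda>j. v (cell_fact B 0 1 (T + 1 + j) 2)) [0..<L]"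
  have L: "L \<le> P" unfolding L_def by (rule Least_le) simp
  have notblank: "\<not> blank j" if "j < L" for j using not_less_Least[of j "\<lambda>j. j = P \<or> blank j"] that by (simp add: L_def)
  have blank: "blank j" if "L \<le> j" "j < P" for j
    using that
  proof (induction j rule: dec_induct)
    case base
    have "L = P \<or> blank L" unfolding L_def by (rule LeastI[of _ P]) simp
    with base show ?case by simp
  next
    case (step j)
    have "\<exists>c. clause_pos M x T P B 5 0 0 0 0 (T + 1 + j) 0 c \<and> v c"
      by (rule D) (use step Bl in \<open>auto simp: clause_neg_def blank_def\<close>)
    then show ?case using step by (simp add: clause_pos_def blank_def)
  qed
  let ?ws = "[x, w]"
  note rw = run_wf[OF wf(1), of ?ws]
  have init: "head_at M ?ws 0 i = 0" "cell_at M ?ws 0 i = word_contents (if i < 2 then ?ws ! i else [])"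
    if "i < num_tapes M" for i
    using that by (auto simp: head_at_def cell_at_def run_tm_def init_config_def)
  have pos: "nat (int (T + 1) + h) < B" "1 \<le> nat (int (T + 1) + h)" "nat (int (T + 1) + h) \<le> 2 * T + 1"
    "int (nat (int (T + 1) + h)) - int (T + 1) = h"
    if "\<bar>h\<bar> \<le> int t" "t \<le> T" for h t
    using that Bl by auto
  have inv: "v (state_fact B t (state_at M ?ws t)) \<and>
     (\<forall>i<num_tapes M. v (head_fact B t i (nat (int (T + 1) + head_at M ?ws t i))) \<and>
       (\<forall>z<B. v (cell_fact B t i z (cell_at M ?ws t i (int z - int (T + 1))))))" if "t \<le> T" for t
    using that
  proof (induction t)
    case 0
    have "\<exists>c. clause_pos M x T P B 1 0 0 0 0 0 0 c \<and> v c"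
      by (rule D) (use Bl in \<open>auto simp: clause_neg_def\<close>)
    then have "v (state_fact B 0 (start_state M))" by (simp add: clause_pos_def)
    moreover have "v (head_fact B 0 i (T + 1))" if i: "i < num_tapes M" for i
    proof -
      have "\<exists>c. clause_pos M x T P B 2 0 0 0 i 0 0 c \<and> v c"
        by (rule D) (use Bl i in \<open>auto simp: clause_neg_def\<close>)
      then show ?thesis using i by (simp add: clause_pos_def)
    qed
    moreover have "v (cell_fact B 0 i z (word_contents (if i < 2 then ?ws ! i else []) (int z - int (T + 1))))"
      if i: "i < num_tapes M" and z: "z < B" for i z
    proof (cases "i = 1")
      case False
      have "\<exists>c. clause_pos M x T P B 3 0 0 0 i z 0 c \<and> v c"
        by (rule D) (use Bl i z in \<open>auto simp: clause_neg_def\<close>)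
      then have "v (cell_fact B 0 i z (input_sym x T i z))" using i False by (simp add: clause_pos_def)
      moreover have "input_sym x T i z = word_contents (if i < 2 then ?ws ! i else []) (int z - int (T + 1))"
        using False by (auto simp: input_sym_def word_contents_def nat_diff_distrib' nat_less_iff numeral_2_eq_2 less_Suc_eq
            algebra_simps of_nat_diff split: if_splits) (auto simp: nat_diff_distrib nat_add_distrib)
      ultimately show ?thesis by simp
    next
      case True
      have cl: "\<exists>c. clause_pos M x T P B 4 0 0 0 0 z 0 c \<and> v c"
        by (rule D) (use Bl z in \<open>auto simp: clause_neg_def\<close>)
      show ?thesis
      proof (cases "T + 1 \<le> z \<and> z < T + 1 + L")
        case in_w: True
        then obtain j where j: "z = T + 1 + j" "j < L" using le_Suc_ex by (metis add_less_cancel_left)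
        have "v (cell_fact B 0 1 z 1) \<or> v (cell_fact B 0 1 z 2)"
          using cl notblank[OF j(2)] by (auto simp: clause_pos_def blank_def j(1))
        moreover have "word_contents w (int z - int (T + 1)) = (if v (cell_fact B 0 1 z 2) then 2 else 1)"
          using j by (simp add: word_contents_def w_def)
        ultimately show ?thesis using True by auto
      next
        case out_w: False
        have "v (cell_fact B 0 1 z 0)"
        proof (cases "T + 1 \<le> z \<and> z < T + 1 + P")
          case True
          then obtain j where j: "z = T + 1 + j" "j < P" using le_Suc_ex by (metis add_less_cancel_left)
          with out_w have "L \<le> j" by auto
          from blank[OF this j(2)] show ?thesis by (simp add: blank_def j(1))
        next
          case False
          then show ?thesis using cl by (auto simp: clause_pos_def)
        qed
        moreover have "word_contents w (int z - int (T + 1)) = 0"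
          using out_w by (auto simp: word_contents_def w_def)
        ultimately show ?thesis using True by simp
      qed
    qed
    ultimately show ?case
      by (simp add: init state_at_def run_tm_def init_config_def nat_add_distrib)
  next
    case (Suc t)
    then have t: "t < T" "t \<le> T" "t < B" "Suc t < B" using Bl by auto
    note IH = Suc.IH[OF t(2)]
    let ?q = "state_at M ?ws t"
    let ?h = "\<lambda>i. nat (int (T + 1) + head_at M ?ws t i)"
    have q: "?q < num_states M" "?q < B" using rw[of t] Bl by auto
    have h: "\<bar>head_at M ?ws t i\<bar> \<le> int t" if "i < num_tapes M" for i using rw[of t] that by blast
    note hp = pos[OF h t(2)]
    have sym: "cell_at M ?ws t i z < B" if "i < num_tapes M" for i z
      using rw[of t] that Bl(2) by (meson less_trans)
    obtain \<sigma> where \<sigma>: "\<sigma> < card (tuples M)"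
      "\<And>i. i < num_tapes M \<Longrightarrow> tuple_sym M \<sigma> i = scan_at M ?ws t i"
      "state_at M ?ws (Suc t) = next_state M ?q \<sigma>"
      "\<And>i. i < num_tapes M \<Longrightarrow> head_at M ?ws (Suc t) i = head_at M ?ws t i + int (moved M ?q \<sigma> i) - 1"
      "\<And>i. i < num_tapes M \<Longrightarrow> cell_at M ?ws (Suc t) i = (cell_at M ?ws t i)(head_at M ?ws t i := written M ?q \<sigma> i)"
      using run_step[OF wf(1)] by blast
    have \<sigma>B: "\<sigma> < B" using \<sigma>(1) Bl(4) by simp
    have scan: "v (scan_fact B t i (scan_at M ?ws t i))" if i: "i < num_tapes M" for i
    proof -
      have "v (cell_fact B t i (?h i) (scan_at M ?ws t i))"
        using IH i hp[OF i] by (metis scan_at_def)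
      then have "\<exists>c. clause_pos M x T P B 7 t 0 0 i (?h i) (scan_at M ?ws t i) c \<and> v c"
        using IH i
        by (intro D) (use Bl t hp[OF i] sym[OF i] in \<open>auto simp: clause_neg_def scan_at_def\<close>)
      then show ?thesis using i t by (simp add: clause_pos_def)
    qed
    have prem: "v c" if "step_premise M B t ?q \<sigma> c" for c
      using that IH scan \<sigma>(2) unfolding step_premise_def by auto
    have "\<exists>c. clause_pos M x T P B 8 t ?q \<sigma> 0 0 0 c \<and> v c"
      by (rule D) (use Bl t q \<sigma>B prem in \<open>auto simp: clause_neg_def\<close>)
    then have 1: "v (state_fact B (Suc t) (state_at M ?ws (Suc t)))"
      using t q \<sigma> by (simp add: clause_pos_def)
    have 2: "v (head_fact B (Suc t) i (nat (int (T + 1) + head_at M ?ws (Suc t) i)))"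
      if i: "i < num_tapes M" for i
    proof -
      have "\<exists>c. clause_pos M x T P B 10 t ?q \<sigma> i (?h i) 0 c \<and> v c"
        by (rule D) (use Bl t q \<sigma>B prem i hp[OF i] IH in \<open>auto simp: clause_neg_def\<close>)
      then have "v (head_fact B (Suc t) i (?h i + moved M ?q \<sigma> i - 1))"
        using t q \<sigma>(1) hp[OF i] i by (simp add: clause_pos_def)
      moreover have "?h i + moved M ?q \<sigma> i - 1 = nat (int (T + 1) + head_at M ?ws (Suc t) i)"
        using hp[OF i] \<sigma>(4)[OF i] by linarith
      ultimately show ?thesis by simp
    qed
    have 3: "v (cell_fact B (Suc t) i z (cell_at M ?ws (Suc t) i (int z - int (T + 1))))"
      if i: "i < num_tapes M" and z: "z < B" for i z
    proof (cases "z = ?h i")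
      case True
      have "\<exists>c. clause_pos M x T P B 9 t ?q \<sigma> i (?h i) 0 c \<and> v c"
        by (rule D) (use Bl t q \<sigma>B prem i hp[OF i] IH in \<open>auto simp: clause_neg_def\<close>)
      then have "v (cell_fact B (Suc t) i (?h i) (written M ?q \<sigma> i))"
        using t q \<sigma>(1) hp[OF i] i by (simp add: clause_pos_def)
      then show ?thesis using True hp[OF i] \<sigma>(5)[OF i] by simp
    next
      case False
      \<comment> \<open>Family 11 leaves open that the head is at \<open>z\<close>. Family 6, with
        the real head position passed as parameter \<open>a\<close>, rules this out.\<close>
      have nh: "\<not> v (head_fact B t i z)"
      proof
        assume "v (head_fact B t i z)"
        then have "\<exists>c. clause_pos M x T P B 6 t 0 0 i z (?h i) c \<and> v c"
          by (intro D) (use Bl t i z hp[OF i] IH in \<open>auto simp: clause_neg_def\<close>)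
        then show False using t i False by (simp add: clause_pos_def)
      qed
      have ne: "int z - int (T + 1) \<noteq> head_at M ?ws t i" using False hp(4)[OF i] by auto
      let ?a = "cell_at M ?ws t i (int z - int (T + 1))"
      have "v (cell_fact B t i z ?a)" using IH i z by blast
      then have "\<exists>c. clause_pos M x T P B 11 t 0 0 i z ?a c \<and> v c"
        by (intro D) (use Bl t i z sym[OF i] in \<open>auto simp: clause_neg_def\<close>)
      then have "v (cell_fact B (Suc t) i z ?a)" using t i nh by (auto simp: clause_pos_def)
      then show ?thesis using ne \<sigma>(5)[OF i] by simp
    qed
    show ?case using 1 2 3 by blast
  qed
  have "state_at M ?ws T = accept_state M"
  proof (rule ccontr)
    assume n: "state_at M ?ws T \<noteq> accept_state M"
    have q: "state_at M ?ws T < num_states M" using rw by blast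
    have "v (state_fact B T (state_at M ?ws T))" using inv[of T] by blast
    then have "\<exists>c. clause_pos M x T P B 12 0 (state_at M ?ws T) 0 0 0 0 c \<and> v c"
      by (intro D) (use Bl q in \<open>auto simp: clause_neg_def\<close>)
    then show False using n q by (simp add: clause_pos_def)
  qed
  moreover have "length w \<le> P" using L by (simp add: w_def)
  ultimately show ?thesis by blast
qed


section \<open>From an accepting run to a satisfying valuation\<close>

lemma tuple_eqI:
  assumes "wf_tm M" "\<sigma> < card (tuples M)" "\<tau> < card (tuples M)"
    "\<And>i. i < num_tapes M \<Longrightarrow> tuple_sym M \<sigma> i = tuple_sym M \<tau> i"
  shows "tuple M \<sigma> = tuple M \<tau>"
  using assms tuple_mem[OF assms(1), of \<sigma>] tuple_mem[OF assms(1), of \<tau>]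
  by (intro nth_equalityI) (auto simp: tuples_def tuple_sym_def table2_def)

text \<open>The valuation makes the facts of the run true, together with all codes whose lowest
  digit is 0, among them the dummy variable. If a clause were violated, all its premises would hold
  in the run, hence also its conclusion.\<close>

lemma accepts_imp_tableau:
  assumes wf: "wf_tm M" "2 \<le> num_tapes M" and w: "length w \<le> P"
    and acc: "state_at M [x, w] T = accept_state M"
  shows "\<exists>v. tableau M x T P v"
proof -
  define B where "B = base M T P"
  have Bl: "num_tapes M < B" "num_symbols M < B" "num_states M < B" "card (tuples M) < B" "2 * T + P + 20 \<le> B"
    unfolding B_def base_def by auto
  let ?ws = "[x, w]"
  note rw = run_wf[OF wf(1), of ?ws]
  define H where "H = (\<lambda>t i. nat (int (T + 1) + head_at M ?ws t i))"
  define C where "C = (\<lambda>t i z. cell_at M ?ws t i (int z - int (T + 1)))"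
  define v where "v = (\<lambda>c. digit B 0 c = 0 \<or>
    digit B 0 c = 1 \<and> digit B 4 c = state_at M ?ws (digit B 1 c) \<or>
    digit B 0 c = 2 \<and> digit B 3 c = H (digit B 1 c) (digit B 2 c) \<or>
    digit B 0 c = 3 \<and> digit B 4 c = C (digit B 1 c) (digit B 2 c) (digit B 3 c) \<or>
    digit B 0 c = 4 \<and> digit B 4 c = scan_at M ?ws (digit B 1 c) (digit B 2 c))"
  have v0: "v 0" by (simp add: v_def digit_def)
  have k: "(1 :: nat) < B" "(2 :: nat) < B" "(3 :: nat) < B" "(4 :: nat) < B" "0 < B" using Bl by auto
  have vs: "v (state_fact B t q) \<longleftrightarrow> q = state_at M ?ws t"
    and vh: "v (head_fact B t i z) \<longleftrightarrow> z = H t i"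
    and vc: "v (cell_fact B t i z a) \<longleftrightarrow> a = C t i z"
    and vr: "v (scan_fact B t i a) \<longleftrightarrow> a = scan_at M ?ws t i"
    if "t < B" "i < B" "z < B" "a < B" "q < B" for t i z a q
    using that k unfolding v_def by (simp_all add: tableau_var_digits del: One_nat_def)
  have H: "1 \<le> H t i" "H t i \<le> 2 * T + 1" "int (H t i) = int (T + 1) + head_at M ?ws t i" "H t i < B"
    if "t \<le> T" "i < num_tapes M" for t i
    using rw[of t] that Bl(5) unfolding H_def by auto
  have C: "C t i z < num_symbols M" "C t i z < B" if "i < num_tapes M" for t i z
    using rw[of t] that Bl(2) unfolding C_def by (auto intro: less_trans)
  have S: "scan_at M ?ws t i = C t i (H t i)" if "t \<le> T" "i < num_tapes M" for t i
    unfolding scan_at_def C_def using H(3)[OF that] by simp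
  have Q: "state_at M ?ws t < num_states M" "state_at M ?ws t < B" for t using rw[of t] Bl(3) by auto
  have C0: "C 0 i z = word_contents (if i < 2 then ?ws ! i else []) (int z - int (T + 1))"
    and H0: "H 0 i = T + 1" if "i < num_tapes M" for i z
    using that by (auto simp: C_def H_def head_at_def cell_at_def run_tm_def init_config_def nat_add_distrib)
  have nxt: "next_state M q \<sigma> = state_at M ?ws (Suc t)"
    "i < num_tapes M \<Longrightarrow> C (Suc t) i z = (if z = H t i then written M q \<sigma> i else C t i z)"
    "i < num_tapes M \<Longrightarrow> H (Suc t) i = H t i + moved M q \<sigma> i - 1"
    if "t < T" "q = state_at M ?ws t" "\<sigma> < card (tuples M)"
      "\<And>j. j < num_tapes M \<Longrightarrow> tuple_sym M \<sigma> j = scan_at M ?ws t j" for t q \<sigma> i z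
  proof -
    obtain \<tau> where \<tau>: "\<tau> < card (tuples M)"
      "\<And>i. i < num_tapes M \<Longrightarrow> tuple_sym M \<tau> i = scan_at M ?ws t i"
      "state_at M ?ws (Suc t) = next_state M (state_at M ?ws t) \<tau>"
      "\<And>i. i < num_tapes M \<Longrightarrow> head_at M ?ws (Suc t) i = head_at M ?ws t i + int (moved M (state_at M ?ws t) \<tau> i) - 1"
      "\<And>i. i < num_tapes M \<Longrightarrow> cell_at M ?ws (Suc t) i = (cell_at M ?ws t i)(head_at M ?ws t i := written M (state_at M ?ws t) \<tau> i)"
      using run_step[OF wf(1)] by blast
    have "tuple M \<sigma> = tuple M \<tau>" using tuple_eqI[OF wf(1) that(3) \<tau>(1)] that(4) \<tau>(2) by simp
    then have e: "next_state M q \<tau> = next_state M q \<sigma>" "moved M q \<tau> i = moved M q \<sigma> i" "written M q \<tau> i = written M q \<sigma> i" for i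
      using that(3) \<tau>(1) by (simp_all add: next_state_def moved_def written_def table2_def table3_def)
    show "next_state M q \<sigma> = state_at M ?ws (Suc t)" using \<tau>(3) e that(2) by simp
    assume i: "i < num_tapes M"
    have t: "t \<le> T" "Suc t \<le> T" using that(1) by auto
    show "H (Suc t) i = H t i + moved M q \<sigma> i - 1"
      using H(3)[OF t(1) i] H(3)[OF t(2) i] H(1)[OF t(1) i] \<tau>(4)[OF i, folded that(2), unfolded e(2)] by linarith
    have "int z - int (T + 1) = head_at M ?ws t i \<longleftrightarrow> z = H t i" using H(3)[OF t(1) i] by linarith
    then show "C (Suc t) i z = (if z = H t i then written M q \<sigma> i else C t i z)"
      using \<tau>(5)[OF i] e(3)[of i] that(2) by (simp add: C_def)
  qed
  have bound: "next_state M q \<sigma> < B" "i < num_tapes M \<Longrightarrow> written M q \<sigma> i < B" "moved M q \<sigma> i \<le> 2"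
    if "q < num_states M" "\<sigma> < card (tuples M)" for q \<sigma> i
  proof -
    have "nat (offset m + 1) \<le> 2" for m by (cases m) auto
    then show "moved M q \<sigma> i \<le> 2" by (simp add: moved_def table3_def table2_def del: nat_le_iff)
    show "next_state M q \<sigma> < B"
      using delta_wf(1)[OF wf(1) that(1) tuple_mem[OF wf(1)]] Bl(3) that
      by (auto simp: next_state_def table2_def intro: less_trans)
    show "written M q \<sigma> i < B" if "i < num_tapes M"
      using delta_wf(3)[OF wf(1) \<open>q < num_states M\<close> tuple_mem[OF wf(1)] that] Bl(2) that \<open>q < num_states M\<close> \<open>\<sigma> < card (tuples M)\<close>
      by (auto simp: written_def table3_def table2_def intro: less_trans)
  qed
  have "holds v (B ^ 5) (clause_pos M x T P B f t q \<sigma> i z a) (clause_neg M T P B f t q \<sigma> i z a)"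
    if d: "t < B" "q < B" "\<sigma> < B" "i < B" "z < B" "a < B" for f t q \<sigma> i z a
  proof (rule ccontr)
    let ?pos = "clause_pos M x T P B f t q \<sigma> i z a" and ?neg = "clause_neg M T P B f t q \<sigma> i z a"
    assume "\<not> holds v (B ^ 5) ?pos ?neg"
    then have n: "\<And>c. c < B ^ 5 \<Longrightarrow> ?pos c \<Longrightarrow> \<not> v c" and p: "\<And>c. c < B ^ 5 \<Longrightarrow> ?neg c \<Longrightarrow> v c"
      unfolding holds_def by blast+
    have n0: "\<not> ?pos 0" using n[of 0] v0 k(5) by auto
    have ns: "\<not> ?pos (state_fact B u b)" if "u < B" "b < B" "b = state_at M ?ws u" for u b
      using n[of "state_fact B u b"] vs[of u 0 0 0 b] that k tableau_var_less[of 1 B u 0 0 b] by auto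
    have nh: "\<not> ?pos (head_fact B u j y)" if "u < B" "j < B" "y < B" "y = H u j" for u j y
      using n[of "head_fact B u j y"] vh[of u j y 0 0] that k tableau_var_less[of 2 B u j y 0] by auto
    have nc: "\<not> ?pos (cell_fact B u j y b)" if "u < B" "j < B" "y < B" "b < B" "b = C u j y" for u j y b
      using n[of "cell_fact B u j y b"] vc[of u j y b 0] that k tableau_var_less[of 3 B u j y b] by auto
    have nr: "\<not> ?pos (scan_fact B u j b)" if "u < B" "j < B" "b < B" "b = scan_at M ?ws u j" for u j b
      using n[of "scan_fact B u j b"] vr[of u j 0 b 0] that k tableau_var_less[of 4 B u j 0 b] by auto
    have ps: "b = state_at M ?ws u" if "?neg (state_fact B u b)" "u < B" "b < B" for u b
      using p[OF _ that(1)] vs[of u 0 0 0 b] that k tableau_var_less[of 1 B u 0 0 b] by auto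
    have ph: "y = H u j" if "?neg (head_fact B u j y)" "u < B" "j < B" "y < B" for u j y
      using p[OF _ that(1)] vh[of u j y 0 0] that k tableau_var_less[of 2 B u j y 0] by auto
    have pc: "b = C u j y" if "?neg (cell_fact B u j y b)" "u < B" "j < B" "y < B" "b < B" for u j y b
      using p[OF _ that(1)] vc[of u j y b 0] that k tableau_var_less[of 3 B u j y b] by auto
    have pr: "b = scan_at M ?ws u j" if "?neg (scan_fact B u j b)" "u < B" "j < B" "b < B" for u j b
      using p[OF _ that(1)] vr[of u j 0 b 0] that k tableau_var_less[of 4 B u j 0 b] by auto
    have sym: "tuple_sym M \<sigma> j < B" for j
    proof -
      have "tuple M \<sigma> ! j < num_symbols M" if "j < num_tapes M"
        using tuple_mem[OF wf(1), of \<sigma>] that by (metis (mono_tags, lifting) lessThan_iff mem_Collect_eq nth_mem subsetD tuples_def)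
      then show ?thesis using Bl(2) k(5) by (auto simp: tuple_sym_def table2_def intro: less_trans)
    qed
    have prem: "q = state_at M ?ws t \<and> (\<forall>j<num_tapes M. tuple_sym M \<sigma> j = scan_at M ?ws t j)"
      if "f = 8 \<or> f = 9 \<or> f = 10"
    proof -
      have "?neg (state_fact B t q)" "\<And>j. j < num_tapes M \<Longrightarrow> ?neg (scan_fact B t j (tuple_sym M \<sigma> j))"
        using that by (auto simp: clause_neg_def step_premise_def)
      then show ?thesis using ps[of t q] pr[of t _ "tuple_sym M \<sigma> _"] d sym Bl(1) by auto
    qed
    have tt: "t < B" "Suc t < B" if "t < T" using that Bl by auto
    have iB: "i < B" by (rule d)
    consider "f = 1" | "f = 2" | "f = 3" | "f = 4" | "f = 5" | "f = 6" | "f = 7" | "f = 8" | "f = 9" | "f = 10"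
      | "f = 11" | "f = 12" | "f = 0 \<or> f > 12" by atomize_elim presburger
    then show False
    proof cases
      case 1
      have "start_state M = state_at M ?ws 0" by (simp add: state_at_def run_tm_def init_config_def)
      then show False using ns[of 0 "start_state M"] 1 Q[of 0] k by (auto simp: clause_pos_def)
    next
      case 2
      then have i: "i < num_tapes M" using n0 by (auto simp: clause_pos_def split: if_splits)
      then show False using nh[of 0 i "T + 1"] 2 H0[OF i] Bl d by (auto simp: clause_pos_def)
    next
      case 3
      then have i: "i < num_tapes M" "i \<noteq> 1" using n0 by (auto simp: clause_pos_def split: if_splits)
      have "input_sym x T i z = C 0 i z"
        unfolding C0[OF i(1)]
        using i(2) by (auto simp: input_sym_def word_contents_def nat_diff_distrib' nat_less_iff numeral_2_eq_2 less_Suc_eq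
            algebra_simps of_nat_diff split: if_splits) (auto simp: nat_diff_distrib nat_add_distrib)
      then show False using nc[of 0 i z "input_sym x T i z"] 3 i d C[OF i(1), of 0 z] k by (auto simp: clause_pos_def)
    next
      case 4
      have i: "1 < num_tapes M" using wf by simp
      have cz: "C 0 1 z = word_contents w (int z - int (T + 1))" using C0[OF i, of z] by simp
      consider "C 0 1 z = 0" | "C 0 1 z \<in> {1, 2}" "T + 1 \<le> z" "z < T + 1 + P"
        using w unfolding cz by (force simp: word_contents_def split: if_splits)
      then show False
      proof cases
        case 1
        then show False using nc[of 0 1 z 0] 4 d k by (auto simp: clause_pos_def)
      next
        case 2
        then show False using nc[of 0 1 z 1] nc[of 0 1 z 2] 4 d k by (auto simp: clause_pos_def)
      qed
    next
      case 5
      then have z: "T + 1 \<le> z" "z + 1 < T + 1 + P" using n0 by (auto simp: clause_pos_def split: if_splits)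
      have i: "1 < num_tapes M" using wf by simp
      have "?neg (cell_fact B 0 1 z 0)" using 5 by (simp add: clause_neg_def)
      then have "0 = C 0 1 z" by (rule pc) (use d k in auto)
      then have "length w \<le> z - (T + 1)"
        using C0[OF i, of z] z by (auto simp: word_contents_def split: if_splits)
      then have "0 = C 0 1 (z + 1)" using C0[OF i, of "z + 1"] z by (auto simp: word_contents_def)
      then show False using nc[of 0 1 "z + 1" 0] 5 z d k Bl by (auto simp: clause_pos_def)
    next
      case 6
      then have g: "t \<le> T" "i < num_tapes M" "z \<noteq> a" using n0 by (auto simp: clause_pos_def split: if_splits)
      then show False using ph[of t i z] ph[of t i a] 6 d by (auto simp: clause_neg_def)
    next
      case 7
      then have g: "t \<le> T" "i < num_tapes M" using n0 by (auto simp: clause_pos_def split: if_splits)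
      have "z = H t i" "a = C t i z"
        using ph[of t i z] pc[of t i z a] 7 d by (auto simp: clause_neg_def)
      then have "a = scan_at M ?ws t i" using S[OF g] by simp
      then show False using nr[of t i a] 7 g d by (auto simp: clause_pos_def)
    next
      case 8
      then have g: "t < T" "q < num_states M" "\<sigma> < card (tuples M)" using n0 by (auto simp: clause_pos_def split: if_splits)
      have "next_state M q \<sigma> = state_at M ?ws (Suc t)" using nxt(1)[OF g(1) _ g(3)] prem 8 by blast
      then show False using ns[of "Suc t" "next_state M q \<sigma>"] bound(1)[OF g(2,3)] tt[OF g(1)] 8 g by (auto simp: clause_pos_def)
    next
      case 9
      then have g: "t < T" "q < num_states M" "\<sigma> < card (tuples M)" "i < num_tapes M"
        using n0 by (auto simp: clause_pos_def split: if_splits)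
      have "z = H t i" using ph[of t i z] 9 d by (auto simp: clause_neg_def)
      then have "written M q \<sigma> i = C (Suc t) i z" using nxt(2)[OF g(1) _ g(3) _ g(4), of q z] prem 9 by auto
      then show False using nc[of "Suc t" i z "written M q \<sigma> i"] bound(2)[OF g(2,3,4)] tt[OF g(1)] 9 g d
        by (auto simp: clause_pos_def)
    next
      case 10
      then have g: "t < T" "q < num_states M" "\<sigma> < card (tuples M)" "i < num_tapes M" "1 \<le> z" "z \<le> 2 * T + 1"
        using n0 by (auto simp: clause_pos_def split: if_splits)
      have "z = H t i" using ph[of t i z] 10 d by (auto simp: clause_neg_def)
      then have "z + moved M q \<sigma> i - 1 = H (Suc t) i" using nxt(3)[OF g(1) _ g(3) _ g(4), of q] prem 10 by auto
      moreover have "z + moved M q \<sigma> i - 1 < B" using bound(3)[OF g(2,3), of i] g Bl by linarith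
      ultimately show False using nh[of "Suc t" i "z + moved M q \<sigma> i - 1"] tt[OF g(1)] 10 g d
        by (auto simp: clause_pos_def)
    next
      case 11
      then have g: "t < T" "i < num_tapes M" using n0 by (auto simp: clause_pos_def split: if_splits)
      have a: "a = C t i z" using pc[of t i z a] 11 d by (auto simp: clause_neg_def)
      have "z \<noteq> H t i" using nh[of t i z] 11 g d by (auto simp: clause_pos_def)
      \<comment> \<open>Family 11 names no transition; the number of the scanned tuple is supplied
        here in order to apply the facts about one step.\<close>
      obtain \<tau> where \<tau>: "\<tau> < card (tuples M)" "\<And>i. i < num_tapes M \<Longrightarrow> tuple_sym M \<tau> i = scan_at M ?ws t i"
        by (rule run_step[OF wf(1), where ws = ?ws and t = t], rule that) auto
      have "a = C (Suc t) i z"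
        using nxt(2)[OF g(1) refl \<tau> g(2), of z] \<open>z \<noteq> H t i\<close> a by simp
      moreover have "?pos (cell_fact B (Suc t) i z a)" using 11 g by (simp add: clause_pos_def)
      ultimately show False using nc[of "Suc t" i z a] d tt[OF g(1)] by blast
    next
      case 12
      then have g: "q \<noteq> accept_state M" using n0 by (auto simp: clause_pos_def split: if_splits)
      have "q = state_at M ?ws T" using ps[of T q] 12 d Bl by (auto simp: clause_neg_def)
      with g acc show False by simp
    next
      case 13
      then show False using n0 by (auto simp: clause_pos_def)
    qed
  qed
  then show ?thesis unfolding tableau_def Let_def B_def[symmetric] by blast
qed

text \<open>The seven digits of a row number are the family and its six parameters, and the five
  digits of a column number describe a fact; hence \<open>B ^ 7\<close> rows and
  \<open>B ^ 5\<close> columns. As \<open>B\<close> is at least 20, \<open>6 \<le> m\<close> and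
  \<open>2 \<le> n\<close> come for free; the size estimates for \<open>k \<ge> 3\<close> use the
  former, the chains of cells for two labels the latter.\<close>

theorem Cook_Levin:
  assumes "A \<in> NP"
  obtains m n pos neg where
    "definable (\<lambda>x w e. m x)" "definable (\<lambda>x w e. n x)"
    "definable_pred (\<lambda>x w e. pos x (e 0) (e 1))" "definable_pred (\<lambda>x w e. neg x (e 0) (e 1))"
    "\<And>x. 6 \<le> m x" "\<And>x. 2 \<le> n x" "\<And>x. x \<in> A \<longleftrightarrow> satisfiable (m x) (n x) (pos x) (neg x)"
proof -
  obtain M and p q :: "nat poly" where M: "wf_tm M" "2 \<le> num_tapes M"
    "\<And>x w. length w \<le> poly p (length x) \<Longrightarrow> halts_within M [x, w] (poly q (length x))"
    "\<And>x. x \<in> A \<longleftrightarrow> (\<exists>w. length w \<le> poly p (length x) \<and> accepts M [x, w])"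
    using assms unfolding NP_def by blast
  define T where "T = (\<lambda>x :: bool list. poly q (length x))"
  define P where "P = (\<lambda>x :: bool list. poly p (length x))"
  define B where "B = (\<lambda>x. base M (T x) (P x))"
  define pos where "pos = (\<lambda>x r. clause_pos M x (T x) (P x) (B x) (digit (B x) 0 r) (digit (B x) 1 r) (digit (B x) 2 r)
    (digit (B x) 3 r) (digit (B x) 4 r) (digit (B x) 5 r) (digit (B x) 6 r))"
  define neg where "neg = (\<lambda>x r. clause_neg M (T x) (P x) (B x) (digit (B x) 0 r) (digit (B x) 1 r) (digit (B x) 2 r)
    (digit (B x) 3 r) (digit (B x) 4 r) (digit (B x) 5 r) (digit (B x) 6 r))"
  have dT: "definable (\<lambda>x w e. T x)" and dP: "definable (\<lambda>x w e. P x)"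
    unfolding T_def P_def by (intro definable_poly definable_length_input)+
  then have dB: "definable (\<lambda>x w e. B x)"
    unfolding B_def base_def by (intro definable_add definable_mult definable_const)
  have B20: "20 \<le> B x" for x by (simp add: B_def base_def)
  have Bx: "base M (T x) (P x) = B x" for x by (simp add: B_def)
  have acc: "accepts M [x, w] \<longleftrightarrow> state_at M [x, w] (T x) = accept_state M" if "length w \<le> P x" for x w
  proof
    assume "accepts M [x, w]"
    then obtain t where t: "fst (run_tm M [x, w] t) = accept_state M" unfolding accepts_def by blast
    have "run_tm M [x, w] (max t (T x)) = run_tm M [x, w] t"
      by (rule run_tm_stable) (auto simp: t halting_def)
    moreover have "run_tm M [x, w] (max t (T x)) = run_tm M [x, w] (T x)"
      by (rule run_tm_stable) (use M(3)[of w x] that in \<open>auto simp: halts_within_def T_def P_def\<close>)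
    ultimately show "state_at M [x, w] (T x) = accept_state M" using t by (simp add: state_at_def)
  next
    assume "state_at M [x, w] (T x) = accept_state M"
    then show "accepts M [x, w]" unfolding accepts_def state_at_def by blast
  qed
  have "x \<in> A \<longleftrightarrow> (\<exists>w. length w \<le> P x \<and> state_at M [x, w] (T x) = accept_state M)" for x
    using M(4) acc by (auto simp: P_def)
  also have "\<dots> x \<longleftrightarrow> (\<exists>v. tableau M x (T x) (P x) v)" for x
    using tableau_imp_accepts[OF M(1,2)] accepts_imp_tableau[OF M(1,2)] by blast
  also have "\<dots> x \<longleftrightarrow> satisfiable (B x ^ 7) (B x ^ 5) (pos x) (neg x)" for x
  proof -
    have "tableau M x (T x) (P x) v \<longleftrightarrow> (\<forall>r<B x ^ 7. holds v (B x ^ 5) (pos x r) (neg x r))" (is "?l \<longleftrightarrow> ?r") for v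
    proof
      assume ?l
      then show ?r
        unfolding tableau_def Let_def Bx pos_def neg_def
        using digit_less[of "B x"] B20[of x] by simp
    next
      assume r: ?r
      show ?l
        unfolding tableau_def Let_def Bx
      proof (intro allI impI)
        fix f t q \<sigma> i z a assume d: "f < B x" "t < B x" "q < B x" "\<sigma> < B x" "i < B x" "z < B x" "a < B x"
        let ?r = "f + B x * (t + B x * (q + B x * (\<sigma> + B x * (i + B x * (z + B x * a)))))"
        have "?r < B x ^ 7" using d by (simp add: numeral_eq_Suc mixed_radix_less)
        with r have "holds v (B x ^ 5) (pos x ?r) (neg x ?r)" by blast
        then show "holds v (B x ^ 5) (clause_pos M x (T x) (P x) (B x) f t q \<sigma> i z a)
            (clause_neg M (T x) (P x) (B x) f t q \<sigma> i z a)"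
          using d by (simp add: pos_def neg_def numeral_eq_Suc)
      qed
    qed
    then show ?thesis unfolding satisfiable_def holds_def by simp
  qed
  finally have sat: "x \<in> A \<longleftrightarrow> satisfiable (B x ^ 7) (B x ^ 5) (pos x) (neg x)" for x .
  have pw: "20 \<le> B x ^ Suc k" for x k
    by (rule order_trans[OF B20 self_le_power]) (use B20[of x] in auto)
  show ?thesis
  proof (rule that[of "\<lambda>x. B x ^ 7" "\<lambda>x. B x ^ 5" pos neg])
    show "definable (\<lambda>x w e. B x ^ 7)" "definable (\<lambda>x w e. B x ^ 5)" by (rule definable_power[OF dB])+
    show "definable_pred (\<lambda>x w e. pos x (e 0) (e 1))"
      unfolding pos_def using dT dP dB by (intro definable_clause_pos definable_digit definable_var)
    show "definable_pred (\<lambda>x w e. neg x (e 0) (e 1))"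
      unfolding neg_def using dT dP dB by (intro definable_clause_neg definable_digit definable_var)
    show "6 \<le> B x ^ 7" "2 \<le> B x ^ 5" for x using pw[of x 6] pw[of x 4] by simp_all
  qed (rule sat)
qed

section \<open>Encoding graphs by numbers\<close>

definition map_edges :: "('a \<Rightarrow> 'b) \<Rightarrow> 'a set set \<Rightarrow> 'b set set" where
  "map_edges c E = (\<lambda>e. c ` e) ` E"

lemma map_edges_pairs: "map_edges c {{a, b} | a b. R a b} = {{c a, c b} | a b. R a b}"
proof (intro equalityI subsetI)
  fix e assume "e \<in> map_edges c {{a, b} | a b. R a b}"
  then obtain a b where "R a b" "e = c ` {a, b}" unfolding map_edges_def by blast
  then show "e \<in> {{c a, c b} | a b. R a b}" by auto
next
  fix e assume "e \<in> {{c a, c b} | a b. R a b}"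
  then obtain a b where "R a b" "e = c ` {a, b}" by auto
  then show "e \<in> map_edges c {{a, b} | a b. R a b}" unfolding map_edges_def by blast
qed

lemma neighbors_subset: "simple_graph V E \<Longrightarrow> neighbors E v \<subseteq> V"
  by (auto simp: neighbors_def simple_graph_def)

lemma edge_in_graph: "simple_graph V E \<Longrightarrow> {u, v} \<in> E \<Longrightarrow> u \<in> V \<and> v \<in> V \<and> u \<noteq> v"
proof -
  assume "simple_graph V E" "{u, v} \<in> E"
  then have "{u, v} \<subseteq> V" "card {u, v} = 2" by (auto simp: simple_graph_def)
  then show ?thesis by (cases "u = v") auto
qed

context
  fixes V :: "'v set" and E :: "'v set set" and c :: "'v \<Rightarrow> nat" and n :: nat
  assumes g: "simple_graph V E" and inj: "inj_on c V" and img: "c ` V \<subseteq> {..<n}"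
begin

lemma map_edges_iff: "u \<in> V \<Longrightarrow> v \<in> V \<Longrightarrow> {c u, c v} \<in> map_edges c E \<longleftrightarrow> {u, v} \<in> E"
proof
  assume uv: "u \<in> V" "v \<in> V" and "{c u, c v} \<in> map_edges c E"
  then obtain e where e: "e \<in> E" "c ` e = c ` {u, v}" by (auto simp: map_edges_def)
  then have "e \<subseteq> V" using g by (auto simp: simple_graph_def)
  then have "e = {u, v}" using inj_on_image_eq_iff[OF inj, of e "{u, v}"] e(2) uv by simp
  then show "{u, v} \<in> E" using e(1) by simp
next
  assume "{u, v} \<in> E"
  then have "c ` {u, v} \<in> map_edges c E" unfolding map_edges_def by blast
  then show "{c u, c v} \<in> map_edges c E" by simp
qed

lemma map_edgesE:
  assumes "{a, b} \<in> map_edges c E"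
  obtains u v where "u \<in> V" "v \<in> V" "a = c u" "b = c v" "{u, v} \<in> E"
proof -
  obtain e where e: "e \<in> E" "{a, b} = c ` e" using assms by (auto simp: map_edges_def)
  then have s: "e \<subseteq> V" using g by (auto simp: simple_graph_def)
  have "a \<in> c ` e" "b \<in> c ` e" using e(2)[symmetric] by auto
  then obtain u v where uv: "u \<in> e" "v \<in> e" "a = c u" "b = c v" by blast
  have "c ` e = c ` {u, v}" using e(2) uv by simp
  then have "e = {u, v}" using inj_on_image_eq_iff[OF inj, of e "{u, v}"] s uv by auto
  with e(1) show ?thesis using that[of u v] s uv by blast
qed

lemma simple_graph_map: "simple_graph {..<n} (map_edges c E)"
  unfolding simple_graph_def
proof (intro conjI ballI)
  fix e assume "e \<in> map_edges c E"
  then obtain d where d: "d \<in> E" "e = c ` d" by (auto simp: map_edges_def)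
  then have "d \<subseteq> V" "card d = 2" using g by (auto simp: simple_graph_def)
  then show "e \<subseteq> {..<n}" "card e = 2"
    using d(2) img card_image[OF inj_on_subset[OF inj]] by auto
qed simp

lemma neighbors_map: "v \<in> V \<Longrightarrow> neighbors (map_edges c E) (c v) = c ` neighbors E v"
proof (intro equalityI subsetI)
  fix a assume v: "v \<in> V" and "a \<in> neighbors (map_edges c E) (c v)"
  then have "{a, c v} \<in> map_edges c E" by (simp add: neighbors_def)
  then obtain u w where "u \<in> V" "w \<in> V" "a = c u" "c v = c w" "{u, w} \<in> E" by (rule map_edgesE)
  then show "a \<in> c ` neighbors E v" using inj v by (auto simp: neighbors_def dest: inj_onD)
next
  fix a assume v: "v \<in> V" and "a \<in> c ` neighbors E v"
  then obtain u where "a = c u" "{u, v} \<in> E" by (auto simp: neighbors_def)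
  then show "a \<in> neighbors (map_edges c E) (c v)"
    using map_edges_iff[of u v] edge_in_graph[OF g, of u v] by (auto simp: neighbors_def)
qed

lemma proper_coloring_map:
  "proper_coloring (map_edges c E) h \<longleftrightarrow> proper_coloring E (h \<circ> c)"
proof
  assume h: "proper_coloring (map_edges c E) h"
  show "proper_coloring E (h \<circ> c)"
    unfolding proper_coloring_def
  proof (intro allI impI)
    fix u v assume "{u, v} \<in> E"
    then have "{c u, c v} \<in> map_edges c E" using map_edges_iff edge_in_graph[OF g] by blast
    then show "(h \<circ> c) u \<noteq> (h \<circ> c) v" using h by (simp add: proper_coloring_def)
  qed
next
  assume h: "proper_coloring E (h \<circ> c)"
  show "proper_coloring (map_edges c E) h"
    unfolding proper_coloring_def
  proof (intro allI impI)
    fix a b assume "{a, b} \<in> map_edges c E"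
    then obtain u v where "a = c u" "b = c v" "{u, v} \<in> E" by (rule map_edgesE)
    then show "h a \<noteq> h b" using h by (auto simp: proper_coloring_def)
  qed
qed

lemma proper_coloring_cong:
  "(\<And>v. v \<in> V \<Longrightarrow> h v = h' v) \<Longrightarrow> proper_coloring E h \<longleftrightarrow> proper_coloring E h'"
  unfolding proper_coloring_def using edge_in_graph[OF g] by metis

text \<open>Numbers outside the image of \<open>c\<close> are isolated vertices; they receive the
  label 1, which is in range since \<open>1 \<le> k\<close>.\<close>

lemma has_product_labeling_map:
  assumes "1 \<le> k"
  shows "has_product_labeling k {..<n} (map_edges c E) \<longleftrightarrow> has_product_labeling k V E"
proof -
  have pr: "(\<Prod>u\<in>neighbors (map_edges c E) (c v). f u) = (\<Prod>u\<in>neighbors E v. f (c u))" if "v \<in> V" for v and f :: "nat \<Rightarrow> nat"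
    unfolding neighbors_map[OF that] using inj_on_subset[OF inj neighbors_subset[OF g]]
    by (simp add: prod.reindex)
  have eq: "product_labeling k {..<n} (map_edges c E) f \<longleftrightarrow> f ` {..<n} \<subseteq> {1..k} \<and> product_labeling k V E (f \<circ> c)" for f
  proof -
    have "proper_coloring (map_edges c E) (\<lambda>v. \<Prod>u\<in>neighbors (map_edges c E) v. f u) \<longleftrightarrow>
        proper_coloring E (\<lambda>v. \<Prod>u\<in>neighbors E v. f (c u))"
      unfolding proper_coloring_map by (rule proper_coloring_cong) (simp add: pr)
    then show ?thesis using img by (auto simp: product_labeling_def)
  qed
  show ?thesis
  proof
    assume "has_product_labeling k {..<n} (map_edges c E)"
    then show "has_product_labeling k V E" unfolding has_product_labeling_def eq by blast
  next
    assume "has_product_labeling k V E"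
    then obtain f where f: "product_labeling k V E f" unfolding has_product_labeling_def by blast
    define f' where "f' = (\<lambda>a. if a \<in> c ` V then f (inv_into V c a) else 1)"
    have "f v = (f' \<circ> c) v" if "v \<in> V" for v using that inj by (simp add: f'_def)
    then have p: "product_labeling k V E (f' \<circ> c)"
      using product_labeling_cong[OF g, of f "f' \<circ> c" k] f by simp
    have "f' a \<in> {1..k}" for a
    proof (cases "a \<in> c ` V")
      case True
      then have "f (inv_into V c a) \<in> f ` V" by (simp add: inv_into_into)
      then show ?thesis using f True by (auto simp: product_labeling_def f'_def)
    qed (use assms in \<open>simp add: f'_def\<close>)
    then have "product_labeling k {..<n} (map_edges c E) f'" unfolding eq using p by blast
    then show "has_product_labeling k {..<n} (map_edges c E)" unfolding has_product_labeling_def by blast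
  qed
qed

lemma three_colorable_map:
  assumes "c ` V = {..<n}" "three_colorable V E"
  shows "three_colorable {..<n} (map_edges c E)"
proof -
  obtain h :: "'v \<Rightarrow> nat" where h: "h ` V \<subseteq> {1..3}" "proper_coloring E h"
    using assms(2) unfolding three_colorable_def by blast
  have "proper_coloring E ((h \<circ> inv_into V c) \<circ> c) \<longleftrightarrow> proper_coloring E h"
    by (rule proper_coloring_cong) (simp add: inj)
  then have "proper_coloring (map_edges c E) (h \<circ> inv_into V c)"
    using h(2) unfolding proper_coloring_map by simp
  moreover have "(h \<circ> inv_into V c) ` {..<n} \<subseteq> {1..3}"
    using h(1) inv_into_into[of _ c V] unfolding assms(1)[symmetric] by fastforce
  ultimately show ?thesis unfolding three_colorable_def by blast
qed

text \<open>The drawing is pulled back along the inverse of the numbering, which is onto here, so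
  that every number inherits a point.\<close>

lemma planar_map:
  assumes s: "c ` V = {..<n}" and pl: "planar V E"
  shows "planar {..<n} (map_edges c E)"
proof -
  obtain p h where d: "plane_drawing V E p h" using pl unfolding planar_def by blast
  define i where "i = inv_into V c"
  have ic: "i (c v) = v" if "v \<in> V" for v using that inj by (simp add: i_def)
  have bi: "inj_on i {..<n}" "i ` {..<n} = V"
    unfolding i_def s[symmetric] by (auto simp: inj_on_inv_into inj image_image inv_into_into)
  have ie: "i ` c ` e = e" if "e \<in> E" for e
  proof -
    have "e \<subseteq> V" using g that by (auto simp: simple_graph_def)
    then have "i (c v) = v" if "v \<in> e" for v using that ic by blast
    then show ?thesis by (simp add: image_image)
  qed
  have "plane_drawing {..<n} (map_edges c E) (p \<circ> i) (\<lambda>e. h (i ` e))"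
    unfolding plane_drawing_def
  proof (intro conjI ballI impI)
    show "inj_on (p \<circ> i) {..<n}" using d bi by (simp add: plane_drawing_def comp_inj_on)
    fix e assume "e \<in> map_edges c E"
    then obtain e1 where e1: "e1 \<in> E" "e = c ` e1" by (auto simp: map_edges_def)
    have pn: "(p \<circ> i) ` {..<n} = p ` V" using bi(2) by (metis image_comp)
    have ieq: "i ` e = e1" using ie[OF e1(1)] e1(2) by simp
    have D: "arc (h e1) \<and> {pathstart (h e1), pathfinish (h e1)} = p ` e1 \<and> path_image (h e1) \<inter> p ` V = p ` e1"
      using d e1(1) by (simp add: plane_drawing_def)
    have pe: "(p \<circ> i) ` e = p ` e1" using ie[OF e1(1)] e1(2) by (metis image_comp)
    show "arc (h (i ` e))" "{pathstart (h (i ` e)), pathfinish (h (i ` e))} = (p \<circ> i) ` e"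
      "path_image (h (i ` e)) \<inter> (p \<circ> i) ` {..<n} = (p \<circ> i) ` e"
      using D unfolding ieq pn pe by simp_all
    fix e' assume "e' \<in> map_edges c E" and ne: "e \<noteq> e'"
    then obtain e2 where e2: "e2 \<in> E" "e' = c ` e2" by (auto simp: map_edges_def)
    have "e1 \<noteq> e2" using ne e1 e2 by auto
    then have "path_image (h e1) \<inter> path_image (h e2) = p ` (e1 \<inter> e2)"
      using d e1 e2 by (auto simp: plane_drawing_def)
    moreover have "e1 \<subseteq> V" "e2 \<subseteq> V" using g e1 e2 by (auto simp: simple_graph_def)
    then have "c ` (e1 \<inter> e2) = e \<inter> e'" using inj_on_image_Int[OF inj] e1 e2 by simp
    then have "(p \<circ> i) ` (e \<inter> e') = p ` (i ` c ` (e1 \<inter> e2))" by (simp add: image_comp)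
    moreover have "i ` c ` (e1 \<inter> e2) = e1 \<inter> e2"
    proof -
      have "i (c v) = v" if "v \<in> e1 \<inter> e2" for v using that ic \<open>e1 \<subseteq> V\<close> by blast
      then show ?thesis by (simp add: image_image)
    qed
    ultimately show "path_image (h (i ` e)) \<inter> path_image (h (i ` e')) = (p \<circ> i) ` (e \<inter> e')"
      using ie[OF e1(1)] ie[OF e2(1)] e1(2) e2(2) by simp
  qed
  then show ?thesis unfolding planar_def by blast
qed

end

text \<open>Behind the unary prefix, row and column of a matrix bit are quotient and remainder of
  its position by \<open>n\<close>. Computing a graph is thus reduced to an expressible number of
  vertices and an expressible adjacency test.\<close>

lemma poly_time_graph_code:
  assumes "definable (\<lambda>x w e. n x)" "definable_pred (\<lambda>x w e. A x (e 0) (e 1))"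
    and A: "\<And>x u v. u < n x \<Longrightarrow> v < n x \<Longrightarrow> {u, v} \<in> E x \<longleftrightarrow> A x u v"
  shows "poly_time_computable (\<lambda>x. graph_code (n x) (E x))"
proof -
  define b where "b = (\<lambda>x i. i < n x \<or> n x < i \<and> A x ((i - Suc (n x)) div n x) ((i - Suc (n x)) mod n x))"
  have "definable_pred (\<lambda>x w e. b x (e 0))"
    unfolding b_def using assms(1)
    by (intro definable_pred_disj definable_pred_conj definable_pred_less definable_pred_subst2[OF assms(2)]
        definable_div definable_mod definable_diff definable_Suc definable_var)
  moreover have "definable (\<lambda>x w e. n x + 1 + n x * n x)"
    using assms(1) by (intro definable_add definable_mult definable_const)
  ultimately have "poly_time_computable (\<lambda>x. map (b x) [0..<n x + 1 + n x * n x])"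
    by (intro poly_time_definable)
  moreover have "graph_code (n x) (E x) = map (b x) [0..<n x + 1 + n x * n x]" for x
    unfolding graph_code_eq
  proof (rule map_cong[OF refl])
    fix i assume "i \<in> set [0..<n x + 1 + n x * n x]"
    then have i: "i < n x + 1 + n x * n x" by (simp del: upt_Suc)
    have "(i - Suc (n x)) div n x < n x \<and> (i - Suc (n x)) mod n x < n x" if "n x < i"
    proof -
      have "i - Suc (n x) < n x * n x" using i that by linarith
      moreover from this have "0 < n x" by (cases "n x") auto
      ultimately show ?thesis by (simp add: less_mult_imp_div_less)
    qed
    then show "code_bit (n x) (E x) i = b x i" using A by (auto simp: code_bit_def b_def)
  qed
  ultimately show ?thesis by simp
qed

section \<open>Hardness for at least three labels\<close>

text \<open>A clique whose vertices have the same neighbors outside the clique must carry pairwise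
  different labels; with \<open>k\<close> vertices it carries all labels, and its product is \<open>k!\<close>. Each
  variable \<open>j\<close> is such a clique \<open>Lit j l\<close>, in which \<open>l = 0, 1\<close> are the two literals; a literal is true
  if its label is not 1. Each row \<open>i\<close> consists of two such cliques \<open>Plain i\<close> and \<open>Dup i\<close>, completely
  joined, and of a vertex \<open>Free i\<close>; the literals of the row and \<open>Free i\<close> are joined to all of
  \<open>Dup i\<close>, and then the product of their labels must exceed \<open>k\<close>. Every literal outside the row is
  joined to a clique \<open>Pad i j l\<close> instead, so that each row multiplies its color by \<open>k!\<close>.\<close>

datatype lab_vertex =
    Lit nat nat
  | Plain nat nat
  | Dup nat nat
  | Free nat
  | Pad nat nat nat nat

text \<open>The vertex constructors are parameters, so that one formula describes both the abstract
  graph and, with arithmetic codes in their place, the adjacency test evaluated on numbers.\<close>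

definition lab_edge ::
    "(nat \<Rightarrow> nat \<Rightarrow> 'a) \<Rightarrow> (nat \<Rightarrow> nat \<Rightarrow> 'a) \<Rightarrow> (nat \<Rightarrow> nat \<Rightarrow> 'a) \<Rightarrow> (nat \<Rightarrow> 'a) \<Rightarrow>
     (nat \<Rightarrow> nat \<Rightarrow> nat \<Rightarrow> nat \<Rightarrow> 'a) \<Rightarrow> nat \<Rightarrow> nat \<Rightarrow> nat \<Rightarrow> (nat \<Rightarrow> nat \<Rightarrow> nat \<Rightarrow> bool) \<Rightarrow> 'a \<Rightarrow> 'a \<Rightarrow> bool" where
  "lab_edge q p r s d k m n inc a b \<longleftrightarrow>
     (\<exists>j<n. \<exists>l<k. \<exists>l'<k. l \<noteq> l' \<and> a = q j l \<and> b = q j l') \<or>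
     (\<exists>i<m. \<exists>l<k. \<exists>l'<k. l \<noteq> l' \<and> a = p i l \<and> b = p i l') \<or>
     (\<exists>i<m. \<exists>l<k. \<exists>l'<k. l \<noteq> l' \<and> a = r i l \<and> b = r i l') \<or>
     (\<exists>i<m. \<exists>l<k. \<exists>l'<k. a = p i l \<and> b = r i l') \<or>
     (\<exists>i<m. \<exists>l<k. a = r i l \<and> b = s i) \<or>
     (\<exists>i<m. \<exists>h<k. \<exists>j<n. \<exists>l<k. inc i j l \<and> a = r i h \<and> b = q j l) \<or>
     (\<exists>i<m. \<exists>j<n. \<exists>l<k. \<exists>h<k. \<not> inc i j l \<and> a = d i j l h \<and> b = q j l) \<or>
     (\<exists>i<m. \<exists>j<n. \<exists>l<k. \<exists>h<k. \<exists>h'<k. h \<noteq> h' \<and> a = d i j l h \<and> b = d i j l h')"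

definition lab_vertices :: "nat \<Rightarrow> nat \<Rightarrow> nat \<Rightarrow> lab_vertex set" where
  "lab_vertices k m n = {v. case v of Lit j l \<Rightarrow> j < n \<and> l < k | Plain i l \<Rightarrow> i < m \<and> l < k
     | Dup i l \<Rightarrow> i < m \<and> l < k | Free i \<Rightarrow> i < m | Pad i j l h \<Rightarrow> i < m \<and> j < n \<and> l < k \<and> h < k}"

lemma finite_lab_vertices: "finite (lab_vertices k m n)"
proof (rule finite_subset)
  show "lab_vertices k m n \<subseteq>
     (\<lambda>(j, l). Lit j l) ` ({..<n} \<times> {..<k}) \<union> (\<lambda>(i, l). Plain i l) ` ({..<m} \<times> {..<k}) \<union>
     (\<lambda>(i, l). Dup i l) ` ({..<m} \<times> {..<k}) \<union> Free ` {..<m} \<union>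
     (\<lambda>(i, j, l, h). Pad i j l h) ` ({..<m} \<times> {..<n} \<times> {..<k} \<times> {..<k})"
  proof
    fix v assume "v \<in> lab_vertices k m n"
    then show "v \<in> (\<lambda>(j, l). Lit j l) ` ({..<n} \<times> {..<k}) \<union> (\<lambda>(i, l). Plain i l) ` ({..<m} \<times> {..<k}) \<union>
     (\<lambda>(i, l). Dup i l) ` ({..<m} \<times> {..<k}) \<union> Free ` {..<m} \<union>
     (\<lambda>(i, j, l, h). Pad i j l h) ` ({..<m} \<times> {..<n} \<times> {..<k} \<times> {..<k})"
      by (cases v) (auto simp: lab_vertices_def image_iff)
  qed
qed auto

definition lab_edges :: "nat \<Rightarrow> nat \<Rightarrow> nat \<Rightarrow> (nat \<Rightarrow> nat \<Rightarrow> nat \<Rightarrow> bool) \<Rightarrow> lab_vertex set set" where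
  "lab_edges k m n inc = {{a, b} | a b. lab_edge Lit Plain Dup Free Pad k m n inc a b}"

lemma inj_on_labels:
  assumes "inj_on g {..<k}" "\<And>l. l < k \<Longrightarrow> g l \<in> {1..k}"
  shows "g ` {..<k} = {1..k}" "(\<Prod>l<k. g l) = fact k"
proof -
  have "card (g ` {..<k}) = card {1..k}" using assms(1) by (simp add: card_image)
  then show i: "g ` {..<k} = {1..k}" using assms(2) by (intro card_subset_eq) auto
  have "(\<Prod>l<k. g l) = \<Prod>(g ` {..<k})" using assms(1) by (simp add: prod.reindex)
  then show "(\<Prod>l<k. g l) = fact k" unfolding i by (simp add: fact_prod)
qed

text \<open>For twins in a clique, the label times the color is one and the same product
  \<open>C\<close>. Equal labels would therefore give equal colors on an edge.\<close>

lemma clique_labels: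
  fixes g c :: "nat \<Rightarrow> nat"
  assumes "\<And>l. l < k \<Longrightarrow> g l * c l = C" "\<And>l. l < k \<Longrightarrow> g l \<in> {1..k}"
    and "\<And>l l'. l < k \<Longrightarrow> l' < k \<Longrightarrow> l \<noteq> l' \<Longrightarrow> c l \<noteq> c l'"
  shows "inj_on g {..<k}"
proof (rule inj_onI)
  fix l l' assume l: "l \<in> {..<k}" "l' \<in> {..<k}" "g l = g l'"
  then have "g l * c l = g l * c l'" using assms(1)[of l] assms(1)[of l'] by simp
  moreover have "g l \<noteq> 0" using assms(2)[of l] l by auto
  ultimately have "c l = c l'" by simp
  then show "l = l'" using assms(3)[of l l'] l by blast
qed

text \<open>Besides the clauses, every \<open>Lit j l\<close> with \<open>l \<ge> 2\<close> has a
  row of its own, which keeps the label 1 away from it; the label 1 of the clique is then left for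
  one of the two literals. The condition \<open>6 \<le> m\<close> makes the colors of literals large
  enough to be told by size from those of certain neighbors.\<close>

locale lab_graph =
  fixes k m n :: nat and inc :: "nat \<Rightarrow> nat \<Rightarrow> nat \<Rightarrow> bool"
  assumes k: "3 \<le> k" and m: "6 \<le> m"
    and rows: "\<And>i. i < m \<Longrightarrow> (\<forall>j<n. \<forall>l<k. inc i j l \<longrightarrow> l < 2) \<or>
      (\<exists>j0<n. \<exists>l0<k. 2 \<le> l0 \<and> (\<forall>j<n. \<forall>l<k. inc i j l \<longleftrightarrow> j = j0 \<and> l = l0))"
    and units: "\<And>j l. j < n \<Longrightarrow> l < k \<Longrightarrow> 2 \<le> l \<Longrightarrow>
      \<exists>i<m. \<forall>j'<n. \<forall>l'<k. inc i j' l' \<longleftrightarrow> j' = j \<and> l' = l"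
begin

abbreviation "V \<equiv> lab_vertices k m n"
abbreviation "E \<equiv> lab_edges k m n inc"

lemma simple: "simple_graph V E"
proof -
  have "a \<in> V \<and> b \<in> V \<and> a \<noteq> b" if "lab_edge Lit Plain Dup Free Pad k m n inc a b" for a b
    using that unfolding lab_edge_def lab_vertices_def by (elim disjE exE conjE) simp_all
  then show ?thesis
    unfolding simple_graph_def lab_edges_def using finite_lab_vertices by (auto simp: card_insert_if)
qed

lemma neighbors_iff:
  "u \<in> neighbors E v \<longleftrightarrow> lab_edge Lit Plain Dup Free Pad k m n inc u v \<or> lab_edge Lit Plain Dup Free Pad k m n inc v u"
  by (auto simp: neighbors_def lab_edges_def doubleton_eq_iff)

definition row_lits :: "nat \<Rightarrow> (nat \<times> nat) set" where
  "row_lits i = {(j, l). j < n \<and> l < k \<and> inc i j l}"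

lemma finite_row_lits: "finite (row_lits i)"
  by (rule finite_subset[of _ "{..<n} \<times> {..<k}"]) (auto simp: row_lits_def)

section \<open>Neighborhoods and colors in the graph for at least three labels\<close>

lemma neighbors_Lit:
  assumes "j < n" "l < k"
  shows "neighbors E (Lit j l) = Lit j ` ({..<k} - {l}) \<union>
    (\<Union>i<m. if inc i j l then Dup i ` {..<k} else Pad i j l ` {..<k})"
proof (rule set_eqI)
  fix u show "u \<in> neighbors E (Lit j l) \<longleftrightarrow> u \<in> Lit j ` ({..<k} - {l}) \<union>
    (\<Union>i<m. if inc i j l then Dup i ` {..<k} else Pad i j l ` {..<k})"
    unfolding neighbors_iff lab_edge_def using assms by (cases u) auto
qed

lemma neighbors_Plain:
  assumes "i < m" "l < k"
  shows "neighbors E (Plain i l) = Plain i ` ({..<k} - {l}) \<union> Dup i ` {..<k}"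
proof (rule set_eqI)
  fix u show "u \<in> neighbors E (Plain i l) \<longleftrightarrow> u \<in> Plain i ` ({..<k} - {l}) \<union> Dup i ` {..<k}"
    unfolding neighbors_iff lab_edge_def using assms by (cases u) auto
qed

lemma neighbors_Dup:
  assumes "i < m" "l < k"
  shows "neighbors E (Dup i l) = Dup i ` ({..<k} - {l}) \<union> Plain i ` {..<k} \<union> {Free i} \<union>
    (\<lambda>(j, l). Lit j l) ` row_lits i"
proof (rule set_eqI)
  fix u show "u \<in> neighbors E (Dup i l) \<longleftrightarrow> u \<in> Dup i ` ({..<k} - {l}) \<union> Plain i ` {..<k} \<union> {Free i} \<union>
    (\<lambda>(j, l). Lit j l) ` row_lits i"
    unfolding neighbors_iff lab_edge_def row_lits_def using assms by (cases u) (auto; blast)+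
qed

lemma neighbors_Free:
  assumes "i < m"
  shows "neighbors E (Free i) = Dup i ` {..<k}"
proof (rule set_eqI)
  fix u show "u \<in> neighbors E (Free i) \<longleftrightarrow> u \<in> Dup i ` {..<k}"
    unfolding neighbors_iff lab_edge_def using assms by (cases u) auto
qed

lemma neighbors_Pad:
  assumes "i < m" "j < n" "l < k" "h < k"
  shows "neighbors E (Pad i j l h) = Pad i j l ` ({..<k} - {h}) \<union> (if inc i j l then {} else {Lit j l})"
proof (rule set_eqI)
  fix u show "u \<in> neighbors E (Pad i j l h) \<longleftrightarrow>
    u \<in> Pad i j l ` ({..<k} - {h}) \<union> (if inc i j l then {} else {Lit j l})"
    unfolding neighbors_iff lab_edge_def using assms by (cases u) auto
qed

definition color :: "(lab_vertex \<Rightarrow> nat) \<Rightarrow> lab_vertex \<Rightarrow> nat" where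
  "color f v = (\<Prod>u\<in>neighbors E v. f u)"

lemma prod_remove: "l < k \<Longrightarrow> f l * (\<Prod>l'\<in>{..<k} - {l}. f l') = (\<Prod>l'<k. (f l' :: nat))"
  by (simp add: prod.remove[of "{..<k}" l])

text \<open>Multiplying the color by the label of the vertex completes the product over its clique.
  Once all \<open>Dup\<close> and \<open>Pad\<close> cliques have the product \<open>k!\<close>, the
  right-hand side no longer depends on \<open>l\<close>; this is what the pads are for.\<close>

lemma color_Lit:
  assumes "j < n" "l < k"
  shows "f (Lit j l) * color f (Lit j l) = (\<Prod>l'<k. f (Lit j l')) *
    (\<Prod>i<m. if inc i j l then \<Prod>h<k. f (Dup i h) else \<Prod>h<k. f (Pad i j l h))"
proof -
  let ?S = "\<lambda>i. if inc i j l then Dup i ` {..<k} else Pad i j l ` {..<k}"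
  have "color f (Lit j l) = prod f (Lit j ` ({..<k} - {l})) * prod f (\<Union>i<m. ?S i)"
    unfolding color_def neighbors_Lit[OF assms] by (rule prod.union_disjoint) (auto split: if_splits)
  also have "prod f (\<Union>i<m. ?S i) = (\<Prod>i<m. prod f (?S i))"
    by (rule prod.UNION_disjoint) (auto split: if_splits)
  also have "\<dots> = (\<Prod>i<m. if inc i j l then \<Prod>h<k. f (Dup i h) else \<Prod>h<k. f (Pad i j l h))"
    by (intro prod.cong) (auto simp: prod.reindex inj_on_def)
  also have "prod f (Lit j ` ({..<k} - {l})) = (\<Prod>l'\<in>{..<k} - {l}. f (Lit j l'))"
    by (simp add: prod.reindex inj_on_def)
  finally show ?thesis
    by (simp only: mult.assoc[symmetric] prod_remove[OF assms(2), of "\<lambda>l'. f (Lit j l')"])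
qed

lemma color_Plain:
  assumes "i < m" "l < k"
  shows "f (Plain i l) * color f (Plain i l) = (\<Prod>l'<k. f (Plain i l')) * (\<Prod>l'<k. f (Dup i l'))"
proof -
  have "color f (Plain i l) = prod f (Plain i ` ({..<k} - {l})) * prod f (Dup i ` {..<k})"
    unfolding color_def neighbors_Plain[OF assms] by (rule prod.union_disjoint) auto
  also have "\<dots> = (\<Prod>l'\<in>{..<k} - {l}. f (Plain i l')) * (\<Prod>l'<k. f (Dup i l'))"
    by (simp add: prod.reindex inj_on_def)
  finally show ?thesis
    by (simp only: mult.assoc[symmetric] prod_remove[OF assms(2), of "\<lambda>l'. f (Plain i l')"])
qed

definition row_product :: "(lab_vertex \<Rightarrow> nat) \<Rightarrow> nat \<Rightarrow> nat" where
  "row_product f i = f (Free i) * (\<Prod>(j, l)\<in>row_lits i. f (Lit j l))"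

lemma color_Dup:
  assumes "i < m" "l < k"
  shows "f (Dup i l) * color f (Dup i l) =
    (\<Prod>l'<k. f (Dup i l')) * (\<Prod>l'<k. f (Plain i l')) * row_product f i"
proof -
  have "color f (Dup i l) = prod f (Dup i ` ({..<k} - {l}) \<union> Plain i ` {..<k} \<union> {Free i}) *
      prod f ((\<lambda>(j, l). Lit j l) ` row_lits i)"
    unfolding color_def neighbors_Dup[OF assms]
    by (rule prod.union_disjoint) (auto simp: finite_row_lits)
  also have "prod f (Dup i ` ({..<k} - {l}) \<union> Plain i ` {..<k} \<union> {Free i}) =
      prod f (Dup i ` ({..<k} - {l}) \<union> Plain i ` {..<k}) * f (Free i)"
    by (subst prod.union_disjoint) auto
  also have "prod f (Dup i ` ({..<k} - {l}) \<union> Plain i ` {..<k}) =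
      prod f (Dup i ` ({..<k} - {l})) * prod f (Plain i ` {..<k})"
    by (rule prod.union_disjoint) auto
  also have "prod f ((\<lambda>(j, l). Lit j l) ` row_lits i) = (\<Prod>(j, l)\<in>row_lits i. f (Lit j l))"
    by (subst prod.reindex) (auto simp: inj_on_def case_prod_beta intro!: prod.cong)
  also have "prod f (Dup i ` ({..<k} - {l})) * prod f (Plain i ` {..<k}) =
      (\<Prod>l'\<in>{..<k} - {l}. f (Dup i l')) * (\<Prod>l'<k. f (Plain i l'))"
    by (simp add: prod.reindex inj_on_def)
  finally show ?thesis
    by (simp only: row_product_def mult.assoc[symmetric] prod_remove[OF assms(2), of "\<lambda>l'. f (Dup i l')"])
qed

lemma color_Free: "i < m \<Longrightarrow> color f (Free i) = (\<Prod>l<k. f (Dup i l))"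
  by (simp add: color_def neighbors_Free prod.reindex inj_on_def)

lemma color_Pad:
  assumes "i < m" "j < n" "l < k" "h < k"
  shows "f (Pad i j l h) * color f (Pad i j l h) =
    (\<Prod>h'<k. f (Pad i j l h')) * (if inc i j l then 1 else f (Lit j l))"
proof -
  have "color f (Pad i j l h) = prod f (Pad i j l ` ({..<k} - {h})) * prod f (if inc i j l then {} else {Lit j l})"
    unfolding color_def neighbors_Pad[OF assms] by (rule prod.union_disjoint) (auto split: if_splits)
  also have "\<dots> = (\<Prod>h'\<in>{..<k} - {h}. f (Pad i j l h')) * (if inc i j l then 1 else f (Lit j l))"
    by (simp add: prod.reindex inj_on_def)
  finally show ?thesis
    by (simp only: mult.assoc[symmetric] prod_remove[OF assms(4), of "\<lambda>h'. f (Pad i j l h')"])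
qed

lemma vertex_mem:
  "j < n \<Longrightarrow> l < k \<Longrightarrow> Lit j l \<in> V" "i < m \<Longrightarrow> l < k \<Longrightarrow> Plain i l \<in> V" "i < m \<Longrightarrow> l < k \<Longrightarrow> Dup i l \<in> V"
  "i < m \<Longrightarrow> Free i \<in> V" "i < m \<Longrightarrow> j < n \<Longrightarrow> l < k \<Longrightarrow> h < k \<Longrightarrow> Pad i j l h \<in> V"
  by (simp_all add: lab_vertices_def)

definition sat_by :: "(nat \<Rightarrow> bool) \<Rightarrow> bool" where
  "sat_by a \<longleftrightarrow> (\<forall>i<m. \<exists>j<n. \<exists>l<k. inc i j l \<and> (l = 0 \<longrightarrow> a j) \<and> (l = 1 \<longrightarrow> \<not> a j))"

text \<open>Row cliques and pads carry all labels, so each row contributes the factor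
  \<open>k!\<close> to every literal; only then are the literals of one variable twins up to a
  constant and carry all labels as well. A literal is read as true if its label is not 1.\<close>

lemma labeling_imp_sat:
  assumes f: "product_labeling k V E f"
  shows "\<exists>a. sat_by a"
proof -
  have F: "f v \<in> {1..k}" if "v \<in> V" for v using f that by (auto simp: product_labeling_def)
  have ne: "color f u \<noteq> color f v" if "lab_edge Lit Plain Dup Free Pad k m n inc u v" for u v
    using f that unfolding product_labeling_def proper_coloring_def lab_edges_def color_def by blast
  have P: "inj_on (\<lambda>l. f (Plain i l)) {..<k}" if i: "i < m" for i
  proof (rule clique_labels)
    show "f (Plain i l) * color f (Plain i l) = (\<Prod>l'<k. f (Plain i l')) * (\<Prod>l'<k. f (Dup i l'))" if "l < k" for l
      by (rule color_Plain[OF i that])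
    show "color f (Plain i l) \<noteq> color f (Plain i l')" if "l < k" "l' < k" "l \<noteq> l'" for l l'
      by (rule ne) (use i that in \<open>auto simp: lab_edge_def\<close>)
  qed (use F vertex_mem i in auto)
  have R: "inj_on (\<lambda>l. f (Dup i l)) {..<k}" if i: "i < m" for i
  proof (rule clique_labels)
    show "f (Dup i l) * color f (Dup i l) =
      (\<Prod>l'<k. f (Dup i l')) * (\<Prod>l'<k. f (Plain i l')) * row_product f i" if "l < k" for l
      by (rule color_Dup[OF i that])
    show "color f (Dup i l) \<noteq> color f (Dup i l')" if "l < k" "l' < k" "l \<noteq> l'" for l l'
      by (rule ne) (use i that in \<open>auto simp: lab_edge_def\<close>)
  qed (use F vertex_mem i in auto)
  have D: "inj_on (\<lambda>h. f (Pad i j l h)) {..<k}" if i: "i < m" "j < n" "l < k" for i j l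
  proof (rule clique_labels)
    show "f (Pad i j l h) * color f (Pad i j l h) =
      (\<Prod>h'<k. f (Pad i j l h')) * (if inc i j l then 1 else f (Lit j l))" if "h < k" for h
      by (rule color_Pad[OF i that])
    show "color f (Pad i j l h) \<noteq> color f (Pad i j l h')" if "h < k" "h' < k" "h \<noteq> h'" for h h'
      by (rule ne) (use i that in \<open>auto simp: lab_edge_def\<close>)
  qed (use F vertex_mem i in auto)
  have pP: "(\<Prod>l<k. f (Plain i l)) = fact k" "(\<lambda>l. f (Plain i l)) ` {..<k} = {1..k}"
    and pR: "(\<Prod>l<k. f (Dup i l)) = fact k" "(\<lambda>l. f (Dup i l)) ` {..<k} = {1..k}" if "i < m" for i
    using inj_on_labels[OF P[OF that]] inj_on_labels[OF R[OF that]] F vertex_mem(2,3)[OF that] by auto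
  have pD: "(\<Prod>h<k. f (Pad i j l h)) = fact k" if "i < m" "j < n" "l < k" for i j l
    using inj_on_labels(2)[OF D[OF that]] F vertex_mem(5)[OF that] by auto
  have Q: "inj_on (\<lambda>l. f (Lit j l)) {..<k}" if j: "j < n" for j
  proof (rule clique_labels)
    show "f (Lit j l) * color f (Lit j l) = (\<Prod>l'<k. f (Lit j l')) * (\<Prod>i<m. fact k)" if "l < k" for l
    proof -
      have "(\<Prod>i<m. if inc i j l then \<Prod>h<k. f (Dup i h) else \<Prod>h<k. f (Pad i j l h)) = (\<Prod>i<m. fact k)"
        by (rule prod.cong) (use pR(1) pD j that in auto)
      then show ?thesis using color_Lit[OF j that, of f] by simp
    qed
    show "color f (Lit j l) \<noteq> color f (Lit j l')" if "l < k" "l' < k" "l \<noteq> l'" for l l'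
      by (rule ne) (use j that in \<open>auto simp: lab_edge_def\<close>)
  qed (use F vertex_mem j in auto)
  have row: "\<exists>j<n. \<exists>l<k. inc i j l \<and> f (Lit j l) \<noteq> 1" if i: "i < m" for i
  proof (rule ccontr)
    assume "\<not> ?thesis"
    then have "(\<Prod>(j, l)\<in>row_lits i. f (Lit j l)) = 1" by (intro prod.neutral) (auto simp: row_lits_def)
    then have w: "row_product f i = f (Free i)" by (simp add: row_product_def)
    \<comment> \<open>If all literals of the row have label 1, the row product is the label of
      \<open>Free i\<close>, hence also the label of some \<open>Dup i l'\<close>. That vertex and
      the vertex of \<open>Plain i\<close> with label 1 then both have the color
      \<open>k! * k!\<close> although they are adjacent.\<close>
    have "row_product f i \<in> {1..k}" unfolding w using F vertex_mem(4)[OF i] by blast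
    then have "row_product f i \<in> (\<lambda>l. f (Dup i l)) ` {..<k}" unfolding pR(2)[OF i] .
    then obtain l' where l': "l' < k" "f (Dup i l') = row_product f i" by auto
    have "(1 :: nat) \<in> {1..k}" using k by simp
    then have "1 \<in> (\<lambda>l. f (Plain i l)) ` {..<k}" unfolding pP(2)[OF i] .
    then obtain l where l: "l < k" "f (Plain i l) = 1" by auto
    have "color f (Plain i l) = fact k * fact k"
      using color_Plain[OF i l(1), of f] pP(1)[OF i] pR(1)[OF i] l(2) by simp
    moreover have "row_product f i * color f (Dup i l') = row_product f i * (fact k * fact k)"
      using color_Dup[OF i l'(1), of f] pP(1)[OF i] pR(1)[OF i] l'(2) by (simp add: mult.commute)
    then have "color f (Dup i l') = fact k * fact k" using \<open>row_product f i \<in> {1..k}\<close> by simp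
    moreover have "color f (Plain i l) \<noteq> color f (Dup i l')"
      by (rule ne) (use i l l' in \<open>auto simp: lab_edge_def\<close>)
    ultimately show False by simp
  qed
  have big: "f (Lit j l) \<noteq> 1" if "j < n" "l < k" "2 \<le> l" for j l
    using units[OF that] row that by metis
  \<comment> \<open>The label 1 occurs in the clique and is excluded for \<open>l \<ge> 2\<close>,
    so the two literals of a variable are not both true.\<close>
  have one: "f (Lit j 0) = 1 \<or> f (Lit j 1) = 1" if j: "j < n" for j
  proof -
    have "(1 :: nat) \<in> {1..k}" using k by simp
    also have "\<dots> = (\<lambda>l. f (Lit j l)) ` {..<k}"
      using inj_on_labels(1)[OF Q[OF j]] F vertex_mem(1)[OF j] by auto
    finally obtain l where "l < k" "f (Lit j l) = 1" by auto
    then show ?thesis using big[OF j, of l] by (cases "l < 2") (auto simp: less_2_cases_iff)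
  qed
  have "sat_by (\<lambda>j. f (Lit j 0) \<noteq> 1)"
    unfolding sat_by_def
  proof (intro allI impI)
    fix i assume "i < m"
    from row[OF this] obtain j l where jl: "j < n" "l < k" "inc i j l" "f (Lit j l) \<noteq> 1" by blast
    then have "l = 0 \<longrightarrow> f (Lit j 0) \<noteq> 1" "l = 1 \<longrightarrow> \<not> f (Lit j 0) \<noteq> 1" using one[of j] by auto
    with jl show "\<exists>j<n. \<exists>l<k. inc i j l \<and> (l = 0 \<longrightarrow> f (Lit j 0) \<noteq> 1) \<and> (l = 1 \<longrightarrow> \<not> f (Lit j 0) \<noteq> 1)"
      by blast
  qed
  then show ?thesis by blast
qed

text \<open>The vertices with \<open>l \<ge> 2\<close> use up the labels 2 to \<open>k - 1\<close>,
  so 1 and \<open>k\<close> remain for false and true. \<open>Free\<close> gets \<open>k\<close>,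
  whence a single label of at least 2 in the row already lifts the row product above
  \<open>k\<close>.\<close>

fun sat_label :: "(nat \<Rightarrow> bool) \<Rightarrow> lab_vertex \<Rightarrow> nat" where
  "sat_label a (Lit j l) = (if l = 0 then if a j then k else 1 else if l = 1 then if a j then 1 else k else l)"
| "sat_label a (Plain i l) = Suc l"
| "sat_label a (Dup i l) = Suc l"
| "sat_label a (Free i) = k"
| "sat_label a (Pad i j l h) = Suc h"

lemma fact_gt: "k < fact k"
proof -
  have "2 \<le> (fact (k - 1) :: nat)" using k fact_ge_self[of "k - 1"] by linarith
  then have "k * 1 < k * fact (k - 1)" using k by (intro mult_strict_left_mono) auto
  then show ?thesis using k by (simp add: fact_reduce)
qed

text \<open>Within a clique, distinct labels give distinct colors. Between vertices of different
  kinds, an equality of colors is multiplied by both labels and then refuted by size or by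
  divisibility.\<close>

lemma sat_imp_labeling:
  assumes a: "sat_by a"
  shows "product_labeling k V E (sat_label a)"
proof -
  let ?f = "sat_label a"
  let ?F = "fact k :: nat"
  have F: "?f v \<in> {1..k}" if "v \<in> V" for v
    using that k by (cases v) (simp_all add: lab_vertices_def)
  have sucs: "(\<Prod>l<k. Suc l) = ?F"
    using inj_on_labels(2)[of Suc k] by (auto simp: inj_on_def)
  have injQ: "inj_on (\<lambda>l. ?f (Lit j l)) {..<k}" for j
  proof (rule inj_on_inverseI)
    let ?g = "\<lambda>y. if y = k then if a j then 0 else 1 else if y = 1 then if a j then 1 else 0 else y"
    fix l assume "l \<in> {..<k}"
    then show "?g (?f (Lit j l)) = l" using k by (cases "l = 0"; cases "l = 1") simp_all
  qed
  have prodQ: "(\<Prod>l<k. ?f (Lit j l)) = ?F" for j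
    by (rule inj_on_labels(2)[OF injQ]) (use k in auto)
  note sat_label.simps(1) [simp del] mult_Suc [simp del] mult_Suc_right [simp del]
  have cQ: "?f (Lit j l) * color ?f (Lit j l) = ?F * ?F ^ m" if "j < n" "l < k" for j l
    using color_Lit[OF that, of ?f] prodQ sucs by (simp add: if_distrib cong: if_cong)
  have cP: "?f (Plain i l) * color ?f (Plain i l) = ?F * ?F" if "i < m" "l < k" for i l
    using color_Plain[OF that, of ?f] sucs by simp
  have cR: "?f (Dup i l) * color ?f (Dup i l) = ?F * ?F * row_product ?f i" if "i < m" "l < k" for i l
    using color_Dup[OF that, of ?f] sucs by simp
  have cW: "color ?f (Free i) = ?F" if "i < m" for i
    using color_Free[OF that, of ?f] sucs by simp
  have cD: "?f (Pad i j l h) * color ?f (Pad i j l h) = ?F * (if inc i j l then 1 else ?f (Lit j l))"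
    if "i < m" "j < n" "l < k" "h < k" for i j l h
    using color_Pad[OF that, of ?f] sucs by simp
  have F0: "0 < ?F" by simp
  have kF: "k < ?F" by (rule fact_gt)
  have pw: "k ^ r \<le> ?F ^ r" for r using kF by (intro power_mono) auto
  have row: "k < row_product ?f i" if i: "i < m" for i
  proof -
    obtain j l where jl: "j < n" "l < k" "inc i j l" "l = 0 \<longrightarrow> a j" "l = 1 \<longrightarrow> \<not> a j"
      using a i unfolding sat_by_def by blast
    then have mem: "(j, l) \<in> row_lits i" by (simp add: row_lits_def)
    have "2 \<le> ?f (Lit j l)" using jl k by (auto simp: sat_label.simps(1))
    moreover have pos: "1 \<le> ?f (Lit j l)" if "(j, l) \<in> row_lits i" for j l
      using F[OF vertex_mem(1)] that by (auto simp: row_lits_def)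
    have "1 \<le> (\<Prod>(j, l)\<in>row_lits i - {(j, l)}. ?f (Lit j l))"
      by (rule prod_ge_1) (use pos in auto)
    ultimately have "2 * 1 \<le> ?f (Lit j l) * (\<Prod>(j, l)\<in>row_lits i - {(j, l)}. ?f (Lit j l))"
      by (rule mult_le_mono)
    also have "\<dots> = (\<Prod>(j, l)\<in>row_lits i. ?f (Lit j l))"
      using prod.remove[OF finite_row_lits mem, of "\<lambda>(j, l). ?f (Lit j l)"] by simp
    finally have "k * 2 \<le> row_product ?f i" unfolding row_product_def by simp
    then show ?thesis using k by linarith
  qed
  have diff: "color ?f u \<noteq> color ?f v" if "?f u * color ?f u = C" "?f v * color ?f v = C" "?f u \<noteq> ?f v" "0 < C" for u v C
    using that by (metis mult_cancel2 mult_0_right less_irrefl)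
  have RQ: "color ?f (Dup i h) \<noteq> color ?f (Lit j l)" if b: "i < m" "h < k" "j < n" "l < k" "inc i j l" for i h j l
  proof
    assume e: "color ?f (Dup i h) = color ?f (Lit j l)"
    define r where "r = m - 2"
    have r: "m = r + 2" using m by (simp add: r_def)
    have "Suc h * (?F * ?F ^ m) = ?f (Lit j l) * (Suc h * color ?f (Lit j l))"
      unfolding cQ[OF b(3,4), symmetric] by (rule mult.left_commute)
    also have "\<dots> = ?f (Lit j l) * (?F * ?F * row_product ?f i)"
      unfolding cR[OF b(1,2), unfolded e sat_label.simps(3)] ..
    finally have "(?F * ?F) * (Suc h * (?F * ?F ^ r)) = (?F * ?F) * (?f (Lit j l) * row_product ?f i)"
      by (simp only: r power_add power2_eq_square mult.assoc mult.commute mult.left_commute)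
    then have eq: "Suc h * (?F * ?F ^ r) = ?f (Lit j l) * row_product ?f i" using F0 by simp
    have four: "4 \<le> r" using m r by simp
    from rows[OF b(1)] show False
    proof (elim disjE exE conjE)
      \<comment> \<open>All labels in such a row are 1 or \<open>k\<close>, hence coprime to
        \<open>k - 1\<close>, and so is the right-hand side; but \<open>k - 1\<close>, which is at
        least 2, divides the factor \<open>k!\<close> on the left.\<close>
      assume small: "\<forall>j<n. \<forall>l<k. inc i j l \<longrightarrow> l < 2"
      have p: "coprime (k - 1) (?f (Lit j l))" if "(j, l) \<in> row_lits i" for j l
      proof -
        have "l < 2" using small that by (auto simp: row_lits_def)
        then have "?f (Lit j l) \<in> {1, k}" by (auto simp: less_2_cases_iff sat_label.simps(1))
        moreover have "coprime (k - 1) k" using coprime_diff_one_left_nat[of k] k by simp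
        ultimately show ?thesis by auto
      qed
      have "coprime (k - 1) (\<Prod>(j, l)\<in>row_lits i. ?f (Lit j l))"
        by (rule prod_coprime_right) (use p in auto)
      moreover have "coprime (k - 1) k" using coprime_diff_one_left_nat[of k] k by simp
      ultimately have "coprime (k - 1) (?f (Lit j l) * row_product ?f i)"
        unfolding row_product_def using p[of j l] b by (simp add: row_lits_def)
      moreover have "k - 1 dvd ?F" using k by (intro dvd_fact) auto
      then have "k - 1 dvd Suc h * (?F * ?F ^ r)" by simp
      ultimately have "is_unit (k - 1)" unfolding eq by (metis coprime_absorb_left)
      then show False using k by simp
    next
      \<comment> \<open>For a row with a single literal the right-hand side has three factors and is
        at most \<open>k ^ 3\<close>, while the left-hand side is at least \<open>k!\<close> to the
        power \<open>r \<ge> 4\<close>.\<close>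
      fix j0 l0 assume j0: "j0 < n" "l0 < k" "2 \<le> l0" "\<forall>j<n. \<forall>l<k. inc i j l \<longleftrightarrow> j = j0 \<and> l = l0"
      then have "row_lits i = {(j0, l0)}" by (auto simp: row_lits_def)
      then have "row_product ?f i = k * l0" using j0 by (simp add: row_product_def sat_label.simps(1))
      moreover have "?f (Lit j l) = l0" using j0 b by (auto simp: sat_label.simps(1))
      ultimately have "?f (Lit j l) * row_product ?f i = l0 * (k * l0)" by simp
      also have "\<dots> \<le> k * (k * k)" using j0(2) by (intro mult_le_mono) auto
      also have "\<dots> = k ^ 3" by (simp add: power3_eq_cube)
      also have "\<dots> < k ^ r" using k four by (intro power_strict_increasing) auto
      also have "\<dots> \<le> ?F ^ r" by (rule pw)
      also have "\<dots> \<le> Suc h * (?F * ?F ^ r)" using F0 by simp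
      finally show False using eq by simp
    qed
  qed
  have DQ: "color ?f (Pad i j l h) \<noteq> color ?f (Lit j l)" if b: "i < m" "j < n" "l < k" "h < k" "\<not> inc i j l" for i j l h
  proof
    assume e: "color ?f (Pad i j l h) = color ?f (Lit j l)"
    have "Suc h * (?F * ?F ^ m) = ?f (Lit j l) * (Suc h * color ?f (Lit j l))"
      unfolding cQ[OF b(2,3), symmetric] by (rule mult.left_commute)
    also have "\<dots> = ?f (Lit j l) * (?F * ?f (Lit j l))"
      using cD[OF b(1-4)] b(5) e by simp
    finally have "?F * (Suc h * ?F ^ m) = ?F * (?f (Lit j l) * ?f (Lit j l))"
      by (simp only: mult.assoc mult.commute mult.left_commute)
    then have "Suc h * ?F ^ m = ?f (Lit j l) * ?f (Lit j l)" using F0 by simp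
    moreover have "?f (Lit j l) \<le> k" using F[OF vertex_mem(1)[OF b(2,3)]] by simp
    then have "?f (Lit j l) * ?f (Lit j l) \<le> k ^ 2" unfolding power2_eq_square by (intro mult_le_mono)
    moreover have "k ^ 2 < k ^ m" using k m by (intro power_strict_increasing) auto
    moreover have "k ^ m \<le> Suc h * ?F ^ m" by (rule order_trans[OF pw]) (simp add: mult_Suc)
    ultimately show False by simp
  qed
  have PR: "color ?f (Plain i l) \<noteq> color ?f (Dup i l')" if b: "i < m" "l < k" "l' < k" for i l l'
  proof
    assume e: "color ?f (Plain i l) = color ?f (Dup i l')"
    have "Suc l' * (?F * ?F) = Suc l * (?f (Dup i l') * color ?f (Dup i l'))"
      using cP[OF b(1,2)] e by (simp add: mult.left_commute)
    also have "\<dots> = Suc l * row_product ?f i * (?F * ?F)" using cR[OF b(1,3)] by (simp add: mult.commute mult.left_commute)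
    finally have "Suc l' = Suc l * row_product ?f i" using F0 by simp
    then have "row_product ?f i \<le> Suc l'" by simp
    then show False using row[OF b(1)] b(3) by simp
  qed
  have RW: "color ?f (Dup i l) \<noteq> color ?f (Free i)" if b: "i < m" "l < k" for i l
  proof
    assume "color ?f (Dup i l) = color ?f (Free i)"
    then have "Suc l * ?F = ?F * row_product ?f i * ?F" using cR[OF b] cW[OF b(1)] by (simp add: mult.commute mult.left_commute)
    then have "Suc l = ?F * row_product ?f i" using F0 by simp
    moreover have "k * 1 < ?F * row_product ?f i"
      using kF row[OF b(1)] k by (intro mult_less_le_imp_less) auto
    ultimately show False using b(2) by simp
  qed
  have main: "color ?f u \<noteq> color ?f v" if "lab_edge Lit Plain Dup Free Pad k m n inc u v" for u v
    using that unfolding lab_edge_def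
  proof (elim disjE exE conjE)
    fix j l l' assume b: "j < n" "l < k" "l' < k" "l \<noteq> l'" "u = Lit j l" "v = Lit j l'"
    have "?f (Lit j l) \<noteq> ?f (Lit j l')" using inj_onD[OF injQ[of j], of l l'] b by auto
    then show ?thesis unfolding b(5,6) by (rule diff[OF cQ[OF b(1,2)] cQ[OF b(1,3)]]) simp
  next
    fix i l l' assume b: "i < m" "l < k" "l' < k" "l \<noteq> l'" "u = Plain i l" "v = Plain i l'"
    then show ?thesis unfolding b(5,6) by (intro diff[OF cP[OF b(1,2)] cP[OF b(1,3)]]) auto
  next
    fix i l l' assume b: "i < m" "l < k" "l' < k" "l \<noteq> l'" "u = Dup i l" "v = Dup i l'"
    then show ?thesis unfolding b(5,6) using row[OF b(1)] k by (intro diff[OF cR[OF b(1,2)] cR[OF b(1,3)]]) auto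
  next
    fix i l l' assume "i < m" "l < k" "l' < k" "u = Plain i l" "v = Dup i l'"
    then show ?thesis using PR by blast
  next
    fix i l assume "i < m" "l < k" "u = Dup i l" "v = Free i"
    then show ?thesis using RW by blast
  next
    fix i h j l assume "i < m" "h < k" "j < n" "l < k" "inc i j l" "u = Dup i h" "v = Lit j l"
    then show ?thesis using RQ by blast
  next
    fix i j l h assume "i < m" "j < n" "l < k" "h < k" "\<not> inc i j l" "u = Pad i j l h" "v = Lit j l"
    then show ?thesis using DQ by blast
  next
    fix i j l h h' assume b: "i < m" "j < n" "l < k" "h < k" "h' < k" "h \<noteq> h'" "u = Pad i j l h" "v = Pad i j l h'"
    have "0 < ?f (Lit j l)" using F[OF vertex_mem(1)[OF b(2,3)]] by simp
    then show ?thesis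
      unfolding b(7,8) using b by (intro diff[OF cD[OF b(1-4)] cD[OF b(1-3,5)]]) (auto simp del: sat_label.simps(1))
  qed
  have "color ?f u \<noteq> color ?f v" if e: "{u, v} \<in> E" for u v
  proof -
    obtain a b where ab: "lab_edge Lit Plain Dup Free Pad k m n inc a b" "{u, v} = {a, b}"
      using e unfolding lab_edges_def by blast
    show ?thesis using main[OF ab(1)] ab(2) by (auto simp: doubleton_eq_iff)
  qed
  then show ?thesis
    using F unfolding product_labeling_def proper_coloring_def color_def by blast
qed

lemma has_product_labeling_iff: "has_product_labeling k V E \<longleftrightarrow> (\<exists>a. sat_by a)"
  using labeling_imp_sat sat_imp_labeling unfolding has_product_labeling_def by blast

end


section \<open>Numbering and computability of the graph for at least three labels\<close>

lemma tableau_var_eq_iff: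
  assumes "k < B" "t < B" "i < B" "z < B" "a < B" "k' < B" "t' < B" "i' < B" "z' < B" "a' < B"
  shows "tableau_var B k t i z a = tableau_var B k' t' i' z' a' \<longleftrightarrow> k = k' \<and> t = t' \<and> i = i' \<and> z = z' \<and> a = a'"
  using tableau_var_digits[OF assms(1-5)] tableau_var_digits[OF assms(6-10)] by metis

fun lab_code :: "nat \<Rightarrow> lab_vertex \<Rightarrow> nat" where
  "lab_code B (Lit j l) = tableau_var B 0 j l 0 0"
| "lab_code B (Plain i l) = tableau_var B 1 i l 0 0"
| "lab_code B (Dup i l) = tableau_var B 2 i l 0 0"
| "lab_code B (Free i) = tableau_var B 3 i 0 0 0"
| "lab_code B (Pad i j l h) = tableau_var B 4 i j l h"

lemma lab_code_inj:
  assumes "m + n + k + 5 \<le> B"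
  shows "inj_on (lab_code B) (lab_vertices k m n)" "lab_code B ` lab_vertices k m n \<subseteq> {..<B ^ 5}"
proof -
  have k: "(0 :: nat) < B" "(1 :: nat) < B" "(2 :: nat) < B" "(3 :: nat) < B" "(4 :: nat) < B" using assms by auto
  show "inj_on (lab_code B) (lab_vertices k m n)"
  proof (rule inj_onI)
    fix u v assume uv: "u \<in> lab_vertices k m n" "v \<in> lab_vertices k m n" "lab_code B u = lab_code B v"
    then show "u = v"
      using assms k by (cases u; cases v) (simp_all add: lab_vertices_def tableau_var_eq_iff)
  qed
  show "lab_code B ` lab_vertices k m n \<subseteq> {..<B ^ 5}"
  proof
    fix y assume "y \<in> lab_code B ` lab_vertices k m n"
    then obtain v where "v \<in> lab_vertices k m n" "y = lab_code B v" by blast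
    then show "y \<in> {..<B ^ 5}"
      using assms k by (cases v) (simp_all add: lab_vertices_def tableau_var_less)
  qed
qed

lemma lab_edge_map:
  "lab_edge (\<lambda>j l. c (q j l)) (\<lambda>i l. c (p i l)) (\<lambda>i l. c (r i l)) (\<lambda>i. c (s i)) (\<lambda>i j l h. c (d i j l h)) k m n inc u v \<longleftrightarrow>
    (\<exists>a b. lab_edge q p r s d k m n inc a b \<and> u = c a \<and> v = c b)"
  unfolding lab_edge_def conj_disj_distribR ex_disj_distrib
  by (intro arg_cong2[where f = "(\<or>)"]; blast)

definition lab_code_edge :: "nat \<Rightarrow> nat \<Rightarrow> nat \<Rightarrow> nat \<Rightarrow> (nat \<Rightarrow> nat \<Rightarrow> nat \<Rightarrow> bool) \<Rightarrow> nat \<Rightarrow> nat \<Rightarrow> bool" where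
  "lab_code_edge B = lab_edge (\<lambda>j l. tableau_var B 0 j l 0 0) (\<lambda>i l. tableau_var B 1 i l 0 0)
     (\<lambda>i l. tableau_var B 2 i l 0 0) (\<lambda>i. tableau_var B 3 i 0 0 0) (\<lambda>i j l h. tableau_var B 4 i j l h)"

lemma map_lab_edges:
  "{u, v} \<in> map_edges (lab_code B) (lab_edges k m n inc) \<longleftrightarrow>
    lab_code_edge B k m n inc u v \<or> lab_code_edge B k m n inc v u"
proof -
  have e: "lab_code_edge B k m n inc u v \<longleftrightarrow>
      (\<exists>a b. lab_edge Lit Plain Dup Free Pad k m n inc a b \<and> u = lab_code B a \<and> v = lab_code B b)" for u v
    unfolding lab_code_edge_def using lab_edge_map[of "lab_code B" Lit Plain Dup Free Pad k m n inc u v] by simp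
  have "map_edges (lab_code B) (lab_edges k m n inc) =
      {{lab_code B a, lab_code B b} | a b. lab_edge Lit Plain Dup Free Pad k m n inc a b}"
    unfolding lab_edges_def by (rule map_edges_pairs)
  then have "{u, v} \<in> map_edges (lab_code B) (lab_edges k m n inc) \<longleftrightarrow>
      (\<exists>a b. lab_edge Lit Plain Dup Free Pad k m n inc a b \<and> {u, v} = {lab_code B a, lab_code B b})"
    by blast
  then show ?thesis unfolding e doubleton_eq_iff by blast
qed

text \<open>Rows below \<open>m\<close> are the clauses. Row \<open>m + l + k * j\<close> consists
  of \<open>Lit j l\<close> alone if \<open>l \<ge> 2\<close>; for \<open>l < 2\<close> it contains
  both literals of variable \<open>j\<close>, a tautology that only keeps the numbering
  uniform.\<close>

definition row_inc :: "nat \<Rightarrow> nat \<Rightarrow> (nat \<Rightarrow> nat \<Rightarrow> bool) \<Rightarrow> (nat \<Rightarrow> nat \<Rightarrow> bool) \<Rightarrow> nat \<Rightarrow> nat \<Rightarrow> nat \<Rightarrow> bool" where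
  "row_inc k m pos neg i j l \<longleftrightarrow>
     (if i < m then l = 0 \<and> pos i j \<or> l = 1 \<and> neg i j
      else j = (i - m) div k \<and> (if (i - m) mod k < 2 then l < 2 else l = (i - m) mod k))"

lemma row_inc_labeling:
  assumes k: "3 \<le> k" and m: "6 \<le> m"
  shows "simple_graph (lab_vertices k (m + n * k) n) (lab_edges k (m + n * k) n (row_inc k m pos neg))"
    "has_product_labeling k (lab_vertices k (m + n * k) n) (lab_edges k (m + n * k) n (row_inc k m pos neg)) \<longleftrightarrow>
      satisfiable m n pos neg"
proof -
  let ?inc = "row_inc k m pos neg"
  have dm: "(i - m) div k < n" "(i - m) mod k < k" if "i < m + n * k" "\<not> i < m" for i
    using that k by (auto simp: less_mult_imp_div_less)
  interpret lab_graph k "m + n * k" n ?inc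
  proof
    fix i assume i: "i < m + n * k"
    show "(\<forall>j<n. \<forall>l<k. ?inc i j l \<longrightarrow> l < 2) \<or>
      (\<exists>j0<n. \<exists>l0<k. 2 \<le> l0 \<and> (\<forall>j<n. \<forall>l<k. ?inc i j l \<longleftrightarrow> j = j0 \<and> l = l0))"
    proof (cases "i < m \<or> (i - m) mod k < 2")
      case True
      then show ?thesis by (auto simp: row_inc_def)
    next
      case False
      then have "\<forall>j<n. \<forall>l<k. ?inc i j l \<longleftrightarrow> j = (i - m) div k \<and> l = (i - m) mod k" by (simp add: row_inc_def)
      then show ?thesis using dm[OF i] False by (meson not_less)
    qed
  next
    fix j l assume jl: "j < n" "l < k" "2 \<le> l"
    show "\<exists>i<m + n * k. \<forall>j'<n. \<forall>l'<k. ?inc i j' l' \<longleftrightarrow> j' = j \<and> l' = l"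
    proof (intro exI[of _ "m + (l + k * j)"] conjI)
      show "m + (l + k * j) < m + n * k" using mixed_radix_less[OF jl(2,1)] by (simp add: mult.commute)
      show "\<forall>j'<n. \<forall>l'<k. ?inc (m + (l + k * j)) j' l' \<longleftrightarrow> j' = j \<and> l' = l"
        using jl by (auto simp: row_inc_def)
    qed
  qed (use k m in auto)
  show "simple_graph V E" by (rule simple)
  have "sat_by a \<longleftrightarrow> (\<forall>r<m. \<exists>c<n. pos r c \<and> a c \<or> neg r c \<and> \<not> a c)" for a
  proof
    assume s: "sat_by a"
    show "\<forall>r<m. \<exists>c<n. pos r c \<and> a c \<or> neg r c \<and> \<not> a c"
    proof (intro allI impI)
      fix r assume r: "r < m"
      then have "r < m + n * k" by simp
      then obtain j l where "j < n" "?inc r j l" "l = 0 \<longrightarrow> a j" "l = 1 \<longrightarrow> \<not> a j"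
        using s unfolding sat_by_def by blast
      then show "\<exists>c<n. pos r c \<and> a c \<or> neg r c \<and> \<not> a c"
        using r by (intro exI[of _ j]) (auto simp: row_inc_def)
    qed
  next
    assume s: "\<forall>r<m. \<exists>c<n. pos r c \<and> a c \<or> neg r c \<and> \<not> a c"
    show "sat_by a"
      unfolding sat_by_def
    proof (intro allI impI)
      fix i assume i: "i < m + n * k"
      show "\<exists>j<n. \<exists>l<k. ?inc i j l \<and> (l = 0 \<longrightarrow> a j) \<and> (l = 1 \<longrightarrow> \<not> a j)"
      proof (cases "i < m")
        case True
        then obtain c where "c < n" "pos i c \<and> a c \<or> neg i c \<and> \<not> a c" using s by blast
        then show ?thesis
          using True k
          by (intro exI[of _ c] conjI exI[of _ "if pos i c \<and> a c then 0 else 1"]) (auto simp: row_inc_def)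
      next
        case False
        let ?j = "(i - m) div k" and ?l = "(i - m) mod k"
        show ?thesis
          using False k dm[OF i False]
          by (intro exI[of _ ?j] conjI exI[of _ "if ?l < 2 then if a ?j then 0 else 1 else ?l"]) (auto simp: row_inc_def)
      qed
    qed
  qed
  then show "has_product_labeling k V E \<longleftrightarrow> satisfiable m n pos neg"
    unfolding has_product_labeling_iff satisfiable_def by blast
qed

lemma definable_lab_code_edge:
  assumes "definable (\<lambda>x w e. B x)" "definable (\<lambda>x w e. m x)" "definable (\<lambda>x w e. n x)"
    and inc: "\<And>I J L. definable I \<Longrightarrow> definable J \<Longrightarrow> definable L \<Longrightarrow>
      definable_pred (\<lambda>x w e. inc x (I x w e) (J x w e) (L x w e))"
    and "definable U" "definable U'"
  shows "definable_pred (\<lambda>x w e. lab_code_edge (B x) k (m x) (n x) (inc x) (U x w e) (U' x w e))"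
proof -
  have "definable_pred (\<lambda>x w e. lab_code_edge (B x) k (m x) (n x) (inc x) (e 0) (e 1))"
    unfolding lab_code_edge_def lab_edge_def using assms(1-3)
    by (intro definable_pred_disj definable_pred_ex definable_pred_conj definable_pred_not definable_pred_eq inc
        definable_tableau_var definable_var definable_const)
  from definable_pred_subst2[OF this assms(5,6)] show ?thesis .
qed

theorem product_labeling_NP_hard:
  assumes k: "3 \<le> k" and A: "A \<in> NP"
  shows "\<exists>f. poly_time_computable f \<and> (\<forall>x. x \<in> A \<longleftrightarrow>
    f x \<in> {graph_code n E | n E. simple_graph {..<n} E \<and> has_product_labeling k {..<n} E})"
proof -
  obtain m n pos neg where cl:
    "definable (\<lambda>x w e. m x)" "definable (\<lambda>x w e. n x)"
    "definable_pred (\<lambda>x w e. pos x (e 0) (e 1))" "definable_pred (\<lambda>x w e. neg x (e 0) (e 1))"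
    "\<And>x. 6 \<le> m x" "\<And>x. 2 \<le> n x" "\<And>x. x \<in> A \<longleftrightarrow> satisfiable (m x) (n x) (pos x) (neg x)"
    by (rule Cook_Levin[OF A], rule that)
  define M where "M = (\<lambda>x. m x + n x * k)"
  define B where "B = (\<lambda>x. M x + n x + k + 5)"
  define inc where "inc = (\<lambda>x. row_inc k (m x) (pos x) (neg x))"
  define E where "E = (\<lambda>x. map_edges (lab_code (B x)) (lab_edges k (M x) (n x) (inc x)))"
  have dM: "definable (\<lambda>x w e. M x)"
    unfolding M_def using cl(1,2) by (intro definable_add definable_mult definable_const)
  then have dB: "definable (\<lambda>x w e. B x)"
    unfolding B_def using cl(2) by (intro definable_add definable_const)
  have dinc: "definable_pred (\<lambda>x w e. inc x (I x w e) (J x w e) (L x w e))"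
    if "definable I" "definable J" "definable L" for I J L
    unfolding inc_def row_inc_def using that cl(1)
    by (intro definable_pred_if definable_pred_disj definable_pred_conj definable_pred_eq definable_pred_less
        definable_div definable_mod definable_diff definable_const
        definable_pred_subst2[OF cl(3)] definable_pred_subst2[OF cl(4)])
  have g: "simple_graph (lab_vertices k (M x) (n x)) (lab_edges k (M x) (n x) (inc x))"
    and l: "has_product_labeling k (lab_vertices k (M x) (n x)) (lab_edges k (M x) (n x) (inc x)) \<longleftrightarrow> x \<in> A" for x
    using row_inc_labeling[OF k cl(5), of x "n x" "pos x" "neg x"] cl(7) by (simp_all add: M_def inc_def)
  have c: "inj_on (lab_code (B x)) (lab_vertices k (M x) (n x))" "lab_code (B x) ` lab_vertices k (M x) (n x) \<subseteq> {..<B x ^ 5}" for x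
    using lab_code_inj[of "M x" "n x" k "B x"] by (simp_all add: B_def)
  have s: "simple_graph {..<B x ^ 5} (E x)" for x
    unfolding E_def by (rule simple_graph_map[OF g c])
  have iff: "has_product_labeling k {..<B x ^ 5} (E x) \<longleftrightarrow> x \<in> A" for x
    unfolding E_def using has_product_labeling_map[OF g c, of k x] k l by simp
  have "poly_time_computable (\<lambda>x. graph_code (B x ^ 5) (E x))"
  proof (rule poly_time_graph_code)
    show "definable (\<lambda>x w e. B x ^ 5)" by (rule definable_power[OF dB])
    show "definable_pred (\<lambda>x w e. lab_code_edge (B x) k (M x) (n x) (inc x) (e 0) (e 1) \<or>
        lab_code_edge (B x) k (M x) (n x) (inc x) (e 1) (e 0))"
      by (intro definable_pred_disj definable_lab_code_edge[OF dB dM cl(2)] dinc definable_var)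
  qed (simp add: E_def map_lab_edges)
  moreover have "x \<in> A \<longleftrightarrow> graph_code (B x ^ 5) (E x) \<in>
      {graph_code n E | n E. simple_graph {..<n} E \<and> has_product_labeling k {..<n} E}" for x
    using s[of x] iff[of x] graph_code_inject[OF s[of x]] by auto
  ultimately show ?thesis by blast
qed

section \<open>Planarity by drawing on a triangular lattice\<close>

definition pt :: "int \<times> int \<Rightarrow> complex" where
  "pt A = Complex (of_int (fst A)) (of_int (snd A))"

text \<open>Besides the axis directions only one diagonal direction is allowed. Edges of this
  triangular lattice therefore never cross.\<close>

definition unit_step :: "int \<times> int \<Rightarrow> int \<times> int \<Rightarrow> bool" where
  "unit_step A B \<longleftrightarrow> B \<in> {(fst A + 1, snd A), (fst A, snd A + 1), (fst A + 1, snd A + 1)}"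

definition lattice_adj :: "int \<times> int \<Rightarrow> int \<times> int \<Rightarrow> bool" where
  "lattice_adj A B \<longleftrightarrow> unit_step A B \<or> unit_step B A"

lemma pt_eq_iff [simp]: "pt A = pt B \<longleftrightarrow> A = B"
  by (auto simp: pt_def prod_eq_iff)

lemma Re_pt [simp]: "Re (pt A) = of_int (fst A)" and Im_pt [simp]: "Im (pt A) = of_int (snd A)"
  by (simp_all add: pt_def)

text \<open>An interior point determines its segment: the integer parts of the coordinates give the
  starting point, and which coordinates are integers gives the direction.\<close>

lemma segment_point:
  assumes s: "unit_step A B" and z: "z \<in> closed_segment (pt A) (pt B)"
  shows "z = pt A \<or> z = pt B \<or>
    \<lfloor>Re z\<rfloor> = fst A \<and> \<lfloor>Im z\<rfloor> = snd A \<and> (Re z \<in> \<int> \<longleftrightarrow> fst B = fst A) \<and> (Im z \<in> \<int> \<longleftrightarrow> snd B = snd A)"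
proof -
  obtain t where t: "0 \<le> t" "t \<le> 1" "z = (1 - t) *\<^sub>R pt A + t *\<^sub>R pt B"
    using z by (auto simp: closed_segment_def)
  have re: "Re z = of_int (fst A) + t * of_int (fst B - fst A)" and im: "Im z = of_int (snd A) + t * of_int (snd B - snd A)"
    unfolding t(3) by (simp_all add: algebra_simps)
  consider "t = 0" | "t = 1" | "0 < t" "t < 1" using t by linarith
  then show ?thesis
  proof cases
    case 3
    have fl: "\<lfloor>of_int a + t\<rfloor> = a" for a :: int using 3 by linarith
    have ni: "of_int a + t \<notin> \<int>" for a :: int
    proof
      assume "of_int a + t \<in> \<int>"
      then have "of_int \<lfloor>of_int a + t\<rfloor> = of_int a + t" by (metis Ints_cases floor_of_int)
      then show False using fl[of a] 3 by simp
    qed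
    show ?thesis using s fl ni unfolding re im unit_step_def by auto
  qed (use t in auto)
qed

lemma segment_point_not_lattice:
  assumes "unit_step A B" "\<lfloor>Re z\<rfloor> = fst A" "Re z \<in> \<int> \<longleftrightarrow> fst B = fst A" "Im z \<in> \<int> \<longleftrightarrow> snd B = snd A"
  shows "z \<noteq> pt C"
  using assms by (auto simp: unit_step_def)

lemma unit_segments_meet:
  assumes s: "unit_step A B" "unit_step C D" and z: "z \<in> closed_segment (pt A) (pt B)" "z \<in> closed_segment (pt C) (pt D)"
  shows "{A, B} = {C, D} \<or> (\<exists>P\<in>{A, B} \<inter> {C, D}. z = pt P)"
proof -
  note 1 = segment_point[OF s(1) z(1)] and 2 = segment_point[OF s(2) z(2)]
  show ?thesis
  proof (cases "z = pt A \<or> z = pt B")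
    case True
    then have "z = pt C \<or> z = pt D" using 2 segment_point_not_lattice[OF s(2)] by blast
    with True show ?thesis by auto
  next
    case False
    with 1 have i1: "\<lfloor>Re z\<rfloor> = fst A" "\<lfloor>Im z\<rfloor> = snd A" "Re z \<in> \<int> \<longleftrightarrow> fst B = fst A" "Im z \<in> \<int> \<longleftrightarrow> snd B = snd A"
      by blast+
    then have "z \<noteq> pt C" "z \<noteq> pt D" using segment_point_not_lattice[OF s(1)] by blast+
    with 2 have i2: "\<lfloor>Re z\<rfloor> = fst C" "\<lfloor>Im z\<rfloor> = snd C" "Re z \<in> \<int> \<longleftrightarrow> fst D = fst C" "Im z \<in> \<int> \<longleftrightarrow> snd D = snd C"
      by blast+
    have "A = C" using i1 i2 by (simp add: prod_eq_iff)
    moreover have "B = D"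
      using s i1(3,4) i2(3,4) \<open>A = C\<close> unfolding unit_step_def by auto
    ultimately show ?thesis by simp
  qed
qed

lemma lattice_segments_meet:
  assumes "lattice_adj A B" "lattice_adj C D" "z \<in> closed_segment (pt A) (pt B)" "z \<in> closed_segment (pt C) (pt D)"
  shows "{A, B} = {C, D} \<or> (\<exists>P\<in>{A, B} \<inter> {C, D}. z = pt P)"
  using assms unit_segments_meet[of A B C D z] unit_segments_meet[of B A C D z]
    unit_segments_meet[of A B D C z] unit_segments_meet[of B A D C z]
  unfolding lattice_adj_def by (auto simp: closed_segment_commute insert_commute)

lemma lattice_point_on_segment:
  assumes "lattice_adj A B" "pt P \<in> closed_segment (pt A) (pt B)"
  shows "P = A \<or> P = B"
proof -
  have "P = A \<or> P = B" if s: "unit_step A B" "pt P \<in> closed_segment (pt A) (pt B)" for A B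
    using segment_point[OF s] segment_point_not_lattice[OF s(1), of "pt P" P] by auto
  then show ?thesis using assms unfolding lattice_adj_def by (metis closed_segment_commute)
qed

fun polyline :: "(int \<times> int) list \<Rightarrow> real \<Rightarrow> complex" where
  "polyline (A # B # C # ps) = linepath (pt A) (pt B) +++ polyline (B # C # ps)"
| "polyline [A, B] = linepath (pt A) (pt B)"
| "polyline _ = linepath 0 0"

fun walk :: "(int \<times> int) list \<Rightarrow> bool" where
  "walk (A # B # ps) \<longleftrightarrow> lattice_adj A B \<and> A \<notin> set (B # ps) \<and> (ps = [] \<or> walk (B # ps))"
| "walk _ \<longleftrightarrow> False"

definition segments :: "(int \<times> int) list \<Rightarrow> ((int \<times> int) \<times> (int \<times> int)) set" where
  "segments ps = set (zip ps (tl ps))"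

lemma segments_Cons2 [simp]: "segments (A # B # ps) = insert (A, B) (segments (B # ps))"
  by (simp add: segments_def)

lemma segments_single [simp]: "segments [A] = {}"
  by (simp add: segments_def)

lemma segments_subset: "(A, B) \<in> segments ps \<Longrightarrow> A \<in> set ps \<and> B \<in> set ps"
  unfolding segments_def by (cases ps) (auto dest: set_zip_leftD set_zip_rightD)

lemma walk_segments: "walk ps \<Longrightarrow> (A, B) \<in> segments ps \<Longrightarrow> lattice_adj A B \<and> A \<noteq> B"
proof (induction ps rule: walk.induct)
  case (1 C D ps)
  then show ?case by (cases ps) auto
qed auto

lemma polyline_walk:
  "walk ps \<Longrightarrow> arc (polyline ps) \<and> pathstart (polyline ps) = pt (hd ps) \<and> pathfinish (polyline ps) = pt (last ps) \<and>
     path_image (polyline ps) = (\<Union>(A, B)\<in>segments ps. closed_segment (pt A) (pt B))"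
proof (induction ps rule: polyline.induct)
  case (1 A B C ps)
  let ?q = "polyline (B # C # ps)"
  from 1 have IH: "arc ?q" "pathstart ?q = pt B" "pathfinish ?q = pt (last (B # C # ps))"
    "path_image ?q = (\<Union>(A, B)\<in>segments (B # C # ps). closed_segment (pt A) (pt B))" by auto
  have w: "walk (B # C # ps)" "lattice_adj A B" "A \<notin> set (B # C # ps)" using "1.prems" by auto
  then have AB: "A \<noteq> B" by auto
  have "z = pt B" if z: "z \<in> closed_segment (pt A) (pt B)" "z \<in> path_image ?q" for z
  proof -
    obtain P Q where PQ: "(P, Q) \<in> segments (B # C # ps)" "z \<in> closed_segment (pt P) (pt Q)"
      using z(2) unfolding IH(4) by blast
    have "P \<in> set (B # C # ps)" "Q \<in> set (B # C # ps)" using segments_subset[OF PQ(1)] by auto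
    then have ne: "A \<noteq> P" "A \<noteq> Q" using w(3) by auto
    have "lattice_adj P Q" using walk_segments[OF w(1) PQ(1)] by blast
    from lattice_segments_meet[OF w(2) this z(1) PQ(2)] show ?thesis using ne by auto
  qed
  then have "arc (linepath (pt A) (pt B) +++ ?q)"
    using IH AB by (intro arc_join arc_linepath) auto
  then show ?case using IH by (auto simp: path_image_join)
next
  case (2 A B)
  then show ?case by (auto intro: arc_linepath)
qed auto

lemma polyline_lattice_point:
  assumes "walk ps"
  shows "pt P \<in> path_image (polyline ps) \<longleftrightarrow> P \<in> set ps"
proof
  assume "pt P \<in> path_image (polyline ps)"
  then obtain A B where "(A, B) \<in> segments ps" "pt P \<in> closed_segment (pt A) (pt B)"
    using polyline_walk[OF assms] by auto
  then show "P \<in> set ps"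
    using walk_segments[OF assms] lattice_point_on_segment segments_subset by blast
next
  assume "P \<in> set ps"
  then have "\<exists>Q. (P, Q) \<in> segments ps \<or> (Q, P) \<in> segments ps"
    using assms
  proof (induction ps rule: walk.induct)
    case (1 A B ps)
    consider "P = A" | "P = B" | "ps \<noteq> []" "P \<in> set (B # ps)" "walk (B # ps)"
      using "1.prems" by (cases "ps = []") auto
    then show ?case
    proof cases
      case 3
      then show ?thesis using "1.IH" by (simp only: segments_Cons2) blast
    qed (simp only: segments_Cons2, blast)+
  qed auto
  then obtain A B where "(A, B) \<in> segments ps" "P = A \<or> P = B" by blast
  moreover from this have "pt P \<in> closed_segment (pt A) (pt B)" by auto
  moreover have "path_image (polyline ps) = (\<Union>(A, B)\<in>segments ps. closed_segment (pt A) (pt B))"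
    using polyline_walk[OF assms] by blast
  ultimately show "pt P \<in> path_image (polyline ps)" by blast
qed

text \<open>The second alternative covers a common segment; in that case the two paths share two
  different lattice points.\<close>

lemma polylines_meet:
  assumes "walk ps" "walk qs" "z \<in> path_image (polyline ps)" "z \<in> path_image (polyline qs)"
  shows "(\<exists>P\<in>set ps \<inter> set qs. z = pt P) \<or> (\<exists>A B. A \<noteq> B \<and> {A, B} \<subseteq> set ps \<inter> set qs)"
proof -
  obtain A B where AB: "(A, B) \<in> segments ps" "z \<in> closed_segment (pt A) (pt B)"
    using polyline_walk[OF assms(1)] assms(3) by auto
  obtain C D where CD: "(C, D) \<in> segments qs" "z \<in> closed_segment (pt C) (pt D)"
    using polyline_walk[OF assms(2)] assms(4) by auto
  have s: "A \<in> set ps" "B \<in> set ps" "C \<in> set qs" "D \<in> set qs"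
    using segments_subset[OF AB(1)] segments_subset[OF CD(1)] by auto
  have "lattice_adj A B" "A \<noteq> B" "lattice_adj C D"
    using walk_segments[OF assms(1) AB(1)] walk_segments[OF assms(2) CD(1)] by auto
  then have "{A, B} = {C, D} \<or> (\<exists>P\<in>{A, B} \<inter> {C, D}. z = pt P)"
    using lattice_segments_meet AB(2) CD(2) by blast
  then show ?thesis
  proof
    assume "{A, B} = {C, D}"
    then have "{A, B} \<subseteq> set ps \<inter> set qs" using s by auto
    then show ?thesis using \<open>A \<noteq> B\<close> by blast
  next
    assume "\<exists>P\<in>{A, B} \<inter> {C, D}. z = pt P"
    then show ?thesis using s by auto
  qed
qed

text \<open>Planarity becomes a statement about finite sets of lattice points. Different edges share
  at most one vertex, so by the last premise their paths share at most one lattice point and hence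
  no segment.\<close>

theorem lattice_planar:
  assumes g: "simple_graph V E" and inj: "inj_on p V"
    and w: "\<And>e. e \<in> E \<Longrightarrow> walk (ps e) \<and> {hd (ps e), last (ps e)} = p ` e \<and> set (ps e) \<inter> p ` V = p ` e"
    and d: "\<And>e e'. e \<in> E \<Longrightarrow> e' \<in> E \<Longrightarrow> e \<noteq> e' \<Longrightarrow> set (ps e) \<inter> set (ps e') = p ` (e \<inter> e')"
  shows "planar V E"
proof -
  have "plane_drawing V E (\<lambda>v. pt (p v)) (\<lambda>e. polyline (ps e))"
    unfolding plane_drawing_def
  proof (intro conjI ballI impI)
    show "inj_on (\<lambda>v. pt (p v)) V" using inj by (auto simp: inj_on_def)
    fix e assume e: "e \<in> E"
    note we = w[OF e] and pe = polyline_walk[OF conjunct1[OF w[OF e]]]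
    show "arc (polyline (ps e))" using pe by blast
    have "{pathstart (polyline (ps e)), pathfinish (polyline (ps e))} = pt ` {hd (ps e), last (ps e)}" using pe by simp
    then show "{pathstart (polyline (ps e)), pathfinish (polyline (ps e))} = (\<lambda>v. pt (p v)) ` e"
      using we by (simp add: image_image)
    have "path_image (polyline (ps e)) \<inter> pt ` p ` V = pt ` (set (ps e) \<inter> p ` V)"
      using polyline_lattice_point[OF conjunct1[OF we]] by (auto simp: image_iff)
    then show "path_image (polyline (ps e)) \<inter> (\<lambda>v. pt (p v)) ` V = (\<lambda>v. pt (p v)) ` e"
      using we by (simp add: image_image)
    fix e' assume e': "e' \<in> E" and ne: "e \<noteq> e'"
    note we' = w[OF e']
    have card: "card e = 2" "card e' = 2" using g e e' by (auto simp: simple_graph_def)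
    have small: "\<not> {A, B} \<subseteq> p ` (e \<inter> e')" if "A \<noteq> B" for A B
    proof
      assume "{A, B} \<subseteq> p ` (e \<inter> e')"
      then obtain u v where "u \<in> e \<inter> e'" "v \<in> e \<inter> e'" "u \<noteq> v" using \<open>A \<noteq> B\<close> by blast
      then have "{u, v} \<subseteq> e" "{u, v} \<subseteq> e'" "card {u, v} = 2" by auto
      then have "{u, v} = e" "{u, v} = e'"
        using card by (metis card.infinite card_subset_eq zero_neq_numeral)+
      with ne show False by simp
    qed
    show "path_image (polyline (ps e)) \<inter> path_image (polyline (ps e')) = (\<lambda>v. pt (p v)) ` (e \<inter> e')" (is "?L = ?R")
    proof (intro equalityI subsetI)
      fix z assume z: "z \<in> ?L"
      have "(\<exists>P\<in>set (ps e) \<inter> set (ps e'). z = pt P) \<or> (\<exists>A B. A \<noteq> B \<and> {A, B} \<subseteq> set (ps e) \<inter> set (ps e'))"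
        by (rule polylines_meet[OF conjunct1[OF we] conjunct1[OF we']]) (use z in auto)
      then show "z \<in> ?R" unfolding d[OF e e' ne] using small by blast
    next
      fix z assume "z \<in> ?R"
      then obtain P where "z = pt P" "P \<in> p ` (e \<inter> e')" by blast
      then have "P \<in> set (ps e) \<inter> set (ps e')" using d[OF e e' ne] by simp
      then show "z \<in> ?L" using polyline_lattice_point[OF conjunct1[OF we]] polyline_lattice_point[OF conjunct1[OF we']] \<open>z = pt P\<close> by simp
    qed
  qed
  then show ?thesis unfolding planar_def by blast
qed

section \<open>Labelings with two labels\<close>

text \<open>With \<open>X\<close> the set of vertices labeled 2, the color of \<open>v\<close> is 2
  to the power \<open>sdeg E X v\<close>. The sum of indicators can be evaluated directly once a
  neighborhood is listed.\<close>

definition sdeg :: "'a set set \<Rightarrow> 'a set \<Rightarrow> 'a \<Rightarrow> nat" where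
  "sdeg E X v = (\<Sum>u\<in>neighbors E v. of_bool (u \<in> X))"

lemma has_product_labeling_2:
  assumes g: "simple_graph V E"
  shows "has_product_labeling 2 V E \<longleftrightarrow> (\<exists>X. \<forall>u v. {u, v} \<in> E \<longrightarrow> sdeg E X u \<noteq> sdeg E X v)"
proof -
  have pr: "(\<Prod>u\<in>neighbors E v. f u) = 2 ^ sdeg E {u. f u = 2} v" if f: "f ` V \<subseteq> {1..2 :: nat}" for f v
  proof -
    have "f u = 2 ^ of_bool (u \<in> {u. f u = 2})" if u: "u \<in> neighbors E v" for u
    proof -
      have "f u \<in> {1..2}" using f neighbors_subset[OF g, of v] u by blast
      then have "f u = 1 \<or> f u = 2" by auto
      then show ?thesis by auto
    qed
    then have "(\<Prod>u\<in>neighbors E v. f u) = (\<Prod>u\<in>neighbors E v. 2 ^ of_bool (u \<in> {u. f u = 2}))"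
      by (rule prod.cong[OF refl])
    then show ?thesis by (simp only: sdeg_def power_sum)
  qed
  show ?thesis
  proof
    assume "has_product_labeling 2 V E"
    then obtain f where "product_labeling 2 V E f" unfolding has_product_labeling_def by blast
    then have f: "f ` V \<subseteq> {1..2}" "proper_coloring E (\<lambda>v. \<Prod>u\<in>neighbors E v. f u)"
      by (simp_all add: product_labeling_def)
    have "\<forall>u v. {u, v} \<in> E \<longrightarrow> (2 :: nat) ^ sdeg E {u. f u = 2} u \<noteq> 2 ^ sdeg E {u. f u = 2} v"
      using f(2) unfolding proper_coloring_def pr[OF f(1)] .
    then have "\<forall>u v. {u, v} \<in> E \<longrightarrow> sdeg E {u. f u = 2} u \<noteq> sdeg E {u. f u = 2} v"
      by metis
    then show "\<exists>X. \<forall>u v. {u, v} \<in> E \<longrightarrow> sdeg E X u \<noteq> sdeg E X v" by blast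
  next
    assume "\<exists>X. \<forall>u v. {u, v} \<in> E \<longrightarrow> sdeg E X u \<noteq> sdeg E X v"
    then obtain X where X: "\<forall>u v. {u, v} \<in> E \<longrightarrow> sdeg E X u \<noteq> sdeg E X v" by blast
    define f where "f = (\<lambda>u. if u \<in> X then 2 else 1 :: nat)"
    have s: "{u. f u = 2} = X" by (auto simp: f_def)
    have f: "f ` V \<subseteq> {1..2}" by (auto simp: f_def)
    have "product_labeling 2 V E f"
      unfolding product_labeling_def proper_coloring_def pr[OF f] s using f X by simp
    then show "has_product_labeling 2 V E" unfolding has_product_labeling_def by blast
  qed
qed

text \<open>Cell \<open>(i, j)\<close> of the graph belongs to clause \<open>i\<close> and variable \<open>j\<close>. The sites \<open>P, R, S, Q\<close> and
  their partners carry four Boolean values. A pendant forces its host to have label 1 and adds 1 to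
  the degree of the host, so that a site \<open>A\<close> demands a true literal among its neighbors: otherwise its
  degree is 1, which is also the degree of a false literal. The sites \<open>W\<close> have degree 3, which excludes
  that exactly two of the three literals at \<open>A1\<close>, \<open>A2\<close>, \<open>A3\<close> are true. These three parity conditions copy
  \<open>P\<close> to \<open>Q\<close> and \<open>R\<close> to the cell below although the two signals cross. Finally, \<open>A4\<close> demands that the
  signal \<open>P\<close> of the next cell is false unless \<open>Q\<close> or the literal of variable \<open>j\<close> in clause \<open>i\<close> is true.\<close>

datatype site = P | P' | R | R' | S | S' | Q | Q' | A1 | A2 | A3 | A4 | W1 | W2 | W3 | Pend nat nat

text \<open>Thirteen pendants: one for each of \<open>A1\<close> to \<open>A4\<close> and three for
  each of \<open>W1\<close> to \<open>W3\<close>. Three of them give a \<open>W\<close> the degree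
  3, since its remaining neighbor is a gate and has label 1.\<close>

definition pend_host :: "nat \<Rightarrow> site" where
  "pend_host e = (if e = 0 then A1 else if e = 1 then A2 else if e = 2 then A3 else if e = 3 then A4
     else if e < 7 then W1 else if e < 10 then W2 else W3)"

definition core_pairs :: "(site \<times> site) list" where
  "core_pairs = [(P, P'), (S, S'), (Q, Q'), (A1, P), (A1, R), (A1, S), (A1, W1),
     (A2, S), (A2, R), (A2, Q), (A2, W2), (A3, S), (A3, P), (A3, W3)]"

definition pend_pairs :: "nat \<Rightarrow> (site \<times> site) list" where
  "pend_pairs e = [(pend_host e, Pend e 0), (Pend e 0, Pend e 1), (Pend e 0, Pend e 2),
     (Pend e 2, Pend e 3), (Pend e 2, Pend e 4), (Pend e 3, Pend e 4)]"

definition cell_pairs :: "(site \<times> site) list" where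
  "cell_pairs = core_pairs @ concat (map pend_pairs [0..<13])"

type_synonym cell_vertex = "nat \<times> nat \<times> site"

text \<open>The additional row \<open>m\<close> only carries the pairs \<open>R\<close>,
  \<open>R'\<close> in which the vertical signals end; its other sites are isolated. In column 0 the
  edge from \<open>A4\<close> to \<open>Q\<close> is missing, so that no clause is satisfied by a
  signal entering from outside.\<close>

definition cell_edge ::
    "nat \<Rightarrow> nat \<Rightarrow> (nat \<Rightarrow> nat \<Rightarrow> bool) \<Rightarrow> (nat \<Rightarrow> nat \<Rightarrow> bool) \<Rightarrow> cell_vertex \<Rightarrow> cell_vertex \<Rightarrow> bool" where
  "cell_edge m n pos neg u v \<longleftrightarrow> (\<exists>i<Suc m. \<exists>j<n.
     (u, v) = ((i, j, R), (i, j, R')) \<or>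
     i < m \<and> ((\<exists>(a, b)\<in>set cell_pairs. (u, v) = ((i, j, a), (i, j, b))) \<or>
       0 < j \<and> (u, v) = ((i, j, A4), (i, j, Q)) \<or>
       pos i j \<and> (u, v) = ((i, j, A4), (i, j, R)) \<or>
       neg i j \<and> (u, v) = ((i, j, A4), (i, j, R')) \<or>
       (u, v) = ((i, j, A3), (Suc i, j, R)) \<or>
       Suc j < n \<and> (u, v) = ((i, j, A4), (i, Suc j, P'))))"

definition sites :: "site set" where
  "sites = {P, P', R, R', S, S', Q, Q', A1, A2, A3, A4, W1, W2, W3} \<union> {Pend e t | e t. e < 13 \<and> t < 5}"

definition cell_vertices :: "nat \<Rightarrow> nat \<Rightarrow> cell_vertex set" where
  "cell_vertices m n = {..<Suc m} \<times> {..<n} \<times> sites"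

definition cell_edges :: "nat \<Rightarrow> nat \<Rightarrow> (nat \<Rightarrow> nat \<Rightarrow> bool) \<Rightarrow> (nat \<Rightarrow> nat \<Rightarrow> bool) \<Rightarrow> cell_vertex set set" where
  "cell_edges m n pos neg = {{u, v} | u v. cell_edge m n pos neg u v}"

lemma cell_pairs_iff:
  "(a, b) \<in> set cell_pairs \<longleftrightarrow> (a, b) \<in> set core_pairs \<or> (\<exists>e<13. (a, b) \<in> set (pend_pairs e))"
  by (auto simp: cell_pairs_def)

lemma pend_host_cases:
  "e < 13 \<Longrightarrow> pend_host e = A1 \<longleftrightarrow> e = 0" "e < 13 \<Longrightarrow> pend_host e = A2 \<longleftrightarrow> e = 1" "e < 13 \<Longrightarrow> pend_host e = A3 \<longleftrightarrow> e = 2"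
  "e < 13 \<Longrightarrow> pend_host e = A4 \<longleftrightarrow> e = 3" "e < 13 \<Longrightarrow> pend_host e = W1 \<longleftrightarrow> e = 4 \<or> e = 5 \<or> e = 6"
  "e < 13 \<Longrightarrow> pend_host e = W2 \<longleftrightarrow> e = 7 \<or> e = 8 \<or> e = 9" "e < 13 \<Longrightarrow> pend_host e = W3 \<longleftrightarrow> e = 10 \<or> e = 11 \<or> e = 12"
  by (auto simp: pend_host_def)

lemma pend_host_core [simp]:
  "pend_host e \<noteq> P" "pend_host e \<noteq> P'" "pend_host e \<noteq> R" "pend_host e \<noteq> R'" "pend_host e \<noteq> S" "pend_host e \<noteq> S'"
  "pend_host e \<noteq> Q" "pend_host e \<noteq> Q'" "pend_host e \<noteq> Pend f t"
  by (auto simp: pend_host_def)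

lemma pend_host_sites: "pend_host e \<in> sites"
  by (auto simp: pend_host_def sites_def)

lemma mem_sites:
  "P \<in> sites" "P' \<in> sites" "R \<in> sites" "R' \<in> sites" "S \<in> sites" "S' \<in> sites" "Q \<in> sites" "Q' \<in> sites"
  "A1 \<in> sites" "A2 \<in> sites" "A3 \<in> sites" "A4 \<in> sites" "W1 \<in> sites" "W2 \<in> sites" "W3 \<in> sites"
  "Pend e t \<in> sites \<longleftrightarrow> e < 13 \<and> t < 5"
  by (auto simp: sites_def)

lemma cell_pairs_sites: "(a, b) \<in> set cell_pairs \<Longrightarrow> a \<in> sites \<and> b \<in> sites \<and> a \<noteq> b"
  unfolding cell_pairs_iff
  using pend_host_core[symmetric] by (auto simp: core_pairs_def pend_pairs_def pend_host_sites mem_sites)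

text \<open>A failing \<open>A4\<close> has degree 1 and is refuted by a neighbor of degree 1. With
  at least two columns it always has \<open>P'\<close> of the next column or its own
  \<open>Q\<close> for this purpose.\<close>

locale cell_graph =
  fixes m n :: nat and pos neg :: "nat \<Rightarrow> nat \<Rightarrow> bool"
  assumes n: "2 \<le> n"
begin

abbreviation "V \<equiv> cell_vertices m n"
abbreviation "E \<equiv> cell_edges m n pos neg"
abbreviation "adj \<equiv> cell_edge m n pos neg"

lemma adj_vertices: "adj u v \<Longrightarrow> u \<in> V \<and> v \<in> V \<and> u \<noteq> v"
proof -
  show "adj u v \<Longrightarrow> u \<in> V \<and> v \<in> V \<and> u \<noteq> v"
    unfolding cell_edge_def cell_vertices_def
    by (elim exE conjE disjE bexE) (auto simp: mem_sites dest: cell_pairs_sites)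
qed

lemma finite_sites: "finite sites"
proof -
  have "{Pend e t | e t. e < 13 \<and> t < 5} = (\<lambda>(e, t). Pend e t) ` ({..<13} \<times> {..<5})" by auto
  then show ?thesis unfolding sites_def by simp
qed

lemma simple: "simple_graph V E"
proof -
  have "finite V" by (simp add: cell_vertices_def finite_sites)
  then show ?thesis
    unfolding simple_graph_def cell_edges_def using adj_vertices by (auto simp: card_insert_if)
qed

lemma edge_iff: "{u, v} \<in> E \<longleftrightarrow> adj u v \<or> adj v u"
proof
  assume "{u, v} \<in> E"
  then obtain a b where "adj a b" "{u, v} = {a, b}" unfolding cell_edges_def by blast
  then show "adj u v \<or> adj v u" by (auto simp: doubleton_eq_iff)
next
  have "{u, v} \<in> E" if "adj u v" for u v using that unfolding cell_edges_def by blast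
  moreover assume "adj u v \<or> adj v u"
  ultimately show "{u, v} \<in> E" by (metis insert_commute)
qed

lemma neighbors_iff: "u \<in> neighbors E v \<longleftrightarrow> adj u v \<or> adj v u"
  by (simp add: neighbors_def edge_iff)

section \<open>Neighborhoods in the cell graph\<close>

lemma neighborsI:
  "(\<And>i j a. adj (i, j, a) v \<or> adj v (i, j, a) \<longleftrightarrow> (i, j, a) \<in> X) \<Longrightarrow> neighbors E v = X"
  using neighbors_iff by (metis prod_cases3 set_eqI)

lemma adj_expand:
  "adj (i, j, a) (i', j', b) \<longleftrightarrow> j < n \<and>
     (i < Suc m \<and> i' = i \<and> j' = j \<and> a = R \<and> b = R' \<or>
      i < m \<and> (i' = i \<and> j' = j \<and> (a, b) \<in> set cell_pairs \<or>
       i' = i \<and> j' = j \<and> a = A4 \<and> (0 < j \<and> b = Q \<or> pos i j \<and> b = R \<or> neg i j \<and> b = R') \<or>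
       i' = Suc i \<and> j' = j \<and> a = A3 \<and> b = R \<or>
       i' = i \<and> j' = Suc j \<and> Suc j < n \<and> a = A4 \<and> b = P'))" (is "?l \<longleftrightarrow> ?r")
proof
  assume ?l
  then show ?r unfolding cell_edge_def by auto
next
  assume r: ?r
  then have ij: "i < Suc m" "j < n" by auto
  have e: "(\<exists>(c, d)\<in>set cell_pairs. ((i, j, a), (i', j', b)) = ((i, j, c), (i, j, d))) \<longleftrightarrow>
      i' = i \<and> j' = j \<and> (a, b) \<in> set cell_pairs" by auto
  show ?l
    unfolding cell_edge_def
    by (rule exI[of _ i], rule conjI[OF ij(1)], rule exI[of _ j], rule conjI[OF ij(2)])
       (unfold e, unfold prod.inject, use r in argo)
qed

lemma pair_core [simp]:
  "(a, P) \<in> set cell_pairs \<longleftrightarrow> a = A1 \<or> a = A3" "(P, a) \<in> set cell_pairs \<longleftrightarrow> a = P'"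
  "(a, P') \<in> set cell_pairs \<longleftrightarrow> a = P" "(P', a) \<notin> set cell_pairs"
  "(a, R) \<in> set cell_pairs \<longleftrightarrow> a = A1 \<or> a = A2" "(R, a) \<notin> set cell_pairs"
  "(a, R') \<notin> set cell_pairs" "(R', a) \<notin> set cell_pairs"
  "(a, S) \<in> set cell_pairs \<longleftrightarrow> a = A1 \<or> a = A2 \<or> a = A3" "(S, a) \<in> set cell_pairs \<longleftrightarrow> a = S'"
  "(a, S') \<in> set cell_pairs \<longleftrightarrow> a = S" "(S', a) \<notin> set cell_pairs"
  "(a, Q) \<in> set cell_pairs \<longleftrightarrow> a = A2" "(Q, a) \<in> set cell_pairs \<longleftrightarrow> a = Q'"
  "(a, Q') \<in> set cell_pairs \<longleftrightarrow> a = Q" "(Q', a) \<notin> set cell_pairs"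
  "(a, A1) \<notin> set cell_pairs" "(a, A2) \<notin> set cell_pairs" "(a, A3) \<notin> set cell_pairs" "(a, A4) \<notin> set cell_pairs"
  "(a, W1) \<in> set cell_pairs \<longleftrightarrow> a = A1" "(a, W2) \<in> set cell_pairs \<longleftrightarrow> a = A2" "(a, W3) \<in> set cell_pairs \<longleftrightarrow> a = A3"
  "(A1, a) \<in> set cell_pairs \<longleftrightarrow> a = P \<or> a = R \<or> a = S \<or> a = W1 \<or> a = Pend 0 0"
  "(A2, a) \<in> set cell_pairs \<longleftrightarrow> a = S \<or> a = R \<or> a = Q \<or> a = W2 \<or> a = Pend 1 0"
  "(A3, a) \<in> set cell_pairs \<longleftrightarrow> a = S \<or> a = P \<or> a = W3 \<or> a = Pend 2 0"
  "(A4, a) \<in> set cell_pairs \<longleftrightarrow> a = Pend 3 0"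
  "(W1, a) \<in> set cell_pairs \<longleftrightarrow> a = Pend 4 0 \<or> a = Pend 5 0 \<or> a = Pend 6 0"
  "(W2, a) \<in> set cell_pairs \<longleftrightarrow> a = Pend 7 0 \<or> a = Pend 8 0 \<or> a = Pend 9 0"
  "(W3, a) \<in> set cell_pairs \<longleftrightarrow> a = Pend 10 0 \<or> a = Pend 11 0 \<or> a = Pend 12 0"
  unfolding cell_pairs_iff core_pairs_def pend_pairs_def
  by (auto simp: pend_host_cases eq_commute[of _ "pend_host _"])

lemma pair_pend:
  assumes "e < 13"
  shows "(a, Pend e 0) \<in> set cell_pairs \<longleftrightarrow> a = pend_host e" "(Pend e 0, a) \<in> set cell_pairs \<longleftrightarrow> a = Pend e 1 \<or> a = Pend e 2"
    "(a, Pend e 1) \<in> set cell_pairs \<longleftrightarrow> a = Pend e 0" "(Pend e 1, a) \<notin> set cell_pairs"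
    "(a, Pend e 2) \<in> set cell_pairs \<longleftrightarrow> a = Pend e 0" "(Pend e 2, a) \<in> set cell_pairs \<longleftrightarrow> a = Pend e 3 \<or> a = Pend e 4"
    "(a, Pend e 3) \<in> set cell_pairs \<longleftrightarrow> a = Pend e 2" "(Pend e 3, a) \<in> set cell_pairs \<longleftrightarrow> a = Pend e 4"
    "(a, Pend e 4) \<in> set cell_pairs \<longleftrightarrow> a = Pend e 2 \<or> a = Pend e 3" "(Pend e 4, a) \<notin> set cell_pairs"
  unfolding cell_pairs_iff core_pairs_def pend_pairs_def using assms pend_host_core[symmetric] by auto

context
  fixes i j assumes ij: "i < m" "j < n"
begin

lemma nb_pend:
  assumes "e < 13"
  shows "neighbors E (i, j, Pend e 0) = {(i, j, pend_host e), (i, j, Pend e 1), (i, j, Pend e 2)}"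
    "neighbors E (i, j, Pend e 1) = {(i, j, Pend e 0)}"
    "neighbors E (i, j, Pend e 2) = {(i, j, Pend e 0), (i, j, Pend e 3), (i, j, Pend e 4)}"
    "neighbors E (i, j, Pend e 3) = {(i, j, Pend e 2), (i, j, Pend e 4)}"
    "neighbors E (i, j, Pend e 4) = {(i, j, Pend e 2), (i, j, Pend e 3)}"
  by - (rule neighborsI; auto simp: adj_expand pair_pend[OF assms] pair_pend(3,4)[OF assms, unfolded One_nat_def] ij)+

lemma nb_A:
  "neighbors E (i, j, A1) = {(i, j, P), (i, j, R), (i, j, S), (i, j, W1), (i, j, Pend 0 0)}"
  "neighbors E (i, j, A2) = {(i, j, S), (i, j, R), (i, j, Q), (i, j, W2), (i, j, Pend 1 0)}"
  "neighbors E (i, j, A3) = {(i, j, S), (i, j, P), (Suc i, j, R), (i, j, W3), (i, j, Pend 2 0)}"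
  "neighbors E (i, j, A4) = {(i, j, Pend 3 0)} \<union> (if 0 < j then {(i, j, Q)} else {}) \<union> (if pos i j then {(i, j, R)} else {}) \<union>
     (if neg i j then {(i, j, R')} else {}) \<union> (if Suc j < n then {(i, Suc j, P')} else {})"
proof -
  show "neighbors E (i, j, A1) = {(i, j, P), (i, j, R), (i, j, S), (i, j, W1), (i, j, Pend 0 0)}"
    "neighbors E (i, j, A2) = {(i, j, S), (i, j, R), (i, j, Q), (i, j, W2), (i, j, Pend 1 0)}"
    "neighbors E (i, j, A3) = {(i, j, S), (i, j, P), (Suc i, j, R), (i, j, W3), (i, j, Pend 2 0)}"
    by - (rule neighborsI; auto simp: adj_expand ij)+
  show "neighbors E (i, j, A4) = {(i, j, Pend 3 0)} \<union> (if 0 < j then {(i, j, Q)} else {}) \<union> (if pos i j then {(i, j, R)} else {}) \<union>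
     (if neg i j then {(i, j, R')} else {}) \<union> (if Suc j < n then {(i, Suc j, P')} else {})"
    by (rule neighborsI) (auto simp: adj_expand ij)
qed

lemma nb_W:
  "neighbors E (i, j, W1) = {(i, j, A1), (i, j, Pend 4 0), (i, j, Pend 5 0), (i, j, Pend 6 0)}"
  "neighbors E (i, j, W2) = {(i, j, A2), (i, j, Pend 7 0), (i, j, Pend 8 0), (i, j, Pend 9 0)}"
  "neighbors E (i, j, W3) = {(i, j, A3), (i, j, Pend 10 0), (i, j, Pend 11 0), (i, j, Pend 12 0)}"
  by - (rule neighborsI; auto simp: adj_expand ij)+

end

fun partner :: "site \<Rightarrow> site" where
  "partner P = P'" | "partner P' = P" | "partner R = R'" | "partner R' = R"
| "partner S = S'" | "partner S' = S" | "partner Q = Q'" | "partner Q' = Q" | "partner a = a"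

definition literal :: "site set" where
  "literal = {P, P', R, R', S, S', Q, Q'}"

definition gates :: "cell_vertex set" where
  "gates = {(i, j, a) | i j a. i < m \<and> j < n \<and> a \<in> {A1, A2, A3, A4}}"

lemma literal_adj:
  assumes "a \<in> literal" "adj (i, j, a) (i', j', b)"
  shows "(i', j', b) = (i, j, partner a)"
  using assms by (cases a) (simp_all add: literal_def adj_expand)

lemma literal_adj':
  assumes "a \<in> literal" "adj (i', j', b) (i, j, a)"
  shows "(i', j', b) = (i, j, partner a) \<or> (i', j', b) \<in> gates"
  using assms by (cases a) (simp_all add: literal_def adj_expand gates_def, auto)

lemma nb_literal:
  assumes "j < n" "i < m \<or> i = m \<and> a \<in> {R, R'}" "a \<in> literal"
  shows "(i, j, partner a) \<in> neighbors E (i, j, a)" "neighbors E (i, j, a) \<subseteq> insert (i, j, partner a) gates"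
proof -
  have a: "a = P \<or> a = P' \<or> a = R \<or> a = R' \<or> a = S \<or> a = S' \<or> a = Q \<or> a = Q'" using assms(3) by (simp add: literal_def)
  show "(i, j, partner a) \<in> neighbors E (i, j, a)"
    using a assms(1,2) by (elim disjE; simp add: neighbors_iff adj_expand; fail)
  show "neighbors E (i, j, a) \<subseteq> insert (i, j, partner a) gates"
  proof
    fix u assume u: "u \<in> neighbors E (i, j, a)"
    obtain i' j' b where ub: "u = (i', j', b)" by (rule prod_cases3)
    have "adj (i', j', b) (i, j, a) \<or> adj (i, j, a) (i', j', b)" using u by (simp add: neighbors_iff ub)
    then show "u \<in> insert (i, j, partner a) gates"
      unfolding ub using literal_adj[OF assms(3), of i j i' j' b] literal_adj'[OF assms(3), of i' j' b i j]
      by (elim disjE) auto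
  qed
qed

text \<open>Apart from its partner, a literal only sees gates, which have label 1 as hosts of
  pendants. Its degree is therefore the value of the partner, and the edge between partners makes
  their values complementary.\<close>

lemma sdeg_literal:
  assumes "j < n" "i < m \<or> i = m \<and> a \<in> {R, R'}" "a \<in> literal" "gates \<inter> X = {}"
  shows "sdeg E X (i, j, a) = of_bool ((i, j, partner a) \<in> X)"
proof -
  have "sdeg E X (i, j, a) = (\<Sum>u\<in>{(i, j, partner a)}. of_bool (u \<in> X))"
    unfolding sdeg_def
  proof (rule sum.mono_neutral_right)
    show "finite (neighbors E (i, j, a))"
      by (rule finite_subset[OF neighbors_subset[OF simple]]) (simp add: cell_vertices_def finite_sites)
    show "{(i, j, partner a)} \<subseteq> neighbors E (i, j, a)" using nb_literal[OF assms(1-3)] by simp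
    show "\<forall>u\<in>neighbors E (i, j, a) - {(i, j, partner a)}. of_bool (u \<in> X) = (0 :: nat)"
      using nb_literal(2)[OF assms(1-3)] assms(4) by auto
  qed
  then show ?thesis by simp
qed

definition proper :: "cell_vertex set \<Rightarrow> bool" where
  "proper X \<longleftrightarrow> (\<forall>u v. adj u v \<longrightarrow> sdeg E X u \<noteq> sdeg E X v)"

lemma proper_iff: "proper X \<longleftrightarrow> (\<forall>u v. {u, v} \<in> E \<longrightarrow> sdeg E X u \<noteq> sdeg E X v)"
  unfolding proper_def edge_iff by metis

lemma sdeg_pend:
  assumes "i < m" "j < n" "e < 13"
  shows "sdeg E X (i, j, Pend e 0) = of_bool ((i, j, pend_host e) \<in> X) + of_bool ((i, j, Pend e 1) \<in> X) + of_bool ((i, j, Pend e 2) \<in> X)"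
    "sdeg E X (i, j, Pend e 1) = of_bool ((i, j, Pend e 0) \<in> X)"
    "sdeg E X (i, j, Pend e 2) = of_bool ((i, j, Pend e 0) \<in> X) + of_bool ((i, j, Pend e 3) \<in> X) + of_bool ((i, j, Pend e 4) \<in> X)"
    "sdeg E X (i, j, Pend e 3) = of_bool ((i, j, Pend e 2) \<in> X) + of_bool ((i, j, Pend e 4) \<in> X)"
    "sdeg E X (i, j, Pend e 4) = of_bool ((i, j, Pend e 2) \<in> X) + of_bool ((i, j, Pend e 3) \<in> X)"
  unfolding sdeg_def nb_pend[OF assms] by simp_all

text \<open>Let \<open>x0\<close>, ..., \<open>x4\<close> be 1 or 0 according to membership in
  \<open>X\<close>. The edge from \<open>Pend e 3\<close> to \<open>Pend e 4\<close> makes exactly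
  one of the two a member, so \<open>Pend e 2\<close> has degree \<open>x0 + 1\<close>, which must
  avoid \<open>x2\<close> and \<open>x2 + 1\<close>; this leaves \<open>x2 = 0\<close> and
  \<open>x0 = 1\<close>. Now the leaf \<open>Pend e 1\<close> has degree 1 and
  \<open>Pend e 2\<close> has degree 2, so the degree of \<open>Pend e 0\<close>, to which only host
  and leaf can still contribute, must be 0.\<close>

lemma pend_forced:
  assumes X: "proper X" and ij: "i < m" "j < n" "e < 13"
  shows "(i, j, pend_host e) \<notin> X" "(i, j, Pend e 0) \<in> X"
proof -
  have "adj (i, j, Pend e 0) (i, j, Pend e 1)" "adj (i, j, Pend e 0) (i, j, Pend e 2)"
    "adj (i, j, Pend e 2) (i, j, Pend e 3)" "adj (i, j, Pend e 2) (i, j, Pend e 4)" "adj (i, j, Pend e 3) (i, j, Pend e 4)"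
    using ij by (simp_all add: adj_expand pair_pend)
  then have "sdeg E X (i, j, Pend e 0) \<noteq> sdeg E X (i, j, Pend e 1)" "sdeg E X (i, j, Pend e 0) \<noteq> sdeg E X (i, j, Pend e 2)"
    "sdeg E X (i, j, Pend e 2) \<noteq> sdeg E X (i, j, Pend e 3)" "sdeg E X (i, j, Pend e 2) \<noteq> sdeg E X (i, j, Pend e 4)"
    "sdeg E X (i, j, Pend e 3) \<noteq> sdeg E X (i, j, Pend e 4)"
    using X unfolding proper_def by blast+
  then have "(i, j, pend_host e) \<notin> X \<and> (i, j, Pend e 0) \<in> X"
    unfolding sdeg_pend[OF ij]
    by (cases "(i, j, pend_host e) \<in> X"; cases "(i, j, Pend e 0) \<in> X"; cases "(i, j, Pend e 1) \<in> X";
        cases "(i, j, Pend e 2) \<in> X"; cases "(i, j, Pend e 3) \<in> X"; cases "(i, j, Pend e 4) \<in> X") simp_all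
  then show "(i, j, pend_host e) \<notin> X" "(i, j, Pend e 0) \<in> X" by blast+
qed

lemma sdeg_gate:
  assumes ij: "i < m" "j < n" and X: "\<forall>e<13. (i, j, pend_host e) \<notin> X \<and> (i, j, Pend e 0) \<in> X"
  shows "sdeg E X (i, j, A1) = 1 + of_bool ((i, j, P) \<in> X) + of_bool ((i, j, R) \<in> X) + of_bool ((i, j, S) \<in> X)"
    "sdeg E X (i, j, A2) = 1 + of_bool ((i, j, S) \<in> X) + of_bool ((i, j, R) \<in> X) + of_bool ((i, j, Q) \<in> X)"
    "sdeg E X (i, j, A3) = 1 + of_bool ((i, j, S) \<in> X) + of_bool ((i, j, P) \<in> X) + of_bool ((Suc i, j, R) \<in> X)"
    "sdeg E X (i, j, A4) = 1 + of_bool (0 < j \<and> (i, j, Q) \<in> X) + of_bool (pos i j \<and> (i, j, R) \<in> X) +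
       of_bool (neg i j \<and> (i, j, R') \<in> X) + of_bool (Suc j < n \<and> (i, Suc j, P') \<in> X)"
    "sdeg E X (i, j, W1) = 3" "sdeg E X (i, j, W2) = 3" "sdeg E X (i, j, W3) = 3"
proof -
  have h: "(i, j, A1) \<notin> X" "(i, j, A2) \<notin> X" "(i, j, A3) \<notin> X" "(i, j, W1) \<notin> X" "(i, j, W2) \<notin> X" "(i, j, W3) \<notin> X"
    using X[rule_format, of 0] X[rule_format, of 1] X[rule_format, of 2] X[rule_format, of 4]
      X[rule_format, of 7] X[rule_format, of 10] by (simp_all add: pend_host_def)
  have p: "(i, j, Pend e 0) \<in> X" if "e < 13" for e using X that by blast
  show "sdeg E X (i, j, A1) = 1 + of_bool ((i, j, P) \<in> X) + of_bool ((i, j, R) \<in> X) + of_bool ((i, j, S) \<in> X)"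
    "sdeg E X (i, j, A2) = 1 + of_bool ((i, j, S) \<in> X) + of_bool ((i, j, R) \<in> X) + of_bool ((i, j, Q) \<in> X)"
    "sdeg E X (i, j, A3) = 1 + of_bool ((i, j, S) \<in> X) + of_bool ((i, j, P) \<in> X) + of_bool ((Suc i, j, R) \<in> X)"
    "sdeg E X (i, j, W1) = 3" "sdeg E X (i, j, W2) = 3" "sdeg E X (i, j, W3) = 3"
    unfolding sdeg_def nb_A[OF ij] nb_W[OF ij] by (simp_all add: h p)
  show "sdeg E X (i, j, A4) = 1 + of_bool (0 < j \<and> (i, j, Q) \<in> X) + of_bool (pos i j \<and> (i, j, R) \<in> X) +
       of_bool (neg i j \<and> (i, j, R') \<in> X) + of_bool (Suc j < n \<and> (i, Suc j, P') \<in> X)"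
    unfolding sdeg_def nb_A[OF ij]
    using p[of 3] by (cases "0 < j"; cases "pos i j"; cases "neg i j"; cases "Suc j < n") simp_all
qed

lemma gates_hosts:
  assumes "\<And>i j e. i < m \<Longrightarrow> j < n \<Longrightarrow> e < 13 \<Longrightarrow> (i, j, pend_host e) \<notin> X"
  shows "gates \<inter> X = {}"
proof -
  have "(i, j, a) \<notin> X" if "i < m" "j < n" "a \<in> {A1, A2, A3, A4}" for i j a
    using assms[OF that(1,2), of 0] assms[OF that(1,2), of 1] assms[OF that(1,2), of 2] assms[OF that(1,2), of 3] that(3)
    by (auto simp: pend_host_def)
  then show ?thesis unfolding gates_def by blast
qed

lemma proper_imp_satisfiable:
  assumes X: "proper X"
  shows "satisfiable m n pos neg"
proof -
  note forced = pend_forced[OF X]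
  have g: "gates \<inter> X = {}" by (rule gates_hosts) (rule forced(1))
  have fc: "\<forall>e<13. (i, j, pend_host e) \<notin> X \<and> (i, j, Pend e 0) \<in> X" if "i < m" "j < n" for i j
    using forced[OF that] by blast
  note lit = sdeg_literal[OF _ _ _ g]
  have ne: "sdeg E X u \<noteq> sdeg E X v" if "adj u v" for u v using X that unfolding proper_def by blast
  have part: "(i, j, P') \<in> X \<longleftrightarrow> (i, j, P) \<notin> X" "(i, j, S') \<in> X \<longleftrightarrow> (i, j, S) \<notin> X" "(i, j, Q') \<in> X \<longleftrightarrow> (i, j, Q) \<notin> X"
    if ij: "i < m" "j < n" for i j
    using ne[of "(i, j, P)" "(i, j, P')"] ne[of "(i, j, S)" "(i, j, S')"] ne[of "(i, j, Q)" "(i, j, Q')"] ij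
    by (auto simp: adj_expand lit literal_def)
  have partR: "(i, j, R') \<in> X \<longleftrightarrow> (i, j, R) \<notin> X" if ij: "i < m \<or> i = m" "j < n" for i j
    using ne[of "(i, j, R)" "(i, j, R')"] ij by (auto simp: adj_expand lit literal_def)
  \<comment> \<open>A gate without true values has degree 1 and collides with \<open>S\<close>,
    which is then false and has degree 1 as well; with two true values it has degree 3 and collides
    with its \<open>W\<close>. So an odd number of the three values is true.\<close>
  have parity: "(i, j, P) \<in> X \<longleftrightarrow> ((i, j, R) \<in> X \<longleftrightarrow> (i, j, S) \<in> X)" "(i, j, S) \<in> X \<longleftrightarrow> ((i, j, R) \<in> X \<longleftrightarrow> (i, j, Q) \<in> X)"
    "(i, j, S) \<in> X \<longleftrightarrow> ((i, j, P) \<in> X \<longleftrightarrow> (Suc i, j, R) \<in> X)" if ij: "i < m" "j < n" for i j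
  proof -
    have lits: "sdeg E X (i, j, S) = of_bool ((i, j, S) \<notin> X)"
      using ij part[OF ij] by (simp_all add: lit literal_def)
    have "adj (i, j, A1) (i, j, S)" "adj (i, j, A1) (i, j, W1)" "adj (i, j, A2) (i, j, S)" "adj (i, j, A2) (i, j, W2)"
      "adj (i, j, A3) (i, j, S)" "adj (i, j, A3) (i, j, W3)"
      using ij by (simp_all add: adj_expand)
    note N = this[THEN ne, unfolded sdeg_gate[OF ij fc[OF ij]] lits]
    show "(i, j, P) \<in> X \<longleftrightarrow> ((i, j, R) \<in> X \<longleftrightarrow> (i, j, S) \<in> X)"
      using N(1,2) by (cases "(i, j, P) \<in> X"; cases "(i, j, R) \<in> X"; cases "(i, j, S) \<in> X") simp_all
    show "(i, j, S) \<in> X \<longleftrightarrow> ((i, j, R) \<in> X \<longleftrightarrow> (i, j, Q) \<in> X)"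
      using N(3,4) by (cases "(i, j, Q) \<in> X"; cases "(i, j, R) \<in> X"; cases "(i, j, S) \<in> X") simp_all
    show "(i, j, S) \<in> X \<longleftrightarrow> ((i, j, P) \<in> X \<longleftrightarrow> (Suc i, j, R) \<in> X)"
      using N(5,6) by (cases "(i, j, P) \<in> X"; cases "(Suc i, j, R) \<in> X"; cases "(i, j, S) \<in> X") simp_all
  qed
  \<comment> \<open>Eliminating \<open>S\<close> from the three parity conditions leaves these two
    equivalences: the signals have crossed.\<close>
  have QP: "(i, j, Q) \<in> X \<longleftrightarrow> (i, j, P) \<in> X" and RR: "(Suc i, j, R) \<in> X \<longleftrightarrow> (i, j, R) \<in> X" if "i < m" "j < n" for i j
    using parity[OF that] by blast+
  define a where "a = (\<lambda>j. (0, j, R) \<in> X)"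
  have R: "(i, j, R) \<in> X \<longleftrightarrow> a j" if "i \<le> m" "j < n" for i j
    using that by (induction i) (auto simp: a_def RR)
  define L where "L = (\<lambda>i j. pos i j \<and> a j \<or> neg i j \<and> \<not> a j)"
  \<comment> \<open>If the disjunction fails, \<open>A4\<close> has degree 1 from its pendant alone,
    and so has a neighbor: \<open>P'\<close> of the next column, or \<open>Q\<close> in the last
    column.\<close>
  have clause: "0 < j \<and> (i, j, P) \<in> X \<or> L i j \<or> Suc j < n \<and> (i, Suc j, P) \<notin> X" if ij: "i < m" "j < n" for i j
  proof (rule ccontr)
    assume c: "\<not> ?thesis"
    then have d: "sdeg E X (i, j, A4) = 1"
      unfolding sdeg_gate[OF ij fc[OF ij]] L_def using R[of i j] partR[of i j] QP[OF ij] part(1)[of i "Suc j"] ij by auto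
    show False
    proof (cases "Suc j < n")
      case True
      have "adj (i, j, A4) (i, Suc j, P')" using True ij by (simp add: adj_expand)
      moreover have "sdeg E X (i, Suc j, P') = 1" using True ij c by (simp add: lit literal_def)
      ultimately show False using ne d by metis
    next
      case False
      then have "0 < j" using n ij by linarith
      then have "adj (i, j, A4) (i, j, Q)" using ij by (simp add: adj_expand)
      moreover have "sdeg E X (i, j, Q) = 1" using \<open>0 < j\<close> ij c QP[OF ij] part(3)[OF ij] by (simp add: lit literal_def)
      ultimately show False using ne d by metis
    qed
  qed
  \<comment> \<open>A true \<open>P\<close> goes back to a true literal further left, because in
    column 0 the gate \<open>A4\<close> does not see \<open>Q\<close>.\<close>
  have chain: "\<exists>j'<j. L i j'" if "i < m" "j < n" "0 < j" "(i, j, P) \<in> X" for i j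
    using that(2-4)
  proof (induction j)
    case (Suc j)
    then have "0 < j \<and> (i, j, P) \<in> X \<or> L i j" using clause[OF that(1), of j] by auto
    then show ?case using Suc by (metis Suc_lessD less_SucI lessI)
  qed simp
  have "\<exists>j<n. L i j" if i: "i < m" for i
  proof -
    have "0 < n - 1 \<and> (i, n - 1, P) \<in> X \<or> L i (n - 1)" using clause[OF i, of "n - 1"] n by auto
    then show ?thesis using chain[OF i, of "n - 1"] n by (metis diff_less less_trans zero_less_one less_imp_diff_less pos2 less_le_trans)
  qed
  then show ?thesis unfolding satisfiable_def L_def by blast
qed

text \<open>\<open>P\<close> in column \<open>j\<close> is given the meaning that the clause has a
  true literal before \<open>j\<close>. Then literals have degree at most 1, \<open>A1\<close> to
  \<open>A3\<close> have 2 or 4, the \<open>W\<close> sites 3 and \<open>A4\<close> at least 2,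
  which separates all kinds of sites that are joined by edges.\<close>

lemma satisfiable_imp_proper:
  assumes "satisfiable m n pos neg"
  shows "\<exists>X. proper X"
proof -
  obtain a where a: "\<forall>i<m. \<exists>j<n. pos i j \<and> a j \<or> neg i j \<and> \<not> a j" using assms unfolding satisfiable_def by blast
  define L where "L = (\<lambda>i j. pos i j \<and> a j \<or> neg i j \<and> \<not> a j)"
  define p where "p = (\<lambda>i j. \<exists>j'<j. L i j')"
  \<comment> \<open>In each pendant the members of \<open>X\<close> are vertices 0 and 3, which
    gives its five vertices the degrees 0, 1, 2, 0, 1.\<close>
  define val where "val = (\<lambda>i j x. case x of P \<Rightarrow> p i j | P' \<Rightarrow> \<not> p i j | R \<Rightarrow> a j | R' \<Rightarrow> \<not> a j | S \<Rightarrow> p i j \<longleftrightarrow> a j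
    | S' \<Rightarrow> \<not> (p i j \<longleftrightarrow> a j) | Q \<Rightarrow> p i j | Q' \<Rightarrow> \<not> p i j | Pend e t \<Rightarrow> t = 0 \<or> t = 3 | _ \<Rightarrow> False)"
  define X where "X = {(i, j, x). val i j x}"
  have mem: "(i, j, x) \<in> X \<longleftrightarrow> val i j x" for i j x by (simp add: X_def)
  have host: "(i, j, pend_host e) \<notin> X" for i j e by (auto simp: mem val_def pend_host_def)
  have g: "gates \<inter> X = {}" by (rule gates_hosts) (rule host)
  have pe: "(i, j, Pend e 0) \<in> X" for i j e by (simp add: mem val_def)
  have hp: "\<forall>e<13. (i, j, pend_host e) \<notin> X \<and> (i, j, Pend e 0) \<in> X" for i j
    using host pe by blast
  note gate = sdeg_gate[OF _ _ hp]
  have lit: "sdeg E X (i, j, x) = of_bool (\<not> val i j x)" if "j < n" "i < m \<or> i = m \<and> x \<in> {R, R'}" "x \<in> literal" for i j x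
    unfolding sdeg_literal[OF that g] mem using that(3) by (auto simp: literal_def val_def)
  have litR: "sdeg E X (i, j, R) = of_bool (\<not> a j)" if "j < n" "i \<le> m" for i j
    using lit[of j i R] that by (cases "i = m") (auto simp: literal_def val_def)
  have dP: "sdeg E X (i, j, Pend e 0) = 0" "sdeg E X (i, j, Pend e 1) = 1" "sdeg E X (i, j, Pend e 2) = 2"
    "sdeg E X (i, j, Pend e 3) = 0" "sdeg E X (i, j, Pend e 4) = 1" if "i < m" "j < n" "e < 13" for i j e
    unfolding sdeg_pend[OF that] using host[of i j e] by (simp_all add: mem val_def)
  have d1: "sdeg E X (i, j, A1) \<in> {2, 4}" "sdeg E X (i, j, A2) \<in> {2, 4}" "sdeg E X (i, j, A3) \<in> {2, 4}"
    if ij: "i < m" "j < n" for i j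
    unfolding gate[OF ij] by (cases "p i j"; cases "a j"; simp add: mem val_def)+
  have d4: "2 \<le> sdeg E X (i, j, A4)" if ij: "i < m" "j < n" for i j
  proof -
    have "L i j \<or> 0 < j \<and> p i j \<or> Suc j < n \<and> \<not> p i (Suc j)"
    proof (cases "Suc j < n")
      case True
      have "L i j \<or> 0 < j \<and> p i j" if pj: "p i (Suc j)"
      proof -
        obtain j' where "j' < Suc j" "L i j'" using pj unfolding p_def by blast
        then show ?thesis unfolding p_def by (cases "j' = j") auto
      qed
      with True show ?thesis by blast
    next
      case False
      then have "n = Suc j" using ij by simp
      then obtain j' where "j' < Suc j" "L i j'" using a ij by (auto simp: L_def)
      then show ?thesis unfolding p_def by (cases "j' = j") auto
    qed
    then show ?thesis unfolding gate[OF ij] mem val_def L_def by auto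
  qed
  have dh: "2 \<le> sdeg E X (i, j, pend_host e)" if ij: "i < m" "j < n" "e < 13" for i j e
    using d1[OF ij(1,2)] d4[OF ij(1,2)] gate(5-7)[OF ij(1,2)] by (auto simp: pend_host_def)
  have "sdeg E X u \<noteq> sdeg E X v" if uv: "adj u v" for u v
  proof -
    obtain i j x where u: "u = (i, j, x)" by (rule prod_cases3)
    obtain i' j' y where v: "v = (i', j', y)" by (rule prod_cases3)
    from uv have "j < n" "i < m \<or> i = m \<and> x = R \<and> y = R' \<and> i' = i \<and> j' = j"
      unfolding u v adj_expand by auto
    then consider "x = R" "y = R'" "i' = i" "j' = j" | "i < m" "i' = i" "j' = j" "(x, y) \<in> set cell_pairs"
      | "i < m" "x = A4" "i' = i" "j' < n" "y \<in> literal" | "i < m" "i' = Suc i" "j' = j" "x = A3" "y = R"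
      using uv unfolding u v adj_expand literal_def by auto
    then show ?thesis
    proof cases
      case 1
      have "i \<le> m" using \<open>i < m \<or> _\<close> by auto
      then show ?thesis unfolding u v using 1 \<open>j < n\<close> lit[of j i R] lit[of j i R']
        by (cases "i = m") (auto simp: literal_def val_def)
    next
      case 2
      from 2(4) consider "(x, y) \<in> set core_pairs" | e where "e < 13" "(x, y) \<in> set (pend_pairs e)"
        unfolding cell_pairs_iff by blast
      then show ?thesis
      proof cases
        case 1
        have l: "sdeg E X (i, j, z) = of_bool (\<not> val i j z)" if "z \<in> literal" for z
          using lit[OF \<open>j < n\<close>, of i z] 2(1) that by blast
        have lv: "sdeg E X (i, j, P) = of_bool (\<not> p i j)" "sdeg E X (i, j, P') = of_bool (p i j)"
          "sdeg E X (i, j, R) = of_bool (\<not> a j)" "sdeg E X (i, j, S) = of_bool (p i j \<noteq> a j)"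
          "sdeg E X (i, j, S') = of_bool (p i j = a j)" "sdeg E X (i, j, Q) = of_bool (\<not> p i j)"
          "sdeg E X (i, j, Q') = of_bool (p i j)"
          by (simp_all add: l literal_def val_def)
        have q: "sdeg E X (i, j, z) = 2 \<or> sdeg E X (i, j, z) = 4" if "z \<in> {A1, A2, A3}" for z
          using d1[OF 2(1) \<open>j < n\<close>] that by auto
        have w: "sdeg E X (i, j, z) = 3" if "z \<in> {W1, W2, W3}" for z
          using gate(5-7)[OF 2(1) \<open>j < n\<close>] that by auto
        have gl: "sdeg E X (i, j, z) \<noteq> of_bool c" "sdeg E X (i, j, z) \<noteq> 3" if "z \<in> {A1, A2, A3}" for z c
          using q[OF that] by auto
        have "(x, y) \<in> {(P, P'), (S, S'), (Q, Q')} \<or> x \<in> {A1, A2, A3} \<and> y \<in> {P, R, S, Q} \<or>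
            x \<in> {A1, A2, A3} \<and> y \<in> {W1, W2, W3}"
          using 1 by (auto simp: core_pairs_def)
        then show ?thesis
          unfolding u v 2(2,3)
        proof (elim disjE conjE)
          assume "(x, y) \<in> {(P, P'), (S, S'), (Q, Q')}"
          then show "sdeg E X (i, j, x) \<noteq> sdeg E X (i, j, y)" by (cases "p i j"; cases "a j") (auto simp: lv)
        next
          assume x: "x \<in> {A1, A2, A3}" and "y \<in> {P, R, S, Q}"
          then obtain c where "sdeg E X (i, j, y) = of_bool c" using lv by auto
          then show "sdeg E X (i, j, x) \<noteq> sdeg E X (i, j, y)" using gl(1)[OF x] by simp
        next
          assume "x \<in> {A1, A2, A3}" "y \<in> {W1, W2, W3}"
          then show "sdeg E X (i, j, x) \<noteq> sdeg E X (i, j, y)" using gl(2) w by simp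
        qed
      next
        case (2 e)
        then show ?thesis
          using \<open>i < m\<close> \<open>i' = i\<close> \<open>j' = j\<close> \<open>j < n\<close> dP[of i j e] dh[of i j e] unfolding u v pend_pairs_def by auto
      qed
    next
      case 3
      then have "sdeg E X (i', j', y) \<le> 1" using lit[of j' i' y] by simp
      moreover have "2 \<le> sdeg E X (i, j, x)" using d4[OF 3(1) \<open>j < n\<close>] 3(2) by simp
      ultimately show ?thesis unfolding u v by linarith
    next
      case 4
      then have "sdeg E X (i', j', y) \<le> 1" using litR[of j' i'] \<open>j < n\<close> by simp
      moreover have "2 \<le> sdeg E X (i, j, x)" using d1(3)[OF 4(1) \<open>j < n\<close>] 4 by auto
      ultimately show ?thesis unfolding u v by linarith
    qed
  qed
  then show ?thesis unfolding proper_def by blast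
qed

theorem cell_labeling_iff: "has_product_labeling 2 V E \<longleftrightarrow> satisfiable m n pos neg"
  unfolding has_product_labeling_2[OF simple] proper_iff[symmetric]
  using proper_imp_satisfiable satisfiable_imp_proper by blast

section \<open>A proper coloring with three colors\<close>

fun site_color :: "site \<Rightarrow> nat" where
  "site_color P = 1" | "site_color P' = 2" | "site_color R = 1" | "site_color R' = 2"
| "site_color S = 1" | "site_color S' = 2" | "site_color Q = 1" | "site_color Q' = 2"
| "site_color A1 = 3" | "site_color A2 = 3" | "site_color A3 = 3" | "site_color A4 = 3"
| "site_color W1 = 1" | "site_color W2 = 1" | "site_color W3 = 1"
| "site_color (Pend e t) = (if t = 0 \<or> t = 3 then 2 else if t = 4 then 3 else 1)"

lemma cell_three_colorable: "three_colorable V E"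
proof -
  have "site_color (pend_host e) \<noteq> 2" for e by (auto simp: pend_host_def)
  then have "site_color a \<noteq> site_color b" if "(a, b) \<in> set cell_pairs" for a b
    using that unfolding cell_pairs_iff core_pairs_def pend_pairs_def by auto
  then have "site_color a \<noteq> site_color b" if "adj (i, j, a) (i', j', b)" for i j a i' j' b
    using that unfolding adj_expand by auto
  then have "proper_coloring E (\<lambda>(i, j, a). site_color a)"
    unfolding proper_coloring_def edge_iff by (auto; metis)
  moreover have "site_color a \<in> {1..3}" for a by (cases a) auto
  then have "(\<lambda>(i, j, a). site_color a) ` V \<subseteq> {1..3}" by auto
  ultimately show ?thesis unfolding three_colorable_def by blast
qed

end

section \<open>The drawing of the cell graph\<close>

text \<open>All cells are drawn in the same way in squares of side 24. Longer edges follow lattice paths;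
  the two kinds of edges that leave a cell end at a site of the cell below or to the right.
  The table \<open>owner\<close> shows that no lattice point modulo 24 is used twice: it contains
  \<open>100 * site_num a + site_num b + 1\<close> at the inner points of the path from \<open>a\<close> to \<open>b\<close>,
  \<open>101 * site_num a + 1\<close> at the point of the site \<open>a\<close>, and 0 elsewhere.\<close>

fun site_num :: "site \<Rightarrow> nat" where
  "site_num P = 0"
| "site_num P' = 1"
| "site_num R = 2"
| "site_num R' = 3"
| "site_num S = 4"
| "site_num S' = 5"
| "site_num Q = 6"
| "site_num Q' = 7"
| "site_num A1 = 8"
| "site_num A2 = 9"
| "site_num A3 = 10"
| "site_num A4 = 11"
| "site_num W1 = 12"
| "site_num W2 = 13"
| "site_num W3 = 14"
| "site_num (Pend e t) = 15 + 5 * e + t"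

definition pend_anchor :: "(nat \<times> nat) list" where
  "pend_anchor = [(8, 4), (5, 17), (17, 10), (4, 20), (1, 1), (1, 4), (1, 7), (18, 13), (17, 17), (14, 21), (21, 0), (21, 4), (21, 7)]"

text \<open>In this shape all five edges inside a pendant are single lattice steps, so only the edge
  to the host needs a route.\<close>

definition pend_shape :: "(nat \<times> nat) list" where
  "pend_shape = [(0, 0), (0, 1), (1, 0), (2, 0), (2, 1)]"

fun site_pos :: "site \<Rightarrow> nat \<times> nat" where
  "site_pos P = (12, 2)"
| "site_pos P' = (12, 0)"
| "site_pos R = (2, 12)"
| "site_pos R' = (3, 15)"
| "site_pos S = (11, 11)"
| "site_pos S' = (13, 12)"
| "site_pos Q = (10, 18)"
| "site_pos Q' = (12, 19)"
| "site_pos A1 = (7, 7)"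
| "site_pos A2 = (7, 14)"
| "site_pos A3 = (16, 8)"
| "site_pos A4 = (8, 21)"
| "site_pos W1 = (4, 4)"
| "site_pos W2 = (15, 16)"
| "site_pos W3 = (19, 4)"
| "site_pos (Pend e t) =
     (fst (pend_anchor ! e) + fst (pend_shape ! t), snd (pend_anchor ! e) + snd (pend_shape ! t))"

text \<open>Coordinates are relative to the cell of the first site. The path from \<open>A3\<close>
  to \<open>R\<close> continues beyond 23 into the next cell, where its points are looked up in the
  table modulo 24.\<close>

definition route :: "site \<Rightarrow> site \<Rightarrow> (nat \<times> nat) list" where
  "route a b =
    (if a = P \<and> b = P' then [(12, 1)]
     else if a = R \<and> b = R' then [(2, 13), (2, 14)]
     else if a = S \<and> b = S' then [(12, 11)]
     else if a = Q \<and> b = Q' then [(11, 18)]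
     else if a = A1 \<and> b = P then [(8, 7), (8, 6), (9, 6), (10, 6), (11, 6), (11, 5), (11, 4), (11, 3), (11, 2)]
     else if a = A1 \<and> b = R then [(6, 7), (5, 7), (4, 7), (4, 8), (4, 9), (3, 9), (2, 9), (2, 10), (2, 11)]
     else if a = A1 \<and> b = S then [(8, 8), (9, 9), (10, 10)]
     else if a = A1 \<and> b = W1 then [(6, 6), (5, 5)]
     else if a = A2 \<and> b = S then [(7, 13), (7, 12), (7, 11), (8, 11), (9, 11), (10, 11)]
     else if a = A2 \<and> b = R then [(6, 13), (5, 12), (4, 12), (3, 12)]
     else if a = A2 \<and> b = Q then [(7, 15), (8, 16), (9, 17)]
     else if a = A2 \<and> b = W2 then [(8, 14), (9, 14), (10, 14), (11, 14), (12, 14), (13, 14), (14, 15)]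
     else if a = A3 \<and> b = S then [(15, 8), (14, 8), (13, 8), (12, 8), (11, 8), (11, 9), (11, 10)]
     else if a = A3 \<and> b = P then [(15, 7), (14, 6), (13, 5), (12, 4), (12, 3)]
     else if a = A3 \<and> b = W3 then [(16, 7), (16, 6), (16, 5), (16, 4), (17, 4), (18, 4)]
     else if a = A4 \<and> b = Q then [(9, 21), (10, 21), (10, 20), (10, 19)]
     else if a = A4 \<and> b = R then [(8, 22), (8, 23), (7, 23), (6, 23), (5, 22), (4, 22), (3, 21), (2, 20), (1, 19), (1, 18), (1, 17), (1, 16), (1, 15), (1, 14), (1, 13), (1, 12)]
     else if a = A4 \<and> b = R' then [(7, 20), (6, 19), (5, 19), (4, 18), (3, 17), (3, 16)]
     else if a = A3 \<and> b = R then [(17, 8), (18, 8), (19, 8), (20, 8), (21, 9), (22, 9), (23, 9), (24, 10), (25, 11)]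
     else if a = A4 \<and> b = P' then [(9, 22), (10, 22), (11, 23)]
     else if a = A1 \<and> b = Pend 0 0 then [(7, 6), (7, 5), (7, 4)]
     else if a = A2 \<and> b = Pend 1 0 then [(6, 14), (6, 15), (6, 16), (5, 16)]
     else if a = A3 \<and> b = Pend 2 0 then [(16, 9)]
     else if a = A4 \<and> b = Pend 3 0 then [(7, 21), (7, 22), (6, 22), (5, 21)]
     else if a = W1 \<and> b = Pend 4 0 then [(4, 3), (4, 2), (4, 1), (3, 0), (2, 0), (1, 0)]
     else if a = W1 \<and> b = Pend 5 0 then [(3, 3), (2, 3), (1, 3)]
     else if a = W1 \<and> b = Pend 6 0 then [(4, 5), (4, 6), (3, 6), (2, 6), (1, 6)]
     else if a = W2 \<and> b = Pend 7 0 then [(15, 15), (15, 14), (15, 13), (16, 13), (17, 13)]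
     else if a = W2 \<and> b = Pend 8 0 then [(16, 16)]
     else if a = W2 \<and> b = Pend 9 0 then [(14, 16), (14, 17), (14, 18), (14, 19), (14, 20)]
     else if a = W3 \<and> b = Pend 10 0 then [(19, 3), (19, 2), (19, 1), (19, 0), (20, 0)]
     else if a = W3 \<and> b = Pend 11 0 then [(20, 4)]
     else if a = W3 \<and> b = Pend 12 0 then [(19, 5), (20, 6)]
     else [])"

definition row_shift :: "site \<Rightarrow> site \<Rightarrow> nat" where "row_shift a b = of_bool (a = A3 \<and> b = R)"
definition col_shift :: "site \<Rightarrow> site \<Rightarrow> nat" where "col_shift a b = of_bool (a = A4 \<and> b = P')"

definition full_route :: "site \<Rightarrow> site \<Rightarrow> (nat \<times> nat) list" where
  "full_route a b = site_pos a # route a b @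
     [(fst (site_pos b) + 24 * row_shift a b, snd (site_pos b) + 24 * col_shift a b)]"

definition owner_row :: "nat \<Rightarrow> nat list" where
  "owner_row y =
    (if y = 0 then [0, 0, 0, 0, 0, 0, 0, 0, 0, 0, 1003, 0, 0, 0, 0, 0, 0, 0, 0, 0, 0, 0, 0, 0]
     else if y = 1 then [1236, 3536, 3637, 1241, 4041, 4142, 1246, 4546, 4647, 0, 0, 1003, 1103, 1103, 1103, 1103, 1103, 1103, 1103, 1103, 0, 0, 0, 0]
     else if y = 2 then [1236, 3738, 0, 1241, 4243, 0, 1246, 4748, 0, 803, 803, 803, 203, 204, 204, 0, 0, 0, 0, 0, 1103, 0, 0, 0]
     else if y = 3 then [1236, 3839, 3940, 1241, 4344, 4445, 1246, 4849, 4950, 803, 0, 0, 903, 0, 0, 304, 1104, 1104, 0, 0, 0, 1103, 0, 0]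
     else if y = 4 then [0, 1236, 1236, 1236, 1213, 1246, 1246, 803, 803, 803, 0, 0, 903, 0, 0, 0, 0, 0, 1104, 0, 3031, 3132, 1103, 0]
     else if y = 5 then [0, 0, 0, 0, 0, 813, 0, 803, 0, 0, 0, 0, 903, 0, 0, 0, 921, 2021, 2122, 1104, 3233, 1131, 1103, 0]
     else if y = 6 then [0, 0, 0, 0, 0, 0, 813, 803, 0, 0, 0, 0, 0, 903, 921, 921, 921, 2223, 0, 1104, 3334, 3435, 1131, 1103]
     else if y = 7 then [0, 0, 0, 0, 816, 816, 816, 809, 0, 0, 0, 905, 905, 905, 910, 907, 0, 2324, 2425, 0, 1104, 1131, 1131, 1103]
     else if y = 8 then [0, 0, 0, 0, 1516, 1617, 801, 801, 805, 0, 0, 905, 0, 0, 914, 0, 907, 0, 0, 0, 0, 1112, 1103, 1103]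
     else if y = 9 then [0, 0, 0, 0, 1718, 0, 801, 0, 0, 805, 0, 905, 0, 0, 914, 0, 0, 907, 0, 0, 0, 1107, 1102, 0]
     else if y = 10 then [0, 0, 0, 0, 1819, 1920, 801, 0, 0, 0, 805, 905, 0, 0, 914, 0, 0, 0, 607, 1107, 1107, 1107, 1102, 0]
     else if y = 11 then [0, 0, 801, 801, 801, 801, 801, 0, 1005, 1005, 1005, 405, 0, 0, 914, 0, 0, 0, 608, 0, 0, 0, 0, 1102]
     else if y = 12 then [102, 2, 1, 1001, 1001, 0, 0, 0, 1005, 0, 0, 406, 0, 0, 914, 0, 0, 0, 0, 708, 0, 0, 0, 0]
     else if y = 13 then [0, 0, 0, 0, 0, 1001, 0, 0, 1005, 0, 0, 0, 506, 0, 914, 0, 0, 0, 0, 0, 0, 0, 0, 0]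
     else if y = 14 then [0, 0, 0, 0, 0, 0, 1001, 0, 1005, 0, 0, 0, 0, 0, 0, 914, 1361, 1361, 1361, 1361, 1361, 6061, 6162, 0]
     else if y = 15 then [0, 0, 0, 0, 0, 0, 0, 1001, 1005, 0, 0, 0, 0, 1351, 1351, 1351, 1314, 0, 0, 0, 0, 6263, 0, 0]
     else if y = 16 then [0, 0, 0, 0, 1015, 1015, 1015, 1015, 1011, 1026, 0, 0, 0, 1351, 0, 0, 1356, 0, 0, 0, 0, 6364, 6465, 0]
     else if y = 17 then [0, 0, 0, 0, 1015, 0, 0, 0, 1003, 0, 2526, 2627, 0, 1351, 0, 0, 0, 5556, 5657, 0, 0, 0, 0, 0]
     else if y = 18 then [0, 0, 0, 0, 1015, 0, 0, 0, 1003, 0, 2728, 0, 0, 5051, 5152, 0, 0, 5758, 0, 0, 0, 0, 0, 0]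
     else if y = 19 then [1466, 1466, 1466, 1466, 1415, 1476, 0, 0, 1003, 0, 2829, 2930, 0, 5253, 0, 0, 0, 5859, 5960, 0, 0, 0, 0, 0]
     else if y = 20 then [1466, 0, 0, 0, 1471, 0, 1476, 0, 1003, 0, 0, 0, 0, 5354, 5455, 0, 0, 0, 0, 0, 0, 0, 0, 0]
     else if y = 21 then [6566, 6667, 0, 0, 7071, 7172, 0, 7576, 7677, 1003, 0, 0, 0, 0, 0, 0, 0, 0, 0, 0, 0, 0, 0, 0]
     else if y = 22 then [6768, 0, 0, 0, 7273, 0, 0, 7778, 0, 1003, 0, 0, 0, 0, 0, 0, 0, 0, 0, 0, 0, 0, 0, 0]
     else [6869, 6970, 0, 0, 7374, 7475, 0, 7879, 7980, 1003, 0, 0, 0, 0, 0, 0, 0, 0, 0, 0, 0, 0, 0, 0])"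

definition owner :: "nat \<times> nat \<Rightarrow> nat" where
  "owner q = owner_row (fst q mod 24) ! (snd q mod 24)"

definition drawn_pairs :: "(site \<times> site) list" where
  "drawn_pairs = [(R, R'), (A4, Q), (A4, R), (A4, R'), (A3, R), (A4, P')] @ cell_pairs"

definition nat_adj :: "nat \<times> nat \<Rightarrow> nat \<times> nat \<Rightarrow> bool" where
  "nat_adj p q \<longleftrightarrow> q = (Suc (fst p), snd p) \<or> q = (fst p, Suc (snd p)) \<or> q = (Suc (fst p), Suc (snd p)) \<or>
     p = (Suc (fst q), snd q) \<or> p = (fst q, Suc (snd q)) \<or> p = (Suc (fst q), Suc (snd q))"

fun nat_path :: "(nat \<times> nat) list \<Rightarrow> bool" where
  "nat_path (p # q # ps) \<longleftrightarrow> nat_adj p q \<and> nat_path (q # ps)"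
| "nat_path _ \<longleftrightarrow> True"

text \<open>The third condition keeps a path apart from its own translates in other cells, which the
  table cannot distinguish because they carry the same entry.\<close>

definition route_ok :: "site \<times> site \<Rightarrow> bool" where
  "route_ok ab = (case ab of (a, b) \<Rightarrow> nat_path (full_route a b) \<and>
     list_all (\<lambda>q. owner q = 100 * site_num a + site_num b + 1) (route a b) \<and>
     distinct (map (\<lambda>q. (fst q mod 24, snd q mod 24)) (route a b)))"

lemma core_routes_ok:
  "list_all route_ok [(R, R'), (A4, Q), (A4, R), (A4, R'), (A3, R), (A4, P')]" "list_all route_ok core_pairs"
  by (simp_all add: core_pairs_def route_ok_def full_route_def route_def row_shift_def col_shift_def
      owner_def owner_row_def nat_adj_def)

definition pend_routes_ok :: "nat \<Rightarrow> bool" where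
  "pend_routes_ok e \<longleftrightarrow> list_all route_ok (pend_pairs e)"

definition owner_ok :: "site \<Rightarrow> bool" where
  "owner_ok a \<longleftrightarrow> owner (site_pos a) = 101 * site_num a + 1"

definition pend_owner_ok :: "nat \<Rightarrow> bool" where
  "pend_owner_ok e \<longleftrightarrow> list_all owner_ok [Pend e 0, Pend e 1, Pend e 2, Pend e 3, Pend e 4]"

lemma all_pend_routes_ok: "list_all pend_routes_ok [0, 1, 2, 3, 4, 5, 6, 7, 8, 9, 10, 11, 12]"
  by (simp add: pend_routes_ok_def pend_pairs_def pend_host_def route_ok_def full_route_def route_def
      row_shift_def col_shift_def owner_def owner_row_def nat_adj_def pend_anchor_def pend_shape_def)

lemma core_owner_ok: "list_all owner_ok [P, P', R, R', S, S', Q, Q', A1, A2, A3, A4, W1, W2, W3]"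
  by (simp add: owner_ok_def owner_def owner_row_def)

lemma all_pend_owner_ok: "list_all pend_owner_ok [0, 1, 2, 3, 4, 5, 6, 7, 8, 9, 10, 11, 12]"
  by (simp add: pend_owner_ok_def owner_ok_def owner_def owner_row_def pend_anchor_def pend_shape_def)

lemma less_13_cases: "(e :: nat) < 13 \<longleftrightarrow> e \<in> set [0, 1, 2, 3, 4, 5, 6, 7, 8, 9, 10, 11, 12]"
  by simp presburger

lemma drawn_route_ok:
  assumes "(a, b) \<in> set drawn_pairs"
  shows "route_ok (a, b)"
proof -
  consider "(a, b) \<in> set [(R, R'), (A4, Q), (A4, R), (A4, R'), (A3, R), (A4, P')]"
    | "(a, b) \<in> set core_pairs" | e where "e < 13" "(a, b) \<in> set (pend_pairs e)"
    using assms unfolding drawn_pairs_def set_append cell_pairs_iff[symmetric] Un_iff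
    by (auto simp: cell_pairs_iff simp del: set_simps)
  then show ?thesis
  proof cases
    case 1
    then show ?thesis using core_routes_ok(1) unfolding list_all_iff by blast
  next
    case 2
    then show ?thesis using core_routes_ok(2) unfolding list_all_iff by blast
  next
    case 3
    then have "pend_routes_ok e" using all_pend_routes_ok unfolding less_13_cases list_all_iff by blast
    then show ?thesis using 3(2) unfolding pend_routes_ok_def list_all_iff by blast
  qed
qed

lemma owner_site:
  assumes "a \<in> sites"
  shows "owner (site_pos a) = 101 * site_num a + 1"
proof -
  consider "a \<in> set [P, P', R, R', S, S', Q, Q', A1, A2, A3, A4, W1, W2, W3]"
    | e t where "a = Pend e t" "e < 13" "t < 5"
    using assms unfolding sites_def by auto
  then show ?thesis
  proof cases
    case 1
    then show ?thesis using core_owner_ok unfolding list_all_iff owner_ok_def by blast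
  next
    case 2
    then have "pend_owner_ok e" using all_pend_owner_ok unfolding less_13_cases list_all_iff by blast
    moreover have "t = 0 \<or> t = 1 \<or> t = 2 \<or> t = 3 \<or> t = 4" using 2(3) by presburger
    ultimately show ?thesis unfolding pend_owner_ok_def owner_ok_def 2(1) by auto
  qed
qed

lemma site_num_less: "a \<in> sites \<Longrightarrow> site_num a < 80"
  unfolding sites_def by auto

lemma site_num_inj:
  assumes "a \<in> sites" "b \<in> sites" "site_num a = site_num b"
  shows "a = b"
proof -
  define g where "g y = (if y < 15 then [P, P', R, R', S, S', Q, Q', A1, A2, A3, A4, W1, W2, W3] ! y
    else Pend ((y - 15) div 5) ((y - 15) mod 5))" for y
  have "g (site_num a) = a" if "a \<in> sites" for a
    using that by (cases a) (simp_all add: g_def mem_sites)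
  then show ?thesis using assms by metis
qed

text \<open>Site numbers are below 80, so a nonzero table entry determines both sites of the edge it
  belongs to.\<close>

lemma base_100_eqD:
  fixes a b c d :: nat
  assumes "100 * a + b = 100 * c + d" "b < 100" "d < 100"
  shows "a = c" "b = d"
proof -
  have "(100 * a + b) div 100 = a" "(100 * c + d) div 100 = c" using assms(2,3) by simp_all
  then show "a = c" using assms(1) by simp
  then show "b = d" using assms(1) by simp
qed

lemma site_num_bij: "bij_betw site_num sites {..<80}"
proof (rule bij_betwI')
  fix y :: nat assume y: "y \<in> {..<80}"
  show "\<exists>a\<in>sites. y = site_num a"
  proof (cases "y < 15")
    case True
    then have "y \<in> site_num ` {P, P', R, R', S, S', Q, Q', A1, A2, A3, A4, W1, W2, W3}" by simp presburger
    then show ?thesis unfolding sites_def by blast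
  next
    case False
    let ?a = "Pend ((y - 15) div 5) ((y - 15) mod 5)"
    have "(y - 15) div 5 < 13" using y False by (simp add: less_mult_imp_div_less)
    then have "?a \<in> sites" by (simp add: mem_sites)
    moreover have "y = site_num ?a" using False by simp
    ultimately show ?thesis by blast
  qed
qed (auto dest: site_num_inj site_num_less)

definition shift :: "nat \<Rightarrow> nat \<Rightarrow> nat \<times> nat \<Rightarrow> int \<times> int" where
  "shift i j q = (int (24 * i + fst q), int (24 * j + snd q))"

fun vertex_pos :: "cell_vertex \<Rightarrow> int \<times> int" where
  "vertex_pos (i, j, a) = shift i j (site_pos a)"

fun edge_route :: "cell_vertex \<Rightarrow> cell_vertex \<Rightarrow> (int \<times> int) list" where
  "edge_route (i, j, a) (i', j', b) = map (shift i j) (full_route a b)"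

definition point_owner :: "int \<times> int \<Rightarrow> nat" where
  "point_owner z = owner (nat (fst z), nat (snd z))"

lemma point_owner_shift: "point_owner (shift i j q) = owner q"
  by (simp add: point_owner_def shift_def owner_def nat_int_add del: of_nat_add of_nat_mult)

lemma shift_eqD:
  assumes "shift i j q = shift i' j' q'"
  shows "fst q mod 24 = fst q' mod 24" "snd q mod 24 = snd q' mod 24" "q = q' \<Longrightarrow> i = i' \<and> j = j'" "i = i' \<Longrightarrow> j = j' \<Longrightarrow> q = q'"
proof -
  have e: "24 * i + fst q = 24 * i' + fst q'" "24 * j + snd q = 24 * j' + snd q'"
    using assms unfolding shift_def prod.inject of_nat_eq_iff by blast+
  then show "fst q mod 24 = fst q' mod 24" "snd q mod 24 = snd q' mod 24"
    by (metis mod_mult_self4)+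
  show "q = q' \<Longrightarrow> i = i' \<and> j = j'" "i = i' \<Longrightarrow> j = j' \<Longrightarrow> q = q'" using e by (auto simp: prod_eq_iff)
qed

lemma nat_path_walk:
  "nat_path ps \<Longrightarrow> distinct ps \<Longrightarrow> 2 \<le> length ps \<Longrightarrow> walk (map (shift i j) ps)"
proof (induction ps rule: nat_path.induct)
  case (1 p q ps)
  have a: "lattice_adj (shift i j p) (shift i j q)"
    using "1.prems"(1) by (auto simp: nat_adj_def lattice_adj_def unit_step_def shift_def)
  have n: "shift i j p \<notin> set (map (shift i j) (q # ps))"
    using "1.prems"(2) shift_eqD(4)[of i j p i j, OF _ refl refl] by (metis distinct.simps(2) imageE list.set_map)
  show ?case
  proof (cases "ps = []")
    case True
    then show ?thesis using a n by simp
  next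
    case False
    then have "2 \<le> length (q # ps)" by (cases ps) auto
    then have "walk (map (shift i j) (q # ps))" using "1.IH" "1.prems" by simp
    then show ?thesis using a n by simp
  qed
qed auto

section \<open>Disjointness of the paths in the periodic drawing\<close>

context cell_graph
begin

lemma adj_drawn:
  assumes "adj (i, j, a) (i', j', b)"
  shows "(a, b) \<in> set drawn_pairs" "i' = i + row_shift a b" "j' = j + col_shift a b" "a \<in> sites" "b \<in> sites" "a \<noteq> b"
proof -
  show "(a, b) \<in> set drawn_pairs" using assms unfolding adj_expand drawn_pairs_def by auto
  have "row_shift a b = 0 \<and> col_shift a b = 0" if "(a, b) \<in> set cell_pairs"
    using that by (auto simp: row_shift_def col_shift_def)
  then show "i' = i + row_shift a b" "j' = j + col_shift a b"
    using assms unfolding adj_expand by (auto simp: row_shift_def col_shift_def)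
  show "a \<in> sites" "b \<in> sites" using adj_vertices[OF assms] by (auto simp: cell_vertices_def)
  show "a \<noteq> b" using assms unfolding adj_expand by (auto dest: cell_pairs_sites)
qed

lemma vertex_pos_inj:
  assumes "u \<in> V" "v \<in> V" "vertex_pos u = vertex_pos v"
  shows "u = v"
proof -
  obtain i j a where u: "u = (i, j, a)" by (rule prod_cases3)
  obtain i' j' b where v: "v = (i', j', b)" by (rule prod_cases3)
  have ab: "a \<in> sites" "b \<in> sites" using assms u v by (auto simp: cell_vertices_def)
  have s: "shift i j (site_pos a) = shift i' j' (site_pos b)" using assms(3) u v by simp
  then have "owner (site_pos a) = owner (site_pos b)" by (metis point_owner_shift)
  then have "a = b" using owner_site ab site_num_inj by simp
  then show ?thesis using shift_eqD(3)[OF s] u v by simp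
qed

definition inner :: "cell_vertex \<Rightarrow> cell_vertex \<Rightarrow> (int \<times> int) set" where
  "inner u v = (case u of (i, j, a) \<Rightarrow> case v of (i', j', b) \<Rightarrow> shift i j ` set (route a b))"

lemma inner_owner:
  assumes "adj (i, j, a) (i', j', b)" "z \<in> inner (i, j, a) (i', j', b)"
  shows "point_owner z = 100 * site_num a + site_num b + 1"
proof -
  obtain q where "q \<in> set (route a b)" "z = shift i j q" using assms(2) by (auto simp: inner_def)
  then show ?thesis
    using drawn_route_ok[OF adj_drawn(1)[OF assms(1)]] by (simp add: point_owner_shift route_ok_def list_all_iff)
qed

text \<open>The entry at a site codes the pair of the site with itself, whereas the two ends of an
  edge are always different sites, even across cells.\<close>

lemma inner_vertex:
  assumes "adj u v" "z \<in> inner u v" "w \<in> V"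
  shows "z \<noteq> vertex_pos w"
proof
  assume z: "z = vertex_pos w"
  obtain i j a where u: "u = (i, j, a)" by (rule prod_cases3)
  obtain i' j' b where v: "v = (i', j', b)" by (rule prod_cases3)
  obtain i'' j'' c where w: "w = (i'', j'', c)" by (rule prod_cases3)
  note d = adj_drawn[OF assms(1)[unfolded u v]]
  have c: "c \<in> sites" using assms(3) w by (simp add: cell_vertices_def)
  have "point_owner z = 101 * site_num c + 1" using z w owner_site[OF c] by (simp add: point_owner_shift)
  moreover have "point_owner z = 100 * site_num a + site_num b + 1" using inner_owner assms(1,2) u v by blast
  ultimately have "100 * site_num a + site_num b = 100 * site_num c + site_num c" by simp
  then have "site_num a = site_num b"
    using base_100_eqD[of "site_num a" "site_num b" "site_num c" "site_num c"] site_num_less[OF d(5)] site_num_less[OF c]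
    by simp
  then show False using site_num_inj d(4-6) by blast
qed

text \<open>Equal table entries give the same pair of sites. Points of this path that agree modulo
  24 are the same relative point, and then the cells agree as well.\<close>

lemma inner_disjoint:
  assumes "adj u v" "adj u' v'" "z \<in> inner u v" "z \<in> inner u' v'"
  shows "u = u' \<and> v = v'"
proof -
  obtain i j a where u: "u = (i, j, a)" by (rule prod_cases3)
  obtain i1 j1 b where v: "v = (i1, j1, b)" by (rule prod_cases3)
  obtain i' j' a' where u': "u' = (i', j', a')" by (rule prod_cases3)
  obtain i1' j1' b' where v': "v' = (i1', j1', b')" by (rule prod_cases3)
  note d = adj_drawn[OF assms(1)[unfolded u v]] and d' = adj_drawn[OF assms(2)[unfolded u' v']]
  have "100 * site_num a + site_num b + 1 = 100 * site_num a' + site_num b' + 1"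
    using inner_owner[of i j a i1 j1 b z] inner_owner[of i' j' a' i1' j1' b' z] assms u v u' v' by simp
  then have "site_num a = site_num a' \<and> site_num b = site_num b'"
    using base_100_eqD[of "site_num a" "site_num b" "site_num a'" "site_num b'"] site_num_less[OF d(5)] site_num_less[OF d'(5)]
    by simp
  then have ab: "a = a'" "b = b'" using site_num_inj d d' by blast+
  obtain q where q: "q \<in> set (route a b)" "z = shift i j q" using assms(3) u v by (auto simp: inner_def)
  obtain q' where q': "q' \<in> set (route a b)" "z = shift i' j' q'" using assms(4) u' v' ab by (auto simp: inner_def)
  have "inj_on (\<lambda>q. (fst q mod 24, snd q mod 24)) (set (route a b))"
    using drawn_route_ok[OF d(1)] by (simp add: route_ok_def distinct_map)
  then have "q = q'" using q q' shift_eqD(1,2)[of i j q i' j' q'] by (auto dest: inj_onD)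
  then have "i = i' \<and> j = j'" using shift_eqD(3)[of i j q i' j' q'] q q' by simp
  then show ?thesis using ab d(2,3) d'(2,3) u v u' v' by simp
qed

lemma edge_route_properties:
  assumes "adj u v"
  shows "walk (edge_route u v)" "hd (edge_route u v) = vertex_pos u" "last (edge_route u v) = vertex_pos v"
    "set (edge_route u v) = {vertex_pos u, vertex_pos v} \<union> inner u v"
proof -
  obtain i j a where u: "u = (i, j, a)" by (rule prod_cases3)
  obtain i' j' b where v: "v = (i', j', b)" by (rule prod_cases3)
  note d = adj_drawn[OF assms[unfolded u v]]
  let ?t = "(fst (site_pos b) + 24 * row_shift a b, snd (site_pos b) + 24 * col_shift a b)"
  have ok: "route_ok (a, b)" by (rule drawn_route_ok[OF d(1)])
  have t: "shift i j ?t = vertex_pos v" unfolding v d(2,3) by (simp add: shift_def algebra_simps)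
  have V: "u \<in> V" "v \<in> V" "u \<noteq> v" using adj_vertices[OF assms] by auto
  have "vertex_pos u \<noteq> vertex_pos v" using vertex_pos_inj V by blast
  moreover have "shift i j (site_pos a) = vertex_pos u" using u by simp
  ultimately have 1: "site_pos a \<noteq> ?t" using t by metis
  have in1: "shift i j q \<in> inner u v" if "q \<in> set (route a b)" for q using that u v by (simp add: inner_def)
  have 2: "site_pos a \<notin> set (route a b)" using in1 inner_vertex[OF assms _ V(1)] u by fastforce
  have 3: "?t \<notin> set (route a b)" using in1 inner_vertex[OF assms _ V(2)] t by metis
  have "distinct (map (\<lambda>q. (fst q mod 24, snd q mod 24)) (route a b))" using ok by (simp add: route_ok_def)
  then have "distinct (route a b)" by (simp add: distinct_map)
  then have "distinct (full_route a b)" using 1 2 3 by (simp add: full_route_def)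
  moreover have "nat_path (full_route a b)" using ok by (simp add: route_ok_def)
  ultimately show "walk (edge_route u v)"
    unfolding u v edge_route.simps by (intro nat_path_walk) (auto simp: full_route_def)
  show "hd (edge_route u v) = vertex_pos u" "last (edge_route u v) = vertex_pos v"
    using t unfolding u v by (auto simp: full_route_def)
  show "set (edge_route u v) = {vertex_pos u, vertex_pos v} \<union> inner u v"
    using t unfolding u v by (auto simp: full_route_def inner_def)
qed

theorem cell_planar: "planar V E"
proof -
  \<comment> \<open>Edges are unordered; a choice of direction fixes the end at which the path
    starts.\<close>
  define ends where "ends = (\<lambda>e. SOME uv. adj (fst uv) (snd uv) \<and> e = {fst uv, snd uv})"
  have ends: "adj (fst (ends e)) (snd (ends e)) \<and> e = {fst (ends e), snd (ends e)}" if e: "e \<in> E" for e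
  proof -
    obtain u v where "adj u v" "e = {u, v}" using e unfolding cell_edges_def by blast
    then have "\<exists>uv. adj (fst uv) (snd uv) \<and> e = {fst uv, snd uv}" by (intro exI[of _ "(u, v)"]) simp
    then show ?thesis unfolding ends_def by (rule someI_ex)
  qed
  let ?ps = "\<lambda>e. edge_route (fst (ends e)) (snd (ends e))"
  show ?thesis
  proof (rule lattice_planar[OF simple, of vertex_pos ?ps])
    show "inj_on vertex_pos V" using vertex_pos_inj by (blast intro: inj_onI)
    fix e assume e: "e \<in> E"
    obtain u v where uv: "ends e = (u, v)" "adj u v" "e = {u, v}" using ends[OF e] by (metis prod.collapse)
    note pr = edge_route_properties[OF uv(2)] and V = adj_vertices[OF uv(2)]
    have "inner u v \<inter> vertex_pos ` V = {}" using inner_vertex[OF uv(2)] by blast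
    then have "set (edge_route u v) \<inter> vertex_pos ` V = vertex_pos ` e" unfolding pr(4) uv(3) using V by blast
    then show "walk (?ps e) \<and> {hd (?ps e), last (?ps e)} = vertex_pos ` e \<and> set (?ps e) \<inter> vertex_pos ` V = vertex_pos ` e"
      using pr(1-3) unfolding uv(1) fst_conv snd_conv by (simp add: uv(3))
    fix e' assume e': "e' \<in> E" and ne: "e \<noteq> e'"
    obtain u' v' where uv': "ends e' = (u', v')" "adj u' v'" "e' = {u', v'}" using ends[OF e'] by (metis prod.collapse)
    note pr' = edge_route_properties[OF uv'(2)] and V' = adj_vertices[OF uv'(2)]
    have "inner u v \<inter> inner u' v' = {}" using inner_disjoint[OF uv(2) uv'(2)] uv(3) uv'(3) ne by blast
    moreover have "inner u v \<inter> vertex_pos ` e' = {}" using inner_vertex[OF uv(2)] uv'(3) V' by blast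
    moreover have "vertex_pos ` e \<inter> inner u' v' = {}" using inner_vertex[OF uv'(2)] uv(3) V by blast
    moreover have "vertex_pos ` e \<inter> vertex_pos ` e' = vertex_pos ` (e \<inter> e')"
    proof (rule inj_on_image_Int[symmetric, of _ V])
      show "inj_on vertex_pos V" using vertex_pos_inj by (blast intro: inj_onI)
      show "e \<subseteq> V" "e' \<subseteq> V" using V V' unfolding uv(3) uv'(3) by blast+
    qed
    moreover have "set (edge_route u v) = vertex_pos ` e \<union> inner u v" "set (edge_route u' v') = vertex_pos ` e' \<union> inner u' v'"
      unfolding pr(4) pr'(4) uv(3) uv'(3) by simp_all
    ultimately show "set (?ps e) \<inter> set (?ps e') = vertex_pos ` (e \<inter> e')"
      unfolding uv(1) uv'(1) fst_conv snd_conv by (simp add: Int_Un_distrib Int_Un_distrib2)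
  qed
qed

end

section \<open>Hardness for two labels\<close>

text \<open>The 80 sites, 15 named ones and 13 times 5 in pendants, form the lowest digit. The
  numbering is onto, as required for carrying over the coloring and the drawing.\<close>

definition cell_code :: "nat \<Rightarrow> cell_vertex \<Rightarrow> nat" where
  "cell_code n v = (case v of (i, j, a) \<Rightarrow> site_num a + 80 * (j + n * i))"

lemma cell_code_bij:
  assumes "0 < n"
  shows "inj_on (cell_code n) (cell_vertices m n)" "cell_code n ` cell_vertices m n = {..<80 * (n * Suc m)}"
proof -
  show inj: "inj_on (cell_code n) (cell_vertices m n)"
  proof (rule inj_onI)
    fix u v assume uv: "u \<in> cell_vertices m n" "v \<in> cell_vertices m n" "cell_code n u = cell_code n v"
    obtain i j a where u: "u = (i, j, a)" by (rule prod_cases3)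
    obtain i' j' b where v: "v = (i', j', b)" by (rule prod_cases3)
    have s: "a \<in> sites" "b \<in> sites" "j < n" "j' < n" using uv u v by (auto simp: cell_vertices_def)
    have "digit 80 0 (cell_code n u) = site_num a" "digit 80 0 (cell_code n v) = site_num b"
      using site_num_less[OF s(1)] site_num_less[OF s(2)] by (simp_all add: cell_code_def u v del: distrib_left_numeral)
    then have ab: "a = b" using uv(3) site_num_inj s by simp
    then have e: "j + n * i = j' + n * i'" using uv(3) by (simp add: cell_code_def u v)
    have "digit n 0 (j + n * i) = j" "digit n 0 (j' + n * i') = j'" using s by simp_all
    then have "j = j'" using e by simp
    then show "u = v" using e ab u v assms by simp
  qed
  have "cell_code n ` cell_vertices m n \<subseteq> {..<80 * (n * Suc m)}"
  proof
    fix y assume "y \<in> cell_code n ` cell_vertices m n"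
    then obtain i j a where "y = site_num a + 80 * (j + n * i)" "i < Suc m" "j < n" "a \<in> sites"
      by (auto simp: cell_code_def cell_vertices_def)
    then show "y \<in> {..<80 * (n * Suc m)}"
      using mixed_radix_less[OF site_num_less mixed_radix_less[of j n i "Suc m"]] by simp
  qed
  moreover have "card (cell_code n ` cell_vertices m n) = card {..<80 * (n * Suc m)}"
    using card_image[OF inj] bij_betw_same_card[OF site_num_bij]
    by (simp add: cell_vertices_def card_cartesian_product algebra_simps)
  ultimately show "cell_code n ` cell_vertices m n = {..<80 * (n * Suc m)}"
    by (intro card_subset_eq) auto
qed

lemma definable_pred_bex:
  assumes "finite L" "\<And>z. z \<in> L \<Longrightarrow> definable_pred (\<lambda>x w e. G z x w e)"
  shows "definable_pred (\<lambda>x w e. \<exists>z\<in>L. G z x w e)"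
  using assms
proof (induction L rule: finite_induct)
  case empty
  then show ?case by (simp add: definable_pred_const)
next
  case (insert z L)
  then have "definable_pred (\<lambda>x w e. G z x w e \<or> (\<exists>z\<in>L. G z x w e))" by (intro definable_pred_disj) auto
  then show ?case by simp
qed

text \<open>This is \<open>cell_edge\<close> with arithmetic codes in place of vertices. The
  quantifier over the constant list of pairs amounts to a finite disjunction, and everything else is
  a bounded quantifier or an equation.\<close>

definition cell_code_edge ::
    "nat \<Rightarrow> nat \<Rightarrow> (nat \<Rightarrow> nat \<Rightarrow> bool) \<Rightarrow> (nat \<Rightarrow> nat \<Rightarrow> bool) \<Rightarrow> nat \<Rightarrow> nat \<Rightarrow> bool" where
  "cell_code_edge m n pos neg u v \<longleftrightarrow> (let c = (\<lambda>a i j. site_num a + 80 * (j + n * i)) in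
     \<exists>i<Suc m. \<exists>j<n.
     (u = c R i j \<and> v = c R' i j) \<or>
     i < m \<and> ((\<exists>ab\<in>set cell_pairs. u = c (fst ab) i j \<and> v = c (snd ab) i j) \<or>
       0 < j \<and> u = c A4 i j \<and> v = c Q i j \<or>
       pos i j \<and> u = c A4 i j \<and> v = c R i j \<or>
       neg i j \<and> u = c A4 i j \<and> v = c R' i j \<or>
       u = c A3 i j \<and> v = c R (Suc i) j \<or>
       Suc j < n \<and> u = c A4 i j \<and> v = c P' i (Suc j)))"

lemma cell_code_edge_iff:
  "cell_code_edge m n pos neg y z \<longleftrightarrow> (\<exists>u v. cell_edge m n pos neg u v \<and> y = cell_code n u \<and> z = cell_code n v)"
proof
  assume "cell_code_edge m n pos neg y z"
  then obtain i j where ij: "i < Suc m" "j < n" and c: "(y = cell_code n (i, j, R) \<and> z = cell_code n (i, j, R')) \<or>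
     i < m \<and> ((\<exists>ab\<in>set cell_pairs. y = cell_code n (i, j, fst ab) \<and> z = cell_code n (i, j, snd ab)) \<or>
       0 < j \<and> y = cell_code n (i, j, A4) \<and> z = cell_code n (i, j, Q) \<or>
       pos i j \<and> y = cell_code n (i, j, A4) \<and> z = cell_code n (i, j, R) \<or>
       neg i j \<and> y = cell_code n (i, j, A4) \<and> z = cell_code n (i, j, R') \<or>
       y = cell_code n (i, j, A3) \<and> z = cell_code n (Suc i, j, R) \<or>
       Suc j < n \<and> y = cell_code n (i, j, A4) \<and> z = cell_code n (i, Suc j, P'))"
    unfolding cell_code_edge_def Let_def cell_code_def prod.case by blast
  have I: "cell_edge m n pos neg u v" if "(u, v) = ((i, j, R), (i, j, R')) \<or>
     i < m \<and> ((\<exists>(a, b)\<in>set cell_pairs. (u, v) = ((i, j, a), (i, j, b))) \<or>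
       0 < j \<and> (u, v) = ((i, j, A4), (i, j, Q)) \<or>
       pos i j \<and> (u, v) = ((i, j, A4), (i, j, R)) \<or>
       neg i j \<and> (u, v) = ((i, j, A4), (i, j, R')) \<or>
       (u, v) = ((i, j, A3), (Suc i, j, R)) \<or>
       Suc j < n \<and> (u, v) = ((i, j, A4), (i, Suc j, P')))" for u v
    unfolding cell_edge_def by (rule exI[of _ i], rule conjI[OF ij(1)], rule exI[of _ j], rule conjI[OF ij(2) that])
  from c show "\<exists>u v. cell_edge m n pos neg u v \<and> y = cell_code n u \<and> z = cell_code n v"
  proof (elim disjE conjE bexE)
    fix ab assume "i < m" "ab \<in> set cell_pairs" "y = cell_code n (i, j, fst ab)" "z = cell_code n (i, j, snd ab)"
    moreover from this have "cell_edge m n pos neg (i, j, fst ab) (i, j, snd ab)"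
      by (intro I disjI2 conjI disjI1 bexI[of _ ab]) (auto simp: case_prod_beta)
    ultimately show ?thesis by blast
  qed (rule exI, rule exI, rule conjI[OF I conjI], force, assumption, assumption)+
next
  assume "\<exists>u v. cell_edge m n pos neg u v \<and> y = cell_code n u \<and> z = cell_code n v"
  then obtain u v where uv: "cell_edge m n pos neg u v" "y = cell_code n u" "z = cell_code n v" by blast
  from uv(1) obtain i j where ij: "i < Suc m" "j < n" and c: "(u, v) = ((i, j, R), (i, j, R')) \<or>
     i < m \<and> ((\<exists>(a, b)\<in>set cell_pairs. (u, v) = ((i, j, a), (i, j, b))) \<or>
       0 < j \<and> (u, v) = ((i, j, A4), (i, j, Q)) \<or>
       pos i j \<and> (u, v) = ((i, j, A4), (i, j, R)) \<or>
       neg i j \<and> (u, v) = ((i, j, A4), (i, j, R')) \<or>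
       (u, v) = ((i, j, A3), (Suc i, j, R)) \<or>
       Suc j < n \<and> (u, v) = ((i, j, A4), (i, Suc j, P')))"
    unfolding cell_edge_def by blast
  have e: "(\<exists>ab\<in>set cell_pairs. y = cell_code n (i, j, fst ab) \<and> z = cell_code n (i, j, snd ab))"
    if "\<exists>(a, b)\<in>set cell_pairs. (u, v) = ((i, j, a), (i, j, b))"
    using that uv(2,3) by force
  show "cell_code_edge m n pos neg y z"
    unfolding cell_code_edge_def Let_def
    by (rule exI[of _ i], rule conjI[OF ij(1)], rule exI[of _ j], rule conjI[OF ij(2)])
       (use c e uv(2,3) in \<open>elim disjE conjE; simp add: cell_code_def\<close>)
qed

lemma definable_cell_code_edge:
  assumes "definable (\<lambda>x w e. m x)" "definable (\<lambda>x w e. n x)"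
    "definable_pred (\<lambda>x w e. pos x (e 0) (e 1))" "definable_pred (\<lambda>x w e. neg x (e 0) (e 1))"
    and "definable U" "definable U'"
  shows "definable_pred (\<lambda>x w e. cell_code_edge (m x) (n x) (pos x) (neg x) (U x w e) (U' x w e))"
proof -
  have "definable_pred (\<lambda>x w e. cell_code_edge (m x) (n x) (pos x) (neg x) (e 0) (e 1))"
    unfolding cell_code_edge_def Let_def using assms(1,2)
    by (intro definable_pred_ex definable_pred_disj definable_pred_conj definable_pred_bex finite_set
        definable_pred_eq definable_pred_less definable_pred_subst2[OF assms(3)] definable_pred_subst2[OF assms(4)]
        definable_add definable_mult definable_Suc definable_var definable_const)
  from definable_pred_subst2[OF this assms(5,6)] show ?thesis .
qed

theorem planar_labeling_NP_hard:
  assumes A: "A \<in> NP"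
  shows "\<exists>f. poly_time_computable f \<and> (\<forall>x.
    f x \<in> {graph_code n E | n E. simple_graph {..<n} E \<and> planar {..<n} E \<and> three_colorable {..<n} E} \<and>
    (x \<in> A \<longleftrightarrow> f x \<in> {graph_code n E | n E. simple_graph {..<n} E \<and> planar {..<n} E \<and> three_colorable {..<n} E \<and>
       has_product_labeling 2 {..<n} E}))"
proof -
  obtain m n pos neg where cl:
    "definable (\<lambda>x w e. m x)" "definable (\<lambda>x w e. n x)"
    "definable_pred (\<lambda>x w e. pos x (e 0) (e 1))" "definable_pred (\<lambda>x w e. neg x (e 0) (e 1))"
    "\<And>x. 6 \<le> m x" "\<And>x. 2 \<le> n x" "\<And>x. x \<in> A \<longleftrightarrow> satisfiable (m x) (n x) (pos x) (neg x)"
    by (rule Cook_Levin[OF A], rule that)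
  define N where "N = (\<lambda>x. 80 * (n x * Suc (m x)))"
  define E where "E = (\<lambda>x. map_edges (cell_code (n x)) (cell_edges (m x) (n x) (pos x) (neg x)))"
  have cg: "cell_graph (n x)" for x using cl(6) by unfold_locales
  have n0: "0 < n x" for x using cl(6)[of x] by simp
  note g = cell_graph.simple[OF cg] and b = cell_code_bij[OF n0]
  have i: "cell_code (n x) ` cell_vertices (m x) (n x) = {..<N x}" for x unfolding N_def by (rule b(2))
  then have i': "cell_code (n x) ` cell_vertices (m x) (n x) \<subseteq> {..<N x}" for x by simp
  have s: "simple_graph {..<N x} (E x)" for x
    unfolding E_def by (rule simple_graph_map[OF g b(1) i'])
  have pl: "planar {..<N x} (E x)" for x
    unfolding E_def by (rule planar_map[OF g b(1) i' i cell_graph.cell_planar[OF cg]])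
  have tc: "three_colorable {..<N x} (E x)" for x
    unfolding E_def by (rule three_colorable_map[OF g b(1) i' i cell_graph.cell_three_colorable[OF cg]])
  have iff: "has_product_labeling 2 {..<N x} (E x) \<longleftrightarrow> x \<in> A" for x
    unfolding E_def using has_product_labeling_map[OF g b(1) i', of 2] cell_graph.cell_labeling_iff[OF cg] cl(7) by simp
  have "poly_time_computable (\<lambda>x. graph_code (N x) (E x))"
  proof (rule poly_time_graph_code)
    show "definable (\<lambda>x w e. N x)"
      unfolding N_def using cl(1,2) by (intro definable_mult definable_Suc definable_const)
    show "definable_pred (\<lambda>x w e. cell_code_edge (m x) (n x) (pos x) (neg x) (e 0) (e 1) \<or>
        cell_code_edge (m x) (n x) (pos x) (neg x) (e 1) (e 0))"
      by (intro definable_pred_disj definable_cell_code_edge[OF cl(1-4)] definable_var)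
    fix x u v
    have "{u, v} \<in> E x \<longleftrightarrow> (\<exists>a b. cell_edge (m x) (n x) (pos x) (neg x) a b \<and> {u, v} = {cell_code (n x) a, cell_code (n x) b})"
      unfolding E_def cell_edges_def map_edges_pairs by blast
    then show "{u, v} \<in> E x \<longleftrightarrow> cell_code_edge (m x) (n x) (pos x) (neg x) u v \<or> cell_code_edge (m x) (n x) (pos x) (neg x) v u"
      unfolding cell_code_edge_iff doubleton_eq_iff by blast
  qed
  moreover have "graph_code (N x) (E x) \<in> {graph_code n E | n E. simple_graph {..<n} E \<and> planar {..<n} E \<and> three_colorable {..<n} E}" for x
    using s pl tc by blast
  moreover have "x \<in> A \<longleftrightarrow> graph_code (N x) (E x) \<in> {graph_code n E | n E. simple_graph {..<n} E \<and> planar {..<n} E \<and>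
      three_colorable {..<n} E \<and> has_product_labeling 2 {..<n} E}" for x
    using s[of x] pl[of x] tc[of x] iff[of x] graph_code_inject[OF s[of x]] by auto
  ultimately show ?thesis by blast
qed

theorem theorem3:
  shows "NP_complete_on
           {graph_code n E | n E. simple_graph {..<n} E \<and> planar {..<n} E \<and> three_colorable {..<n} E}
           {graph_code n E | n E. simple_graph {..<n} E \<and> planar {..<n} E \<and> three_colorable {..<n} E \<and>
              has_product_labeling 2 {..<n} E} \<and>
         (\<forall>k\<ge>3. NP_complete
           {graph_code n E | n E. simple_graph {..<n} E \<and> has_product_labeling k {..<n} E})"
proof (intro conjI allI impI)
  let ?I = "{graph_code n E | n E. simple_graph {..<n} E \<and> planar {..<n} E \<and> three_colorable {..<n} E}"
  let ?Y = "{graph_code n E | n E. simple_graph {..<n} E \<and> planar {..<n} E \<and> three_colorable {..<n} E \<and>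
    has_product_labeling 2 {..<n} E}"
  let ?L = "{graph_code n E | n E. simple_graph {..<n} E \<and> has_product_labeling 2 {..<n} E}"
  have "\<forall>x\<in>?I. x \<in> ?Y \<longleftrightarrow> x \<in> ?L"
  proof
    fix x assume "x \<in> ?I"
    then obtain n E where x: "x = graph_code n E" "simple_graph {..<n} E" "planar {..<n} E" "three_colorable {..<n} E"
      by blast
    have "x \<in> ?Y" if "x \<in> ?L"
    proof -
      from that obtain n' E' where "x = graph_code n' E'" "simple_graph {..<n'} E'" "has_product_labeling 2 {..<n'} E'"
        by blast
      with x graph_code_inject[of n E n' E'] show ?thesis by blast
    qed
    then show "x \<in> ?Y \<longleftrightarrow> x \<in> ?L" by blast
  qed
  \<comment> \<open>Membership only has to be correct on planar 3-colorable graphs, so the language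
    without these two conditions serves; by injectivity of \<open>graph_code\<close> it agrees with
    the yes-instances there.\<close>
  then have "\<exists>L\<in>NP. \<forall>x\<in>?I. x \<in> ?Y \<longleftrightarrow> x \<in> L" using product_labeling_in_NP[of 2] by (rule bexI)
  then show "NP_complete_on ?I ?Y"
    unfolding NP_complete_on_def using planar_labeling_NP_hard by (intro conjI ballI)
next
  fix k :: nat
  assume "3 \<le> k"
  then show "NP_complete {graph_code n E | n E. simple_graph {..<n} E \<and> has_product_labeling k {..<n} E}"
    unfolding NP_complete_def using product_labeling_in_NP product_labeling_NP_hard by (intro conjI ballI)
qed


end
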